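(* For $s\in\,]0,1[$ there is a constant $M$ such that for all $h$ and all $u\in\mathrm H^{p+1}\mathrm{Alt}^\bullet(S)$: $$\|\mathrm d u-\mathrm d\Pi_hu\|_{\mathrm H^{-s}}\le M\,h^{p+s}\,|\nabla^{p+1}u| .$$
   Context: Domain: $S=\mathbb R^n/\mathbb L$, $\mathbb L=\sum_{i=1}^n\mathbb Z e_i$ for a basis $(e_i)$ of $\mathbb R^n$, with the flat Euclidean metric. $O=\mathrm L^2\mathrm{Alt}^\bullet(S)$ is the space of $\mathrm L^2$ differential forms of all degrees, with norm $|\cdot|$; $\mathrm d$ is the exterior derivative; $X=\{u\in O:\mathrm d u\in O\}$. Meshes: $(\mathcal T_h)$ is a sequence of cellular complexes on $S$, indexed by $h>0$ with $h\to0$, where $h$ is the largest diameter of a cell of $\mathcal T_h$. It is quasi-uniform: each $\mathcal T_h$ has a simplicial refinement, these refinements being quasi-uniform in the usual sense (uniformly shape-regular simplices with diameters uniformly comparable to $h$), and each cell of $\mathcal T_h$ is composed of a uniformly bounded number of simplices. Finite element spaces: for each $h$, $X_h=\bigoplus_{k=0}^n X_h^k\subset X$ is the space of a finite element system on $\mathcal T_h$: to each cell $T$ (of any dimension) and each $k$ is attached a finite dimensional space $X^k(T)$ of $k$-forms on $T$, smooth up to the boundary, such that $\mathrm d X^k(T)\subset X^{k+1}(T)$ and pullback to a subcell $T'\subset T$ maps $X^k(T)$ into $X^k(T')$; $X_h^k$ consists of the $k$-forms on $S$ having, on every cell $T$, a single-valued pullback belonging to $X^k(T)$. The system is compatible: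 for each $T$ the sequence $0\to\mathbb R\to X^0(T)\to\cdots\to X^{\dim T}(T)\to0$ (with maps $\mathrm d$) is exact, and any family of elements of the $X^k(T')$, $T'$ ranging over proper subcells of $T$, compatible under pullback, extends to an element of $X^k(T)$. In the $h$-setting: after scaling by $h^{-1}$, the macro-elements (unions of cells touching a given cell) with their local spaces range in a compact family (finitely many combinatorial types, uniformly bounded dimensions). The local spaces contain the polynomial forms of degree up to a fixed integer $p\ge0$. Mollified interpolator: $\phi$ is a smooth nonnegative function on $\mathbb R^n$ supported in the unit ball, with integral $1$, chosen such that $\int\phi(-x)q(x)\,\mathrm dx=q(0)$ for all polynomials $q$ of degree up to $p$; $\phi_\epsilon(x)=\epsilon^{-n}\phi(\epsilon^{-1}x)$. $I_h$ is an interpolator onto $X_h$ deduced from degrees of freedom, defined on smooth forms: a projection commuting with $\mathrm d$, local to cells, and uniformly bounded after scaling with respect to some $C^m$ norm. Let $Q_h:O\to X_h$, $Q_hu=I_h(\phi_{\epsilon h}\ast u)$. For $\epsilon>0$ fixed small enough (depending only on the family of meshes and spaces, $I_h$ and $\phi$), $Q_h$ restricts to an isomorphism $X_h\to X_h$ and $\Pi_h=(Q_h|_{X_h})^{-1}Q_h:O\to X_h$, a projector that is uniformly bounded $O\to O$ and commutes with $\mathrm d$ on $X$. Such a sufficiently small $\epsilon$ is fixed. *)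

theory Defs
  imports "HOL-Analysis.Analysis"
begin

section \<open>The torus\<close>

text \<open>Objects on the torus \<open>\<real>\<^sup>n / L\<close> are represented by their lifts to \<open>\<real>\<^sup>n\<close>: functions and
  forms by \<open>L\<close>-periodic ones, cells by subsets of \<open>\<real>\<^sup>n\<close> that embed into the quotient.\<close>

type_synonym 'n euclid = "real^'n"

definition lattice :: "('n::finite \<Rightarrow> 'n euclid) \<Rightarrow> ('n euclid) set" where
  "lattice e = {\<Sum>i\<in>UNIV. of_int (m i) *\<^sub>R e i | m. True}"

definition fund_cell :: "('n::finite \<Rightarrow> 'n euclid) \<Rightarrow> ('n euclid) set" where
  "fund_cell e = {\<Sum>i\<in>UNIV. t i *\<^sub>R e i | t. \<forall>i. 0 \<le> t i \<and> t i < 1}"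

definition torus_integral ::
  "('n::finite \<Rightarrow> 'n euclid) \<Rightarrow> ('n euclid \<Rightarrow> 'b::{banach, second_countable_topology}) \<Rightarrow> 'b" where
  "torus_integral e f = set_lebesgue_integral lebesgue (fund_cell e) f"

definition periodic :: "('n::finite \<Rightarrow> 'n euclid) \<Rightarrow> ('n euclid \<Rightarrow> 'b) \<Rightarrow> bool" where
  "periodic e u \<longleftrightarrow> (\<forall>l\<in>lattice e. \<forall>x. u (x + l) = u x)"

section \<open>Smooth functions\<close>

primrec partial_deriv ::
  "'n list \<Rightarrow> ('n euclid \<Rightarrow> 'b) \<Rightarrow> 'n::finite euclid \<Rightarrow> 'b::real_normed_vector" where
  "partial_deriv [] u = u"
| "partial_deriv (j # js) u = (\<lambda>x. frechet_derivative (partial_deriv js u) (at x) (axis j 1))"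

definition smooth :: "('n::finite euclid \<Rightarrow> 'b::real_normed_vector) \<Rightarrow> bool" where
  "smooth u \<longleftrightarrow> (\<forall>js x. partial_deriv js u differentiable (at x))"

definition poly_degree_le :: "nat \<Rightarrow> ('n::finite euclid \<Rightarrow> real) \<Rightarrow> bool" where
  "poly_degree_le p q \<longleftrightarrow>
     (\<exists>c. q = (\<lambda>x. \<Sum>\<alpha> | (\<Sum>i\<in>UNIV. \<alpha> i) \<le> p. c \<alpha> * (\<Prod>i\<in>UNIV. (x $ i) ^ \<alpha> i)))"

text \<open>The \<open>C\<^sup>m\<close> norm on \<open>T\<close> after scaling lengths by \<open>1/\<delta>\<close>.\<close>

definition Cm_norm ::
  "real \<Rightarrow> nat \<Rightarrow> ('n::finite euclid) set \<Rightarrow> ('n euclid \<Rightarrow> 'b::real_normed_vector) \<Rightarrow> real" where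
  "Cm_norm \<delta> m T u =
     (\<Sum>js | length js \<le> m. \<delta> ^ length js * (SUP x\<in>T. norm (partial_deriv js u x)))"

section \<open>Differential forms\<close>

text \<open>A form \<open>u = \<Sum>\<^sub>I u\<^sub>I dx\<^sub>I\<close>, of possibly mixed degree, is the function \<open>x \<mapsto> (u\<^sub>I(x))\<^sub>I\<close> with
  \<open>I\<close> ranging over all sets of coordinate indices and
  \<open>dx\<^sub>I = dx\<^bsub>i1\<^esub> \<and> \<dots> \<and> dx\<^bsub>ik\<^esub>\<close> for \<open>I = {i1 < \<dots> < ik}\<close>.
  The Euclidean norm of \<open>real^('n set)\<close> is the usual norm on alternating forms.\<close>

type_synonym 'n form = "'n euclid \<Rightarrow> real^('n set)"

definition is_kform :: "nat \<Rightarrow> 'n::finite form \<Rightarrow> bool" where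
  "is_kform k u \<longleftrightarrow> (\<forall>x I. card I \<noteq> k \<longrightarrow> u x $ I = 0)"

definition deg_part :: "nat \<Rightarrow> 'n::finite form \<Rightarrow> 'n form" where
  "deg_part k u = (\<lambda>x. \<chi> I. if card I = k then u x $ I else 0)"

definition smooth_kforms :: "nat \<Rightarrow> 'n::finite form set" where
  "smooth_kforms k = {u. smooth u \<and> is_kform k u}"

definition polynomial_kforms :: "nat \<Rightarrow> nat \<Rightarrow> 'n::finite form set" where
  "polynomial_kforms p k = {u. is_kform k u \<and> (\<forall>I. poly_degree_le p (\<lambda>x. u x $ I))}"

definition ext_sign :: "'n::{finite,linorder} \<Rightarrow> 'n set \<Rightarrow> real" where
  "ext_sign j J = (- 1) ^ card {i \<in> J. i < j}"

definition smooth_d :: "'n::{finite,linorder} form \<Rightarrow> 'n form" where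
  "smooth_d u = (\<lambda>x. \<chi> J. \<Sum>j\<in>J. ext_sign j J * partial_deriv [j] u x $ (J - {j}))"

text \<open>Evaluation of the part of degree \<open>length vs\<close> of \<open>\<omega>\<close> on the vectors \<open>vs\<close>: the sum over \<open>I\<close> of
  \<open>\<omega>\<^sub>I\<close> times the determinant of the \<open>I\<close>-coordinates of \<open>vs\<close>, expanded over the orderings
  \<open>js\<close> of \<open>I\<close>.\<close>

definition alt_eval :: "real^('n::{finite,linorder} set) \<Rightarrow> ('n euclid) list \<Rightarrow> real" where
  "alt_eval \<omega> vs =
     (\<Sum>js | length js = length vs \<and> distinct js.
        (- 1) ^ card {(a, b). a < b \<and> b < length js \<and> js ! b < js ! a}
        * \<omega> $ set js * (\<Prod>a<length vs. (vs ! a) $ (js ! a)))"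

text \<open>Equality of the pullbacks of two ambient forms to a polyhedral set \<open>T\<close>, in every degree. A list \<open>vs\<close> of
  vectors is tested at \<open>x\<close> if the simplex with vertex \<open>x\<close> and edges \<open>vs\<close> lies in \<open>T\<close>; up to rescaling,
  the linearly independent such lists are those generating a simplex at \<open>x\<close> tangent to \<open>T\<close>.\<close>

definition same_pullback :: "('n euclid) set \<Rightarrow> 'n::{finite,linorder} form \<Rightarrow> 'n form \<Rightarrow> bool" where
  "same_pullback T u v \<longleftrightarrow>
     (\<forall>x vs. convex hull (insert x ((+) x ` set vs)) \<subseteq> T
        \<longrightarrow> alt_eval (u x) vs = alt_eval (v x) vs)"

section \<open>Square integrable forms, Sobolev spaces\<close>

text \<open>Elements of \<open>L\<^sup>2\<close> are represented by functions; equality of classes is \<open>ae_eq\<close>.\<close>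

definition ae_eq :: "'n::finite form \<Rightarrow> 'n form \<Rightarrow> bool" where
  "ae_eq u v \<longleftrightarrow> (AE x in lebesgue. u x = v x)"

definition L2_forms :: "('n::finite \<Rightarrow> 'n euclid) \<Rightarrow> 'n form set" where
  "L2_forms e = {u. periodic e u \<and> u \<in> borel_measurable lebesgue \<and>
                    set_integrable lebesgue (fund_cell e) (\<lambda>x. (norm (u x))\<^sup>2)}"

definition L2_norm :: "('n::finite \<Rightarrow> 'n euclid) \<Rightarrow> 'n form \<Rightarrow> real" where
  "L2_norm e u = sqrt (torus_integral e (\<lambda>x. (norm (u x))\<^sup>2))"

definition test_functions :: "('n::finite \<Rightarrow> 'n euclid) \<Rightarrow> ('n euclid \<Rightarrow> real) set" where
  "test_functions e = {\<psi>. periodic e \<psi> \<and> smooth \<psi>}"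

definition has_weak_partial ::
  "('n::finite \<Rightarrow> 'n euclid) \<Rightarrow> 'n list \<Rightarrow> 'n form \<Rightarrow> 'n form \<Rightarrow> bool" where
  "has_weak_partial e js u v \<longleftrightarrow> v \<in> L2_forms e \<and>
     (\<forall>\<psi>\<in>test_functions e.
        torus_integral e (\<lambda>x. \<psi> x *\<^sub>R v x)
        = (- 1) ^ length js *\<^sub>R torus_integral e (\<lambda>x. partial_deriv js \<psi> x *\<^sub>R u x))"

definition weak_partial :: "('n::finite \<Rightarrow> 'n euclid) \<Rightarrow> 'n list \<Rightarrow> 'n form \<Rightarrow> 'n form" where
  "weak_partial e js u = (SOME v. has_weak_partial e js u v)"

definition sobolev_forms :: "('n::finite \<Rightarrow> 'n euclid) \<Rightarrow> nat \<Rightarrow> 'n form set" where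
  "sobolev_forms e m =
     {u \<in> L2_forms e. \<forall>js. length js \<le> m \<longrightarrow> (\<exists>v. has_weak_partial e js u v)}"

definition grad_norm :: "('n::finite \<Rightarrow> 'n euclid) \<Rightarrow> nat \<Rightarrow> 'n form \<Rightarrow> real" where
  "grad_norm e m u = sqrt (\<Sum>js | length js = m. (L2_norm e (weak_partial e js u))\<^sup>2)"

definition has_weak_d ::
  "('n::{finite,linorder} \<Rightarrow> 'n euclid) \<Rightarrow> 'n form \<Rightarrow> 'n form \<Rightarrow> bool" where
  "has_weak_d e u v \<longleftrightarrow> v \<in> L2_forms e \<and>
     (\<forall>\<psi>\<in>test_functions e. \<forall>J.
        torus_integral e (\<lambda>x. \<psi> x * v x $ J)
        = - (\<Sum>j\<in>J. ext_sign j J * torus_integral e (\<lambda>x. partial_deriv [j] \<psi> x * u x $ (J - {j}))))"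

definition weak_d :: "('n::{finite,linorder} \<Rightarrow> 'n euclid) \<Rightarrow> 'n form \<Rightarrow> 'n form" where
  "weak_d e u = (SOME v. has_weak_d e u v)"

definition d_domain :: "('n::{finite,linorder} \<Rightarrow> 'n euclid) \<Rightarrow> 'n form set" where
  "d_domain e = {u \<in> L2_forms e. \<exists>v. has_weak_d e u v}"

text \<open>\<open>H\<^sup>r\<close> norms on the torus by Fourier series, for \<open>r\<close> real. Frequencies range over \<open>2\<pi>\<close> times the
  dual lattice; the normalisation makes the \<open>H\<^sup>0\<close> norm equal to the \<open>L\<^sup>2\<close> norm.\<close>

definition frequencies :: "('n::finite \<Rightarrow> 'n euclid) \<Rightarrow> ('n euclid) set" where
  "frequencies e = {\<xi>. \<forall>i. \<exists>m::int. \<xi> \<bullet> e i = 2 * pi * of_int m}"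

definition fourier_coeff ::
  "('n::finite \<Rightarrow> 'n euclid) \<Rightarrow> 'n form \<Rightarrow> 'n set \<Rightarrow> 'n euclid \<Rightarrow> complex" where
  "fourier_coeff e u I \<xi> =
     torus_integral e (\<lambda>x. complex_of_real (u x $ I) * cis (- (\<xi> \<bullet> x)))
     / of_real (measure lebesgue (fund_cell e))"

definition Hr_term :: "('n::finite \<Rightarrow> 'n euclid) \<Rightarrow> real \<Rightarrow> 'n form \<Rightarrow> 'n euclid \<Rightarrow> real" where
  "Hr_term e r u \<xi> = measure lebesgue (fund_cell e) * (1 + (norm \<xi>)\<^sup>2) powr r
     * (\<Sum>I\<in>UNIV. (cmod (fourier_coeff e u I \<xi>))\<^sup>2)"

definition finite_Hr_norm :: "('n::finite \<Rightarrow> 'n euclid) \<Rightarrow> real \<Rightarrow> 'n form \<Rightarrow> bool" where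
  "finite_Hr_norm e r u \<longleftrightarrow> Hr_term e r u summable_on frequencies e"

definition Hr_norm :: "('n::finite \<Rightarrow> 'n euclid) \<Rightarrow> real \<Rightarrow> 'n form \<Rightarrow> real" where
  "Hr_norm e r u = sqrt (\<Sum>\<^sub>\<infinity>\<xi>\<in>frequencies e. Hr_term e r u \<xi>)"

section \<open>Cellular complexes\<close>

definition cell_chart ::
  "nat \<Rightarrow> ('n::finite euclid) set \<Rightarrow> ('n euclid \<Rightarrow> 'n euclid) \<Rightarrow> ('n euclid) set \<Rightarrow> bool" where
  "cell_chart d V f T \<longleftrightarrow> subspace V \<and> dim V = d \<and> T = f ` (cball 0 1 \<inter> V) \<and>
     (\<exists>c C. 0 < c \<and> (\<forall>x \<in> cball 0 1 \<inter> V. \<forall>y \<in> cball 0 1 \<inter> V.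
        c * dist x y \<le> dist (f x) (f y) \<and> dist (f x) (f y) \<le> C * dist x y))"

definition is_cell :: "nat \<Rightarrow> ('n::finite euclid) set \<Rightarrow> bool" where
  "is_cell d T \<longleftrightarrow> (\<exists>V f. cell_chart d V f T)"

definition cell_interior :: "('n::finite euclid) set \<Rightarrow> ('n euclid) set" where
  "cell_interior T = {f x | d V f x. cell_chart d V f T \<and> x \<in> ball 0 1 \<inter> V}"

definition cell_boundary :: "('n::finite euclid) set \<Rightarrow> ('n euclid) set" where
  "cell_boundary T = {f x | d V f x. cell_chart d V f T \<and> x \<in> sphere 0 1 \<inter> V}"

definition cellular_complex :: "('n::finite \<Rightarrow> 'n euclid) \<Rightarrow> ('n euclid) set set \<Rightarrow> bool" where
  "cellular_complex e K \<longleftrightarrow>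
     (\<forall>T\<in>K. \<exists>d. is_cell d T) \<and>
     (\<forall>T\<in>K. \<forall>l\<in>lattice e. (+) l ` T \<in> K) \<and>
     (\<exists>F. finite F \<and> K = {(+) l ` T | l T. l \<in> lattice e \<and> T \<in> F}) \<and>
     (\<forall>T\<in>K. \<forall>l\<in>lattice e. l \<noteq> 0 \<longrightarrow> T \<inter> (+) l ` T = {}) \<and>
     (\<forall>T\<in>K. \<forall>T'\<in>K. T \<noteq> T' \<longrightarrow> cell_interior T \<inter> cell_interior T' = {}) \<and>
     (\<forall>T\<in>K. \<exists>F\<subseteq>K. cell_boundary T = \<Union>F) \<and>
     \<Union>K = UNIV"

definition simplicial_mesh :: "('n::finite \<Rightarrow> 'n euclid) \<Rightarrow> ('n euclid) set set \<Rightarrow> bool" where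
  "simplicial_mesh e S \<longleftrightarrow> cellular_complex e S \<and>
     (\<forall>\<sigma>\<in>S. \<exists>d\<ge>0. d simplex \<sigma>) \<and>
     (\<forall>\<sigma>\<in>S. \<forall>\<tau>. \<tau> face_of \<sigma> \<and> \<tau> \<noteq> {} \<longrightarrow> \<tau> \<in> S) \<and>
     (\<forall>\<sigma>\<in>S. \<forall>\<tau>\<in>S. \<sigma> \<inter> \<tau> face_of \<sigma>)"

definition mesh_width :: "('n::finite euclid) set set \<Rightarrow> real \<Rightarrow> bool" where
  "mesh_width K h \<longleftrightarrow> (\<forall>T\<in>K. diameter T \<le> h) \<and> (\<exists>T\<in>K. diameter T = h)"

text \<open>The conditions on full-dimensional simplices imply the corresponding ones for their faces.\<close>

definition quasi_uniform ::
  "('n::finite \<Rightarrow> 'n euclid) \<Rightarrow> (nat \<Rightarrow> ('n euclid) set set) \<Rightarrow> (nat \<Rightarrow> real) \<Rightarrow> bool" where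
  "quasi_uniform e K h \<longleftrightarrow>
     (\<exists>S \<kappa> C N. 0 < \<kappa> \<and> (\<forall>i.
        simplicial_mesh e (S i) \<and>
        (\<forall>\<sigma>\<in>S i. int CARD('n) simplex \<sigma> \<longrightarrow>
           (\<exists>x. cball x (\<kappa> * diameter \<sigma>) \<subseteq> \<sigma>) \<and> \<kappa> * h i \<le> diameter \<sigma> \<and> diameter \<sigma> \<le> C * h i) \<and>
        (\<forall>T\<in>K i. \<exists>F\<subseteq>S i. finite F \<and> card F \<le> N \<and> T = \<Union>F)))"

section \<open>Finite element systems\<close>

text \<open>A \<open>k\<close>-form on a cell \<open>T\<close>, smooth up to the boundary, is the pullback to \<open>T\<close> of a smooth \<open>k\<close>-form on
  \<open>\<real>\<^sup>n\<close>. The space attached to \<open>T\<close> is given as the set \<open>X k T\<close> of \<^emph>\<open>all\<close> smooth \<open>k\<close>-forms on \<open>\<real>\<^sup>n\<close>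
  whose pullback to \<open>T\<close> belongs to it, so that linear algebra in it is understood modulo
  \<open>same_pullback T\<close>, and the pullback of \<open>u\<close> to a subcell is represented by \<open>u\<close> itself.\<close>

type_synonym 'n local_spaces = "nat \<Rightarrow> ('n euclid) set \<Rightarrow> 'n form set"

definition finite_element_system ::
  "('n::{finite,linorder} \<Rightarrow> 'n euclid) \<Rightarrow> ('n euclid) set set \<Rightarrow> 'n local_spaces \<Rightarrow> bool" where
  "finite_element_system e K X \<longleftrightarrow> (\<forall>T\<in>K. \<forall>k.
     X k T \<subseteq> smooth_kforms k \<and>
     (\<forall>u\<in>X k T. \<forall>v\<in>smooth_kforms k. same_pullback T u v \<longrightarrow> v \<in> X k T) \<and>
     (\<lambda>x. 0) \<in> X k T \<and>
     (\<forall>u\<in>X k T. \<forall>v\<in>X k T. \<forall>a b. (\<lambda>x. a *\<^sub>R u x + b *\<^sub>R v x) \<in> X k T) \<and>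
     (\<exists>B. finite B \<and> B \<subseteq> X k T \<and>
        (\<forall>u\<in>X k T. \<exists>c. same_pullback T u (\<lambda>x. \<Sum>b\<in>B. c b *\<^sub>R b x))) \<and>
     (\<forall>l\<in>lattice e. X k ((+) l ` T) = (\<lambda>u x. u (x - l)) ` X k T) \<and>
     smooth_d ` X k T \<subseteq> X (Suc k) T \<and>
     (\<forall>T'\<in>K. T' \<subseteq> T \<longrightarrow> X k T \<subseteq> X k T'))"

definition exact_on_cells :: "('n::{finite,linorder} euclid) set set \<Rightarrow> 'n local_spaces \<Rightarrow> bool" where
  "exact_on_cells K X \<longleftrightarrow> (\<forall>T\<in>K.
     (\<forall>c. (\<lambda>x. axis {} c) \<in> X 0 T) \<and>
     (\<forall>u\<in>X 0 T. same_pullback T (smooth_d u) (\<lambda>x. 0)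
        \<longrightarrow> (\<exists>c. same_pullback T u (\<lambda>x. axis {} c))) \<and>
     (\<forall>k. \<forall>u\<in>X (Suc k) T. same_pullback T (smooth_d u) (\<lambda>x. 0)
        \<longrightarrow> (\<exists>v\<in>X k T. same_pullback T (smooth_d v) u)))"

definition has_extensions :: "('n::{finite,linorder} euclid) set set \<Rightarrow> 'n local_spaces \<Rightarrow> bool" where
  "has_extensions K X \<longleftrightarrow> (\<forall>T\<in>K. \<forall>k w.
     (\<forall>T'\<in>K. T' \<subset> T \<longrightarrow> w T' \<in> X k T') \<and>
     (\<forall>T'\<in>K. \<forall>T''\<in>K. T'' \<subseteq> T' \<and> T' \<subset> T \<longrightarrow> same_pullback T'' (w T') (w T''))
     \<longrightarrow> (\<exists>v\<in>X k T. \<forall>T'\<in>K. T' \<subset> T \<longrightarrow> same_pullback T' v (w T')))"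

definition compatible_system ::
  "('n::{finite,linorder} \<Rightarrow> 'n euclid) \<Rightarrow> ('n euclid) set set \<Rightarrow> 'n local_spaces \<Rightarrow> bool" where
  "compatible_system e K X \<longleftrightarrow>
     finite_element_system e K X \<and> exact_on_cells K X \<and> has_extensions K X"

text \<open>The global space: the values on the cells of dimension \<open>n\<close> determine the form almost everywhere;
  \<open>w T\<close> is its single-valued pullback to \<open>T\<close>.\<close>

definition global_kforms ::
  "('n::{finite,linorder} \<Rightarrow> 'n euclid) \<Rightarrow> ('n euclid) set set \<Rightarrow> 'n local_spaces \<Rightarrow> nat \<Rightarrow> 'n form set" where
  "global_kforms e K X k = {u. periodic e u \<and> is_kform k u \<and>
     (\<exists>w. (\<forall>T\<in>K. w T \<in> X k T) \<and>
          (\<forall>T\<in>K. \<forall>T'\<in>K. T' \<subseteq> T \<longrightarrow> same_pullback T' (w T) (w T')) \<and>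
          (\<forall>T\<in>K. is_cell CARD('n) T \<longrightarrow> (AE x in lebesgue. x \<in> T \<longrightarrow> u x = w T x)))}"

definition global_space ::
  "('n::{finite,linorder} \<Rightarrow> 'n euclid) \<Rightarrow> ('n euclid) set set \<Rightarrow> 'n local_spaces \<Rightarrow> 'n form set" where
  "global_space e K X = {u. \<forall>k\<le>CARD('n). deg_part k u \<in> global_kforms e K X k}"

subsection \<open>Compactness of the scaled macro-elements\<close>

definition macro_element :: "('n::finite euclid) set set \<Rightarrow> ('n euclid) set \<Rightarrow> ('n euclid) set set" where
  "macro_element K T = {T'' \<in> K. \<exists>T'\<in>K. T' \<inter> T \<noteq> {} \<and> T'' \<subseteq> T'}"

definition independent_on ::
  "('n::{finite,linorder} euclid) set \<Rightarrow> nat \<Rightarrow> (nat \<Rightarrow> 'n form) \<Rightarrow> bool" where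
  "independent_on T N b \<longleftrightarrow>
     (\<forall>c. same_pullback T (\<lambda>x. \<Sum>r<N. c r *\<^sub>R b r x) (\<lambda>x. 0) \<longrightarrow> (\<forall>r<N. c r = 0))"

definition spanned_on ::
  "('n::{finite,linorder} euclid) set \<Rightarrow> nat \<Rightarrow> nat \<Rightarrow> (nat \<Rightarrow> 'n form) \<Rightarrow> 'n form set" where
  "spanned_on T k N b =
     {u \<in> smooth_kforms k. \<exists>c. same_pullback T u (\<lambda>x. \<Sum>r<N. c r *\<^sub>R b r x)}"

text \<open>There are finitely many combinatorial types \<open>j < J\<close>. A type consists of \<open>N j\<close> reference cells
  \<open>R j a\<close>; \<open>\<theta>\<close> in the compact set \<open>\<Theta> j\<close> parametrises the geometry, through a homeomorphism \<open>G j \<theta>\<close>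
  of the reference macro-element, and the local spaces, through bases \<open>b j \<theta> a k\<close> of fixed length
  \<open>D j a k\<close> depending continuously on \<open>\<theta>\<close> with all their derivatives. Every macro-element, translated
  and scaled by \<open>1 / h\<close>, is one of these. Since every compact metric space embeds into \<open>nat \<Rightarrow> real\<close>
  with the product topology, it is no restriction to take the parameters there.\<close>

definition compact_macro_elements ::
  "(nat \<Rightarrow> ('n::{finite,linorder} euclid) set set) \<Rightarrow> (nat \<Rightarrow> 'n local_spaces) \<Rightarrow> (nat \<Rightarrow> real) \<Rightarrow> bool"
  where
  "compact_macro_elements K X h \<longleftrightarrow>
    (\<exists>(J::nat) (N :: nat \<Rightarrow> nat) (R :: nat \<Rightarrow> nat \<Rightarrow> ('n euclid) set) (\<Theta> :: nat \<Rightarrow> (nat \<Rightarrow> real) set)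
      (G :: nat \<Rightarrow> (nat \<Rightarrow> real) \<Rightarrow> 'n euclid \<Rightarrow> 'n euclid) (D :: nat \<Rightarrow> nat \<Rightarrow> nat \<Rightarrow> nat)
      (b :: nat \<Rightarrow> (nat \<Rightarrow> real) \<Rightarrow> nat \<Rightarrow> nat \<Rightarrow> nat \<Rightarrow> 'n form).
      (\<forall>j<J.
         compact (\<Theta> j) \<and> (\<forall>a<N j. compact (R j a)) \<and>
         continuous_on (\<Theta> j \<times> (\<Union>a<N j. R j a)) (\<lambda>(\<theta>, x). G j \<theta> x) \<and>
         (\<exists>c C. 0 < c \<and> (\<forall>\<theta>\<in>\<Theta> j. \<forall>x \<in> (\<Union>a<N j. R j a). \<forall>y \<in> (\<Union>a<N j. R j a).
            c * dist x y \<le> dist (G j \<theta> x) (G j \<theta> y) \<and> dist (G j \<theta> x) (G j \<theta> y) \<le> C * dist x y)) \<and>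
         (\<forall>a<N j. \<forall>k.
            (\<forall>\<theta>\<in>\<Theta> j. independent_on (G j \<theta> ` R j a) (D j a k) (b j \<theta> a k)) \<and>
            (\<forall>r<D j a k.
               (\<forall>\<theta>\<in>\<Theta> j. b j \<theta> a k r \<in> smooth_kforms k) \<and>
               (\<forall>js. continuous_on (\<Theta> j \<times> UNIV) (\<lambda>(\<theta>, x). partial_deriv js (b j \<theta> a k r) x))))) \<and>
      (\<forall>i. \<forall>T\<in>K i. \<exists>j<J. \<exists>\<theta>\<in>\<Theta> j. \<exists>A x0.
         bij_betw A {..<N j} (macro_element (K i) T) \<and>
         (\<forall>a<N j.
            A a = (\<lambda>x. x0 + h i *\<^sub>R G j \<theta> x) ` R j a \<and>
            (\<forall>k. X i k (A a) =
               spanned_on (A a) k (D j a k) (\<lambda>r x. b j \<theta> a k r ((1 / h i) *\<^sub>R (x - x0)))))))"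

section \<open>Degrees of freedom and interpolators\<close>

type_synonym 'n dofs = "nat \<Rightarrow> ('n euclid) set \<Rightarrow> ('n form \<Rightarrow> real) set"

definition interpolates ::
  "('n::{finite,linorder} euclid) set set \<Rightarrow> 'n local_spaces \<Rightarrow> 'n dofs
    \<Rightarrow> nat \<Rightarrow> ('n euclid) set \<Rightarrow> 'n form \<Rightarrow> 'n form \<Rightarrow> bool" where
  "interpolates K X F k T u w \<longleftrightarrow>
     w \<in> X k T \<and> (\<forall>T'\<in>K. T' \<subseteq> T \<longrightarrow> (\<forall>f\<in>F k T'. f w = f u))"

definition degrees_of_freedom ::
  "('n::{finite,linorder} \<Rightarrow> 'n euclid) \<Rightarrow> ('n euclid) set set \<Rightarrow> 'n dofs \<Rightarrow> bool" where
  "degrees_of_freedom e K F \<longleftrightarrow> (\<forall>T\<in>K. \<forall>k.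
     (\<forall>f\<in>F k T. \<forall>u\<in>smooth_kforms k. \<forall>v\<in>smooth_kforms k.
        (same_pullback T u v \<longrightarrow> f u = f v) \<and>
        (\<forall>a b. f (\<lambda>x. a *\<^sub>R u x + b *\<^sub>R v x) = a * f u + b * f v)) \<and>
     (\<forall>l\<in>lattice e. F k ((+) l ` T) = (\<lambda>f u. f (\<lambda>x. u (x + l))) ` F k T))"

definition unisolvent ::
  "('n::{finite,linorder} euclid) set set \<Rightarrow> 'n local_spaces \<Rightarrow> 'n dofs \<Rightarrow> bool" where
  "unisolvent K X F \<longleftrightarrow> (\<forall>T\<in>K. \<forall>k. \<forall>u\<in>smooth_kforms k.
     (\<exists>w. interpolates K X F k T u w) \<and>
     (\<forall>w w'. interpolates K X F k T u w \<and> interpolates K X F k T u w' \<longrightarrow> same_pullback T w w'))"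

definition local_interpolator ::
  "('n::{finite,linorder} euclid) set set \<Rightarrow> 'n local_spaces \<Rightarrow> 'n dofs
    \<Rightarrow> nat \<Rightarrow> ('n euclid) set \<Rightarrow> 'n form \<Rightarrow> 'n form" where
  "local_interpolator K X F k T u = (SOME w. interpolates K X F k T u w)"

definition interpolator_commutes ::
  "('n::{finite,linorder} euclid) set set \<Rightarrow> 'n local_spaces \<Rightarrow> 'n dofs \<Rightarrow> bool" where
  "interpolator_commutes K X F \<longleftrightarrow> (\<forall>T\<in>K. \<forall>k. \<forall>u\<in>smooth_kforms k.
     same_pullback T (local_interpolator K X F (Suc k) T (smooth_d u))
                     (smooth_d (local_interpolator K X F k T u)))"

definition interpolators_uniformly_bounded ::
  "(nat \<Rightarrow> ('n::{finite,linorder} euclid) set set) \<Rightarrow> (nat \<Rightarrow> 'n local_spaces)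
    \<Rightarrow> (nat \<Rightarrow> 'n dofs) \<Rightarrow> (nat \<Rightarrow> real) \<Rightarrow> bool" where
  "interpolators_uniformly_bounded K X F h \<longleftrightarrow>
     (\<exists>m C. \<forall>i. \<forall>T\<in>K i. is_cell CARD('n) T \<longrightarrow> (\<forall>k. \<forall>u\<in>smooth_kforms k.
        Cm_norm (h i) m T (local_interpolator (K i) (X i) (F i) k T u) \<le> C * Cm_norm (h i) m T u))"

text \<open>The global interpolator; its value on the null set outside the interiors of the \<open>n\<close>-cells
  is irrelevant.\<close>

definition interpolator ::
  "('n::{finite,linorder} euclid) set set \<Rightarrow> 'n local_spaces \<Rightarrow> 'n dofs \<Rightarrow> 'n form \<Rightarrow> 'n form" where
  "interpolator K X F u = (\<lambda>x.
     if \<exists>T\<in>K. is_cell CARD('n) T \<and> x \<in> cell_interior T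
     then let T = (THE T. T \<in> K \<and> is_cell CARD('n) T \<and> x \<in> cell_interior T)
          in \<Sum>k\<le>CARD('n). local_interpolator K X F k T (deg_part k u) x
     else 0)"

section \<open>Mollified interpolation\<close>

text \<open>Nonnegativity is required for \<open>p \<le> 1\<close> only: for \<open>p \<ge> 2\<close> it contradicts the moment condition
  (take \<open>q(x) = |x|\<^sup>2\<close>).\<close>

definition mollifier :: "nat \<Rightarrow> ('n::finite euclid \<Rightarrow> real) \<Rightarrow> bool" where
  "mollifier p \<phi> \<longleftrightarrow> smooth \<phi> \<and> (p \<le> 1 \<longrightarrow> (\<forall>x. 0 \<le> \<phi> x)) \<and> (\<forall>x. 1 < norm x \<longrightarrow> \<phi> x = 0) \<and>
     integral\<^sup>L lebesgue \<phi> = 1 \<and>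
     (\<forall>q. poly_degree_le p q \<longrightarrow> integral\<^sup>L lebesgue (\<lambda>x. \<phi> (- x) * q x) = q 0)"

definition mollify :: "('n::finite euclid \<Rightarrow> real) \<Rightarrow> real \<Rightarrow> 'n form \<Rightarrow> 'n form" where
  "mollify \<phi> \<delta> u =
     (\<lambda>x. integral\<^sup>L lebesgue (\<lambda>y. ((1 / \<delta>) ^ CARD('n) * \<phi> ((1 / \<delta>) *\<^sub>R y)) *\<^sub>R u (x - y)))"

definition mollified_interpolator ::
  "('n::{finite,linorder} euclid) set set \<Rightarrow> 'n local_spaces \<Rightarrow> 'n dofs
    \<Rightarrow> ('n euclid \<Rightarrow> real) \<Rightarrow> real \<Rightarrow> 'n form \<Rightarrow> 'n form" where
  "mollified_interpolator K X F \<phi> \<delta> u = interpolator K X F (mollify \<phi> \<delta> u)"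

definition restricts_to_iso :: "'n::finite form set \<Rightarrow> ('n form \<Rightarrow> 'n form) \<Rightarrow> bool" where
  "restricts_to_iso Xh Q \<longleftrightarrow> Q ` Xh \<subseteq> Xh \<and>
     (\<forall>v\<in>Xh. \<exists>w\<in>Xh. ae_eq (Q w) v) \<and>
     (\<forall>w\<in>Xh. \<forall>w'\<in>Xh. ae_eq (Q w) (Q w') \<longrightarrow> ae_eq w w')"

text \<open>\<open>(Q|\<^bsub>Xh\<^esub>)\<^sup>-\<^sup>1 Q\<close>\<close>

definition projection_of :: "'n::finite form set \<Rightarrow> ('n form \<Rightarrow> 'n form) \<Rightarrow> 'n form \<Rightarrow> 'n form" where
  "projection_of Xh Q u = (SOME w. w \<in> Xh \<and> ae_eq (Q w) (Q u))"

definition smoothed_projection ::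
  "('n::{finite,linorder} \<Rightarrow> 'n euclid) \<Rightarrow> ('n euclid) set set \<Rightarrow> 'n local_spaces \<Rightarrow> 'n dofs
    \<Rightarrow> ('n euclid \<Rightarrow> real) \<Rightarrow> real \<Rightarrow> 'n form \<Rightarrow> 'n form" where
  "smoothed_projection e K X F \<phi> \<delta> =
     projection_of (global_space e K X) (mollified_interpolator K X F \<phi> \<delta>)"

text \<open>\<open>\<epsilon>\<close> is small enough for the projections \<open>\<Pi>\<^sub>h\<close> to be defined, uniformly bounded and commuting.\<close>

definition admissible_eps ::
  "('n::{finite,linorder} \<Rightarrow> 'n euclid) \<Rightarrow> (nat \<Rightarrow> ('n euclid) set set) \<Rightarrow> (nat \<Rightarrow> 'n local_spaces)
    \<Rightarrow> (nat \<Rightarrow> 'n dofs) \<Rightarrow> (nat \<Rightarrow> real) \<Rightarrow> ('n euclid \<Rightarrow> real) \<Rightarrow> real \<Rightarrow> bool" where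
  "admissible_eps e K X F h \<phi> \<epsilon> \<longleftrightarrow> 0 < \<epsilon> \<and>
     (\<forall>i. restricts_to_iso (global_space e (K i) (X i))
            (mollified_interpolator (K i) (X i) (F i) \<phi> (\<epsilon> * h i))) \<and>
     (\<exists>C. \<forall>i. \<forall>u\<in>L2_forms e.
        L2_norm e (smoothed_projection e (K i) (X i) (F i) \<phi> (\<epsilon> * h i) u) \<le> C * L2_norm e u) \<and>
     (\<forall>i. \<forall>u\<in>d_domain e.
        ae_eq (weak_d e (smoothed_projection e (K i) (X i) (F i) \<phi> (\<epsilon> * h i) u))
              (smoothed_projection e (K i) (X i) (F i) \<phi> (\<epsilon> * h i) (weak_d e u)))"

end

theory Submission
  imports Defs
begin

text \<open>The projection \<open>\<Pi>\<close> is bounded and quasi-optimal in \<open>L\<^sup>2\<close>, so \<open>|w - \<Pi> w|\<close> is at most a constant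
  times \<open>|w - Q f|\<close> for every mollification \<open>f\<close> of \<open>w\<close>. For smooth \<open>f\<close> and almost every \<open>x\<close>, let \<open>q\<close> be
  the Taylor polynomial of \<open>f\<close> at \<open>x\<close> itself. As \<open>Q q = q\<close> near \<open>x\<close> and \<open>Q\<close> is local, \<open>|f(x) - Q f(x)|\<close>
  is controlled by the mean of \<open>|f - q|\<close> over a ball of radius comparable to \<open>h\<close> centred at \<open>x\<close>;
  integrating the Taylor remainder over \<open>x\<close>, with translation invariance on the torus, gives the
  estimate \<open>|f - Q f| \<le> C h\<^sup>r |\<nabla>\<^sup>r f|\<close> for \<open>r \<le> p + 1\<close> without any local Bramble-Hilbert argument or
  counting of overlaps. Applied to \<open>u\<close> with \<open>r = p + 1\<close> and to \<open>d u\<close> with \<open>r = p\<close>, it bounds the error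
  \<open>d u - d \<Pi> u = d u - \<Pi> d u\<close> in \<open>H\<^sup>-\<^sup>1\<close> and in \<open>L\<^sup>2\<close>, and the claim follows by interpolation between
  these two norms, which for Fourier series only needs Bessel's inequality.\<close>

section \<open>Partial derivatives\<close>

text \<open>Two mollifications occur, at unrelated scales. The one at scale \<epsilon> h belongs to
  \<open>Q\<close>: it makes interpolation meaningful for square integrable forms and, by the moment
  condition, preserves polynomials of degree up to \<open>p\<close>. The other, at a scale \<delta>
  that depends on the form and shrinks to 0, only makes Taylor expansion available; its L2 error is
  arbitrarily small, while its derivatives stay bounded by the weak ones times the L1 norm of
  \<phi>, which may exceed 1 since \<phi> may change sign when p \<ge> 2. Taylor polynomials are not
  periodic, so convolution is developed for locally integrable functions, and periodicity enters
  when remainders are integrated over the base point. For d u and p = 0 the order is r = 0; the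
  Taylor polynomial is then 0 and the estimate is mere stability. The H^-1 bound of the error is the
  L2 bound of u - \<Pi> u, because d multiplies a Fourier coefficient by a covector of length
  |\<xi>|. The interpolation parameter is finally h, which gives both contributions the same
  order.\<close>

lemma partial_deriv_append: "partial_deriv (ks @ js) u = partial_deriv ks (partial_deriv js u)"
  by (induction ks) auto

lemma partial_deriv_Cons_eqI:
  assumes "(partial_deriv js u has_derivative D) (at x)"
  shows "partial_deriv (j # js) u x = D (axis j 1)"
  using frechet_derivative_at[OF assms] by simp

lemma partial_deriv_single_eqI:
  assumes "(u has_derivative D) (at x)"
  shows "partial_deriv [j] u x = D (axis j 1)"
  using partial_deriv_Cons_eqI[of "[]" u] assms by simp

lemma smooth_partial_deriv: "smooth u \<Longrightarrow> smooth (partial_deriv js u)"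
  unfolding smooth_def by (metis partial_deriv_append)

lemma differentiable_imp_has_derivative_partials:
  fixes u :: "'n::finite euclid \<Rightarrow> 'b::real_normed_vector"
  assumes "u differentiable (at x)"
  shows "(u has_derivative (\<lambda>v. \<Sum>j\<in>UNIV. (v $ j) *\<^sub>R partial_deriv [j] u x)) (at x)"
proof -
  let ?D = "frechet_derivative u (at x)"
  have D: "(u has_derivative ?D) (at x)"
    using assms frechet_derivative_works by blast
  then have lin: "linear ?D"
    using has_derivative_linear by blast
  have "?D v = (\<Sum>j\<in>UNIV. (v $ j) *\<^sub>R partial_deriv [j] u x)" for v
  proof -
    have "?D v = ?D (\<Sum>j\<in>UNIV. (v $ j) *\<^sub>R axis j 1)"
      using basis_expansion[of v] by (simp add: scalar_mult_eq_scaleR)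
    then show ?thesis
      by (simp add: linear_sum[OF lin] linear_cmul[OF lin])
  qed
  then have "?D = (\<lambda>v. \<Sum>j\<in>UNIV. (v $ j) *\<^sub>R partial_deriv [j] u x)"
    by blast
  with D show ?thesis
    by argo
qed

lemma smooth_has_derivative:
  fixes u :: "'n::finite euclid \<Rightarrow> 'b::real_normed_vector"
  assumes "smooth u"
  shows "(u has_derivative (\<lambda>v. \<Sum>j\<in>UNIV. (v $ j) *\<^sub>R partial_deriv [j] u x)) (at x)"
  using assms differentiable_imp_has_derivative_partials[of u x] unfolding smooth_def
  by (metis partial_deriv.simps(1))

lemma smooth_partial_has_derivative:
  fixes u :: "'n::finite euclid \<Rightarrow> 'b::real_normed_vector"
  assumes "smooth u"
  shows "(partial_deriv js u has_derivative
    (\<lambda>v. \<Sum>j\<in>UNIV. (v $ j) *\<^sub>R partial_deriv (j # js) u x)) (at x)"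
  using smooth_has_derivative[OF smooth_partial_deriv[OF assms, of js], of x]
  by simp

lemma smooth_continuous_on: "smooth u \<Longrightarrow> continuous_on A (partial_deriv js u)"
  by (metis (no_types, lifting) continuous_at_imp_continuous_on differentiable_imp_continuous_within smooth_def)

lemma smooth_continuous: "smooth u \<Longrightarrow> continuous_on A u"
  using smooth_continuous_on[of u A "[]"] by simp

text \<open>Induction on the list of derivatives keeps every iterated partial derivative inside
  \<open>S\<close>, so it suffices to differentiate members of \<open>S\<close> once. The intended
  \<open>S\<close> is a family of trigonometric functions.\<close>

lemma smoothI_class:
  assumes "u \<in> S" "\<And>v x. v \<in> S \<Longrightarrow> v differentiable (at x)"
    and "\<And>v j. v \<in> S \<Longrightarrow> partial_deriv [j] v \<in> S"
  shows "smooth u"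
proof -
  have "partial_deriv js u \<in> S" for js
  proof (induction js)
    case (Cons j js)
    then show ?case
      using assms(3)[of "partial_deriv js u" j] by simp
  qed (use assms(1) in simp)
  then show ?thesis
    using assms(2) by (auto simp: smooth_def)
qed

text \<open>A family indexed by lists whose first derivatives are again members of the family must
  consist of the iterated partial derivatives of \<open>D []\<close>. The closure rules below, and
  the one for convolutions, propose a formula for all orders at once and check only first
  derivatives.\<close>

lemma smoothI_derivs:
  fixes u :: "'n::finite euclid \<Rightarrow> 'b::real_normed_vector"
  assumes "\<And>js x. (D js has_derivative (\<lambda>v. \<Sum>j\<in>UNIV. (v $ j) *\<^sub>R D (j # js) x)) (at x)"
  shows "partial_deriv js (D []) = D js" "smooth (D [])"
proof -
  show eq: "partial_deriv js (D []) = D js" for js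
  proof (induction js)
    case (Cons j js)
    have "partial_deriv (j # js) (D []) x = (\<Sum>i\<in>UNIV. (axis j 1 $ i) *\<^sub>R D (i # js) x)" for x
      by (rule partial_deriv_Cons_eqI) (use Cons assms in simp)
    also have "\<And>x. (\<Sum>i\<in>UNIV. (axis j 1 $ i) *\<^sub>R D (i # js) x) = (\<Sum>i\<in>UNIV. if i = j then D (i # js) x else 0)"
      by (intro sum.cong) (auto simp: axis_def)
    finally show ?case
      by (auto simp: fun_eq_iff)
  qed simp
  show "smooth (D [])"
    unfolding smooth_def eq using assms differentiable_def by blast
qed

section \<open>Closure of smooth functions under linear maps, sums and affine substitutions\<close>

lemma partial_deriv_bounded_linear:
  assumes L: "bounded_linear L" and u: "smooth u"
  shows "partial_deriv js (\<lambda>x. L (u x)) = (\<lambda>x. L (partial_deriv js u x))" (is ?A)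
    and "smooth (\<lambda>x. L (u x))" (is ?B)
proof -
  have "((\<lambda>x. L (partial_deriv js u x)) has_derivative
     (\<lambda>v. \<Sum>j\<in>UNIV. (v $ j) *\<^sub>R L (partial_deriv (j # js) u x))) (at x)" for js x
    using bounded_linear.has_derivative[OF L smooth_partial_has_derivative[OF u]]
    by (simp add: linear_sum[OF bounded_linear.linear[OF L]] linear_cmul[OF bounded_linear.linear[OF L]])
  from smoothI_derivs[of "\<lambda>js x. L (partial_deriv js u x)", OF this]
  show ?A ?B by auto
qed

lemma partial_deriv_sum:
  assumes "\<And>i. i \<in> A \<Longrightarrow> smooth (u i)"
  shows "partial_deriv js (\<lambda>x. \<Sum>i\<in>A. u i x) = (\<lambda>x. \<Sum>i\<in>A. partial_deriv js (u i) x)" (is ?A)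
    and "smooth (\<lambda>x. \<Sum>i\<in>A. u i x)" (is ?B)
proof -
  have "((\<lambda>x. \<Sum>i\<in>A. partial_deriv js (u i) x) has_derivative
     (\<lambda>v. \<Sum>j\<in>UNIV. (v $ j) *\<^sub>R (\<Sum>i\<in>A. partial_deriv (j # js) (u i) x))) (at x)" for js x
    unfolding scaleR_sum_right
    by (subst sum.swap, intro has_derivative_sum smooth_partial_has_derivative assms)
  from smoothI_derivs[of "\<lambda>js x. \<Sum>i\<in>A. partial_deriv js (u i) x", OF this]
  show ?A ?B by auto
qed

lemma partial_deriv_add:
  assumes "smooth u" "smooth v"
  shows "partial_deriv js (\<lambda>x. u x + v x) = (\<lambda>x. partial_deriv js u x + partial_deriv js v x)" (is ?A)
    and "smooth (\<lambda>x. u x + v x)" (is ?B)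
proof -
  have "smooth (if b then u else v)" for b using assms by auto
  from partial_deriv_sum[of UNIV "\<lambda>b. if b then u else v", OF this]
  show ?A ?B by (auto simp: UNIV_bool add.commute)
qed

lemma partial_deriv_scaleR:
  assumes "smooth u"
  shows "partial_deriv js (\<lambda>x. c *\<^sub>R u x) = (\<lambda>x. c *\<^sub>R partial_deriv js u x)"
    and "smooth (\<lambda>x. c *\<^sub>R u x)"
  using partial_deriv_bounded_linear[OF bounded_linear_scaleR_right assms] by auto

lemma smooth_lincomb: "smooth u \<Longrightarrow> smooth v \<Longrightarrow> smooth (\<lambda>x. a *\<^sub>R u x + b *\<^sub>R v x)"
  by (intro partial_deriv_add partial_deriv_scaleR)

lemma partial_deriv_affine:
  fixes u :: "'n::finite euclid \<Rightarrow> 'b::real_normed_vector"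
  assumes u: "smooth u"
  shows "partial_deriv js (\<lambda>x. u (c *\<^sub>R x + a)) = (\<lambda>x. c ^ length js *\<^sub>R partial_deriv js u (c *\<^sub>R x + a))" (is ?A)
    and "smooth (\<lambda>x. u (c *\<^sub>R x + a))" (is ?B)
proof -
  have "((\<lambda>x. c ^ length js *\<^sub>R partial_deriv js u (c *\<^sub>R x + a)) has_derivative
     (\<lambda>v. \<Sum>j\<in>UNIV. (v $ j) *\<^sub>R (c ^ length (j # js) *\<^sub>R partial_deriv (j # js) u (c *\<^sub>R x + a)))) (at x)" for js x
  proof -
    have 1: "((\<lambda>x. c *\<^sub>R x + a) has_derivative (\<lambda>v. c *\<^sub>R v)) (at x)"
      by (auto intro!: derivative_eq_intros)
    have "((\<lambda>x. c ^ length js *\<^sub>R partial_deriv js u (c *\<^sub>R x + a)) has_derivative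
     (\<lambda>v. c ^ length js *\<^sub>R (\<Sum>j\<in>UNIV. ((c *\<^sub>R v) $ j) *\<^sub>R partial_deriv (j # js) u (c *\<^sub>R x + a)))) (at x)"
      by (intro has_derivative_scaleR_right
          has_derivative_compose[OF 1 smooth_partial_has_derivative[OF u]])
    then show ?thesis
      by (simp add: scaleR_sum_right algebra_simps)
  qed
  from smoothI_derivs[of "\<lambda>js x. c ^ length js *\<^sub>R partial_deriv js u (c *\<^sub>R x + a)", OF this]
  show ?A ?B by auto
qed

lemma partial_deriv_translate:
  fixes u :: "'n::finite euclid \<Rightarrow> 'b::real_normed_vector"
  assumes u: "smooth u"
  shows "partial_deriv js (\<lambda>x. u (x + a)) = (\<lambda>x. partial_deriv js u (x + a))"
    and "smooth (\<lambda>x. u (x + a))"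
  using partial_deriv_affine[OF u, where c=1 and a=a] by simp_all

lemma bounded_linear_of_euclidean:
  fixes L :: "'a::euclidean_space \<Rightarrow> 'b::real_normed_vector"
  shows "linear L \<Longrightarrow> bounded_linear L"
  using linear_conv_bounded_linear by blast

section \<open>Homogeneous parts of forms of mixed degree\<close>

lemma bounded_linear_deg_part:
  "bounded_linear (\<lambda>v :: real^('n::finite set). \<chi> I. if card I = k then v $ I else 0)"
  by (intro bounded_linear_of_euclidean linearI) (auto simp: vec_eq_iff)

lemma deg_part_nth: "deg_part k u x $ I = (if card I = k then u x $ I else 0)"
  by (simp add: deg_part_def)

lemma partial_deriv_deg_part:
  assumes "smooth u"
  shows "partial_deriv js (deg_part k u) = deg_part k (partial_deriv js u)"
    and "smooth (deg_part k u)"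
  using partial_deriv_bounded_linear[OF bounded_linear_deg_part assms] unfolding deg_part_def by auto

lemma smooth_component:
  "smooth u \<Longrightarrow> smooth (\<lambda>x. u x $ I)"
  "smooth u \<Longrightarrow> partial_deriv js (\<lambda>x. u x $ I) = (\<lambda>x. partial_deriv js u x $ I)"
  using partial_deriv_bounded_linear[OF bounded_linear_vec_nth] by auto

lemma norm_deg_part_le: "norm (deg_part k u x) \<le> norm (u x)"
  by (intro norm_le_componentwise_cart) (auto simp: deg_part_nth)

lemma deg_part_smooth_kforms: "smooth u \<Longrightarrow> deg_part k u \<in> smooth_kforms k"
  by (auto simp: smooth_kforms_def is_kform_def deg_part_nth partial_deriv_deg_part)

lemma sum_deg_part: "(\<Sum>k\<le>CARD('n). deg_part k u x) = (u x :: real^('n::finite set))"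
proof -
  have "(\<Sum>k\<le>CARD('n). if card I = k then u x $ I else 0) = u x $ I" for I :: "'n set"
    by (simp add: sum.delta card_mono)
  then show ?thesis
    by (simp add: vec_eq_iff deg_part_nth)
qed

lemma partial_deriv_zero_outside:
  fixes u :: "'n::finite euclid \<Rightarrow> 'b::real_normed_vector"
  assumes "open A" "\<And>x. x \<in> A \<Longrightarrow> u x = 0" "x \<in> A"
  shows "partial_deriv js u x = 0"
  using assms(3)
proof (induction js arbitrary: x)
  case (Cons j js)
  have "(partial_deriv js u has_derivative (\<lambda>v. 0)) (at x)"
    by (rule has_derivative_transform_within_open[of "\<lambda>_. 0", OF _ assms(1) Cons.prems])
       (use Cons.IH in auto)
  then show ?case by (rule partial_deriv_Cons_eqI)
qed (use assms in simp)

text \<open>Outside the closed ball the function vanishes on an open set, so its derivatives vanish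
  there too; on the closed ball they are continuous on a compact set.\<close>

lemma smooth_compact_support_bounded:
  fixes k :: "'n::finite euclid \<Rightarrow> real"
  assumes "smooth k" "\<And>x. r < norm x \<Longrightarrow> k x = 0"
  shows "r < norm x \<Longrightarrow> partial_deriv js k x = 0"
    and "\<exists>B\<ge>0. \<forall>x. norm (partial_deriv js k x) \<le> B"
proof -
  have op: "open {x :: 'n euclid. r < norm x}"
    by (intro open_Collect_less continuous_intros)
  show 1: "r < norm x \<Longrightarrow> partial_deriv js k x = 0" for x
    using partial_deriv_zero_outside[OF op, of k x js] assms(2) by auto
  have "compact (partial_deriv js k ` cball 0 r)"
    by (intro compact_continuous_image smooth_continuous_on assms) auto
  then obtain B where B: "\<forall>y\<in>partial_deriv js k ` cball 0 r. norm y \<le> B"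
    using compact_imp_bounded bounded_iff by metis
  have "norm (partial_deriv js k x) \<le> max B 0" for x
  proof (cases "r < norm x")
    case False
    then have "norm (partial_deriv js k x) \<le> B"
      using B by (intro B[rule_format] imageI) simp
    then show ?thesis by simp
  qed (use 1[of x] in simp)
  then show "\<exists>B\<ge>0. \<forall>x. norm (partial_deriv js k x) \<le> B"
    by (meson max.cobounded2)
qed

section \<open>Integration over the torus\<close>

text \<open>The Jacobian |c|^n is 1. The cases c = 1 and c = -1 give invariance under translations
  and under the reflection sending x to a - x, which is the change of variables in a
  convolution.\<close>

lemma lebesgue_affine_pm1:
  fixes a :: "'a::euclidean_space"
  assumes c: "\<bar>c\<bar> = (1::real)"
  shows "(\<lambda>x. a + c *\<^sub>R x) \<in> lebesgue \<rightarrow>\<^sub>M lebesgue"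
    and "distr lebesgue lebesgue (\<lambda>x. a + c *\<^sub>R x) = lebesgue"
proof -
  have nz: "\<And>j. j \<in> (Basis::'a set) \<Longrightarrow> c \<noteq> 0" using c by auto
  have eq: "(\<lambda>x::'a. a + (\<Sum>j\<in>Basis. (c * (x \<bullet> j)) *\<^sub>R j)) = (\<lambda>x. a + c *\<^sub>R x)"
    by (simp add: scaleR_scaleR[symmetric] scaleR_sum_right[symmetric] euclidean_representation del: scaleR_scaleR)
  show "(\<lambda>x. a + c *\<^sub>R x) \<in> lebesgue \<rightarrow>\<^sub>M lebesgue"
    using lebesgue_affine_measurable[of "\<lambda>_. c" a, OF nz] by (simp add: eq)
  show "distr lebesgue lebesgue (\<lambda>x. a + c *\<^sub>R x) = lebesgue"
    using lebesgue_affine_euclidean[of "\<lambda>_. c" a, OF nz] c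
    by (simp add: eq density_1)
qed

lemma lebesgue_translate_measurable [measurable]: "(\<lambda>x::'a::euclidean_space. x + a) \<in> lebesgue \<rightarrow>\<^sub>M lebesgue"
  using lebesgue_affine_pm1(1)[of 1 a] by (simp add: add.commute)

lemma lebesgue_translate_minus_measurable [measurable]: "(\<lambda>x::'a::euclidean_space. x - a) \<in> lebesgue \<rightarrow>\<^sub>M lebesgue"
  using lebesgue_translate_measurable[of "-a"] by simp

lemma lebesgue_reflect_measurable [measurable]: "(\<lambda>x::'a::euclidean_space. a - x) \<in> lebesgue \<rightarrow>\<^sub>M lebesgue"
  using lebesgue_affine_pm1(1)[of "-1" a] by simp

lemma lebesgue_distr_translate: "distr lebesgue lebesgue (\<lambda>x::'a::euclidean_space. x + a) = lebesgue"
  using lebesgue_affine_pm1(2)[of 1 a] by (simp add: add.commute)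

lemma lebesgue_distr_reflect: "distr lebesgue lebesgue (\<lambda>x::'a::euclidean_space. a - x) = lebesgue"
  using lebesgue_affine_pm1(2)[of "-1" a] by simp

lemma nn_integral_lebesgue_translate:
  assumes "f \<in> borel_measurable lebesgue"
  shows "(\<integral>\<^sup>+x. f (x + a) \<partial>lebesgue) = (\<integral>\<^sup>+x. f (x::'a::euclidean_space) \<partial>lebesgue)"
  by (subst (2) lebesgue_distr_translate[of a, symmetric]) (simp add: nn_integral_distr assms)

lemma integral_lebesgue_reflect:
  fixes f :: "'a::euclidean_space \<Rightarrow> 'b::{banach, second_countable_topology}"
  assumes "f \<in> borel_measurable lebesgue"
  shows "(\<integral>x. f (a - x) \<partial>lebesgue) = (\<integral>x. f x \<partial>lebesgue)"
  by (subst (2) lebesgue_distr_reflect[of a, symmetric]) (simp add: integral_distr assms)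

lemma AE_lebesgue_translate:
  assumes "AE x in lebesgue. P x"
  shows "AE x in lebesgue. P ((x::'a::euclidean_space) + a)"
proof -
  have "AE x in distr lebesgue lebesgue (\<lambda>x. x + a). P x"
    unfolding lebesgue_distr_translate by (rule assms)
  then show ?thesis
    by (rule AE_distrD[OF lebesgue_translate_measurable])
qed

lemma continuous_borel_measurable_lebesgue:
  "continuous_on UNIV (f :: 'a::euclidean_space \<Rightarrow> 'b::topological_space) \<Longrightarrow> f \<in> borel_measurable lebesgue"
  by (simp add: borel_measurable_continuous_onI measurable_completion)

text \<open>The common home of periodic square integrable forms and of Taylor polynomials, which are
  not periodic: everything that gets mollified lies in this class.\<close>

definition locally_integrable :: "('a::euclidean_space \<Rightarrow> 'b::euclidean_space) \<Rightarrow> bool" where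
  "locally_integrable u \<longleftrightarrow> u \<in> borel_measurable lebesgue \<and>
     (\<forall>R. set_integrable lebesgue (cball 0 R) u)"

lemma locally_integrable_bounded:
  assumes "locally_integrable u" "bounded A" "A \<in> sets lebesgue"
  shows "set_integrable lebesgue A u"
proof -
  obtain R where "A \<subseteq> cball 0 R"
    using bounded_subset_ballD[OF assms(2), of 0] ball_subset_cball by (meson subset_trans)
  moreover have "set_integrable lebesgue (cball 0 R) u"
    using assms(1) unfolding locally_integrable_def by blast
  ultimately show ?thesis
    using set_integrable_subset[of lebesgue "cball 0 R" u A] assms(3) by blast
qed

lemma continuous_locally_integrable:
  fixes u :: "'a::euclidean_space \<Rightarrow> 'b::euclidean_space"
  assumes "continuous_on UNIV u"
  shows "locally_integrable u"
  unfolding locally_integrable_def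
proof (intro conjI allI continuous_borel_measurable_lebesgue assms)
  fix R :: real
  obtain a where "cball 0 R \<subseteq> cbox (- a) (a :: 'a)"
    using bounded_subset_cbox_symmetric[OF bounded_cball] by blast
  moreover have "u absolutely_integrable_on cbox (- a) a"
    by (intro absolutely_integrable_continuous continuous_on_subset[OF assms]) auto
  ultimately show "u absolutely_integrable_on cball 0 R"
    using set_integrable_subset by fastforce
qed

lemma locally_integrable_diff:
  "locally_integrable u \<Longrightarrow> locally_integrable v \<Longrightarrow> locally_integrable (\<lambda>x. u x - v x)"
  unfolding locally_integrable_def by (intro conjI allI borel_measurable_diff set_integral_diff(1)) blast+

lemma ennreal_indicator_sq: "ennreal (indicator A x * y) = ennreal y * indicator A x"
  by (auto simp: indicator_def)

locale torus_basis =
  fixes e :: "'n::finite \<Rightarrow> 'n euclid"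
  assumes inj_e: "inj e" and indep_e: "independent (range e)"
begin

section \<open>Coordinates with respect to the lattice basis\<close>

definition lincomb :: "'n euclid \<Rightarrow> 'n euclid" where
  "lincomb t = (\<Sum>i\<in>UNIV. (t $ i) *\<^sub>R e i)"

lemma linear_lincomb: "linear lincomb"
  by (intro linearI) (simp_all add: lincomb_def algebra_simps sum.distrib scaleR_sum_right)

lemma inj_lincomb: "inj lincomb"
proof -
  have "t = 0" if "lincomb t = 0" for t
  proof -
    have "(\<Sum>v\<in>range e. (t $ inv e v) *\<^sub>R v) = 0"
      using that by (simp add: lincomb_def sum.reindex[OF inj_e] inj_e)
    then have "\<forall>v\<in>range e. t $ inv e v = 0"
      using indep_e independentD[of "range e" "range e" "\<lambda>v. t $ inv e v"] by auto
    then show "t = 0"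
      by (simp add: vec_eq_iff inj_e)
  qed
  then show ?thesis
    using linear_injective_0[OF linear_lincomb] by blast
qed

definition coord :: "'n euclid \<Rightarrow> 'n euclid" where
  "coord = inv lincomb"

lemma coord_lincomb [simp]: "coord (lincomb t) = t"
  by (simp add: coord_def inj_lincomb)

lemma lincomb_coord [simp]: "lincomb (coord x) = x"
  using linear_injective_imp_surjective[OF linear_lincomb inj_lincomb]
  by (simp add: coord_def surj_f_inv_f)

lemma linear_coord: "linear coord"
  by (rule linearI)
     (metis coord_lincomb lincomb_coord linear_add[OF linear_lincomb],
      metis coord_lincomb lincomb_coord linear_cmul[OF linear_lincomb])

lemma coord_e [simp]: "coord (e i) = axis i 1"
proof -
  have "(\<Sum>j\<in>UNIV. (axis i 1 $ j) *\<^sub>R e j) = (\<Sum>j\<in>UNIV. if j = i then e j else 0)"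
    by (intro sum.cong) (auto simp: axis_def)
  then have "lincomb (axis i 1) = e i"
    by (simp add: lincomb_def)
  then show ?thesis
    by (metis coord_lincomb)
qed

lemma continuous_on_coord [continuous_intros]:
  "continuous_on A f \<Longrightarrow> continuous_on A (\<lambda>x. coord (f x))"
  by (rule bounded_linear.continuous_on[OF bounded_linear_of_euclidean[OF linear_coord]])

lemma fund_cell_eq: "fund_cell e = {x. \<forall>i. 0 \<le> coord x $ i \<and> coord x $ i < 1}"
proof -
  have "fund_cell e = lincomb ` {t. \<forall>i. 0 \<le> t $ i \<and> t $ i < 1}"
    unfolding fund_cell_def lincomb_def
  proof (intro set_eqI iffI; clarsimp)
    fix t :: "'n \<Rightarrow> real" assume "\<forall>i. 0 \<le> t i \<and> t i < 1"
    then show "(\<Sum>i\<in>UNIV. t i *\<^sub>R e i) \<in> (\<lambda>t. \<Sum>i\<in>UNIV. t $ i *\<^sub>R e i) ` {t. \<forall>i. 0 \<le> t $ i \<and> t $ i < 1}"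
      by (intro image_eqI[of _ _ "\<chi> i. t i"]) auto
  qed auto
  also have "\<dots> = {x. \<forall>i. 0 \<le> coord x $ i \<and> coord x $ i < 1}"
    by (auto intro!: image_eqI[of _ _ "coord _"])
  finally show ?thesis .
qed

lemma lattice_eq: "lattice e = {x. \<forall>i. coord x $ i \<in> \<int>}"
proof (intro set_eqI iffI)
  fix x assume "x \<in> lattice e"
  then obtain m :: "'n \<Rightarrow> int" where "x = (\<Sum>i\<in>UNIV. of_int (m i) *\<^sub>R e i)"
    unfolding lattice_def by auto
  then have "x = lincomb (\<chi> i. of_int (m i))" by (simp add: lincomb_def)
  then show "x \<in> {x. \<forall>i. coord x $ i \<in> \<int>}" by simp
next
  fix x assume "x \<in> {x. \<forall>i. coord x $ i \<in> \<int>}"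
  then have "\<forall>i. \<exists>m::int. coord x $ i = of_int m"
    by (auto elim!: Ints_cases)
  then obtain m :: "'n \<Rightarrow> int" where "\<forall>i. coord x $ i = of_int (m i)"
    by metis
  then have "x = (\<Sum>i\<in>UNIV. of_int (m i) *\<^sub>R e i)"
    using lincomb_coord[of x] by (simp add: lincomb_def)
  then show "x \<in> lattice e"
    unfolding lattice_def by blast
qed

lemma lattice_uminus: "l \<in> lattice e \<Longrightarrow> - l \<in> lattice e"
  by (auto simp: lattice_eq linear_neg[OF linear_coord])

lemma lattice_int: "of_int m *\<^sub>R e i \<in> lattice e"
  by (simp add: lattice_eq linear_cmul[OF linear_coord] axis_def)

lemma countable_lattice: "countable (lattice e)"
proof -
  have "lattice e = (\<lambda>m. \<Sum>i\<in>UNIV. of_int (m i) *\<^sub>R e i) ` (UNIV :: ('n \<Rightarrow> int) set)"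
    by (auto simp: lattice_def)
  moreover have "countable (UNIV :: ('n \<Rightarrow> int) set)"
    using countable_PiE[of "UNIV :: 'n set" "\<lambda>_. UNIV :: int set"] by (simp add: PiE_UNIV_domain)
  ultimately show ?thesis by simp
qed

lemma borel_fund_cell: "fund_cell e \<in> sets borel"
proof -
  have "coord \<in> borel_measurable borel"
    by (intro borel_measurable_continuous_onI continuous_intros)
  then have "(\<lambda>x. coord x $ i) \<in> borel_measurable borel" for i
    by (rule measurable_compose) (intro borel_measurable_continuous_onI continuous_intros)
  note [measurable] = this
  show ?thesis
    unfolding fund_cell_eq by measurable
qed

lemma sets_fund_cell [measurable]: "fund_cell e \<in> sets lebesgue"
  using borel_fund_cell by simp

lemma coord_measurable [measurable]: "(\<lambda>x. coord x $ i) \<in> borel_measurable lebesgue"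
  by (intro continuous_borel_measurable_lebesgue continuous_intros)

lemma bounded_fund_cell: "bounded (fund_cell e)"
proof -
  have "fund_cell e \<subseteq> lincomb ` cbox 0 1"
  proof
    fix x assume "x \<in> fund_cell e"
    then have "coord x \<in> cbox 0 1"
      by (auto simp: fund_cell_eq mem_box_cart less_imp_le)
    then show "x \<in> lincomb ` cbox 0 1"
      by (rule image_eqI[rotated]) simp
  qed
  moreover have "compact (lincomb ` cbox 0 1)"
    by (intro compact_continuous_image linear_continuous_on compact_cbox)
       (simp add: linear_lincomb linear_conv_bounded_linear[symmetric])
  ultimately show ?thesis
    using bounded_subset compact_imp_bounded by blast
qed

lemma finite_emeasure_fund_cell: "emeasure lebesgue (fund_cell e) < \<infinity>"
  using emeasure_bounded_finite[OF bounded_fund_cell] borel_fund_cell by simp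

lemma periodic_translate: "periodic e f \<Longrightarrow> periodic e (\<lambda>x. f (x + a))"
  unfolding periodic_def by (metis (no_types, lifting) add.assoc add.commute)

text \<open>In the coordinate along \<open>e i\<close> the shifted cell is [t, 1 + t), the union of
  [t, 1) and [1, 1 + t), the latter being [0, t) moved by one period. The second claim makes the two
  pieces disjoint, so that their indicators add up.\<close>

lemma fund_cell_shift_iff:
  assumes "0 \<le> t" "t < 1"
  shows "x - t *\<^sub>R e i \<in> fund_cell e \<longleftrightarrow> x \<in> fund_cell e \<and> t \<le> coord x $ i
    \<or> x - e i \<in> fund_cell e \<and> coord (x - e i) $ i < t"
    and "\<not> (x \<in> fund_cell e \<and> x - e i \<in> fund_cell e)"
proof -
  have c: "coord (x - s *\<^sub>R e i) $ j = coord x $ j - (if j = i then s else 0)" for s j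
    by (simp add: linear_diff[OF linear_coord] linear_cmul[OF linear_coord] axis_def)
  note c1 = c[of 1, simplified]
  have split: "x - s *\<^sub>R e i \<in> fund_cell e \<longleftrightarrow>
      (\<forall>j. j \<noteq> i \<longrightarrow> 0 \<le> coord x $ j \<and> coord x $ j < 1) \<and> s \<le> coord x $ i \<and> coord x $ i < 1 + s" for s
    unfolding fund_cell_eq mem_Collect_eq c by (auto split: if_splits)
  note split' = split[of 0, simplified] split[of 1, simplified]
  show "x - t *\<^sub>R e i \<in> fund_cell e \<longleftrightarrow> x \<in> fund_cell e \<and> t \<le> coord x $ i
    \<or> x - e i \<in> fund_cell e \<and> coord (x - e i) $ i < t"
    unfolding split split' c1 using assms by auto
  show "\<not> (x \<in> fund_cell e \<and> x - e i \<in> fund_cell e)"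
    unfolding split' by auto
qed

text \<open>The fundamental cell shifted by a fraction of \<open>e i\<close> is reassembled from two pieces.\<close>

lemma torus_translate_step:
  assumes per: "periodic e f" and t: "0 \<le> t" "t < 1"
    and f[measurable]: "f \<in> borel_measurable lebesgue"
  shows "(\<integral>\<^sup>+x. (f (x + t *\<^sub>R e i) :: ennreal) * indicator (fund_cell e) x \<partial>lebesgue)
        = (\<integral>\<^sup>+x. f x * indicator (fund_cell e) x \<partial>lebesgue)"
proof -
  define A where "A = {x \<in> fund_cell e. t \<le> coord x $ i}"
  define B where "B = {x \<in> fund_cell e. coord x $ i < t}"
  have [measurable]: "A \<in> sets lebesgue" "B \<in> sets lebesgue"
    unfolding A_def B_def by measurable
  have ind: "indicator (fund_cell e) (x - t *\<^sub>R e i) = indicator A x + (indicator B (x - e i) :: ennreal)" for x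
    using fund_cell_shift_iff[OF t, of x i] by (auto simp: A_def B_def indicator_def)
  have fe: "f (x - e i) = f x" for x
    using per lattice_uminus[OF lattice_int[of 1 i]] unfolding periodic_def
    by (metis diff_conv_add_uminus of_int_1 scaleR_one)
  have "(\<integral>\<^sup>+x. f (x + t *\<^sub>R e i) * indicator (fund_cell e) x \<partial>lebesgue)
      = (\<integral>\<^sup>+x. f x * indicator (fund_cell e) (x - t *\<^sub>R e i) \<partial>lebesgue)"
    using nn_integral_lebesgue_translate[of "\<lambda>x. f x * indicator (fund_cell e) (x - t *\<^sub>R e i)" "t *\<^sub>R e i"]
    by simp
  also have "\<dots> = (\<integral>\<^sup>+x. f x * indicator A x \<partial>lebesgue) + (\<integral>\<^sup>+x. f (x - e i) * indicator B (x - e i) \<partial>lebesgue)"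
    unfolding ind fe by (subst nn_integral_add[symmetric]) (auto simp: algebra_simps)
  also have "(\<integral>\<^sup>+x. f (x - e i) * indicator B (x - e i) \<partial>lebesgue) = (\<integral>\<^sup>+x. f x * indicator B x \<partial>lebesgue)"
    using nn_integral_lebesgue_translate[of "\<lambda>x. f x * indicator B x" "- e i"] by simp
  also have "(\<integral>\<^sup>+x. f x * indicator A x \<partial>lebesgue) + \<dots> = (\<integral>\<^sup>+x. f x * indicator (fund_cell e) x \<partial>lebesgue)"
    by (subst nn_integral_add[symmetric]) (auto simp: A_def B_def indicator_def intro!: nn_integral_cong)
  finally show ?thesis .
qed

text \<open>The translation is performed one basis vector at a time. The integer part of each
  coordinate of \<open>a\<close> is absorbed by periodicity; the fractional part lies in [0, 1), as
  \<open>torus_translate_step\<close> requires.\<close>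

lemma nn_integral_torus_translate:
  assumes per: "periodic e f" and f: "(f :: _ \<Rightarrow> ennreal) \<in> borel_measurable lebesgue"
  shows "(\<integral>\<^sup>+x\<in>fund_cell e. f (x + a) \<partial>lebesgue) = (\<integral>\<^sup>+x\<in>fund_cell e. f x \<partial>lebesgue)"
proof -
  define S where "S J = (\<Sum>i\<in>J. (coord a $ i) *\<^sub>R e i)" for J
  have "(\<integral>\<^sup>+x. f (x + S J) * indicator (fund_cell e) x \<partial>lebesgue)
      = (\<integral>\<^sup>+x. f x * indicator (fund_cell e) x \<partial>lebesgue)" if "finite J" for J
    using that
  proof (induction J)
    case empty
    then show ?case by (simp add: S_def)
  next
    case (insert i J)
    define c where "c = coord a $ i"
    have "f (x + S (insert i J)) = f (x + frac c *\<^sub>R e i + S J)" for x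
    proof -
      have "x + S (insert i J) = (x + frac c *\<^sub>R e i + S J) + of_int \<lfloor>c\<rfloor> *\<^sub>R e i"
        using insert by (simp add: S_def c_def[symmetric] frac_def algebra_simps)
      then show ?thesis
        using per lattice_int unfolding periodic_def by metis
    qed
    then have "(\<integral>\<^sup>+x. f (x + S (insert i J)) * indicator (fund_cell e) x \<partial>lebesgue)
      = (\<integral>\<^sup>+x. f (x + frac c *\<^sub>R e i + S J) * indicator (fund_cell e) x \<partial>lebesgue)"
      by simp
    also have "\<dots> = (\<integral>\<^sup>+x. f (x + S J) * indicator (fund_cell e) x \<partial>lebesgue)"
      by (rule torus_translate_step[of "\<lambda>x. f (x + S J)"])
         (use f in \<open>auto intro!: periodic_translate per measurable_compose[OF lebesgue_translate_measurable] frac_lt_1\<close>)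
    finally show ?case
      using insert by simp
  qed
  from this[of UNIV] show ?thesis
    using lincomb_coord[of a] by (simp add: S_def lincomb_def)
qed

text \<open>Both claims reduce to the nonnegative case, applied to the absolute value for
  integrability and to the positive and negative parts for the value.\<close>

lemma torus_integral_translate:
  fixes f :: "'n euclid \<Rightarrow> real"
  assumes per: "periodic e f" and f[measurable]: "f \<in> borel_measurable lebesgue"
  shows "set_integrable lebesgue (fund_cell e) f \<Longrightarrow> set_integrable lebesgue (fund_cell e) (\<lambda>x. f (x + a))"
    and "torus_integral e (\<lambda>x. f (x + a)) = torus_integral e f"
proof -
  have per': "periodic e (\<lambda>x. g (f x))" for g :: "real \<Rightarrow> ennreal"
    using per by (auto simp: periodic_def)
  have eq: "(\<integral>\<^sup>+x. g (f (x + a)) * indicator (fund_cell e) x \<partial>lebesgue)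
      = (\<integral>\<^sup>+x. g (f x) * indicator (fund_cell e) x \<partial>lebesgue)"
    if [measurable]: "g \<in> borel_measurable borel" for g :: "real \<Rightarrow> ennreal"
    by (rule nn_integral_torus_translate[OF per']) simp
  have ind: "ennreal (indicator A x * y) = ennreal y * indicator A x"
    "ennreal (- (indicator A x * y)) = ennreal (- y) * indicator A x"
    "ennreal \<bar>indicator A x * y\<bar> = ennreal \<bar>y\<bar> * indicator A x"
    for A and x :: "'n euclid" and y :: real
    by (auto simp: indicator_def)
  have [measurable]: "(\<lambda>x. f (x + a)) \<in> borel_measurable lebesgue"
    by simp
  show int: "set_integrable lebesgue (fund_cell e) (\<lambda>x. f (x + a))"
    if "set_integrable lebesgue (fund_cell e) f"
    using that eq[of "\<lambda>y. ennreal \<bar>y\<bar>"]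
    unfolding set_integrable_def integrable_iff_bounded by (simp add: ind)
  have int': "set_integrable lebesgue (fund_cell e) f"
    if "set_integrable lebesgue (fund_cell e) (\<lambda>x. f (x + a))"
    using that eq[of "\<lambda>y. ennreal \<bar>y\<bar>"]
    unfolding set_integrable_def integrable_iff_bounded by (simp add: ind)
  show "torus_integral e (\<lambda>x. f (x + a)) = torus_integral e f"
  proof (cases "set_integrable lebesgue (fund_cell e) f")
    case True
    with int have 2: "set_integrable lebesgue (fund_cell e) (\<lambda>x. f (x + a))" by simp
    show ?thesis
      using True 2 eq[of "\<lambda>y. ennreal y"] eq[of "\<lambda>y. ennreal (- y)"]
      unfolding torus_integral_def set_lebesgue_integral_def set_integrable_def
      by (simp add: real_lebesgue_integral_def ind)
  next
    \<comment> \<open>Integrability passes in both directions, so both integrals take the default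
      value 0.\<close>
    case False
    with int' have "\<not> set_integrable lebesgue (fund_cell e) (\<lambda>x. f (x + a))" by blast
    with False show ?thesis
      unfolding torus_integral_def set_lebesgue_integral_def set_integrable_def
      by (simp add: not_integrable_integral_eq)
  qed
qed

text \<open>By compactness finitely many translates of the interior of the cell cover the ball, and
  a periodic function has the same integral over every translate of the cell. Overlaps are harmless
  for an upper bound.\<close>

lemma nn_integral_periodic_cball_finite:
  assumes per: "periodic e f" and f[measurable]: "(f :: _ \<Rightarrow> ennreal) \<in> borel_measurable lebesgue"
    and fin: "(\<integral>\<^sup>+x\<in>fund_cell e. f x \<partial>lebesgue) < \<infinity>"
  shows "(\<integral>\<^sup>+x\<in>cball 0 R. f x \<partial>lebesgue) < \<infinity>"
proof -
  define U where "U = {x. \<forall>i. 0 < coord x $ i \<and> coord x $ i < 1}"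
  have op: "open U"
    unfolding U_def Collect_all_eq
    by (intro open_INT ballI finite open_Collect_conj open_Collect_less continuous_intros) 
  have cU: "lincomb (\<chi> i. 1/2) \<in> U" by (simp add: U_def)
  have sub: "U \<subseteq> fund_cell e"
    by (auto simp: U_def fund_cell_eq intro: less_imp_le)
  have "cball 0 R \<subseteq> (\<Union>a. (+) a ` U)"
  proof
    fix x show "x \<in> (\<Union>a. (+) a ` U)"
      by (rule UN_I[of "x - lincomb (\<chi> i. 1/2)"], simp, rule image_eqI[OF _ cU], simp)
  qed
  then obtain D where D: "finite D" "cball 0 R \<subseteq> (\<Union>a\<in>D. (+) a ` U)"
    using compactE_image[OF compact_cball, of UNIV "\<lambda>a. (+) a ` U"] open_translation[OF op]
    by (metis (no_types, lifting) image_cong)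
  have "(\<integral>\<^sup>+x\<in>cball 0 R. f x \<partial>lebesgue) \<le> (\<integral>\<^sup>+x. (\<Sum>a\<in>D. f x * indicator (fund_cell e) (x - a)) \<partial>lebesgue)"
  proof (intro nn_integral_mono)
    fix x
    show "f x * indicator (cball 0 R) x \<le> (\<Sum>a\<in>D. f x * indicator (fund_cell e) (x - a))"
    proof (cases "x \<in> cball 0 R")
      case True
      with D obtain a where a: "a \<in> D" "x - a \<in> U" by fastforce
      then have "f x = f x * indicator (fund_cell e) (x - a)" using sub by auto
      also have "\<dots> \<le> (\<Sum>a\<in>D. f x * indicator (fund_cell e) (x - a))"
        by (rule member_le_sum[OF a(1)]) (use D in auto)
      finally show ?thesis using True by simp
    qed simp
  qed
  also have "\<dots> = (\<Sum>a\<in>D. (\<integral>\<^sup>+x. f x * indicator (fund_cell e) (x - a) \<partial>lebesgue))"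
  proof (rule nn_integral_sum)
    fix a
    show "(\<lambda>x. f x * indicator (fund_cell e) (x - a)) \<in> borel_measurable lebesgue" by measurable
  qed
  also have "\<dots> = (\<Sum>a\<in>D. (\<integral>\<^sup>+x\<in>fund_cell e. f x \<partial>lebesgue))"
  proof (rule sum.cong[OF refl])
    fix a
    have "(\<integral>\<^sup>+x. f x * indicator (fund_cell e) (x - a) \<partial>lebesgue) = (\<integral>\<^sup>+x. f (x + a) * indicator (fund_cell e) x \<partial>lebesgue)"
      using nn_integral_lebesgue_translate[of "\<lambda>x. f x * indicator (fund_cell e) (x - a)" a] by simp
    also have "\<dots> = (\<integral>\<^sup>+x\<in>fund_cell e. f x \<partial>lebesgue)"
      by (rule nn_integral_torus_translate[OF per f])
    finally show "(\<integral>\<^sup>+x. f x * indicator (fund_cell e) (x - a) \<partial>lebesgue) = (\<integral>\<^sup>+x\<in>fund_cell e. f x \<partial>lebesgue)" .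
  qed
  also have "\<dots> < \<infinity>"
    using fin D by (simp add: ennreal_mult_less_top of_nat_less_top)
  finally show ?thesis .
qed

text \<open>The squared norm as an extended nonnegative integral, for any Euclidean range: estimates
  and Tonelli then carry no integrability side conditions, and finiteness becomes a conclusion.
  \<open>L2sq_eq_norm\<close> leads back to \<open>L2_norm\<close>.\<close>

definition L2sq :: "('n euclid \<Rightarrow> 'b::euclidean_space) \<Rightarrow> ennreal" where
  "L2sq u = (\<integral>\<^sup>+x\<in>fund_cell e. ennreal ((norm (u x))\<^sup>2) \<partial>lebesgue)"

lemma L2_forms_iff: "u \<in> L2_forms e \<longleftrightarrow> periodic e u \<and> u \<in> borel_measurable lebesgue \<and> L2sq u < \<infinity>"
proof (cases "u \<in> borel_measurable lebesgue")
  case True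
  then have [measurable]: "u \<in> borel_measurable lebesgue" .
  show ?thesis
    unfolding L2_forms_def L2sq_def set_integrable_def integrable_iff_bounded
    by (simp add: abs_mult ennreal_indicator_sq)
qed (auto simp: L2_forms_def)

lemma L2sq_eq_norm: "u \<in> L2_forms e \<Longrightarrow> L2sq u = ennreal ((L2_norm e u)\<^sup>2)"
  unfolding L2_forms_def L2sq_def L2_norm_def torus_integral_def set_integrable_def set_lebesgue_integral_def
  by (subst real_sqrt_pow2) (auto intro!: integral_nonneg_AE simp: nn_integral_eq_integral[symmetric] ennreal_indicator_sq)

lemma L2_norm_nonneg: "0 \<le> L2_norm e u"
  unfolding L2_norm_def torus_integral_def set_lebesgue_integral_def
  by (auto intro!: integral_nonneg_AE)

lemma L2sq_mono_AE:
  assumes "AE x in lebesgue. norm (u x) \<le> norm (v x)"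
  shows "L2sq u \<le> L2sq v"
  unfolding L2sq_def
  by (intro nn_integral_mono_AE) (use assms in \<open>auto elim!: eventually_mono intro!: mult_right_mono ennreal_leI power_mono\<close>)

lemma L2sq_cong_AE: "AE x in lebesgue. u x = v x \<Longrightarrow> L2sq u = L2sq v"
  by (intro antisym L2sq_mono_AE) (auto elim!: eventually_mono)

lemma L2sq_translate:
  assumes "periodic e u" and [measurable]: "u \<in> borel_measurable lebesgue"
  shows "L2sq (\<lambda>x. u (x + a)) = L2sq u"
  unfolding L2sq_def
  by (rule nn_integral_torus_translate[of "\<lambda>x. ennreal ((norm (u x))\<^sup>2)"])
     (use assms(1) in \<open>auto simp: periodic_def\<close>)

text \<open>All estimates are kept in squares, with |a + b|^2 \<le> 2 |a|^2 + 2 |b|^2 in place of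
  Minkowski's inequality. This is the source of most factors 2 in the constants below.\<close>

lemma L2sq_add_le:
  assumes [measurable]: "u \<in> borel_measurable lebesgue" "v \<in> borel_measurable lebesgue"
  shows "L2sq (\<lambda>x. u x + v x) \<le> 2 * L2sq u + 2 * L2sq v"
proof -
  have "(norm (u x + v x))\<^sup>2 \<le> 2 * (norm (u x))\<^sup>2 + 2 * (norm (v x))\<^sup>2" for x
  proof -
    have "(norm (u x + v x))\<^sup>2 \<le> (norm (u x) + norm (v x))\<^sup>2"
      by (intro power_mono norm_triangle_ineq) simp
    also have "\<dots> \<le> 2 * (norm (u x))\<^sup>2 + 2 * (norm (v x))\<^sup>2"
      using sum_squares_bound[of "norm (u x)" "norm (v x)"] by (simp add: power2_sum)
    finally show ?thesis .
  qed
  note bound = this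
  have "ennreal ((norm (u x + v x))\<^sup>2) \<le> 2 * ennreal ((norm (u x))\<^sup>2) + 2 * ennreal ((norm (v x))\<^sup>2)" for x
  proof -
    have "ennreal ((norm (u x + v x))\<^sup>2) \<le> ennreal (2 * (norm (u x))\<^sup>2 + 2 * (norm (v x))\<^sup>2)"
      by (rule ennreal_leI[OF bound])
    then show ?thesis by (simp add: ennreal_plus ennreal_mult')
  qed
  then have "L2sq (\<lambda>x. u x + v x) \<le>
     (\<integral>\<^sup>+x. 2 * (ennreal ((norm (u x))\<^sup>2) * indicator (fund_cell e) x) + 2 * (ennreal ((norm (v x))\<^sup>2) * indicator (fund_cell e) x) \<partial>lebesgue)"
    unfolding L2sq_def by (intro nn_integral_mono) (auto simp: indicator_def)
  also have "\<dots> = 2 * L2sq u + 2 * L2sq v"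
    unfolding L2sq_def by (subst nn_integral_add) (auto simp: nn_integral_cmult)
  finally show ?thesis .
qed

lemma L2sq_scaleR:
  assumes [measurable]: "u \<in> borel_measurable lebesgue"
  shows "L2sq (\<lambda>x. c *\<^sub>R u x) = ennreal (c\<^sup>2) * L2sq u"
  unfolding L2sq_def
  by (subst nn_integral_cmult[symmetric]) (auto simp: power_mult_distrib ennreal_mult ac_simps)

lemma L2_forms_lincomb:
  assumes "u \<in> L2_forms e" "v \<in> L2_forms e"
  shows "(\<lambda>x. a *\<^sub>R u x + b *\<^sub>R v x) \<in> L2_forms e"
proof -
  have [measurable]: "u \<in> borel_measurable lebesgue" "v \<in> borel_measurable lebesgue"
    using assms by (auto simp: L2_forms_iff)
  have "L2sq (\<lambda>x. a *\<^sub>R u x + b *\<^sub>R v x) \<le> 2 * L2sq (\<lambda>x. a *\<^sub>R u x) + 2 * L2sq (\<lambda>x. b *\<^sub>R v x)"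
    by (intro L2sq_add_le) auto
  also have "\<dots> < \<infinity>"
    using assms by (auto simp: L2_forms_iff L2sq_scaleR ennreal_mult_less_top)
  finally show ?thesis
    using assms by (auto simp: L2_forms_iff periodic_def)
qed

lemma L2_forms_diff: "u \<in> L2_forms e \<Longrightarrow> v \<in> L2_forms e \<Longrightarrow> (\<lambda>x. u x - v x) \<in> L2_forms e"
  using L2_forms_lincomb[of u v 1 "-1"] by simp

lemma L2_forms_zero: "(\<lambda>x. 0) \<in> L2_forms e"
  by (simp add: L2_forms_iff periodic_def L2sq_def)

lemma L2_forms_sum:
  assumes "\<And>i. i \<in> A \<Longrightarrow> u i \<in> L2_forms e"
  shows "(\<lambda>x. \<Sum>i\<in>A. u i x) \<in> L2_forms e"
  using assms
proof (induction A rule: infinite_finite_induct)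
  case (insert i A)
  then show ?case
    using L2_forms_lincomb[of "u i" "\<lambda>x. \<Sum>i\<in>A. u i x" 1 1] by simp
qed (simp_all add: L2_forms_zero)

lemma continuous_periodic_L2:
  assumes "periodic e u" "continuous_on UNIV u"
  shows "u \<in> L2_forms e"
proof -
  have "locally_integrable (\<lambda>x. (norm (u x))\<^sup>2)"
    by (intro continuous_locally_integrable continuous_intros assms)
  then have "set_integrable lebesgue (fund_cell e) (\<lambda>x. (norm (u x))\<^sup>2)"
    by (intro locally_integrable_bounded bounded_fund_cell sets_fund_cell)
  then show ?thesis
    using assms by (auto simp: L2_forms_def continuous_borel_measurable_lebesgue)
qed

lemma L2_forms_square_cball:
  assumes "u \<in> L2_forms e"
  shows "(\<integral>\<^sup>+x\<in>cball 0 R. ennreal ((norm (u x))\<^sup>2) \<partial>lebesgue) < \<infinity>"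
proof (rule nn_integral_periodic_cball_finite)
  have [measurable]: "u \<in> borel_measurable lebesgue" using assms by (auto simp: L2_forms_iff)
  show "(\<lambda>x. ennreal ((norm (u x))\<^sup>2)) \<in> borel_measurable lebesgue" by measurable
  show "periodic e (\<lambda>x. ennreal ((norm (u x))\<^sup>2))" using assms by (auto simp: L2_forms_iff periodic_def)
  show "(\<integral>\<^sup>+x\<in>fund_cell e. ennreal ((norm (u x))\<^sup>2) \<partial>lebesgue) < \<infinity>"
    using assms by (auto simp: L2_forms_iff L2sq_def)
qed

text \<open>A ball has finite measure, so |u| \<le> 1 + |u|^2 reduces the claim to the integral of
  |u|^2 over a ball, which is finite by periodicity.\<close>

lemma L2_forms_locally_integrable:
  assumes "u \<in> L2_forms e"
  shows "locally_integrable u"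
  unfolding locally_integrable_def
proof (intro conjI allI)
  show [measurable]: "u \<in> borel_measurable lebesgue" using assms by (auto simp: L2_forms_iff)
  fix R :: real
  have [measurable]: "cball 0 R \<in> sets (lebesgue :: 'n euclid measure)" by simp
  have "set_integrable lebesgue (cball 0 R) (\<lambda>x. 1 + (norm (u x))\<^sup>2)"
  proof (intro set_integral_add)
    show "set_integrable lebesgue (cball 0 R) (\<lambda>x. 1 :: real)"
      using continuous_locally_integrable[of "\<lambda>x :: 'n euclid. 1 :: real"] by (simp add: locally_integrable_def)
    show "set_integrable lebesgue (cball 0 R) (\<lambda>x. (norm (u x))\<^sup>2)"
      using L2_forms_square_cball[OF assms, of R]
      unfolding set_integrable_def integrable_iff_bounded by (simp add: abs_mult ennreal_indicator_sq)
  qed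
  then show "set_integrable lebesgue (cball 0 R) u"
    unfolding set_integrable_def
  proof (rule Bochner_Integration.integrable_bound)
    have "norm (u x) \<le> 1 + (norm (u x))\<^sup>2" for x
      using sum_squares_bound[of "norm (u x)" 1] norm_ge_zero[of "u x"] unfolding power_one mult_1_right by linarith
    then show "AE x in lebesgue. norm (indicator (cball 0 R) x *\<^sub>R u x)
        \<le> norm (indicator (cball 0 R) x *\<^sub>R (1 + (norm (u x))\<^sup>2))"
      by (auto simp: indicator_def)
  qed auto
qed

end

section \<open>Mollification\<close>

declare partial_deriv.simps(2) [simp del]

text \<open>The point x sits in the kernel, so that differentiation in x falls on the smooth
  \<open>k\<close> and never on \<open>u\<close>. The form with x inside \<open>u\<close>, as in
  \<open>mollify\<close>, is recovered by \<open>conv_eq_reflected\<close>; it is the one suited to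
  periodicity.\<close>

definition conv :: "('n::finite euclid \<Rightarrow> real) \<Rightarrow> ('n euclid \<Rightarrow> 'b::euclidean_space) \<Rightarrow> 'n euclid \<Rightarrow> 'b" where
  "conv k u x = (\<integral>y. k (x - y) *\<^sub>R u y \<partial>lebesgue)"

lemma bound_integrable_conv:
  fixes u :: "'n::finite euclid \<Rightarrow> 'b::euclidean_space"
  assumes k: "continuous_on UNIV k" "\<And>y. norm (k y) \<le> B" "\<And>y. r < norm y \<Longrightarrow> k y = 0"
    and u: "locally_integrable u"
  shows "integrable lebesgue (\<lambda>y. k (x - y) *\<^sub>R u y)"
    and "norm (conv k u x) \<le> B * (LINT y:cball x r|lebesgue. norm (u y))"
proof -
  have B: "0 \<le> B" using k(2)[of 0] norm_ge_zero order_trans by blast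
  have [measurable]: "u \<in> borel_measurable lebesgue" using u by (simp add: locally_integrable_def)
  have [measurable]: "(\<lambda>y. k (x - y)) \<in> borel_measurable lebesgue"
    by (intro continuous_borel_measurable_lebesgue continuous_on_compose2[OF k(1)] continuous_intros) auto
  have int: "set_integrable lebesgue (cball x r) u"
    by (intro locally_integrable_bounded u) auto
  have dom: "norm (k (x - y) *\<^sub>R u y) \<le> norm (B *\<^sub>R (indicator (cball x r) y *\<^sub>R u y))" for y
    using k(2)[of "x - y"] k(3)[of "x - y"] B
    by (cases "r < norm (x - y)") (auto simp: indicator_def dist_norm intro!: mult_right_mono)
  have iB: "integrable lebesgue (\<lambda>y. B *\<^sub>R (indicator (cball x r) y *\<^sub>R u y))"
    using int unfolding set_integrable_def by (rule integrable_scaleR_right)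
  show 1: "integrable lebesgue (\<lambda>y. k (x - y) *\<^sub>R u y)"
    by (rule Bochner_Integration.integrable_bound[OF iB]) (use dom in auto)
  have "norm (conv k u x) \<le> (\<integral>y. norm (k (x - y) *\<^sub>R u y) \<partial>lebesgue)"
    unfolding conv_def by (rule integral_norm_bound)
  also have "\<dots> \<le> (\<integral>y. norm (B *\<^sub>R (indicator (cball x r) y *\<^sub>R u y)) \<partial>lebesgue)"
    by (intro integral_mono integrable_norm 1 iB dom)
  also have "\<dots> = B * (LINT y:cball x r|lebesgue. norm (u y))"
    using B unfolding set_lebesgue_integral_def by (simp add: mult.assoc)
  finally show "norm (conv k u x) \<le> B * (LINT y:cball x r|lebesgue. norm (u y))" .
qed

lemma has_derivative_of_quadratic_bound:
  fixes f :: "'a::real_normed_vector \<Rightarrow> 'b::real_normed_vector"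
  assumes "bounded_linear D" and "\<And>v. norm v \<le> 1 \<Longrightarrow> norm (f (x + v) - f x - D v) \<le> C * (norm v)\<^sup>2"
  shows "(f has_derivative D) (at x)"
proof (rule has_derivativeI_sandwich[of 1])
  show "0 < (1::real)" "bounded_linear D" using assms by auto
  show "((\<lambda>y. C * norm (y - x)) \<longlongrightarrow> 0) (at x)"
    by (auto intro!: tendsto_eq_intros)
  fix y assume "y \<noteq> x" "dist y x < 1"
  then show "norm (f y - f x - D (y - x)) / norm (y - x) \<le> C * norm (y - x)"
    using assms(2)[of "y - x"] by (simp add: dist_norm divide_simps power2_eq_square mult.assoc)
qed

locale kernel =
  fixes k :: "'n::finite euclid \<Rightarrow> real" and r :: real
  assumes smooth_k: "smooth k" and supp_k: "\<And>y. r < norm y \<Longrightarrow> k y = 0"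
begin

lemma bounded_partials: "\<exists>B\<ge>0. \<forall>x. norm (partial_deriv js k x) \<le> B"
  using smooth_compact_support_bounded(2)[OF smooth_k, of r js] supp_k by blast

lemma supp_partials: "r < norm x \<Longrightarrow> partial_deriv js k x = 0"
  using smooth_compact_support_bounded(1)[OF smooth_k, of r x js] supp_k by blast

lemma kernel_partial: "kernel (partial_deriv js k) r"
  by unfold_locales (auto simp: smooth_partial_deriv smooth_k supp_partials)

lemma integrable_conv: 
  assumes "locally_integrable u"
  shows "integrable lebesgue (\<lambda>y. k (x - y) *\<^sub>R u y)"
proof -
  obtain B where "\<forall>x. norm (k x) \<le> B" using bounded_partials[of "[]"] by auto
  then show ?thesis
    using bound_integrable_conv(1)[OF smooth_continuous[OF smooth_k] _ supp_k assms] by blast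
qed

lemma integrable_conv_partial: 
  assumes "locally_integrable u"
  shows "integrable lebesgue (\<lambda>y. partial_deriv js k (x - y) *\<^sub>R u y)"
  using kernel.integrable_conv[OF kernel_partial assms] .

lemma partial_lipschitz:
  "\<exists>L\<ge>0. \<forall>x y. norm (partial_deriv js k x - partial_deriv js k y) \<le> L * norm (x - y)"
proof -
  have "\<forall>j. \<exists>B. 0 \<le> B \<and> (\<forall>x. norm (partial_deriv (j # js) k x) \<le> B)"
    using bounded_partials by blast
  from choice[OF this] obtain B where B: "\<And>j. 0 \<le> B j" "\<And>j x. norm (partial_deriv (j # js) k x) \<le> B j"
    by blast
  have "norm (partial_deriv js k x - partial_deriv js k y) \<le> (\<Sum>j\<in>UNIV. B j) * norm (x - y)" for x y
  proof (rule differentiable_bound[of UNIV])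
    fix z
    show "onorm (\<lambda>v. \<Sum>j\<in>UNIV. v $ j *\<^sub>R partial_deriv (j # js) k z) \<le> (\<Sum>j\<in>UNIV. B j)"
    proof (rule onorm_le)
      fix v :: "'n euclid"
      have "norm (\<Sum>j\<in>UNIV. v $ j *\<^sub>R partial_deriv (j # js) k z) \<le> (\<Sum>j\<in>UNIV. norm v * B j)"
        by (rule sum_norm_le) (use B component_le_norm_cart[of v] in \<open>auto simp: abs_mult intro!: mult_mono\<close>)
      then show "norm (\<Sum>j\<in>UNIV. v $ j *\<^sub>R partial_deriv (j # js) k z) \<le> (\<Sum>j\<in>UNIV. B j) * norm v"
        by (simp add: sum_distrib_left mult.commute)
    qed
  qed (use smooth_partial_has_derivative[OF smooth_k, of js] in \<open>auto intro: has_derivative_at_withinI\<close>)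
  moreover have "0 \<le> (\<Sum>j\<in>UNIV. B j)" by (intro sum_nonneg B)
  ultimately show ?thesis by blast
qed

text \<open>Subtracting the linearisation at x leaves a function whose gradient at y is the
  increment of the gradient of \<open>k\<close> from x to y, hence at most a multiple of |v| on the
  ball of radius |v|. The constant is uniform in x, as is needed under the integral sign.\<close>

lemma quadratic_remainder:
  "\<exists>L\<ge>0. \<forall>x v. norm (k (x + v) - k x - (\<Sum>j\<in>UNIV. v $ j *\<^sub>R partial_deriv [j] k x)) \<le> L * (norm v)\<^sup>2"
proof -
  have "\<forall>j. \<exists>L. 0 \<le> L \<and> (\<forall>x y. norm (partial_deriv [j] k x - partial_deriv [j] k y) \<le> L * norm (x - y))"
    using partial_lipschitz by blast
  from choice[OF this] obtain L where L: "\<And>j. 0 \<le> L j"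
      "\<And>j x y. norm (partial_deriv [j] k x - partial_deriv [j] k y) \<le> L j * norm (x - y)"
    by blast
  have "norm (k (x + v) - k x - (\<Sum>j\<in>UNIV. v $ j *\<^sub>R partial_deriv [j] k x)) \<le> (\<Sum>j\<in>UNIV. L j) * (norm v)\<^sup>2" for x v
  proof -
    define F where "F y = k y - (\<Sum>j\<in>UNIV. (y - x) $ j *\<^sub>R partial_deriv [j] k x)" for y
    have "norm (F (x + v) - F x) \<le> ((\<Sum>j\<in>UNIV. L j) * norm v) * norm ((x + v) - x)"
    proof (rule differentiable_bound[of "cball x (norm v)"])
      fix y assume y: "y \<in> cball x (norm v)"
      show "(F has_derivative (\<lambda>w. \<Sum>j\<in>UNIV. w $ j *\<^sub>R (partial_deriv [j] k y - partial_deriv [j] k x)))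
              (at y within cball x (norm v))"
      proof -
        have "(F has_derivative (\<lambda>w. (\<Sum>j\<in>UNIV. w $ j *\<^sub>R partial_deriv [j] k y)
            - (\<Sum>j\<in>UNIV. w $ j *\<^sub>R partial_deriv [j] k x))) (at y)"
          unfolding F_def
          by (intro has_derivative_diff smooth_has_derivative[OF smooth_k] has_derivative_sum)
             (auto intro!: derivative_eq_intros bounded_linear_imp_has_derivative[OF bounded_linear_vec_nth])
        then show ?thesis
          unfolding scaleR_diff_right sum_subtractf by (rule has_derivative_at_withinI)
      qed
      show "onorm (\<lambda>w. \<Sum>j\<in>UNIV. w $ j *\<^sub>R (partial_deriv [j] k y - partial_deriv [j] k x)) \<le> (\<Sum>j\<in>UNIV. L j) * norm v"
      proof (rule onorm_le)
        fix w :: "'n euclid"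
        have 1: "norm (partial_deriv [j] k y - partial_deriv [j] k x) \<le> L j * norm v" for j
          using L(2)[of j y x] y mult_left_mono[OF _ L(1)[of j], of "norm (y - x)" "norm v"]
          by (simp add: dist_norm norm_minus_commute)
        have "norm (\<Sum>j\<in>UNIV. w $ j *\<^sub>R (partial_deriv [j] k y - partial_deriv [j] k x)) \<le> (\<Sum>j\<in>UNIV. norm w * (L j * norm v))"
        proof (rule sum_norm_le)
          fix j
          show "norm (w $ j *\<^sub>R (partial_deriv [j] k y - partial_deriv [j] k x)) \<le> norm w * (L j * norm v)"
            unfolding norm_scaleR
            by (rule mult_mono[OF _ 1]) (use component_le_norm_cart[of w j] in auto)
        qed
        then show "norm (\<Sum>j\<in>UNIV. w $ j *\<^sub>R (partial_deriv [j] k y - partial_deriv [j] k x)) \<le> (\<Sum>j\<in>UNIV. L j) * norm v * norm w"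
          by (simp add: sum_distrib_left sum_distrib_right ac_simps)
      qed
    qed (auto simp: dist_norm)
    then show ?thesis
      by (simp add: F_def power2_eq_square algebra_simps)
  qed
  moreover have "0 \<le> (\<Sum>j\<in>UNIV. L j)" by (intro sum_nonneg L)
  ultimately show ?thesis by blast
qed

text \<open>Differentiation under the integral without a limit theorem: the error of the linear
  approximation is itself the convolution of \<open>u\<close> with the remainder kernel
  \<open>R\<close>, which is bounded by L |v|^2 and supported in a fixed ball.\<close>

lemma conv_has_derivative:
  fixes u :: "'n euclid \<Rightarrow> 'b::euclidean_space"
  assumes u: "locally_integrable u"
  shows "(conv k u has_derivative (\<lambda>v. \<Sum>j\<in>UNIV. v $ j *\<^sub>R conv (partial_deriv [j] k) u x)) (at x)"
proof -
  obtain L where L: "0 \<le> L"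
      "\<And>x v. norm (k (x + v) - k x - (\<Sum>j\<in>UNIV. v $ j *\<^sub>R partial_deriv [j] k x)) \<le> L * (norm v)\<^sup>2"
    using quadratic_remainder by blast
  let ?J = "LINT y:cball x (r + 1)|lebesgue. norm (u y)"
  show ?thesis
  proof (rule has_derivative_of_quadratic_bound)
    show "bounded_linear (\<lambda>v. \<Sum>j\<in>UNIV. v $ j *\<^sub>R conv (partial_deriv [j] k) u x)"
      by (intro bounded_linear_of_euclidean linearI)
         (simp_all add: algebra_simps sum.distrib scaleR_sum_right)
    fix v :: "'n euclid" assume v: "norm v \<le> 1"
    define R where "R z = k (z + v) - k z - (\<Sum>j\<in>UNIV. v $ j *\<^sub>R partial_deriv [j] k z)" for z
    have cR: "continuous_on UNIV R"
      unfolding R_def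
      by (intro continuous_intros smooth_continuous_on smooth_k smooth_continuous
          continuous_on_compose2[OF smooth_continuous[OF smooth_k, of UNIV]]) auto
    \<comment> \<open>A shift by v with |v| \<le> 1 enlarges the support by at most 1.\<close>
    have suppR: "R z = 0" if "r + 1 < norm z" for z
    proof -
      have "r < norm z" using that by simp
      moreover have "r < norm (z + v)" using that v norm_triangle_ineq2[of z "-v"] by simp
      ultimately show ?thesis
        using supp_k supp_partials[of z] by (simp add: R_def)
    qed
    have "conv k u (x + v) - conv k u x - (\<Sum>j\<in>UNIV. v $ j *\<^sub>R conv (partial_deriv [j] k) u x) = conv R u x"
    proof -
      note int = integrable_conv[OF u, of "x + v"] integrable_conv[OF u, of x] integrable_conv_partial[OF u, of _ x]
      have eq: "R (x - y) *\<^sub>R u y = k (x + v - y) *\<^sub>R u y - k (x - y) *\<^sub>R u y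
           - (\<Sum>j\<in>UNIV. v $ j *\<^sub>R (partial_deriv [j] k (x - y) *\<^sub>R u y))" for y
        by (simp add: R_def algebra_simps scaleR_sum_left)
      show ?thesis
        unfolding conv_def eq using int
        by (simp add: Bochner_Integration.integral_diff Bochner_Integration.integral_sum Bochner_Integration.integrable_sum Bochner_Integration.integrable_diff del: scaleR_scaleR)
    qed
    then show "norm (conv k u (x + v) - conv k u x - (\<Sum>j\<in>UNIV. v $ j *\<^sub>R conv (partial_deriv [j] k) u x)) \<le> (L * ?J) * (norm v)\<^sup>2"
      using bound_integrable_conv(2)[of R "L * (norm v)\<^sup>2" "r + 1", OF cR _ suppR u, of x] L(2)
      by (simp add: R_def ac_simps)
  qed
qed

lemma conv_smooth:
  assumes u: "locally_integrable u"
  shows "partial_deriv js (conv k u) = conv (partial_deriv js k) u" (is ?A)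
    and "smooth (conv k u)" (is ?B)
proof -
  have "(conv (partial_deriv js k) u has_derivative (\<lambda>v. \<Sum>j\<in>UNIV. v $ j *\<^sub>R conv (partial_deriv (j # js) k) u x)) (at x)" for js x
    using kernel.conv_has_derivative[OF kernel_partial u, of js x] by (simp add: partial_deriv_append[symmetric])
  from smoothI_derivs[of "\<lambda>js. conv (partial_deriv js k) u", OF this]
  show ?A ?B by auto
qed

lemma conv_bounded_linear:
  assumes L: "bounded_linear L" and u: "locally_integrable u"
  shows "L (conv k u x) = conv k (\<lambda>y. L (u y)) x"
  unfolding conv_def
  using integral_bounded_linear[OF L integrable_conv[OF u]]
  by (simp add: linear_cmul[OF bounded_linear.linear[OF L]])

lemma conv_diff:
  assumes "locally_integrable u" "locally_integrable v"
  shows "conv k (\<lambda>y. u y - v y) x = conv k u x - conv k v x"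
  unfolding conv_def by (simp add: scaleR_diff_right integrable_conv assms)

lemma conv_eq_reflected:
  fixes u :: "'n euclid \<Rightarrow> 'b::euclidean_space"
  assumes u: "locally_integrable u"
  shows "conv k u x = (\<integral>y. k y *\<^sub>R u (x - y) \<partial>lebesgue)"
    and "integrable lebesgue (\<lambda>y. k y *\<^sub>R u (x - y))"
proof -
  note i = integrable_conv[OF u, of x]
  have m: "(\<lambda>y. k (x - y) *\<^sub>R u y) \<in> borel_measurable lebesgue"
    using i by (rule borel_measurable_integrable)
  show "conv k u x = (\<integral>y. k y *\<^sub>R u (x - y) \<partial>lebesgue)"
    using integral_lebesgue_reflect[OF m, of x] by (simp add: conv_def)
  have "integrable (distr lebesgue lebesgue (\<lambda>y. x - y)) (\<lambda>y. k (x - y) *\<^sub>R u y)"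
    using i by (simp only: lebesgue_distr_reflect)
  then show "integrable lebesgue (\<lambda>y. k y *\<^sub>R u (x - y))"
    using integrable_distr[OF lebesgue_reflect_measurable] by fastforce
qed

end

section \<open>The mollifier at scale \<delta>\<close>

definition mollifier_kernel :: "('n::finite euclid \<Rightarrow> real) \<Rightarrow> real \<Rightarrow> 'n euclid \<Rightarrow> real" where
  "mollifier_kernel \<phi> \<delta> y = (1 / \<delta>) ^ CARD('n) * \<phi> ((1 / \<delta>) *\<^sub>R y)"

lemma partial_deriv_mollifier_kernel:
  fixes \<phi> :: "'n::finite euclid \<Rightarrow> real"
  assumes "smooth \<phi>"
  shows "partial_deriv js (mollifier_kernel \<phi> \<delta>) =
      (\<lambda>y. (1 / \<delta>) ^ (CARD('n) + length js) * partial_deriv js \<phi> ((1 / \<delta>) *\<^sub>R y))"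
    and "smooth (mollifier_kernel \<phi> \<delta>)"
proof -
  have eq: "mollifier_kernel \<phi> \<delta> = (\<lambda>y. (1 / \<delta>) ^ CARD('n) *\<^sub>R \<phi> ((1 / \<delta>) *\<^sub>R y + 0))"
    by (auto simp: mollifier_kernel_def fun_eq_iff)
  show "smooth (mollifier_kernel \<phi> \<delta>)"
    unfolding eq by (intro partial_deriv_scaleR partial_deriv_affine assms)
  have "partial_deriv js (mollifier_kernel \<phi> \<delta>) =
     (\<lambda>y. (1 / \<delta>) ^ CARD('n) *\<^sub>R ((1 / \<delta>) ^ length js *\<^sub>R partial_deriv js \<phi> ((1 / \<delta>) *\<^sub>R y + 0)))"
    unfolding eq by (subst partial_deriv_scaleR(1)[OF partial_deriv_affine(2)[OF assms]], subst partial_deriv_affine(1)[OF assms], rule refl)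
  then show "partial_deriv js (mollifier_kernel \<phi> \<delta>) =
      (\<lambda>y. (1 / \<delta>) ^ (CARD('n) + length js) * partial_deriv js \<phi> ((1 / \<delta>) *\<^sub>R y))"
    by (simp add: power_add mult.assoc)
qed

lemma kernel_mollifier:
  assumes "mollifier p \<phi>" "0 < \<delta>"
  shows "kernel (mollifier_kernel \<phi> \<delta>) \<delta>"
proof
  show "smooth (mollifier_kernel \<phi> \<delta>)"
    using assms by (intro partial_deriv_mollifier_kernel) (simp add: mollifier_def)
  fix y :: "'a euclid" assume "\<delta> < norm y"
  then have "1 < norm ((1 / \<delta>) *\<^sub>R y)" using assms by (simp add: divide_simps)
  then show "mollifier_kernel \<phi> \<delta> y = 0"
    using assms by (simp add: mollifier_kernel_def mollifier_def)
qed

lemma mollify_eq_conv: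
  fixes u :: "'n::finite form"
  assumes "mollifier p \<phi>" "0 < \<delta>" "locally_integrable u"
  shows "mollify \<phi> \<delta> u = conv (mollifier_kernel \<phi> \<delta>) u"
  using kernel.conv_eq_reflected(1)[OF kernel_mollifier[OF assms(1,2)] assms(3)]
  by (simp add: mollify_def mollifier_kernel_def fun_eq_iff)

lemma conv_periodic:
  fixes u :: "'n::finite euclid \<Rightarrow> 'b::euclidean_space"
  assumes "kernel k r" "locally_integrable u" "periodic e u"
  shows "periodic e (conv k u)"
  unfolding periodic_def
proof (intro ballI allI)
  fix l x assume l: "l \<in> lattice e"
  have "u (x + l - y) = u (x - y)" for y
    using assms(3) l unfolding periodic_def by (metis add_diff_eq diff_add_eq)
  then show "conv k u (x + l) = conv k u x"
    by (simp add: kernel.conv_eq_reflected(1)[OF assms(1,2)])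
qed

section \<open>Cells\<close>

lemma alt_eval_lincomb:
  "alt_eval (a *\<^sub>R \<omega> + b *\<^sub>R \<eta>) vs = a * alt_eval \<omega> vs + b * alt_eval \<eta> vs"
  unfolding alt_eval_def by (simp add: algebra_simps sum.distrib sum_distrib_left)

lemma same_pullback_lincomb:
  assumes "same_pullback T u u'" "same_pullback T v v'"
  shows "same_pullback T (\<lambda>x. a *\<^sub>R u x + b *\<^sub>R v x) (\<lambda>x. a *\<^sub>R u' x + b *\<^sub>R v' x)"
  using assms unfolding same_pullback_def by (simp add: alt_eval_lincomb)

text \<open>In the expansion over orderings, one that differs from \<open>ks\<close> at some place
  meets a vanishing coordinate of an axis vector there. Only \<open>ks\<close> itself survives, with
  a factor \<delta> for each vector.\<close>

lemma alt_eval_axis: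
  fixes ks :: "'n::{finite,linorder} list"
  assumes "distinct ks"
  shows "alt_eval \<omega> (map (\<lambda>i. axis i \<delta>) ks)
    = (- 1) ^ card {(a, b). a < b \<and> b < length ks \<and> ks ! b < ks ! a} * \<omega> $ set ks * \<delta> ^ length ks"
proof -
  have fin: "finite {js :: 'n list. length js = length ks \<and> distinct js}"
    by (rule finite_subset[OF _ finite_lists_length_eq[of UNIV "length ks"]]) auto
  let ?c = "\<lambda>js. (- 1) ^ card {(a, b). a < b \<and> b < length js \<and> js ! b < js ! a}
        * \<omega> $ set js * (\<Prod>a<length ks. (map (\<lambda>i. axis i \<delta>) ks ! a) $ (js ! a))"
  have zero: "?c js = 0" if js: "length js = length ks" "js \<noteq> ks" for js
  proof -
    obtain a where a: "a < length ks" "js ! a \<noteq> ks ! a"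
      using js by (auto simp: list_eq_iff_nth_eq)
    have "(\<Prod>a<length ks. (map (\<lambda>i. axis i \<delta>) ks ! a) $ (js ! a)) = 0"
      by (rule prod_zero) (use a in \<open>auto simp: axis_def\<close>)
    then show ?thesis by simp
  qed
  have "alt_eval \<omega> (map (\<lambda>i. axis i \<delta>) ks) = (\<Sum>js | length js = length ks \<and> distinct js. ?c js)"
    by (simp add: alt_eval_def)
  also have "\<dots> = (\<Sum>js\<in>{ks}. ?c js)"
    by (rule sum.mono_neutral_right) (use fin assms zero in auto)
  also have "\<dots> = (- 1) ^ card {(a, b). a < b \<and> b < length ks \<and> ks ! b < ks ! a} * \<omega> $ set ks * \<delta> ^ length ks"
    by (simp add: axis_def)
  finally show ?thesis .
qed

text \<open>Near an interior point every small simplex is admissible, in particular those spanned by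
  multiples of coordinate vectors. Evaluation on them reads off each component up to a sign and a
  power of \<delta>, which turns equality of pullbacks into equality of values.\<close>

lemma same_pullback_interior:
  fixes u v :: "'n::{finite,linorder} form"
  assumes uv: "same_pullback T u v" and x: "x \<in> A" "open A" "A \<subseteq> T"
  shows "u x = v x"
proof -
  obtain \<eta> where \<eta>: "0 < \<eta>" "ball x \<eta> \<subseteq> A"
    using x openE by blast
  define \<delta> where "\<delta> = \<eta> / 2"
  have "u x $ I = v x $ I" for I
  proof -
    define js where "js = sorted_list_of_set I"
    have js: "distinct js" "set js = I" by (auto simp: js_def)
    let ?vs = "map (\<lambda>i. axis i \<delta>) js"
    have "norm (axis i \<delta> :: 'n euclid) < \<eta>" for i
    proof -
      have "norm (axis i \<delta> :: 'n euclid) = sqrt (\<delta> * \<delta>)"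
        unfolding norm_eq_sqrt_inner inner_axis_axis by (simp only: simp_thms if_True inner_real_def)
      then show ?thesis using \<eta> by (simp only: real_sqrt_abs2) (simp add: \<delta>_def)
    qed
    then have "insert x ((+) x ` set ?vs) \<subseteq> ball x \<eta>"
      using \<eta> by (auto simp: dist_norm)
    then have "convex hull (insert x ((+) x ` set ?vs)) \<subseteq> ball x \<eta>"
      by (rule hull_minimal) simp
    then have "alt_eval (u x) ?vs = alt_eval (v x) ?vs"
      using uv \<eta> x unfolding same_pullback_def by blast
    then show ?thesis
      using \<eta> unfolding alt_eval_axis[OF js(1)] js(2) by (simp add: \<delta>_def)
  qed
  then show ?thesis by (simp add: vec_eq_iff)
qed

section \<open>Lebesgue measure of cells and of their boundaries\<close>

lemma cell_chart_negligible_image: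
  assumes "cell_chart d V f T" "S \<subseteq> cball 0 1 \<inter> V" "negligible S"
  shows "negligible (f ` S)"
proof (rule negligible_locally_Lipschitz_image)
  obtain C where C: "\<forall>x \<in> cball 0 1 \<inter> V. \<forall>y \<in> cball 0 1 \<inter> V. dist (f x) (f y) \<le> C * dist x y"
    using assms(1) unfolding cell_chart_def by blast
  fix x assume "x \<in> S"
  then show "\<exists>T B. open T \<and> x \<in> T \<and> (\<forall>y\<in>S \<inter> T. norm (f y - f x) \<le> B * norm (y - x))"
    using C assms(2) by (intro exI[of _ UNIV] exI[of _ C]) (auto simp: dist_norm norm_minus_commute)
qed (use assms in auto)

lemma cell_chart_continuous_inj:
  assumes "cell_chart d V f T"
  shows "continuous_on (cball 0 1 \<inter> V) f" "inj_on f (cball 0 1 \<inter> V)"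
proof -
  obtain c C where c: "0 < c" and C: "\<forall>x \<in> cball 0 1 \<inter> V. \<forall>y \<in> cball 0 1 \<inter> V.
     c * dist x y \<le> dist (f x) (f y) \<and> dist (f x) (f y) \<le> C * dist x y"
    using assms unfolding cell_chart_def by blast
  have "(max C 0)-lipschitz_on (cball 0 1 \<inter> V) f"
  proof (rule lipschitz_onI)
    fix x y assume "x \<in> cball 0 1 \<inter> V" "y \<in> cball 0 1 \<inter> V"
    then have "dist (f x) (f y) \<le> C * dist x y" using C by blast
    also have "\<dots> \<le> max C 0 * dist x y" by (intro mult_right_mono) auto
    finally show "dist (f x) (f y) \<le> max C 0 * dist x y" .
  qed simp
  then show "continuous_on (cball 0 1 \<inter> V) f"
    by (rule lipschitz_on_continuous_on)
  show "inj_on f (cball 0 1 \<inter> V)"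
  proof (rule inj_onI)
    fix x y assume "x \<in> cball 0 1 \<inter> V" "y \<in> cball 0 1 \<inter> V" "f x = f y"
    then have "c * dist x y \<le> 0" using C by force
    then show "x = y" using c by (simp add: mult_le_0_iff)
  qed
qed

lemma cell_chart_full:
  fixes V :: "('n::finite euclid) set"
  assumes "cell_chart CARD('n) V f T"
  shows "V = UNIV"
proof -
  have "subspace V" "dim V = DIM('n euclid)" using assms by (auto simp: cell_chart_def)
  then show ?thesis using dim_eq_full[of V] span_eq_iff[of V] by metis
qed

lemma cell_compact: 
  assumes "cell_chart d V f T"
  shows "compact T"
proof -
  have "closed V" using assms closed_subspace unfolding cell_chart_def by blast
  then have "compact (cball 0 1 \<inter> V)" by (simp add: compact_Int_closed)
  then show ?thesis
    using compact_continuous_image[OF cell_chart_continuous_inj(1)[OF assms]] assms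
    unfolding cell_chart_def by simp
qed

lemma is_cell_compact: "is_cell d T \<Longrightarrow> compact T"
  using cell_compact unfolding is_cell_def by blast

lemma low_dim_cell_negligible:
  fixes T :: "('n::finite euclid) set"
  assumes "cell_chart d V f T" "d \<noteq> CARD('n)"
  shows "negligible T"
proof -
  have V: "dim V = d" "T = f ` (cball 0 1 \<inter> V)" using assms by (auto simp: cell_chart_def)
  have "dim V \<le> CARD('n)" using dim_subset_UNIV[of V] by simp
  then have "dim V < DIM('n euclid)" using assms V by simp
  then have "negligible (cball 0 1 \<inter> V)"
    using negligible_lowdim negligible_subset by blast
  then show ?thesis
    using cell_chart_negligible_image[OF assms(1)] V by blast
qed

text \<open>\<open>cell_interior\<close> collects images under all charts of any dimension, so an
  n-cell must be shown not to be a lower dimensional cell through another chart. Lower dimensional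
  cells are negligible, whereas invariance of domain puts a nonempty open set inside an
  n-cell.\<close>

lemma full_cell_charts:
  fixes T :: "('n::finite euclid) set"
  assumes T: "is_cell CARD('n) T" and ch: "cell_chart d V f T"
  shows "V = UNIV" "d = CARD('n)" "open (f ` ball 0 1)" "f ` ball 0 1 \<subseteq> T"
proof -
  have op: "open (g ` ball 0 1) \<and> g ` ball 0 1 \<subseteq> T" if g: "cell_chart CARD('n) W g T" for W g
  proof -
    have W: "W = UNIV" using g by (rule cell_chart_full)
    have "open (g ` ball 0 1)"
    proof (rule invariance_of_domain)
      show "continuous_on (ball 0 1) g" "inj_on g (ball 0 1)"
        using cell_chart_continuous_inj[OF g] ball_subset_cball[of 0 1]
        unfolding W by (auto intro: continuous_on_subset inj_on_subset)
    qed simp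
    moreover have "g ` ball 0 1 \<subseteq> T"
      using g ball_subset_cball[of 0 1] unfolding cell_chart_def W by auto
    ultimately show ?thesis by blast
  qed
  show d: "d = CARD('n)"
  proof (rule ccontr)
    assume "d \<noteq> CARD('n)"
    then have "negligible T" by (rule low_dim_cell_negligible[OF ch])
    moreover obtain W g where g: "cell_chart CARD('n) W g T" using T unfolding is_cell_def by blast
    ultimately have "negligible (g ` ball 0 1)"
      using negligible_subset[of T "g ` ball 0 1"] op[OF g] by simp
    then show False using op[OF g] open_not_negligible[of "g ` ball 0 1"] by simp
  qed
  then show "V = UNIV" using ch cell_chart_full by blast
  show "open (f ` ball 0 1)" "f ` ball 0 1 \<subseteq> T" using op ch d by auto
qed

text \<open>The union over all charts contains the image of the open ball under any one of them, so
  what remains of the cell lies in the Lipschitz image of the unit sphere.\<close>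

lemma cell_interior_full:
  fixes T :: "('n::finite euclid) set"
  assumes T: "is_cell CARD('n) T"
  shows "open (cell_interior T)" "cell_interior T \<subseteq> T" "negligible (T - cell_interior T)"
proof -
  have eq: "cell_interior T = (\<Union>f\<in>{f. \<exists>d V. cell_chart d V f T}. f ` ball 0 1)"
    unfolding cell_interior_def using full_cell_charts(1)[OF T] by blast
  show "open (cell_interior T)" "cell_interior T \<subseteq> T"
    unfolding eq using full_cell_charts(3,4)[OF T] by blast+
  obtain V f where f: "cell_chart CARD('n) V f T" using T unfolding is_cell_def by blast
  have V: "V = UNIV" using f by (rule cell_chart_full)
  have "negligible (f ` sphere 0 1)"
    by (rule cell_chart_negligible_image[OF f]) (auto simp: V negligible_sphere)
  moreover have "T - cell_interior T \<subseteq> f ` sphere 0 1"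
  proof
    fix y assume y: "y \<in> T - cell_interior T"
    then obtain x where x: "y = f x" "x \<in> cball 0 1" using f unfolding cell_chart_def by blast
    have "x \<notin> ball 0 1" using y x(1) f unfolding eq by blast
    then show "y \<in> f ` sphere 0 1" using x by auto
  qed
  ultimately show "negligible (T - cell_interior T)" by (rule negligible_subset)
qed

lemma cell_chart_translate:
  "cell_chart d V f T \<Longrightarrow> cell_chart d V (\<lambda>x. l + f x) ((+) l ` T)"
  unfolding cell_chart_def by (auto simp: image_image)

lemma is_cell_translate: "is_cell d T \<Longrightarrow> is_cell d ((+) l ` T)"
  unfolding is_cell_def using cell_chart_translate by blast

lemma cell_interior_translate: "x \<in> cell_interior T \<Longrightarrow> x + l \<in> cell_interior ((+) l ` T)"
proof -
  assume "x \<in> cell_interior T"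
  then obtain d V f y where f: "cell_chart d V f T" "x = f y" "y \<in> ball 0 1 \<inter> V"
    unfolding cell_interior_def by blast
  then have "x + l = (\<lambda>z. l + f z) y" by simp
  then show ?thesis
    unfolding cell_interior_def mem_Collect_eq
    using cell_chart_translate[OF f(1)] f(3) by (intro exI conjI)
qed

section \<open>The interpolator\<close>

lemma periodic_deg_part: "periodic e u \<Longrightarrow> periodic e (deg_part k u)"
  unfolding periodic_def deg_part_def by (intro ballI allI) presburger

locale fe_interpolation = torus_basis e
  for e :: "'n::{finite,linorder} \<Rightarrow> 'n euclid" +
  fixes K :: "('n euclid) set set" and X :: "'n local_spaces" and F :: "'n dofs"
  assumes complex: "cellular_complex e K" and compatible: "compatible_system e K X"
    and dofs: "degrees_of_freedom e K F" and unisolvent: "unisolvent K X F"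
begin

abbreviation "LI \<equiv> local_interpolator K X F"

abbreviation "is_full T \<equiv> T \<in> K \<and> is_cell CARD('n) T"

text \<open>The complex is countable, being the orbit of finitely many cells under the lattice. The
  cells of lower dimension and the boundaries of the full ones form a countable union of null sets,
  and the cells cover everything.\<close>

lemma AE_in_full_cell: "AE x in lebesgue. \<exists>T. is_full T \<and> x \<in> cell_interior T"
proof -
  have "\<exists>E. finite E \<and> K = {(+) l ` T | l T. l \<in> lattice e \<and> T \<in> E}"
    using complex unfolding cellular_complex_def by (elim conjE)
  then obtain E where E: "finite E" "K = {(+) l ` T | l T. l \<in> lattice e \<and> T \<in> E}"
    by (elim exE conjE)
  have "K = (\<lambda>(l, T). (+) l ` T) ` (lattice e \<times> E)" unfolding E(2) by auto
  then have "countable K" using E(1) countable_lattice by (simp add: countable_finite)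
  define N where "N T = (if is_cell CARD('n) T then T - cell_interior T else T)" for T :: "'n euclid set"
  have "negligible (N T)" if T: "T \<in> K" for T
  proof (cases "is_cell CARD('n) T")
    case False
    have "\<forall>T\<in>K. \<exists>d. is_cell d T"
      using complex unfolding cellular_complex_def by (elim conjE)
    then obtain d V f where "cell_chart d V f T"
      using T unfolding is_cell_def by blast
    with False show ?thesis
      using low_dim_cell_negligible[of d V f T] by (auto simp: N_def is_cell_def)
  qed (simp add: N_def cell_interior_full)
  then have "negligible (\<Union>T\<in>K. N T)"
    using negligible_countable_Union[of "N ` K"] \<open>countable K\<close> by blast
  then have "(\<Union>T\<in>K. N T) \<in> null_sets lebesgue" by (simp add: negligible_iff_null_sets)
  then show ?thesis
  proof (rule AE_I', intro subsetI)
    fix x assume "x \<in> {x \<in> space lebesgue. \<not> (\<exists>T. is_full T \<and> x \<in> cell_interior T)}"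
    then have no: "\<nexists>T. is_full T \<and> x \<in> cell_interior T" by simp
    have "\<Union>K = UNIV" using complex unfolding cellular_complex_def by (elim conjE)
    then obtain T where "T \<in> K" "x \<in> T" by blast
    then show "x \<in> (\<Union>T\<in>K. N T)" using no by (auto simp: N_def)
  qed
qed

lemma fes: "finite_element_system e K X"
  using compatible by (simp add: compatible_system_def)

lemma
  assumes T: "T \<in> K"
  shows X_smooth: "X k T \<subseteq> smooth_kforms k"
    and X_lincomb: "u \<in> X k T \<Longrightarrow> v \<in> X k T \<Longrightarrow> (\<lambda>x. a *\<^sub>R u x + b *\<^sub>R v x) \<in> X k T"
    and X_translate: "l \<in> lattice e \<Longrightarrow> X k ((+) l ` T) = (\<lambda>u x. u (x - l)) ` X k T"
    and X_subcell: "T' \<in> K \<Longrightarrow> T' \<subseteq> T \<Longrightarrow> X k T \<subseteq> X k T'"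
  using fes[unfolded finite_element_system_def, rule_format, OF T, of k] by simp_all

lemma dof_linear:
  assumes "T \<in> K" "f \<in> F k T" "u \<in> smooth_kforms k" "v \<in> smooth_kforms k"
  shows "f (\<lambda>x. a *\<^sub>R u x + b *\<^sub>R v x) = a * f u + b * f v"
proof -
  have "\<forall>f\<in>F k T. \<forall>u\<in>smooth_kforms k. \<forall>v\<in>smooth_kforms k.
        (same_pullback T u v \<longrightarrow> f u = f v) \<and>
        (\<forall>a b. f (\<lambda>x. a *\<^sub>R u x + b *\<^sub>R v x) = a * f u + b * f v)"
    using dofs[unfolded degrees_of_freedom_def, rule_format, OF assms(1), of k] by simp
  then show ?thesis using assms by blast
qed

lemma dof_translate:
  assumes "T \<in> K" "l \<in> lattice e"
  shows "F k ((+) l ` T) = (\<lambda>f u. f (\<lambda>x. u (x + l))) ` F k T"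
  using dofs[unfolded degrees_of_freedom_def, rule_format, OF assms(1), of k] assms(2) by simp

lemma interpolates_LI: 
  assumes "T \<in> K" "u \<in> smooth_kforms k"
  shows "interpolates K X F k T u (LI k T u)"
proof -
  have "\<exists>w. interpolates K X F k T u w"
    using unisolvent assms unfolding unisolvent_def by blast
  then show ?thesis unfolding local_interpolator_def by (rule someI_ex)
qed

lemma LI_mem: "T \<in> K \<Longrightarrow> u \<in> smooth_kforms k \<Longrightarrow> LI k T u \<in> X k T"
  using interpolates_LI unfolding interpolates_def by blast

lemma LI_smooth_kform: "T \<in> K \<Longrightarrow> u \<in> smooth_kforms k \<Longrightarrow> LI k T u \<in> smooth_kforms k"
  using LI_mem X_smooth by blast

lemma interpolates_unique:
  assumes "T \<in> K" "u \<in> smooth_kforms k" "interpolates K X F k T u w" "interpolates K X F k T u w'"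
  shows "same_pullback T w w'"
  using unisolvent assms unfolding unisolvent_def by blast

text \<open>Interpolants are chosen by \<open>SOME\<close> and unique only up to equality of
  pullbacks to \<open>T\<close>, which determines values at interior points. Hence the hypothesis
  \<open>x \<in> cell_interior T\<close> in all pointwise rules; any \<open>w\<close> that meets the
  interpolation conditions computes the value.\<close>

lemma LI_eqI:
  assumes "is_full T" "x \<in> cell_interior T" "u \<in> smooth_kforms k" "interpolates K X F k T u w"
  shows "LI k T u x = w x"
  using same_pullback_interior[OF interpolates_unique[of T u k "LI k T u" w] assms(2)]
    cell_interior_full(1,2)[of T] assms interpolates_LI by blast

lemma LI_lincomb:
  assumes T: "is_full T" "x \<in> cell_interior T" and u: "u \<in> smooth_kforms k" and v: "v \<in> smooth_kforms k"
  shows "LI k T (\<lambda>x. a *\<^sub>R u x + b *\<^sub>R v x) x = a *\<^sub>R LI k T u x + b *\<^sub>R LI k T v x"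
proof (rule LI_eqI[OF T])
  show "(\<lambda>x. a *\<^sub>R u x + b *\<^sub>R v x) \<in> smooth_kforms k"
    using u v by (auto simp: smooth_kforms_def is_kform_def intro!: smooth_lincomb)
  note iu = interpolates_LI[of T u k] and iv = interpolates_LI[of T v k]
  show "interpolates K X F k T (\<lambda>x. a *\<^sub>R u x + b *\<^sub>R v x) (\<lambda>x. a *\<^sub>R LI k T u x + b *\<^sub>R LI k T v x)"
    unfolding interpolates_def
  proof (intro conjI ballI impI)
    show "(\<lambda>x. a *\<^sub>R LI k T u x + b *\<^sub>R LI k T v x) \<in> X k T"
      using T u v by (intro X_lincomb LI_mem) auto
    fix T' f assume T': "T' \<in> K" "T' \<subseteq> T" "f \<in> F k T'"
    have lin: "f (\<lambda>x. a *\<^sub>R w x + b *\<^sub>R z x) = a * f w + b * f z"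
      if "w \<in> smooth_kforms k" "z \<in> smooth_kforms k" for w z
      using dof_linear T' that by blast
    have "f (LI k T u) = f u" "f (LI k T v) = f v"
      using iu iv T' T u v unfolding interpolates_def by blast+
    then show "f (\<lambda>x. a *\<^sub>R LI k T u x + b *\<^sub>R LI k T v x) = f (\<lambda>x. a *\<^sub>R u x + b *\<^sub>R v x)"
      using T u v by (simp add: lin LI_smooth_kform)
  qed
qed

lemma LI_projection:
  assumes "is_full T" "x \<in> cell_interior T" "u \<in> X k T"
  shows "LI k T u x = u x"
  using assms X_smooth by (intro LI_eqI) (auto simp: interpolates_def)

lemma translate_in_K: "T \<in> K \<Longrightarrow> l \<in> lattice e \<Longrightarrow> (+) l ` T \<in> K"
proof -
  have "\<forall>T\<in>K. \<forall>l\<in>lattice e. (+) l ` T \<in> K"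
    using complex unfolding cellular_complex_def by (elim conjE)
  then show "T \<in> K \<Longrightarrow> l \<in> lattice e \<Longrightarrow> (+) l ` T \<in> K" by blast
qed

lemma full_translate: "is_full T \<Longrightarrow> l \<in> lattice e \<Longrightarrow> is_full ((+) l ` T)"
  by (simp add: translate_in_K is_cell_translate)

text \<open>Local spaces and degrees of freedom on the translated cell are translates of those on
  \<open>T\<close>, and \<open>u\<close> equals its own translate. The translated interpolant
  therefore interpolates \<open>u\<close> on the translated cell, and uniqueness applies.\<close>

lemma LI_periodic:
  assumes T: "is_full T" "x \<in> cell_interior T" and u: "u \<in> smooth_kforms k" "periodic e u"
    and l: "l \<in> lattice e"
  shows "LI k ((+) l ` T) u (x + l) = LI k T u x"
proof -
  have "LI k ((+) l ` T) u (x + l) = (\<lambda>y. LI k T u (y - l)) (x + l)"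
  proof (rule LI_eqI[OF full_translate[OF T(1) l] cell_interior_translate[OF T(2)] u(1)])
    have XT: "X k ((+) l ` T) = (\<lambda>u x. u (x - l)) ` X k T"
      using X_translate T l by simp
    show "interpolates K X F k ((+) l ` T) u (\<lambda>y. LI k T u (y - l))"
      unfolding interpolates_def
    proof (intro conjI ballI impI)
      show "(\<lambda>y. LI k T u (y - l)) \<in> X k ((+) l ` T)"
        unfolding XT using T u by (auto intro: LI_mem)
      fix T' f assume T': "T' \<in> K" "T' \<subseteq> (+) l ` T" "f \<in> F k T'"
      \<comment> \<open>A subcell of the translated cell is moved back to a subcell of
        \<open>T\<close>, where the interpolation conditions are known.\<close>
      define T0 where "T0 = (+) (- l) ` T'"
      have T0: "T0 \<in> K" "T0 \<subseteq> T" "T' = (+) l ` T0"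
        using translate_in_K[OF T'(1) lattice_uminus[OF l]] T'(2) by (auto simp: T0_def image_image)
      then have "F k T' = (\<lambda>f u. f (\<lambda>x. u (x + l))) ` F k T0"
        using dof_translate l by simp
      then obtain f0 where f0: "f0 \<in> F k T0" "f = (\<lambda>u. f0 (\<lambda>x. u (x + l)))"
        using T' by blast
      have "f0 (LI k T u) = f0 u"
        using interpolates_LI[of T u k] T u T0 f0(1) unfolding interpolates_def by blast
      moreover have "(\<lambda>x. u (x + l)) = u"
        using u(2) l unfolding periodic_def by auto
      ultimately show "f (\<lambda>y. LI k T u (y - l)) = f u"
        by (simp add: f0(2))
    qed
  qed
  then show ?thesis by simp
qed

lemma interpolator_eq:
  assumes "is_full T" "x \<in> cell_interior T"
  shows "interpolator K X F u x = (\<Sum>k\<le>CARD('n). LI k T (deg_part k u) x)"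
proof -
  have "(THE T. T \<in> K \<and> is_cell CARD('n) T \<and> x \<in> cell_interior T) = T"
  proof (rule the_equality)
    fix T' assume "T' \<in> K \<and> is_cell CARD('n) T' \<and> x \<in> cell_interior T'"
    moreover have "\<forall>T\<in>K. \<forall>T'\<in>K. T \<noteq> T' \<longrightarrow> cell_interior T \<inter> cell_interior T' = {}"
      using complex unfolding cellular_complex_def by (elim conjE)
    ultimately show "T' = T" using assms by blast
  qed (use assms in auto)
  then show ?thesis
    using assms unfolding interpolator_def Let_def by auto
qed

lemma interpolator_lincomb:
  assumes "is_full T" "x \<in> cell_interior T" "smooth u" "smooth v"
  shows "interpolator K X F (\<lambda>x. a *\<^sub>R u x + b *\<^sub>R v x) x
    = a *\<^sub>R interpolator K X F u x + b *\<^sub>R interpolator K X F v x"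
proof -
  have "deg_part k (\<lambda>x. a *\<^sub>R u x + b *\<^sub>R v x) = (\<lambda>x. a *\<^sub>R deg_part k u x + b *\<^sub>R deg_part k v x)" for k
    by (auto simp: deg_part_def vec_eq_iff fun_eq_iff)
  then show ?thesis
    using assms
    by (simp add: interpolator_eq[OF assms(1,2)] LI_lincomb deg_part_smooth_kforms sum.distrib scaleR_sum_right)
qed

lemma interpolator_diff:
  assumes "is_full T" "x \<in> cell_interior T" "smooth u" "smooth v"
  shows "interpolator K X F (\<lambda>x. u x - v x) x = interpolator K X F u x - interpolator K X F v x"
  using interpolator_lincomb[OF assms, of 1 "-1"] by simp

lemma interpolator_projection:
  assumes "is_full T" "x \<in> cell_interior T" "\<And>k. deg_part k q \<in> X k T"
  shows "interpolator K X F q x = q x"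
  using assms by (simp add: interpolator_eq[OF assms(1,2)] LI_projection sum_deg_part)

lemma interpolator_periodic:
  assumes u: "smooth u" "periodic e u"
  shows "periodic e (interpolator K X F u)"
  unfolding periodic_def
proof (intro ballI allI)
  fix l x assume l: "l \<in> lattice e"
  have per: "periodic e (deg_part k u)" for k
    using u by (intro periodic_deg_part)
  have shift: "interpolator K X F u (x + l) = interpolator K X F u x"
    if "is_full T" "x \<in> cell_interior T" "l \<in> lattice e" for T x l
    using that u
    by (simp add: interpolator_eq[OF that(1,2)] LI_periodic[OF that(1,2) deg_part_smooth_kforms per]
      interpolator_eq[OF full_translate[OF that(1,3)] cell_interior_translate[OF that(2)]])
  show "interpolator K X F u (x + l) = interpolator K X F u x"
  proof (cases "\<exists>T. is_full T \<and> x \<in> cell_interior T")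
    case True
    then show ?thesis using shift l by blast
  next
    case False
    show ?thesis
    proof (cases "\<exists>T. is_full T \<and> x + l \<in> cell_interior T")
      case True
      then show ?thesis using shift[of _ "x + l" "- l"] lattice_uminus[OF l] by auto
    next
      \<comment> \<open>Neither point lies in the interior of a full cell, so both values are the
        default 0.\<close>
      case False
      then show ?thesis using \<open>\<not> (\<exists>T. is_full T \<and> x \<in> cell_interior T)\<close> by (auto simp: interpolator_def)
    qed
  qed
qed

text \<open>The pullback to \<open>T\<close> is that of the local interpolant on \<open>T\<close>.
  On a subcell this interpolant still meets the conditions required there, which are among those on
  \<open>T\<close>; by uniqueness it agrees with the interpolant of the subcell, so pullbacks are
  single-valued.\<close>

lemma interpolator_in_global_space:
  assumes u: "smooth u" "periodic e u"
  shows "interpolator K X F u \<in> global_space e K X"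
  unfolding global_space_def mem_Collect_eq
proof (intro allI impI)
  fix k assume k: "k \<le> CARD('n)"
  have uk: "deg_part k u \<in> smooth_kforms k" for k using u by (intro deg_part_smooth_kforms)
  show "deg_part k (interpolator K X F u) \<in> global_kforms e K X k"
    unfolding global_kforms_def mem_Collect_eq
  proof (intro conjI exI[of _ "\<lambda>T. LI k T (deg_part k u)"] ballI impI)
    show "periodic e (deg_part k (interpolator K X F u))"
      using interpolator_periodic[OF u] by (rule periodic_deg_part)
    show "is_kform k (deg_part k (interpolator K X F u))"
      by (simp add: is_kform_def deg_part_nth)
    fix T assume T: "T \<in> K"
    show "LI k T (deg_part k u) \<in> X k T"
      using T uk by (rule LI_mem)
    {
      fix T' assume T': "T' \<in> K" "T' \<subseteq> T"
      have "interpolates K X F k T' (deg_part k u) (LI k T (deg_part k u))"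
        using interpolates_LI[OF T uk] X_subcell[OF T T'] T' unfolding interpolates_def by blast
      then show "same_pullback T' (LI k T (deg_part k u)) (LI k T' (deg_part k u))"
        using interpolates_unique[OF T'(1) uk] interpolates_LI[OF T'(1) uk] by blast
    }
    assume cell: "is_cell CARD('n) T"
    have "T - cell_interior T \<in> null_sets lebesgue"
      using cell_interior_full(3)[OF cell] by (simp add: negligible_iff_null_sets)
    then show "AE x in lebesgue. x \<in> T \<longrightarrow> deg_part k (interpolator K X F u) x = LI k T (deg_part k u) x"
    proof (rule AE_I', intro subsetI)
      fix x assume "x \<in> {x \<in> space lebesgue. \<not> (x \<in> T \<longrightarrow> deg_part k (interpolator K X F u) x = LI k T (deg_part k u) x)}"
      then have x: "x \<in> T" "deg_part k (interpolator K X F u) x \<noteq> LI k T (deg_part k u) x" by auto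
      have "x \<notin> cell_interior T"
      proof
        assume xi: "x \<in> cell_interior T"
        have "is_kform m (LI m T (deg_part m u))" for m
          using LI_smooth_kform[OF T uk] by (simp add: smooth_kforms_def)
        then have zero: "LI m T (deg_part m u) x $ I = 0" if "card I \<noteq> m" for m I
          using that by (auto simp: is_kform_def)
        have "deg_part k (interpolator K X F u) x $ I = LI k T (deg_part k u) x $ I" for I
        proof (cases "card I = k")
          case True
          \<comment> \<open>Interpolants of degree m have no components outside degree m, so only m
            = k contributes to an index set of size k.\<close>
          have "interpolator K X F u x $ I = (\<Sum>m\<le>CARD('n). LI m T (deg_part m u) x $ I)"
            using interpolator_eq[of T x u] T cell xi by simp
          also have "\<dots> = (\<Sum>m\<in>{k}. LI m T (deg_part m u) x $ I)"
            using k True zero by (intro sum.mono_neutral_right) auto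
          finally show ?thesis using True by (simp add: deg_part_nth)
        qed (simp add: deg_part_nth zero)
        then show False using x(2) by (simp add: vec_eq_iff)
      qed
      then show "x \<in> T - cell_interior T" using x(1) by simp
    qed
  qed
qed

text \<open>Injectivity of the mollified interpolator is only available inside the discrete space
  and will be applied to differences of its elements.\<close>

lemma global_space_lincomb:
  assumes "u \<in> global_space e K X" "v \<in> global_space e K X"
  shows "(\<lambda>x. a *\<^sub>R u x + b *\<^sub>R v x) \<in> global_space e K X"
  unfolding global_space_def mem_Collect_eq
proof (intro allI impI)
  fix k assume k: "k \<le> CARD('n)"
  have eq: "deg_part k (\<lambda>x. a *\<^sub>R u x + b *\<^sub>R v x) = (\<lambda>x. a *\<^sub>R deg_part k u x + b *\<^sub>R deg_part k v x)"
    by (auto simp: deg_part_def vec_eq_iff fun_eq_iff)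
  have gu: "deg_part k u \<in> global_kforms e K X k" and gv: "deg_part k v \<in> global_kforms e K X k"
    using assms k by (auto simp: global_space_def)
  from gu obtain w where
    u: "periodic e (deg_part k u)" "is_kform k (deg_part k u)" "\<forall>T\<in>K. w T \<in> X k T"
      "\<forall>T\<in>K. \<forall>T'\<in>K. T' \<subseteq> T \<longrightarrow> same_pullback T' (w T) (w T')"
      "\<forall>T\<in>K. is_cell CARD('n) T \<longrightarrow> (AE x in lebesgue. x \<in> T \<longrightarrow> deg_part k u x = w T x)"
    unfolding global_kforms_def mem_Collect_eq by (elim conjE exE)
  from gv obtain z where v: "periodic e (deg_part k v)" "is_kform k (deg_part k v)" "\<forall>T\<in>K. z T \<in> X k T"
      "\<forall>T\<in>K. \<forall>T'\<in>K. T' \<subseteq> T \<longrightarrow> same_pullback T' (z T) (z T')"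
      "\<forall>T\<in>K. is_cell CARD('n) T \<longrightarrow> (AE x in lebesgue. x \<in> T \<longrightarrow> deg_part k v x = z T x)"
    unfolding global_kforms_def mem_Collect_eq by (elim conjE exE)
  show "deg_part k (\<lambda>x. a *\<^sub>R u x + b *\<^sub>R v x) \<in> global_kforms e K X k"
    unfolding eq global_kforms_def mem_Collect_eq
  proof (intro conjI exI[of _ "\<lambda>T x. a *\<^sub>R w T x + b *\<^sub>R z T x"] ballI impI)
    show "periodic e (\<lambda>x. a *\<^sub>R deg_part k u x + b *\<^sub>R deg_part k v x)"
      using u(1) v(1) by (simp add: periodic_def)
    show "is_kform k (\<lambda>x. a *\<^sub>R deg_part k u x + b *\<^sub>R deg_part k v x)"
      using u(2) v(2) by (simp add: is_kform_def)
    fix T assume T: "T \<in> K"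
    show "(\<lambda>x. a *\<^sub>R w T x + b *\<^sub>R z T x) \<in> X k T"
      using X_lincomb T u(3) v(3) by blast
    show "same_pullback T' (\<lambda>x. a *\<^sub>R w T x + b *\<^sub>R z T x) (\<lambda>x. a *\<^sub>R w T' x + b *\<^sub>R z T' x)"
      if "T' \<in> K" "T' \<subseteq> T" for T'
      using that T u(4) v(4) by (intro same_pullback_lincomb) blast+
    assume "is_cell CARD('n) T"
    then have "AE x in lebesgue. x \<in> T \<longrightarrow> deg_part k u x = w T x"
       "AE x in lebesgue. x \<in> T \<longrightarrow> deg_part k v x = z T x" using T u(5) v(5) by blast+
    then show "AE x in lebesgue. x \<in> T \<longrightarrow> a *\<^sub>R deg_part k u x + b *\<^sub>R deg_part k v x = a *\<^sub>R w T x + b *\<^sub>R z T x"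
      by eventually_elim auto
  qed
qed

lemma global_space_diff:
  "u \<in> global_space e K X \<Longrightarrow> v \<in> global_space e K X \<Longrightarrow> (\<lambda>x. u x - v x) \<in> global_space e K X"
  using global_space_lincomb[of u v 1 "-1"] by simp

end

section \<open>Local stability of mollified interpolation\<close>

lemma compact_bdd_above_partial:
  fixes u :: "'n::finite euclid \<Rightarrow> 'b::real_normed_vector"
  assumes "compact T" "smooth u"
  shows "bdd_above ((\<lambda>x. norm (partial_deriv js u x)) ` T)"
proof -
  have "compact ((\<lambda>x. norm (partial_deriv js u x)) ` T)"
    by (intro compact_continuous_image continuous_on_norm smooth_continuous_on assms)
  then show ?thesis
    by (intro bounded_imp_bdd_above compact_imp_bounded)
qed

lemma finite_lists_le: "finite {js :: 'n::finite list. length js \<le> m}"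
  using finite_lists_length_le[of "UNIV :: 'n set" m] by simp

lemma norm_le_Cm_norm:
  fixes u :: "'n::finite euclid \<Rightarrow> 'b::real_normed_vector"
  assumes T: "compact T" "x \<in> T" and u: "smooth u" and "0 \<le> \<delta>"
  shows "norm (u x) \<le> Cm_norm \<delta> m T u"
proof -
  let ?t = "\<lambda>js. \<delta> ^ length js * (SUP x\<in>T. norm (partial_deriv js u x))"
  have up: "norm (partial_deriv js u x) \<le> (SUP x\<in>T. norm (partial_deriv js u x))" for js
    by (rule cSUP_upper[OF T(2) compact_bdd_above_partial[OF T(1) u]])
  then have nonneg: "0 \<le> ?t js" for js
    using assms(4) order_trans[OF norm_ge_zero up] by (intro mult_nonneg_nonneg) auto
  have "norm (u x) \<le> ?t []" using up[of "[]"] by simp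
  also have "\<dots> \<le> (\<Sum>js | length js \<le> m. ?t js)"
    by (rule member_le_sum) (use nonneg finite_lists_le in auto)
  finally show ?thesis by (simp add: Cm_norm_def)
qed

lemma Cm_norm_le:
  fixes u :: "'n::finite euclid \<Rightarrow> 'b::real_normed_vector"
  assumes "\<And>js y. length js \<le> m \<Longrightarrow> y \<in> T \<Longrightarrow> norm (partial_deriv js u y) \<le> B js"
    and "T \<noteq> {}" "0 \<le> \<delta>"
  shows "Cm_norm \<delta> m T u \<le> (\<Sum>js | length js \<le> m. \<delta> ^ length js * B js)"
  unfolding Cm_norm_def
  by (intro sum_mono mult_left_mono cSUP_least assms) (use assms in auto)

text \<open>The factor n + 1 counts the degrees of forms, \<open>max C 0\<close> makes the
  interpolation bound monotone whatever the sign of \<open>C\<close>, and a derivative of the scaled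
  mollifier, bounded through \<open>B\<close>, brings powers of 1 / \<epsilon>. No power of h
  remains, thanks to the scaling of the C^m norm.\<close>

definition stability_constant :: "('n::finite list \<Rightarrow> real) \<Rightarrow> real \<Rightarrow> nat \<Rightarrow> real \<Rightarrow> real" where
  "stability_constant B \<epsilon> m C = (real CARD('n) + 1) * (max C 0 *
     (\<Sum>js | length js \<le> m. (1 / \<epsilon>) ^ (CARD('n) + length js) * B js))"

lemma set_integral_norm_mono:
  fixes g :: "'a::euclidean_space \<Rightarrow> 'b::euclidean_space"
  assumes "locally_integrable g" "A \<subseteq> B" "bounded B" "A \<in> sets lebesgue" "B \<in> sets lebesgue"
  shows "(LINT y:A|lebesgue. norm (g y)) \<le> (LINT y:B|lebesgue. norm (g y))"
proof -
  have int: "set_integrable lebesgue S (\<lambda>y. norm (g y))" if "bounded S" "S \<in> sets lebesgue" for S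
    by (rule set_integrable_norm[OF locally_integrable_bounded[OF assms(1) that]])
  have bA: "bounded A" using assms(2,3) bounded_subset[of B A] by simp
  show ?thesis
    unfolding set_lebesgue_integral_def
    by (rule integral_mono)
       (use int[OF bA assms(4)] int[OF assms(3,5)] assms(2) in \<open>auto simp: set_integrable_def indicator_def\<close>)
qed

text \<open>A derivative of order l of the mollified function costs the power -(n + l) of \<epsilon>
  h, and the scaled C^m norm pays h^l, so that only h^-n is left in front of an integral over a
  ball. Its radius is h for the diameter of \<open>T\<close> plus \<epsilon> h for the support of
  the kernel. Having an integral of |g| on the right, not a supremum, is what permits L2
  estimates.\<close>

lemma (in fe_interpolation) mollified_interpolator_bound:
  assumes \<phi>: "mollifier p \<phi>" and pos: "0 < \<epsilon>" "0 < h"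
    and B: "\<And>js y. norm (partial_deriv js \<phi> y) \<le> B js"
    and bounded: "\<And>T k u. is_full T \<Longrightarrow> u \<in> smooth_kforms k \<Longrightarrow> Cm_norm h m T (LI k T u) \<le> C * Cm_norm h m T u"
    and T: "is_full T" "x \<in> cell_interior T" and diam: "diameter T \<le> h"
    and g: "locally_integrable g"
  shows "norm (interpolator K X F (mollify \<phi> (\<epsilon> * h) g) x)
    \<le> stability_constant B \<epsilon> m C * ((1 / h) ^ CARD('n) * (LINT y:cball x ((1 + \<epsilon>) * h)|lebesgue. norm (g y)))"
proof -
  let ?n = "CARD('n)"
  let ?\<kappa> = "mollifier_kernel \<phi> (\<epsilon> * h)"
  let ?J = "LINT y:cball x ((1 + \<epsilon>) * h)|lebesgue. norm (g y)"
  have \<epsilon>h: "0 < \<epsilon> * h" using pos by simp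
  have ker: "kernel ?\<kappa> (\<epsilon> * h)" using \<phi> \<epsilon>h by (rule kernel_mollifier)
  have s\<phi>: "smooth \<phi>" using \<phi> by (simp add: mollifier_def)
  have eq: "mollify \<phi> (\<epsilon> * h) g = conv ?\<kappa> g" using \<phi> \<epsilon>h g by (rule mollify_eq_conv)
  have sm: "smooth (conv ?\<kappa> g)" by (rule kernel.conv_smooth(2)[OF ker g])
  have cT: "compact T" using T(1) is_cell_compact by blast
  have xT: "x \<in> T" using T cell_interior_full(2)[of T] by blast
  have J: "0 \<le> ?J" unfolding set_lebesgue_integral_def by (intro integral_nonneg_AE) auto
  have B0: "0 \<le> B js" for js using B[of js 0] norm_ge_zero order_trans by blast
  define b where "b js = (1 / (\<epsilon> * h)) ^ (?n + length js) * B js * ?J" for js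
  have partial: "norm (partial_deriv js (deg_part k (conv ?\<kappa> g)) y) \<le> b js" if y: "y \<in> T" for js k y
  proof -
    let ?D = "partial_deriv js ?\<kappa>"
    have kD: "kernel ?D (\<epsilon> * h)" by (rule kernel.kernel_partial[OF ker])
    have bD: "norm (?D z) \<le> (1 / (\<epsilon> * h)) ^ (?n + length js) * B js" for z
      unfolding partial_deriv_mollifier_kernel(1)[OF s\<phi>] norm_mult
      by (intro mult_mono B) (use pos in auto)
    have "norm (partial_deriv js (deg_part k (conv ?\<kappa> g)) y) \<le> norm (conv ?D g y)"
      unfolding partial_deriv_deg_part(1)[OF sm] kernel.conv_smooth(1)[OF ker g] by (rule norm_deg_part_le)
    also have "\<dots> \<le> (1 / (\<epsilon> * h)) ^ (?n + length js) * B js * (LINT z:cball y (\<epsilon> * h)|lebesgue. norm (g z))"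
      by (rule bound_integrable_conv(2)[OF smooth_continuous[OF kernel.smooth_k[OF kD]] bD kernel.supp_k[OF kD] g])
    also have "\<dots> \<le> b js"
    proof -
      have "dist x y \<le> h"
        using diameter_bounded_bound[OF compact_imp_bounded[OF cT] xT y] diam by simp
      then have sub: "cball y (\<epsilon> * h) \<subseteq> cball x ((1 + \<epsilon>) * h)"
        using dist_triangle[of x _ y] by (auto simp: algebra_simps) (smt (verit))
      have "(LINT z:cball y (\<epsilon> * h)|lebesgue. norm (g z)) \<le> ?J"
        by (rule set_integral_norm_mono[OF g sub]) auto
      then show ?thesis
        unfolding b_def by (intro mult_left_mono) (use B0 pos in auto)
    qed
    finally show ?thesis .
  qed
  have each_degree: "norm (LI k T (deg_part k (conv ?\<kappa> g)) x) \<le> max C 0 * (\<Sum>js | length js \<le> m. h ^ length js * b js)" for k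
  proof -
    have sk: "deg_part k (conv ?\<kappa> g) \<in> smooth_kforms k" by (rule deg_part_smooth_kforms[OF sm])
    have "LI k T (deg_part k (conv ?\<kappa> g)) \<in> smooth_kforms k" using T sk by (intro LI_smooth_kform) auto
    then have "norm (LI k T (deg_part k (conv ?\<kappa> g)) x) \<le> Cm_norm h m T (LI k T (deg_part k (conv ?\<kappa> g)))"
      by (intro norm_le_Cm_norm cT xT) (use pos in \<open>auto simp: smooth_kforms_def\<close>)
    also have "\<dots> \<le> C * Cm_norm h m T (deg_part k (conv ?\<kappa> g))"
      by (rule bounded[OF T(1) sk])
    also have "\<dots> \<le> max C 0 * Cm_norm h m T (deg_part k (conv ?\<kappa> g))"
    proof (rule mult_right_mono)
      show "0 \<le> Cm_norm h m T (deg_part k (conv ?\<kappa> g))"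
        by (rule order_trans[OF norm_ge_zero norm_le_Cm_norm[OF cT xT]])
           (use sk pos in \<open>auto simp: smooth_kforms_def\<close>)
    qed simp
    also have "\<dots> \<le> max C 0 * (\<Sum>js | length js \<le> m. h ^ length js * b js)"
      by (intro mult_left_mono Cm_norm_le partial) (use pos xT in auto)
    finally show ?thesis .
  qed
  have "norm (interpolator K X F (mollify \<phi> (\<epsilon> * h) g) x)
      \<le> (\<Sum>k\<le>?n. max C 0 * (\<Sum>js | length js \<le> m. h ^ length js * b js))"
    unfolding eq interpolator_eq[OF T] by (rule sum_norm_le[OF each_degree])
  also have "\<dots> = (real ?n + 1) * (max C 0 * (\<Sum>js | length js \<le> m. h ^ length js * b js))"
    by simp
  also have "(\<Sum>js | length js \<le> m. h ^ length js * b js)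
     = (\<Sum>js | length js \<le> m. (1 / \<epsilon>) ^ (?n + length js) * B js) * ((1 / h) ^ ?n * ?J)"
    unfolding sum_distrib_right
  proof (rule sum.cong[OF refl])
    fix js :: "'n list"
    have "h ^ length js * (1 / (\<epsilon> * h)) ^ (?n + length js) = (1 / \<epsilon>) ^ (?n + length js) * (1 / h) ^ ?n"
      using pos by (simp add: power_add field_simps)
    then show "h ^ length js * b js = (1 / \<epsilon>) ^ (?n + length js) * B js * ((1 / h) ^ ?n * ?J)"
      by (simp add: b_def mult.assoc[symmetric])
  qed
  finally show ?thesis
    by (simp add: stability_constant_def mult.assoc)
qed

section \<open>Polynomials\<close>

lemma finite_multiindices: "finite {\<alpha> :: 'n::finite \<Rightarrow> nat. (\<Sum>i\<in>UNIV. \<alpha> i) \<le> p}"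
proof (rule finite_subset)
  show "finite (PiE (UNIV :: 'n set) (\<lambda>_. {..p}))" by (intro finite_PiE) auto
  show "{\<alpha> :: 'n \<Rightarrow> nat. (\<Sum>i\<in>UNIV. \<alpha> i) \<le> p} \<subseteq> PiE UNIV (\<lambda>_. {..p})"
  proof
    fix \<alpha> :: "'n \<Rightarrow> nat" assume \<alpha>: "\<alpha> \<in> {\<alpha>. (\<Sum>i\<in>UNIV. \<alpha> i) \<le> p}"
    have "\<alpha> i \<le> (\<Sum>i\<in>UNIV. \<alpha> i)" for i by (rule member_le_sum) auto
    then have "\<alpha> i \<le> p" for i using \<alpha> order_trans by fastforce
    then show "\<alpha> \<in> PiE UNIV (\<lambda>_. {..p})" by (simp add: PiE_UNIV_domain)
  qed
qed

lemma poly_degree_le_zero: "poly_degree_le p (\<lambda>x. 0)"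
  unfolding poly_degree_le_def by (rule exI[of _ "\<lambda>_. 0"]) simp

lemma poly_degree_le_cmult: "poly_degree_le p q \<Longrightarrow> poly_degree_le p (\<lambda>x. a * q x)"
proof -
  assume "poly_degree_le p q"
  then obtain c where "q = (\<lambda>x. \<Sum>\<alpha> | (\<Sum>i\<in>UNIV. \<alpha> i) \<le> p. c \<alpha> * (\<Prod>i\<in>UNIV. (x $ i) ^ \<alpha> i))"
    unfolding poly_degree_le_def by blast
  then show ?thesis
    unfolding poly_degree_le_def
    by (intro exI[of _ "\<lambda>\<alpha>. a * c \<alpha>"]) (simp add: sum_distrib_left mult.assoc)
qed

lemma poly_degree_le_add: "poly_degree_le p q \<Longrightarrow> poly_degree_le p q' \<Longrightarrow> poly_degree_le p (\<lambda>x. q x + q' x)"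
proof -
  assume "poly_degree_le p q" "poly_degree_le p q'"
  then obtain c c' where "q = (\<lambda>x. \<Sum>\<alpha> | (\<Sum>i\<in>UNIV. \<alpha> i) \<le> p. c \<alpha> * (\<Prod>i\<in>UNIV. (x $ i) ^ \<alpha> i))"
    "q' = (\<lambda>x. \<Sum>\<alpha> | (\<Sum>i\<in>UNIV. \<alpha> i) \<le> p. c' \<alpha> * (\<Prod>i\<in>UNIV. (x $ i) ^ \<alpha> i))"
    unfolding poly_degree_le_def by blast
  then show ?thesis
    unfolding poly_degree_le_def
    by (intro exI[of _ "\<lambda>\<alpha>. c \<alpha> + c' \<alpha>"]) (simp add: sum.distrib algebra_simps)
qed

lemma poly_degree_le_sum:
  assumes "\<And>i. i \<in> A \<Longrightarrow> poly_degree_le p (q i)"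
  shows "poly_degree_le p (\<lambda>x. \<Sum>i\<in>A. q i x)"
  using assms
  by (induction A rule: infinite_finite_induct) (simp_all add: poly_degree_le_zero poly_degree_le_add)

lemma poly_degree_le_mono:
  assumes "poly_degree_le p q" "p \<le> p'"
  shows "poly_degree_le p' q"
proof -
  obtain c where c: "q = (\<lambda>x. \<Sum>\<alpha> | (\<Sum>i\<in>UNIV. \<alpha> i) \<le> p. c \<alpha> * (\<Prod>i\<in>UNIV. (x $ i) ^ \<alpha> i))"
    using assms unfolding poly_degree_le_def by blast
  have "q x = (\<Sum>\<alpha> | (\<Sum>i\<in>UNIV. \<alpha> i) \<le> p'. (if (\<Sum>i\<in>UNIV. \<alpha> i) \<le> p then c \<alpha> else 0) * (\<Prod>i\<in>UNIV. (x $ i) ^ \<alpha> i))" for x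
    unfolding c using assms(2) by (intro sum.mono_neutral_cong_left finite_multiindices) auto
  then show ?thesis
    unfolding poly_degree_le_def by (intro exI[of _ "\<lambda>\<alpha>. if (\<Sum>i\<in>UNIV. \<alpha> i) \<le> p then c \<alpha> else 0"] ext)
qed

text \<open>Multiplication by the coordinate j raises the exponent at j by one. The coefficients are
  transported along this injective shift \<open>up\<close> and set to 0 off its range, where the
  exponent at j is 0.\<close>

lemma poly_degree_le_coord_mult:
  assumes "poly_degree_le p q"
  shows "poly_degree_le (Suc p) (\<lambda>x. x $ j * q x)"
proof -
  obtain c where c: "q = (\<lambda>x. \<Sum>\<alpha> | (\<Sum>i\<in>UNIV. \<alpha> i) \<le> p. c \<alpha> * (\<Prod>i\<in>UNIV. (x $ i) ^ \<alpha> i))"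
    using assms unfolding poly_degree_le_def by blast
  define up where "up \<alpha> = \<alpha>(j := Suc (\<alpha> j))" for \<alpha> :: "'a \<Rightarrow> nat"
  define down where "down \<alpha> = \<alpha>(j := \<alpha> j - 1)" for \<alpha> :: "'a \<Rightarrow> nat"
  have du: "down (up \<alpha>) = \<alpha>" for \<alpha> by (simp add: up_def down_def)
  have sum_up: "(\<Sum>i\<in>UNIV. up \<alpha> i) = Suc (\<Sum>i\<in>UNIV. \<alpha> i)" for \<alpha>
    by (simp add: up_def sum.remove[of UNIV j])
  have prod_up: "(\<Prod>i\<in>UNIV. (x $ i) ^ up \<alpha> i) = x $ j * (\<Prod>i\<in>UNIV. (x $ i) ^ \<alpha> i)" for \<alpha> and x :: "'a euclid"
    by (simp add: up_def prod.remove[of UNIV j] mult.assoc)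
  define c' where "c' \<alpha> = (if \<alpha> \<in> range up then c (down \<alpha>) else 0)" for \<alpha>
  have "x $ j * q x = (\<Sum>\<alpha> | (\<Sum>i\<in>UNIV. \<alpha> i) \<le> Suc p. c' \<alpha> * (\<Prod>i\<in>UNIV. (x $ i) ^ \<alpha> i))" for x
  proof -
    have inj: "inj_on up A" for A by (rule inj_on_inverseI[of _ down]) (rule du)
    have "x $ j * q x = (\<Sum>\<alpha> | (\<Sum>i\<in>UNIV. \<alpha> i) \<le> p. c' (up \<alpha>) * (\<Prod>i\<in>UNIV. (x $ i) ^ up \<alpha> i))"
      unfolding c sum_distrib_left prod_up by (intro sum.cong) (auto simp: c'_def du)
    also have "\<dots> = (\<Sum>\<alpha>\<in>up ` {\<alpha>. (\<Sum>i\<in>UNIV. \<alpha> i) \<le> p}. c' \<alpha> * (\<Prod>i\<in>UNIV. (x $ i) ^ \<alpha> i))"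
      by (simp add: sum.reindex[OF inj])
    also have "\<dots> = (\<Sum>\<alpha> | (\<Sum>i\<in>UNIV. \<alpha> i) \<le> Suc p. c' \<alpha> * (\<Prod>i\<in>UNIV. (x $ i) ^ \<alpha> i))"
    proof (rule sum.mono_neutral_left[OF finite_multiindices])
      show "up ` {\<alpha>. (\<Sum>i\<in>UNIV. \<alpha> i) \<le> p} \<subseteq> {\<alpha>. (\<Sum>i\<in>UNIV. \<alpha> i) \<le> Suc p}"
        by (auto simp: sum_up)
      show "\<forall>\<alpha>\<in>{\<alpha>. (\<Sum>i\<in>UNIV. \<alpha> i) \<le> Suc p} - up ` {\<alpha>. (\<Sum>i\<in>UNIV. \<alpha> i) \<le> p}.
          c' \<alpha> * (\<Prod>i\<in>UNIV. (x $ i) ^ \<alpha> i) = 0"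
        by (auto simp: c'_def sum_up)
    qed
    finally show ?thesis .
  qed
  then show ?thesis
    unfolding poly_degree_le_def by (intro exI[of _ c'] ext)
qed

lemma poly_degree_le_affine_mult:
  assumes "poly_degree_le p q"
  shows "poly_degree_le (Suc p) (\<lambda>x. (b + a * x $ j) * q x)"
proof -
  have "poly_degree_le (Suc p) (\<lambda>x. b * q x + a * (x $ j * q x))"
    by (intro poly_degree_le_add poly_degree_le_cmult poly_degree_le_coord_mult
        poly_degree_le_mono[OF assms]) (use assms in auto)
  then show ?thesis by (simp add: algebra_simps)
qed

lemma poly_degree_le_const: "poly_degree_le p (\<lambda>x :: 'n::finite euclid. a)"
proof -
  have "{\<alpha> :: 'n \<Rightarrow> nat. (\<Sum>i\<in>UNIV. \<alpha> i) \<le> 0} = {\<lambda>_. 0}" by auto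
  then have "poly_degree_le 0 (\<lambda>x :: 'n::finite euclid. a)"
    unfolding poly_degree_le_def by (intro exI[of _ "\<lambda>_. a"]) simp
  then show ?thesis by (rule poly_degree_le_mono) simp
qed

text \<open>The affine factors cover at once the recentred Taylor monomials, with a = 1, and their
  values at y + \<delta> z inside the mollifier, with a = \<delta>.\<close>

lemma poly_degree_le_prod:
  fixes b :: "'n::finite \<Rightarrow> real"
  shows "poly_degree_le (length js) (\<lambda>x. \<Prod>j\<leftarrow>js. b j + a * x $ j)"
  by (induction js) (simp_all add: poly_degree_le_const poly_degree_le_affine_mult)

section \<open>Taylor polynomials\<close>

text \<open>The k-th derivative along z, as a sum over ordered lists instead of multi-indices. In
  \<open>taylor\<close> every list then has the same coefficient 1 / k!, and symmetry of mixed
  derivatives never enters.\<close>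

definition taylor_term :: "nat \<Rightarrow> ('n::finite euclid \<Rightarrow> 'b::real_normed_vector) \<Rightarrow> 'n euclid \<Rightarrow> 'n euclid \<Rightarrow> 'b" where
  "taylor_term k f x z = (\<Sum>js | length js = k. (\<Prod>j\<leftarrow>js. z $ j) *\<^sub>R partial_deriv js f x)"

text \<open>The number \<open>m\<close> counts terms: the degree is below \<open>m\<close>,
  \<open>taylor 0\<close> is 0, and the bound m \<le> p + 1 in later statements means degree at most
  \<open>p\<close>.\<close>

definition taylor :: "nat \<Rightarrow> ('n::finite euclid \<Rightarrow> 'b::real_normed_vector) \<Rightarrow> 'n euclid \<Rightarrow> 'n euclid \<Rightarrow> 'b" where
  "taylor m f x z = (\<Sum>k<m. (1 / fact k) *\<^sub>R taylor_term k f x z)"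

lemma taylor_component_poly:
  fixes f :: "'n::finite form"
  assumes "m \<le> p + 1"
  shows "poly_degree_le p (\<lambda>y. taylor m f x (b + a *\<^sub>R y) $ I)"
proof -
  have "poly_degree_le p (\<lambda>y. \<Sum>k<m. \<Sum>js | length js = k. ((1 / fact k) * partial_deriv js f x $ I) * (\<Prod>j\<leftarrow>js. b $ j + a * y $ j))"
  proof (intro poly_degree_le_sum poly_degree_le_cmult)
    fix k and js :: "'n list" assume "k \<in> {..<m}" "js \<in> {js. length js = k}"
    then show "poly_degree_le p (\<lambda>y. \<Prod>j\<leftarrow>js. b $ j + a * y $ j)"
      using assms by (intro poly_degree_le_mono[OF poly_degree_le_prod]) auto
  qed
  then show ?thesis
    by (simp add: taylor_def taylor_term_def sum_distrib_left ac_simps)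
qed

lemma continuous_on_prod_list [continuous_intros]:
  fixes g :: "'j \<Rightarrow> 'a::topological_space \<Rightarrow> real"
  assumes "\<And>j. continuous_on A (g j)"
  shows "continuous_on A (\<lambda>x. \<Prod>j\<leftarrow>js. g j x)"
  by (induction js) (auto intro!: continuous_intros assms)

lemma continuous_on_taylor:
  assumes "smooth f" "continuous_on A g" "continuous_on A k"
  shows "continuous_on A (\<lambda>p. taylor m f (g p) (k p))"
  unfolding taylor_def taylor_term_def
  by (intro continuous_intros assms continuous_on_compose2[OF smooth_continuous_on[OF assms(1)] assms(2)]) auto

lemma integral_lebesgue_scale:
  fixes f :: "'a::euclidean_space \<Rightarrow> real"
  assumes c: "c \<noteq> 0" and f: "f \<in> borel_measurable lebesgue"
  shows "(\<integral>x. f x \<partial>lebesgue) = \<bar>c\<bar> ^ DIM('a) * (\<integral>x. f (c *\<^sub>R x) \<partial>lebesgue)"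
proof -
  have eq: "(\<lambda>x::'a. 0 + (\<Sum>j\<in>Basis. (c * (x \<bullet> j)) *\<^sub>R j)) = (\<lambda>x. c *\<^sub>R x)"
    by (simp add: scaleR_scaleR[symmetric] scaleR_sum_right[symmetric] euclidean_representation del: scaleR_scaleR)
  have leb: "lebesgue = density (distr lebesgue lebesgue (\<lambda>x::'a. c *\<^sub>R x)) (\<lambda>_. ennreal (\<bar>c\<bar> ^ DIM('a)))"
    using lebesgue_affine_euclidean[of "\<lambda>_. c" "0::'a"] c unfolding eq by (simp add: prod_constant)
  have "(\<integral>x. f x \<partial>lebesgue) = (\<integral>x. f x \<partial>density (distr lebesgue lebesgue (\<lambda>x::'a. c *\<^sub>R x)) (\<lambda>_. ennreal (\<bar>c\<bar> ^ DIM('a))))"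
    by (subst (1) leb) (rule refl)
  also have "\<dots> = \<bar>c\<bar> ^ DIM('a) * (\<integral>x. f (c *\<^sub>R x) \<partial>lebesgue)"
    using f by (subst integral_density) (auto simp: integral_distr lebesgue_measurable_scaling)
  finally show ?thesis .
qed

text \<open>The moment condition says that averaging against \<phi>(-z) evaluates a polynomial of
  degree up to \<open>p\<close> at 0. It is applied, component by component, to the polynomial z
  \<mapsto> q(y + \<delta> z).\<close>

lemma conv_taylor:
  fixes f :: "'n::finite form"
  assumes \<phi>: "mollifier p \<phi>" and \<delta>: "0 < \<delta>" and m: "m \<le> p + 1" and f: "smooth f"
  shows "conv (mollifier_kernel \<phi> \<delta>) (\<lambda>y. taylor m f x (y - x)) = (\<lambda>y. taylor m f x (y - x))"
proof (rule ext)
  fix y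
  define q where "q y = taylor m f x (y - x)" for y
  note ker = kernel_mollifier[OF \<phi> \<delta>]
  have s\<phi>: "smooth \<phi>" using \<phi> by (simp add: mollifier_def)
  have cq: "continuous_on A q" for A
    unfolding q_def by (intro continuous_on_taylor f continuous_intros)
  have "conv (mollifier_kernel \<phi> \<delta>) q y $ I = q y $ I" for I
  proof -
    have cI: "continuous_on UNIV (\<lambda>y. q y $ I)" by (intro continuous_intros cq)
    let ?g = "\<lambda>z. mollifier_kernel \<phi> \<delta> z * q (y - z) $ I"
    have c1: "continuous_on UNIV ?g"
      by (intro continuous_intros smooth_continuous[OF kernel.smooth_k[OF ker]] continuous_on_compose2[OF cq[of UNIV]]) auto
    have "conv (mollifier_kernel \<phi> \<delta>) q y $ I = conv (mollifier_kernel \<phi> \<delta>) (\<lambda>y. q y $ I) y"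
      by (rule kernel.conv_bounded_linear[OF ker bounded_linear_vec_nth continuous_locally_integrable[OF cq]])
    also have "\<dots> = (\<integral>z. ?g z \<partial>lebesgue)"
      using kernel.conv_eq_reflected(1)[OF ker continuous_locally_integrable[OF cI]] by simp
    \<comment> \<open>The negative scaling factor produces the reflected argument of \<phi> for
      which the moment condition is stated.\<close>
    also have "\<dots> = \<bar>- \<delta>\<bar> ^ DIM('n euclid) * (\<integral>z. ?g ((- \<delta>) *\<^sub>R z) \<partial>lebesgue)"
      by (rule integral_lebesgue_scale) (use \<delta> continuous_borel_measurable_lebesgue[OF c1] in auto)
    also have "\<dots> = (\<integral>z. \<phi> (- z) * q (y + \<delta> *\<^sub>R z) $ I \<partial>lebesgue)"
    proof -
      have "?g ((- \<delta>) *\<^sub>R z) = (1 / \<delta>) ^ CARD('n) * (\<phi> (- z) * q (y + \<delta> *\<^sub>R z) $ I)" for z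
        using \<delta> by (simp add: mollifier_kernel_def)
      then show ?thesis using \<delta> by (simp add: power_divide)
    qed
    also have "\<dots> = q (y + \<delta> *\<^sub>R 0) $ I"
    proof -
      have "poly_degree_le p (\<lambda>z. q (y + \<delta> *\<^sub>R z) $ I)"
        using taylor_component_poly[OF m, of f x "y - x" \<delta> I] unfolding q_def by (simp add: algebra_simps)
      then show ?thesis using \<phi> unfolding mollifier_def by blast
    qed
    finally show ?thesis by simp
  qed
  then show "conv (mollifier_kernel \<phi> \<delta>) (\<lambda>y. taylor m f x (y - x)) y = taylor m f x (y - x)"
    unfolding q_def[symmetric] by (simp add: vec_eq_iff)
qed

lemma taylor_polynomial_kform:
  fixes f :: "'n::{finite,linorder} form"
  assumes "m \<le> p + 1"
  shows "deg_part k (\<lambda>y. taylor m f x (y - x)) \<in> polynomial_kforms p k"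
proof -
  have "poly_degree_le p (\<lambda>y. deg_part k (\<lambda>y. taylor m f x (y - x)) y $ I)" for I
    using taylor_component_poly[OF assms, of f x "- x" 1 I] poly_degree_le_zero[of p]
    by (cases "card I = k") (simp_all add: deg_part_nth)
  then show ?thesis
    by (simp add: polynomial_kforms_def is_kform_def deg_part_nth)
qed

section \<open>Taylor remainders in mean square\<close>

definition taylor_rem :: "nat \<Rightarrow> ('n::finite euclid \<Rightarrow> 'b::real_normed_vector) \<Rightarrow> 'n euclid \<Rightarrow> 'n euclid \<Rightarrow> 'b" where
  "taylor_rem m f x z = f (x + z) - taylor m f x z"

lemma prod_list_scale: "(\<Prod>j\<leftarrow>js. (t *\<^sub>R z) $ j) = t ^ length js * (\<Prod>j\<leftarrow>js. z $ j)"
  by (induction js) auto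

lemma taylor_term_scale: "taylor_term k f x (t *\<^sub>R z) = t ^ k *\<^sub>R taylor_term k f x z"
  unfolding taylor_term_def scaleR_sum_right by (rule sum.cong) (auto simp: prod_list_scale)

text \<open>The last entry of a list is the innermost derivative. Splitting it off exposes
  \<open>partial_deriv [j] f\<close>, to which an induction hypothesis for arbitrary functions can
  be applied.\<close>

lemma sum_lists_Suc:
  "(\<Sum>js | length js = Suc k. g js) = (\<Sum>j\<in>UNIV. \<Sum>js | length js = k. g (js @ [j :: 'n::finite]))"
proof -
  have eq: "{js :: 'n list. length js = Suc k} = (\<lambda>(j, js). js @ [j]) ` (UNIV \<times> {js. length js = k})"
  proof (intro set_eqI iffI)
    fix js :: "'n list" assume js: "js \<in> {js. length js = Suc k}"
    then have "js = butlast js @ [last js]" by (cases js rule: rev_cases) auto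
    then show "js \<in> (\<lambda>(j, js). js @ [j]) ` (UNIV \<times> {js. length js = k})"
      using js by (intro image_eqI[of _ _ "(last js, butlast js)"]) auto
  qed auto
  have inj: "inj_on (\<lambda>(j, js). js @ [j]) (UNIV \<times> {js :: 'n list. length js = k})"
    by (auto simp: inj_on_def)
  show ?thesis
    unfolding eq sum.reindex[OF inj] sum.cartesian_product by (simp add: case_prod_unfold)
qed

lemma taylor_term_Suc:
  "taylor_term (Suc k) f x z = (\<Sum>j\<in>UNIV. (z $ j) *\<^sub>R taylor_term k (partial_deriv [j] f) x z)"
  unfolding taylor_term_def sum_lists_Suc scaleR_sum_right
  by (intro sum.cong refl) (simp add: partial_deriv_append mult.commute)

lemma taylor_term_0: "taylor_term 0 f x z = f x"
  by (simp add: taylor_term_def)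

lemma taylor_rem_zero: "taylor_rem (Suc m) f x 0 = 0"
proof -
  have "taylor_term k f x 0 = 0 ^ k *\<^sub>R taylor_term k f x 0" for k
    using taylor_term_scale[of k f x 0 0] by simp
  then have "taylor_term (Suc k) f x 0 = 0" for k
    by (metis power_0_Suc scale_zero_left)
  then have "taylor (Suc m) f x 0 = f x"
    unfolding taylor_def by (simp add: sum.lessThan_Suc_shift taylor_term_0 del: sum.lessThan_Suc)
  then show ?thesis by (simp add: taylor_rem_def)
qed

text \<open>Along a segment, the derivative of the remainder of order m + 1 of \<open>f\<close> is a
  combination of remainders of order m of its first partial derivatives. Bounds then follow by
  induction from the fundamental theorem of calculus, without an explicit integral kernel.\<close>

lemma taylor_rem_has_vector_derivative:
  fixes f :: "'n::finite euclid \<Rightarrow> 'b::real_normed_vector"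
  assumes f: "smooth f"
  shows "((\<lambda>t. taylor_rem (Suc m) f x (t *\<^sub>R z)) has_vector_derivative
      (\<Sum>j\<in>UNIV. (z $ j) *\<^sub>R taylor_rem m (partial_deriv [j] f) x (t *\<^sub>R z))) (at t within S)"
proof -
  have 1: "((\<lambda>t. x + t *\<^sub>R z) has_derivative (\<lambda>s. s *\<^sub>R z)) (at t)"
    by (auto intro!: derivative_eq_intros)
  have "((\<lambda>t. f (x + t *\<^sub>R z)) has_derivative
      (\<lambda>s. \<Sum>j\<in>UNIV. ((s *\<^sub>R z) $ j) *\<^sub>R partial_deriv [j] f (x + t *\<^sub>R z))) (at t)"
    by (rule has_derivative_compose[OF 1 smooth_has_derivative[OF f]])
  then have D1: "((\<lambda>t. f (x + t *\<^sub>R z)) has_vector_derivative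
      (\<Sum>j\<in>UNIV. (z $ j) *\<^sub>R partial_deriv [j] f (x + t *\<^sub>R z))) (at t)"
    unfolding has_vector_derivative_def by (simp add: scaleR_sum_right)
  have tay: "taylor (Suc m) f x (t *\<^sub>R z) = f x + (\<Sum>k<m. (t ^ Suc k / fact (Suc k)) *\<^sub>R taylor_term (Suc k) f x z)" for t
    unfolding taylor_def sum.lessThan_Suc_shift by (simp add: taylor_term_scale taylor_term_0)
  have pow: "((\<lambda>t. t ^ Suc k / fact (Suc k)) has_field_derivative (t ^ k / fact k :: real)) (at t)" for k and t :: real
  proof -
    have "((\<lambda>t. t ^ Suc k / fact (Suc k)) has_field_derivative (of_nat (Suc k) * t ^ k / fact (Suc k) :: real)) (at t)"
      using DERIV_cdivide[OF DERIV_pow[of "Suc k" t UNIV], of "fact (Suc k)"] by simp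
    moreover have "of_nat (Suc k) * t ^ k / fact (Suc k) = t ^ k / (fact k :: real)"
      by (simp add: divide_simps fact_Suc del: of_nat_Suc)
    ultimately show ?thesis by simp
  qed
  have "((\<lambda>t. (\<Sum>k<m. (t ^ Suc k / fact (Suc k)) *\<^sub>R taylor_term (Suc k) f x z)) has_vector_derivative
     (\<Sum>k<m. (t ^ k / fact k) *\<^sub>R taylor_term (Suc k) f x z)) (at t)"
  proof (rule has_vector_derivative_sum)
    fix k
    show "((\<lambda>t. (t ^ Suc k / fact (Suc k)) *\<^sub>R taylor_term (Suc k) f x z) has_vector_derivative
        (t ^ k / fact k) *\<^sub>R taylor_term (Suc k) f x z) (at t)"
      using has_vector_derivative_scaleR[OF pow[of k t] has_vector_derivative_const[of "taylor_term (Suc k) f x z"]]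
      by (simp only: scaleR_zero_right add_0_left)
  qed
  from has_vector_derivative_diff[OF D1 has_vector_derivative_add[OF has_vector_derivative_const[of "f x"] this]]
  have "((\<lambda>t. taylor_rem (Suc m) f x (t *\<^sub>R z)) has_vector_derivative
     (\<Sum>j\<in>UNIV. (z $ j) *\<^sub>R partial_deriv [j] f (x + t *\<^sub>R z)) - (0 + (\<Sum>k<m. (t ^ k / fact k) *\<^sub>R taylor_term (Suc k) f x z))) (at t)"
    unfolding taylor_rem_def tay .
  moreover have "(\<Sum>k<m. (t ^ k / fact k) *\<^sub>R taylor_term (Suc k) f x z)
      = (\<Sum>j\<in>UNIV. (z $ j) *\<^sub>R taylor m (partial_deriv [j] f) x (t *\<^sub>R z))"
    unfolding taylor_def taylor_term_scale taylor_term_Suc scaleR_sum_right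
    by (subst sum.swap) (simp add: mult.commute mult.left_commute)
  ultimately have "((\<lambda>t. taylor_rem (Suc m) f x (t *\<^sub>R z)) has_vector_derivative
      (\<Sum>j\<in>UNIV. (z $ j) *\<^sub>R taylor_rem m (partial_deriv [j] f) x (t *\<^sub>R z))) (at t)"
    by (simp add: taylor_rem_def scaleR_diff_right sum_subtractf)
  then show ?thesis by (rule has_vector_derivative_at_within)
qed

lemma continuous_on_taylor_rem:
  assumes "smooth f" "continuous_on A g" "continuous_on A k"
  shows "continuous_on A (\<lambda>p. taylor_rem m f (g p) (k p))"
  unfolding taylor_rem_def
  by (intro continuous_intros continuous_on_taylor assms continuous_on_compose2[OF smooth_continuous[OF assms(1), of UNIV]]) auto

lemma norm_sum_scaleR_sq_le:
  fixes v :: "'n::finite \<Rightarrow> 'b::real_normed_vector" and z :: "'n euclid"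
  shows "(norm (\<Sum>j\<in>UNIV. (z $ j) *\<^sub>R v j))\<^sup>2 \<le> (norm z)\<^sup>2 * (\<Sum>j\<in>UNIV. (norm (v j))\<^sup>2)"
proof -
  have "norm (\<Sum>j\<in>UNIV. (z $ j) *\<^sub>R v j) \<le> (\<Sum>j\<in>UNIV. \<bar>z $ j\<bar> * \<bar>norm (v j)\<bar>)"
    by (rule sum_norm_le) simp
  also have "\<dots> \<le> L2_set (\<lambda>j. z $ j) UNIV * L2_set (\<lambda>j. norm (v j)) UNIV"
    by (rule L2_set_mult_ineq)
  also have "L2_set (\<lambda>j. z $ j) UNIV = norm z" by (simp add: norm_vec_def L2_set_def)
  finally have "(norm (\<Sum>j\<in>UNIV. (z $ j) *\<^sub>R v j))\<^sup>2 \<le> (norm z * L2_set (\<lambda>j. norm (v j)) UNIV)\<^sup>2"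
    by (intro power_mono) auto
  then show ?thesis by (simp add: power_mult_distrib L2_set_def sum_nonneg)
qed

lemma nn_integral_cmult_sum:
  assumes "\<And>j. j \<in> A \<Longrightarrow> G j \<in> borel_measurable M"
  shows "(\<integral>\<^sup>+t. c * (\<Sum>j\<in>A. G j t) \<partial>M) = c * (\<Sum>j\<in>A. \<integral>\<^sup>+t. G j t \<partial>M)"
  by (subst nn_integral_cmult) (auto intro!: borel_measurable_sum simp: nn_integral_sum assms)

lemma nn_integral_square_le:
  fixes f :: "'a \<Rightarrow> ennreal"
  assumes [measurable]: "f \<in> borel_measurable M" "A \<in> sets M"
  shows "(\<integral>\<^sup>+x\<in>A. f x \<partial>M)\<^sup>2 \<le> emeasure M A * (\<integral>\<^sup>+x\<in>A. (f x)\<^sup>2 \<partial>M)"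
proof -
  have "(\<integral>\<^sup>+x. f x * indicator A x \<partial>M) = (\<integral>\<^sup>+x. indicator A x * (f x * indicator A x) \<partial>M)"
    by (intro nn_integral_cong) (auto simp: indicator_def)
  then have "(\<integral>\<^sup>+x. f x * indicator A x \<partial>M)\<^sup>2 \<le> (\<integral>\<^sup>+x. (indicator A x)\<^sup>2 \<partial>M) * (\<integral>\<^sup>+x. (f x * indicator A x)\<^sup>2 \<partial>M)"
    using Cauchy_Schwarz_nn_integral[of "indicator A" M "\<lambda>x. f x * indicator A x"] by simp
  also have "(\<integral>\<^sup>+x. (indicator A x)\<^sup>2 \<partial>M) = (\<integral>\<^sup>+x. indicator A x \<partial>M)"
    by (intro nn_integral_cong) (auto simp: indicator_def)
  also have "\<dots> = emeasure M A" by simp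
  also have "(\<integral>\<^sup>+x. (f x * indicator A x)\<^sup>2 \<partial>M) = (\<integral>\<^sup>+x. (f x)\<^sup>2 * indicator A x \<partial>M)"
    by (intro nn_integral_cong) (auto simp: indicator_def)
  finally show ?thesis .
qed

lemma ennreal_norm_integral_le:
  "ennreal (norm (\<integral>x. f x \<partial>M)) \<le> (\<integral>\<^sup>+x. ennreal (norm (f x)) \<partial>M)"
proof (cases "integrable M f")
  case True
  then show ?thesis by (rule integral_norm_bound_ennreal)
qed (simp add: not_integrable_integral_eq)

text \<open>The remainder vanishes at t = 0, so it is the integral of its derivative over [0, 1].
  Cauchy-Schwarz is used twice: in t, on an interval of length 1, and in the sum over coordinates,
  which yields |z|^2.\<close>

lemma taylor_rem_pointwise:
  fixes f :: "'n::finite euclid \<Rightarrow> 'b::euclidean_space"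
  assumes f: "smooth f"
  shows "ennreal ((norm (taylor_rem (Suc m) f x z))\<^sup>2)
    \<le> ennreal ((norm z)\<^sup>2) * (\<Sum>j\<in>UNIV. \<integral>\<^sup>+t\<in>{0..1}. ennreal ((norm (taylor_rem m (partial_deriv [j] f) x (t *\<^sub>R z)))\<^sup>2) \<partial>lborel)"
proof -
  define R where "R j t = taylor_rem m (partial_deriv [j] f) x (t *\<^sub>R z)" for j t
  define D where "D t = (\<Sum>j\<in>UNIV. (z $ j) *\<^sub>R R j t)" for t
  have cR: "continuous_on A (R j)" for A j
    unfolding R_def by (intro continuous_on_taylor_rem smooth_partial_deriv f continuous_intros)
  have cD: "continuous_on A D" for A unfolding D_def by (intro continuous_intros cR)
  have [measurable]: "R j \<in> borel_measurable borel" "D \<in> borel_measurable borel" for j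
    by (intro borel_measurable_continuous_onI cR cD)+
  have "(\<integral>t. indicator {0..1} t *\<^sub>R D t \<partial>lborel) = taylor_rem (Suc m) f x (1 *\<^sub>R z) - taylor_rem (Suc m) f x (0 *\<^sub>R z)"
    unfolding D_def R_def
    by (rule integral_FTC_Icc[OF _ taylor_rem_has_vector_derivative[OF f]])
       (use cD[unfolded D_def R_def] in auto)
  then have "taylor_rem (Suc m) f x z = (\<integral>t. indicator {0..1} t *\<^sub>R D t \<partial>lborel)"
    by (simp add: taylor_rem_zero)
  then have "ennreal (norm (taylor_rem (Suc m) f x z)) \<le> (\<integral>\<^sup>+t. ennreal (norm (indicator {0..1} t *\<^sub>R D t)) \<partial>lborel)"
    using ennreal_norm_integral_le[of lborel "\<lambda>t. indicator {0..1} t *\<^sub>R D t"] by (simp only:)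
  also have "\<dots> = (\<integral>\<^sup>+t\<in>{0..1}. ennreal (norm (D t)) \<partial>lborel)"
    by (intro nn_integral_cong) (auto simp: indicator_def)
  finally have "(ennreal (norm (taylor_rem (Suc m) f x z)))\<^sup>2 \<le> (\<integral>\<^sup>+t\<in>{0..1}. ennreal (norm (D t)) \<partial>lborel)\<^sup>2"
    by (intro power_mono) auto
  also have "\<dots> \<le> emeasure lborel {0..1::real} * (\<integral>\<^sup>+t\<in>{0..1}. (ennreal (norm (D t)))\<^sup>2 \<partial>lborel)"
    by (rule nn_integral_square_le) auto
  also have "\<dots> = (\<integral>\<^sup>+t\<in>{0..1}. ennreal ((norm (D t))\<^sup>2) \<partial>lborel)"
    by (simp add: ennreal_power)
  also have "\<dots> \<le> (\<integral>\<^sup>+t. ennreal ((norm z)\<^sup>2) * (\<Sum>j\<in>UNIV. ennreal ((norm (R j t))\<^sup>2) * indicator {0..1} t) \<partial>lborel)"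
  proof (intro nn_integral_mono)
    fix t :: real
    have "ennreal ((norm (D t))\<^sup>2) \<le> ennreal ((norm z)\<^sup>2) * (\<Sum>j\<in>UNIV. ennreal ((norm (R j t))\<^sup>2))"
      using norm_sum_scaleR_sq_le[of z "\<lambda>j. R j t"]
      by (simp add: D_def sum_ennreal ennreal_mult[symmetric] sum_nonneg ennreal_leI)
    then show "ennreal ((norm (D t))\<^sup>2) * indicator {0..1} t
      \<le> ennreal ((norm z)\<^sup>2) * (\<Sum>j\<in>UNIV. ennreal ((norm (R j t))\<^sup>2) * indicator {0..1} t)"
      by (auto simp: indicator_def)
  qed
  also have "\<dots> = ennreal ((norm z)\<^sup>2) * (\<Sum>j\<in>UNIV. \<integral>\<^sup>+t\<in>{0..1}. ennreal ((norm (R j t))\<^sup>2) \<partial>lborel)"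
    by (rule nn_integral_cmult_sum) measurable
  finally show ?thesis
    by (simp add: R_def ennreal_power)
qed

context torus_basis
begin

lemma L2sq_lborel: "L2sq u = (\<integral>\<^sup>+x\<in>fund_cell e. ennreal ((norm (u x))\<^sup>2) \<partial>lborel)"
  by (simp add: L2sq_def nn_integral_completion)

text \<open>Tonelli's theorem is applied over \<open>lborel\<close>, where joint continuity of
  \<open>g\<close> provides product measurability. The variable t will be the parameter on a segment
  as well as the offset z in a ball.\<close>

lemma nn_integral_L2sq_swap:
  fixes g :: "'n euclid \<Rightarrow> 'c::euclidean_space \<Rightarrow> 'b::euclidean_space"
  assumes g: "continuous_on UNIV (\<lambda>(x, t). g x t)" and A: "A \<in> sets borel"
  shows "(\<integral>\<^sup>+x\<in>fund_cell e. (\<integral>\<^sup>+t\<in>A. ennreal ((norm (g x t))\<^sup>2) \<partial>lborel) \<partial>lborel)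
      = (\<integral>\<^sup>+t\<in>A. L2sq (\<lambda>x. g x t) \<partial>lborel)"
proof -
  have "(\<lambda>(x, t). g x t) \<in> borel_measurable borel"
    using g by (rule borel_measurable_continuous_onI)
  then have [measurable]: "(\<lambda>p. g (fst p) (snd p)) \<in> borel_measurable (lborel \<Otimes>\<^sub>M lborel)"
    by (simp add: lborel_prod case_prod_unfold)
  have [measurable]: "fund_cell e \<in> sets borel" "A \<in> sets borel" by (rule borel_fund_cell, rule A)
  let ?f = "\<lambda>x t. ennreal ((norm (g x t))\<^sup>2) * indicator A t * indicator (fund_cell e) x"
  have m: "case_prod ?f \<in> borel_measurable (lborel \<Otimes>\<^sub>M lborel)"
    unfolding case_prod_unfold by measurable
  have m2: "(\<lambda>t. ennreal ((norm (g x t))\<^sup>2) * indicator A t) \<in> borel_measurable lborel" for x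
  proof -
    have "continuous_on UNIV (\<lambda>t :: 'c. (x, t))"
      by (rule continuous_on_Pair[OF continuous_on_const continuous_on_id])
    from continuous_on_compose2[OF g this] have "continuous_on UNIV (g x)" by simp
    then have [measurable]: "g x \<in> borel_measurable borel" by (rule borel_measurable_continuous_onI)
    show ?thesis by measurable
  qed
  have m1: "(\<lambda>x. ennreal ((norm (g x t))\<^sup>2) * indicator (fund_cell e) x) \<in> borel_measurable lborel" for t
  proof -
    have "continuous_on UNIV (\<lambda>x :: 'n euclid. (x, t))"
      by (rule continuous_on_Pair[OF continuous_on_id continuous_on_const])
    from continuous_on_compose2[OF g this] have "continuous_on UNIV (\<lambda>x. g x t)" by simp
    then have [measurable]: "(\<lambda>x. g x t) \<in> borel_measurable borel" by (rule borel_measurable_continuous_onI)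
    show ?thesis by measurable
  qed
  have "(\<integral>\<^sup>+x\<in>fund_cell e. (\<integral>\<^sup>+t\<in>A. ennreal ((norm (g x t))\<^sup>2) \<partial>lborel) \<partial>lborel)
      = (\<integral>\<^sup>+x. \<integral>\<^sup>+t. ?f x t \<partial>lborel \<partial>lborel)"
    by (intro nn_integral_cong nn_integral_multc[symmetric] m2)
  also have "\<dots> = (\<integral>\<^sup>+t. \<integral>\<^sup>+x. ?f x t \<partial>lborel \<partial>lborel)"
    by (rule lborel_pair.Fubini'[OF m, symmetric])
  also have "\<dots> = (\<integral>\<^sup>+t. L2sq (\<lambda>x. g x t) * indicator A t \<partial>lborel)"
    unfolding L2sq_lborel
    by (intro nn_integral_cong, subst nn_integral_multc[OF m1, symmetric]) (simp add: ac_simps)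
  finally show ?thesis .
qed

lemma nn_integral_L2sq_swap_le:
  fixes g :: "'n euclid \<Rightarrow> 'c::euclidean_space \<Rightarrow> 'b::euclidean_space"
  assumes g: "continuous_on UNIV (\<lambda>(x, t). g x t)" and A: "A \<in> sets borel"
    and le: "\<And>t. t \<in> A \<Longrightarrow> L2sq (\<lambda>x. g x t) \<le> c"
  shows "(\<integral>\<^sup>+x\<in>fund_cell e. (\<integral>\<^sup>+t\<in>A. ennreal ((norm (g x t))\<^sup>2) \<partial>lborel) \<partial>lborel) \<le> c * emeasure lborel A"
proof -
  have "(\<integral>\<^sup>+t\<in>A. L2sq (\<lambda>x. g x t) \<partial>lborel) \<le> (\<integral>\<^sup>+t\<in>A. c \<partial>lborel)"
    by (intro nn_integral_mono) (use le in \<open>auto simp: indicator_def\<close>)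
  also have "\<dots> = c * emeasure lborel A"
    using A by (simp add: nn_integral_cmult_indicator)
  finally show ?thesis using nn_integral_L2sq_swap[OF g A] by simp
qed

lemma borel_set_nn_integral:
  fixes g :: "'n euclid \<Rightarrow> 'c::euclidean_space \<Rightarrow> 'b::euclidean_space"
  assumes g: "continuous_on UNIV (\<lambda>(x, t). g x t)" and A: "A \<in> sets borel"
  shows "(\<lambda>x. \<integral>\<^sup>+t\<in>A. ennreal ((norm (g x t))\<^sup>2) \<partial>lborel) \<in> borel_measurable borel"
proof -
  have "(\<lambda>(x, t). g x t) \<in> borel_measurable borel"
    using g by (rule borel_measurable_continuous_onI)
  then have [measurable]: "(\<lambda>p. g (fst p) (snd p)) \<in> borel_measurable (lborel \<Otimes>\<^sub>M lborel)"
    by (simp add: lborel_prod case_prod_unfold)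
  have [measurable]: "A \<in> sets borel" by (rule A)
  have "(\<lambda>p. ennreal ((norm (g (fst p) (snd p)))\<^sup>2) * indicator A (snd p)) \<in> borel_measurable (lborel \<Otimes>\<^sub>M lborel)"
    by measurable
  from lborel.borel_measurable_nn_integral_fst[OF this]
  show ?thesis by simp
qed

lemma smooth_periodic_partial:
  assumes "smooth f" "periodic e f"
  shows "periodic e (partial_deriv js f)"
  unfolding periodic_def
proof (intro ballI allI)
  fix l x assume "l \<in> lattice e"
  then have "(\<lambda>x. f (x + l)) = f" using assms(2) unfolding periodic_def by auto
  then show "partial_deriv js f (x + l) = partial_deriv js f x"
    using partial_deriv_translate(1)[OF assms(1), of js l] by (metis)
qed

text \<open>The offset z is fixed and the base point is integrated. At m = 0 the remainder is f(x +
  z) and translation invariance applies; each further order contributes |z|^2, because |t z| \<le>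
  |z| for t in [0, 1].\<close>

lemma taylor_rem_L2:
  fixes f :: "'n euclid \<Rightarrow> 'b::euclidean_space"
  assumes "smooth f" "periodic e f"
  shows "L2sq (\<lambda>x. taylor_rem m f x z) \<le> ennreal ((norm z)\<^sup>2) ^ m * (\<Sum>js | length js = m. L2sq (partial_deriv js f))"
  using assms
proof (induction m arbitrary: f z)
  case 0
  have "f \<in> borel_measurable lebesgue"
    by (intro continuous_borel_measurable_lebesgue smooth_continuous 0)
  then show ?case
    using L2sq_translate[OF 0(2), of z] by (simp add: taylor_rem_def taylor_def)
next
  case (Suc m)
  let ?S = "\<lambda>j. \<Sum>js | length js = m. L2sq (partial_deriv js (partial_deriv [j] f))"
  let ?R = "\<lambda>j x t. taylor_rem m (partial_deriv [j] f) x (t *\<^sub>R z)"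
  let ?c = "ennreal ((norm z)\<^sup>2)"
  have cont: "continuous_on UNIV (\<lambda>(x, t). ?R j x t)" for j
    unfolding case_prod_unfold
    by (intro continuous_on_taylor_rem smooth_partial_deriv Suc.prems continuous_intros)
  have meas: "(\<lambda>x. (\<integral>\<^sup>+t\<in>{0..1}. ennreal ((norm (?R j x t))\<^sup>2) \<partial>lborel)) \<in> borel_measurable borel" for j
    by (rule borel_set_nn_integral[OF cont]) simp
  note [measurable] = meas borel_fund_cell
  have each: "L2sq (\<lambda>x. ?R j x t) \<le> ?c ^ m * ?S j" if "t \<in> {0..1}" for j t
  proof -
    have "L2sq (\<lambda>x. ?R j x t) \<le> ennreal ((norm (t *\<^sub>R z))\<^sup>2) ^ m * ?S j"
      by (intro Suc.IH smooth_partial_deriv smooth_periodic_partial Suc.prems)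
    also have "\<dots> \<le> ?c ^ m * ?S j"
    proof -
      have "norm (t *\<^sub>R z) \<le> 1 * norm z" unfolding norm_scaleR using that by (intro mult_right_mono) auto
      then show ?thesis by (intro mult_right_mono power_mono ennreal_leI) auto
    qed
    finally show ?thesis .
  qed
  have "L2sq (\<lambda>x. taylor_rem (Suc m) f x z)
     \<le> (\<integral>\<^sup>+x\<in>fund_cell e. (?c * (\<Sum>j\<in>UNIV. \<integral>\<^sup>+t\<in>{0..1}. ennreal ((norm (?R j x t))\<^sup>2) \<partial>lborel)) \<partial>lborel)"
    unfolding L2sq_lborel
    by (intro nn_integral_mono mult_right_mono taylor_rem_pointwise Suc.prems) auto
  also have "\<dots> = ?c * (\<Sum>j\<in>UNIV. \<integral>\<^sup>+x\<in>fund_cell e. (\<integral>\<^sup>+t\<in>{0..1}. ennreal ((norm (?R j x t))\<^sup>2) \<partial>lborel) \<partial>lborel)"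
    unfolding mult.assoc sum_distrib_right by (rule nn_integral_cmult_sum) measurable
  also have "\<dots> \<le> ?c * (\<Sum>j\<in>UNIV. (?c ^ m * ?S j) * emeasure lborel {0..1::real})"
    by (intro mult_left_mono sum_mono nn_integral_L2sq_swap_le cont each) auto
  also have "\<dots> = ?c ^ Suc m * (\<Sum>j\<in>UNIV. ?S j)"
    by (simp add: sum_distrib_left mult.assoc)
  also have "(\<Sum>j\<in>UNIV. ?S j) = (\<Sum>js | length js = Suc m. L2sq (partial_deriv js f))"
    by (simp add: sum_lists_Suc partial_deriv_append)
  finally show ?case .
qed

end

section \<open>Interpolation error for smooth forms\<close>

lemma ennreal_set_lebesgue_integral_norm:
  fixes g :: "'a::euclidean_space \<Rightarrow> 'b::euclidean_space"
  assumes "locally_integrable g" "bounded A" "A \<in> sets lebesgue"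
  shows "ennreal (LINT y:A|lebesgue. norm (g y)) = (\<integral>\<^sup>+y\<in>A. ennreal (norm (g y)) \<partial>lebesgue)"
proof -
  have "integrable lebesgue (\<lambda>y. indicator A y *\<^sub>R norm (g y))"
    using set_integrable_norm[OF locally_integrable_bounded[OF assms]] unfolding set_integrable_def .
  then have "ennreal (LINT y:A|lebesgue. norm (g y)) = (\<integral>\<^sup>+y. ennreal (indicator A y *\<^sub>R norm (g y)) \<partial>lebesgue)"
    unfolding set_lebesgue_integral_def by (intro nn_integral_eq_integral[symmetric]) auto
  also have "\<dots> = (\<integral>\<^sup>+y\<in>A. ennreal (norm (g y)) \<partial>lebesgue)"
    by (intro nn_integral_cong) (auto simp: indicator_def)
  finally show ?thesis .
qed

lemma ennreal_sum_square_le: "(a + b)\<^sup>2 \<le> 2 * a\<^sup>2 + 2 * (b::ennreal)\<^sup>2"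
proof (cases "a = \<infinity> \<or> b = \<infinity>")
  case True
  then show ?thesis by (auto simp: power2_eq_square ennreal_top_mult ennreal_mult_top)
next
  case False
  then obtain x y where "0 \<le> x" "0 \<le> y" "a = ennreal x" "b = ennreal y"
    by (metis ennreal_cases infinity_ennreal_def)
  then show ?thesis
    using sum_squares_bound[of x y]
    by (simp add: ennreal_power ennreal_plus[symmetric] ennreal_mult'[symmetric] ennreal_leI power2_sum
        flip: ennreal_numeral del: ennreal_plus)
qed

lemma nn_integral_translate_cball:
  assumes "f \<in> borel_measurable borel"
  shows "(\<integral>\<^sup>+y\<in>cball x r. f y \<partial>lebesgue) = (\<integral>\<^sup>+z\<in>cball 0 r. f (x + z :: 'a::euclidean_space) \<partial>lborel)"
proof -
  have m: "(\<lambda>y. f y * indicator (cball x r) y) \<in> borel_measurable lebesgue"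
  proof (intro measurable_completion)
    note [measurable] = assms
    have [measurable]: "cball x r \<in> sets borel" by simp
    show "(\<lambda>y. f y * indicator (cball x r) y) \<in> borel_measurable lborel" by measurable
  qed
  have "(\<integral>\<^sup>+y. f y * indicator (cball x r) y \<partial>lebesgue) = (\<integral>\<^sup>+z. f (z + x) * indicator (cball x r) (z + x) \<partial>lebesgue)"
    by (rule nn_integral_lebesgue_translate[OF m, symmetric])
  also have "\<dots> = (\<integral>\<^sup>+z. f (x + z) * indicator (cball 0 r) z \<partial>lebesgue)"
    by (intro nn_integral_cong) (auto simp: indicator_def dist_norm add.commute)
  finally show ?thesis by (simp add: nn_integral_completion)
qed

text \<open>The first summand comes from (f - q)(x), the second from the stability constant
  \<open>A\<close>. The square of the latter meets the volume of the ball of radius (1 + \<epsilon>)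
  h twice, in Cauchy-Schwarz and in the integration over offsets, and h^-n cancels it each time. The
  last factor is what the radius leaves beside h to the power 2 r.\<close>

definition smooth_error_constant :: "nat \<Rightarrow> real \<Rightarrow> real \<Rightarrow> nat \<Rightarrow> real" where
  "smooth_error_constant n A \<epsilon> r = (2 + 2 * A\<^sup>2 * (unit_ball_vol (real n) * (1 + \<epsilon>) ^ n)\<^sup>2) * ((1 + \<epsilon>) ^ r)\<^sup>2"

text \<open>The polynomial varies with x and is not periodic, but the comparison at x involves it
  only on a ball around x. In terms of offsets z the ball no longer depends on x, so x can be
  integrated for every fixed z.\<close>

lemma (in fe_interpolation) smooth_interpolation_error:
  fixes f :: "'n form"
  assumes \<phi>: "mollifier p \<phi>" and pos: "0 < \<epsilon>" "0 < h"
    and B: "\<And>js y. norm (partial_deriv js \<phi> y) \<le> B js"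
    and bounded: "\<And>T k u. is_full T \<Longrightarrow> u \<in> smooth_kforms k \<Longrightarrow> Cm_norm h m T (LI k T u) \<le> C * Cm_norm h m T u"
    and diam: "\<And>T. T \<in> K \<Longrightarrow> diameter T \<le> h"
    and polynomials: "\<And>T k. T \<in> K \<Longrightarrow> polynomial_kforms p k \<subseteq> X k T"
    and f: "smooth f" "periodic e f" and r: "r \<le> p + 1"
  shows "L2sq (\<lambda>x. f x - interpolator K X F (mollify \<phi> (\<epsilon> * h) f) x)
    \<le> ennreal (smooth_error_constant CARD('n) (stability_constant B \<epsilon> m C) \<epsilon> r * (h ^ r)\<^sup>2)
      * (\<Sum>js | length js = r. L2sq (partial_deriv js f))"
proof -
  let ?n = "CARD('n)"
  define \<rho> where "\<rho> = (1 + \<epsilon>) * h"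
  define A where "A = stability_constant B \<epsilon> m C"
  define S where "S = (\<Sum>js | length js = r. L2sq (partial_deriv js f))"
  let ?V = "emeasure lborel (cball (0 :: 'n euclid) \<rho>)"
  let ?R = "\<lambda>x z. taylor_rem r f x z"
  let ?Q = "\<lambda>u. interpolator K X F (mollify \<phi> (\<epsilon> * h) u)"
  let ?c = "ennreal ((A * (1 / h) ^ ?n)\<^sup>2)"
  have \<rho>: "0 < \<rho>" using pos by (simp add: \<rho>_def)
  have \<epsilon>h: "0 < \<epsilon> * h" using pos by simp
  note ker = kernel_mollifier[OF \<phi> \<epsilon>h]
  have B0: "0 \<le> B js" for js using B[of js 0] norm_ge_zero order_trans by blast
  have A0: "0 \<le> A"
    unfolding A_def stability_constant_def using B0 pos by (intro mult_nonneg_nonneg sum_nonneg) auto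
  have cf: "continuous_on UNIV f" by (rule smooth_continuous[OF f(1)])
  have contR: "continuous_on UNIV (\<lambda>(x, z). ?R x z)"
    unfolding case_prod_unfold by (intro continuous_on_taylor_rem f continuous_intros)
  have contR0: "continuous_on UNIV (\<lambda>x. ?R x 0)"
    by (intro continuous_on_taylor_rem f continuous_intros)
  have contR1: "continuous_on UNIV (\<lambda>z. ?R x z)" for x
    by (intro continuous_on_taylor_rem f continuous_intros)
  \<comment> \<open>The first summand is 0 unless r = 0, when the Taylor polynomial is 0 and the
    summand equals |f(x)|; keeping it treats all orders alike.\<close>
  have pointwise: "norm (f x - ?Q f x) \<le> norm (?R x 0) + A * ((1 / h) ^ ?n * (LINT y:cball x \<rho>|lebesgue. norm (?R x (y - x))))"
    if T: "is_full T" "x \<in> cell_interior T" for T x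
  proof -
    define q where "q y = taylor r f x (y - x)" for y
    have cq: "continuous_on UNIV q"
      unfolding q_def by (intro continuous_on_taylor f continuous_intros)
    have lf: "locally_integrable f" and lq: "locally_integrable q"
      using cf cq by (auto intro: continuous_locally_integrable)
    have lfq: "locally_integrable (\<lambda>y. f y - q y)" by (rule locally_integrable_diff[OF lf lq])
    have "q = (\<lambda>y. taylor r f x (y - x))" by (simp add: q_def fun_eq_iff)
    \<comment> \<open>Mollification fixes \<open>q\<close> everywhere, so the interpolator is fed
      \<open>q\<close> itself; its homogeneous parts lie in the local spaces and are reproduced at
      x.\<close>
    then have mq: "mollify \<phi> (\<epsilon> * h) q = q"
      using mollify_eq_conv[OF \<phi> \<epsilon>h lq] conv_taylor[OF \<phi> \<epsilon>h r f(1), of x] by simp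
    have sq: "smooth q" using kernel.conv_smooth(2)[OF ker lq] mollify_eq_conv[OF \<phi> \<epsilon>h lq] mq by simp
    have smf: "smooth (mollify \<phi> (\<epsilon> * h) f)"
      using kernel.conv_smooth(2)[OF ker lf] mollify_eq_conv[OF \<phi> \<epsilon>h lf] by simp
    have qX: "deg_part k q \<in> X k T" for k
      using taylor_polynomial_kform[OF r, of k f x] polynomials T(1) unfolding q_def by blast
    have md: "mollify \<phi> (\<epsilon> * h) (\<lambda>y. f y - q y) = (\<lambda>y. mollify \<phi> (\<epsilon> * h) f y - q y)"
      using mollify_eq_conv[OF \<phi> \<epsilon>h lfq] mollify_eq_conv[OF \<phi> \<epsilon>h lf] mollify_eq_conv[OF \<phi> \<epsilon>h lq]
        kernel.conv_diff[OF ker lf lq] mq by (simp add: fun_eq_iff)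
    have "?Q (\<lambda>y. f y - q y) x = ?Q f x - q x"
      unfolding md interpolator_diff[OF T smf sq] interpolator_projection[OF T qX] ..
    then have "f x - ?Q f x = (f x - q x) - ?Q (\<lambda>y. f y - q y) x" by simp
    then have "norm (f x - ?Q f x) \<le> norm (f x - q x) + norm (?Q (\<lambda>y. f y - q y) x)"
      by (metis norm_triangle_ineq4)
    also have "norm (?Q (\<lambda>y. f y - q y) x) \<le> A * ((1 / h) ^ ?n * (LINT y:cball x \<rho>|lebesgue. norm (f y - q y)))"
      unfolding A_def \<rho>_def
      by (rule mollified_interpolator_bound[OF \<phi> pos B bounded T _ lfq]) (use diam T in auto)
    finally show ?thesis by (simp add: q_def taylor_rem_def)
  qed
  have sq_bound: "ennreal ((norm (f x - ?Q f x))\<^sup>2)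
      \<le> 2 * ennreal ((norm (?R x 0))\<^sup>2) + 2 * (?c * (?V * (\<integral>\<^sup>+z\<in>cball 0 \<rho>. ennreal ((norm (?R x z))\<^sup>2) \<partial>lborel)))"
    if T: "is_full T" "x \<in> cell_interior T" for T x
  proof -
    have lR: "locally_integrable (\<lambda>y. ?R x (y - x))"
      by (intro continuous_locally_integrable continuous_on_taylor_rem f continuous_intros)
    have [measurable]: "(\<lambda>y. ?R x (y - x)) \<in> borel_measurable borel" "(\<lambda>z. ?R x z) \<in> borel_measurable borel"
      by (intro borel_measurable_continuous_onI continuous_on_taylor_rem f continuous_intros)+
    let ?J = "LINT y:cball x \<rho>|lebesgue. norm (?R x (y - x))"
    have J: "0 \<le> ?J" unfolding set_lebesgue_integral_def by (intro integral_nonneg_AE) auto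
    have "norm (f x - ?Q f x) \<le> norm (?R x 0) + A * (1 / h) ^ ?n * ?J"
      using pointwise[OF T] by (simp only: mult.assoc)
    then have "ennreal (norm (f x - ?Q f x)) \<le> ennreal (norm (?R x 0) + A * (1 / h) ^ ?n * ?J)"
      by (rule ennreal_leI)
    also have "\<dots> = ennreal (norm (?R x 0)) + ennreal (A * (1 / h) ^ ?n * ?J)"
      using A0 J pos by (intro ennreal_plus mult_nonneg_nonneg) auto
    finally have "ennreal (norm (f x - ?Q f x)) \<le> ennreal (norm (?R x 0)) + ennreal (A * (1 / h) ^ ?n * ?J)" .
    then have "(ennreal (norm (f x - ?Q f x)))\<^sup>2 \<le> (ennreal (norm (?R x 0)) + ennreal (A * (1 / h) ^ ?n * ?J))\<^sup>2"
      by (intro power_mono) auto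
    also have "\<dots> \<le> 2 * (ennreal (norm (?R x 0)))\<^sup>2 + 2 * (ennreal (A * (1 / h) ^ ?n * ?J))\<^sup>2"
      by (rule ennreal_sum_square_le)
    also have "(ennreal (A * (1 / h) ^ ?n * ?J))\<^sup>2 = ?c * (ennreal ?J)\<^sup>2"
      using A0 J pos by (simp add: ennreal_mult ennreal_power power_mult_distrib)
    also have "ennreal ?J = (\<integral>\<^sup>+z\<in>cball 0 \<rho>. ennreal (norm (?R x z)) \<partial>lborel)"
      using ennreal_set_lebesgue_integral_norm[OF lR, of "cball x \<rho>"]
        nn_integral_translate_cball[of "\<lambda>y. ennreal (norm (?R x (y - x)))" x \<rho>] by simp
    also have "(\<integral>\<^sup>+z\<in>cball 0 \<rho>. ennreal (norm (?R x z)) \<partial>lborel)\<^sup>2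
        \<le> ?V * (\<integral>\<^sup>+z\<in>cball 0 \<rho>. (ennreal (norm (?R x z)))\<^sup>2 \<partial>lborel)"
      by (rule nn_integral_square_le) auto
    finally show ?thesis
      by (simp add: ennreal_power mult_left_mono add_left_mono)
  qed
  have remL2: "L2sq (\<lambda>x. ?R x z) \<le> ennreal (\<rho>\<^sup>2) ^ r * S" if "z \<in> cball 0 \<rho>" for z
  proof -
    have "L2sq (\<lambda>x. ?R x z) \<le> ennreal ((norm z)\<^sup>2) ^ r * S"
      unfolding S_def by (rule taylor_rem_L2[OF f])
    also have "\<dots> \<le> ennreal (\<rho>\<^sup>2) ^ r * S"
      using that by (intro mult_right_mono power_mono ennreal_leI) auto
    finally show ?thesis .
  qed
  have [measurable]: "(\<lambda>x. \<integral>\<^sup>+z\<in>cball 0 \<rho>. ennreal ((norm (?R x z))\<^sup>2) \<partial>lborel) \<in> borel_measurable borel"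
    by (rule borel_set_nn_integral[OF contR]) simp
  have [measurable]: "(\<lambda>x. ?R x 0) \<in> borel_measurable borel"
    by (rule borel_measurable_continuous_onI[OF contR0])
  have [measurable]: "fund_cell e \<in> sets borel" by (rule borel_fund_cell)
  have "L2sq (\<lambda>x. f x - ?Q f x) \<le> (\<integral>\<^sup>+x. 2 * (ennreal ((norm (?R x 0))\<^sup>2) * indicator (fund_cell e) x)
      + (2 * (?c * ?V)) * ((\<integral>\<^sup>+z\<in>cball 0 \<rho>. ennreal ((norm (?R x z))\<^sup>2) \<partial>lborel) * indicator (fund_cell e) x) \<partial>lebesgue)"
    unfolding L2sq_def
  proof (rule nn_integral_mono_AE)
    show "AE x in lebesgue. ennreal ((norm (f x - ?Q f x))\<^sup>2) * indicator (fund_cell e) x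
      \<le> 2 * (ennreal ((norm (?R x 0))\<^sup>2) * indicator (fund_cell e) x)
        + (2 * (?c * ?V)) * ((\<integral>\<^sup>+z\<in>cball 0 \<rho>. ennreal ((norm (?R x z))\<^sup>2) \<partial>lborel) * indicator (fund_cell e) x)"
      using AE_in_full_cell
    proof eventually_elim
      case (elim x)
      then obtain T where "is_full T" "x \<in> cell_interior T" by blast
      from sq_bound[OF this] show ?case by (auto simp: indicator_def mult.assoc)
    qed
  qed
  also have "\<dots> = 2 * L2sq (\<lambda>x. ?R x 0) + (2 * (?c * ?V)) * (\<integral>\<^sup>+x\<in>fund_cell e. (\<integral>\<^sup>+z\<in>cball 0 \<rho>. ennreal ((norm (?R x z))\<^sup>2) \<partial>lborel) \<partial>lborel)"
    unfolding nn_integral_completion L2sq_lborel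
    by (subst nn_integral_add) (auto simp: nn_integral_cmult)
  also have "\<dots> \<le> 2 * (ennreal (\<rho>\<^sup>2) ^ r * S) + (2 * (?c * ?V)) * ((ennreal (\<rho>\<^sup>2) ^ r * S) * ?V)"
    using \<rho> by (intro add_mono mult_left_mono nn_integral_L2sq_swap_le contR remL2) auto
  also have "\<dots> = ennreal (smooth_error_constant ?n A \<epsilon> r * (h ^ r)\<^sup>2) * S"
  proof -
    have V: "?V = ennreal (unit_ball_vol ?n * \<rho> ^ ?n)" using \<rho> by (simp add: emeasure_cball)
    have "2 * ennreal (\<rho>\<^sup>2) ^ r + (2 * (?c * ?V)) * (ennreal (\<rho>\<^sup>2) ^ r * ?V)
      = ennreal (2 * (\<rho>\<^sup>2) ^ r + 2 * ((A * (1 / h) ^ ?n)\<^sup>2 * (unit_ball_vol ?n * \<rho> ^ ?n)) * ((\<rho>\<^sup>2) ^ r * (unit_ball_vol ?n * \<rho> ^ ?n)))"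
      unfolding V using \<rho> unit_ball_vol_nonneg[of ?n]
      by (simp add: ennreal_mult ennreal_power ennreal_plus)
    also have "2 * (\<rho>\<^sup>2) ^ r + 2 * ((A * (1 / h) ^ ?n)\<^sup>2 * (unit_ball_vol ?n * \<rho> ^ ?n)) * ((\<rho>\<^sup>2) ^ r * (unit_ball_vol ?n * \<rho> ^ ?n))
      = smooth_error_constant ?n A \<epsilon> r * (h ^ r)\<^sup>2"
    proof -
      have 1: "(\<rho>\<^sup>2) ^ r = ((1 + \<epsilon>) ^ r)\<^sup>2 * (h ^ r)\<^sup>2"
        by (simp add: \<rho>_def power_mult_distrib power_mult[symmetric] mult.commute)
      have 2: "(1 / h) ^ ?n * \<rho> ^ ?n = (1 + \<epsilon>) ^ ?n"
        using pos by (simp add: \<rho>_def power_mult_distrib[symmetric])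
      have "(A * (1 / h) ^ ?n)\<^sup>2 * (unit_ball_vol ?n * \<rho> ^ ?n) * (unit_ball_vol ?n * \<rho> ^ ?n)
          = A\<^sup>2 * (unit_ball_vol ?n * ((1 / h) ^ ?n * \<rho> ^ ?n))\<^sup>2"
        by (simp add: power2_eq_square ac_simps)
      then have 3: "(A * (1 / h) ^ ?n)\<^sup>2 * (unit_ball_vol ?n * \<rho> ^ ?n) * (unit_ball_vol ?n * \<rho> ^ ?n)
          = A\<^sup>2 * (unit_ball_vol ?n * (1 + \<epsilon>) ^ ?n)\<^sup>2"
        unfolding 2 .
      have 4: "2 * b + 2 * (a * V) * (b * V) = (2 + 2 * (a * V * V)) * b" for a b V :: real
        by (simp add: algebra_simps)
      show ?thesis
        unfolding 4 3 smooth_error_constant_def 1 by (simp only: mult.assoc)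
    qed
    finally have eq: "2 * ennreal (\<rho>\<^sup>2) ^ r + (2 * (?c * ?V)) * (ennreal (\<rho>\<^sup>2) ^ r * ?V)
      = ennreal (smooth_error_constant ?n A \<epsilon> r * (h ^ r)\<^sup>2)" .
    have "2 * (ennreal (\<rho>\<^sup>2) ^ r * S) + (2 * (?c * ?V)) * ((ennreal (\<rho>\<^sup>2) ^ r * S) * ?V)
      = (2 * ennreal (\<rho>\<^sup>2) ^ r + (2 * (?c * ?V)) * (ennreal (\<rho>\<^sup>2) ^ r * ?V)) * S"
      by (simp only: distrib_right mult.assoc mult.commute[of ?V S] mult.left_commute)
    then show ?thesis unfolding eq .
  qed
  finally show ?thesis by (simp add: A_def S_def)
qed

section \<open>Weak derivatives of mollified forms\<close>

context torus_basis
begin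

section \<open>Integration by parts on the torus\<close>

lemma torus_integral_lborel:
  fixes f :: "'n euclid \<Rightarrow> 'b::{banach, second_countable_topology}"
  assumes [measurable]: "f \<in> borel_measurable borel"
  shows "torus_integral e f = (\<integral>x. indicator (fund_cell e) x *\<^sub>R f x \<partial>lborel)"
proof -
  have [measurable]: "fund_cell e \<in> sets borel" by (rule borel_fund_cell)
  show ?thesis
    unfolding torus_integral_def set_lebesgue_integral_def
    by (rule integral_completion) measurable
qed

lemma continuous_bounded_on_fund_cell:
  fixes g :: "'n euclid \<Rightarrow> 'b::real_normed_vector"
  assumes "continuous_on UNIV g"
  shows "\<exists>M\<ge>0. \<forall>x\<in>fund_cell e. norm (g x) \<le> M"
proof -
  obtain R where R: "fund_cell e \<subseteq> cball 0 R"
    using bounded_subset_ballD[OF bounded_fund_cell, of 0] ball_subset_cball by (meson subset_trans)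
  have "compact (g ` cball 0 R)"
    by (intro compact_continuous_image continuous_on_subset[OF assms]) auto
  then obtain M where M: "\<forall>y\<in>g ` cball 0 R. norm y \<le> M"
    using compact_imp_bounded bounded_iff by metis
  then have "\<forall>x\<in>fund_cell e. norm (g x) \<le> max M 0" using R by fastforce
  then show ?thesis by (meson max.cobounded2)
qed

lemma integrable_scaleR_continuous:
  fixes w :: "'n euclid \<Rightarrow> 'b::euclidean_space"
  assumes "locally_integrable w" "continuous_on UNIV g"
  shows "set_integrable lebesgue (fund_cell e) (\<lambda>x. g x *\<^sub>R w x)"
proof -
  obtain M where M: "0 \<le> M" "\<forall>x\<in>fund_cell e. norm (g x) \<le> M"
    using continuous_bounded_on_fund_cell[OF assms(2)] by blast
  have [measurable]: "w \<in> borel_measurable lebesgue" "g \<in> borel_measurable lebesgue"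
    using assms by (auto simp: locally_integrable_def continuous_borel_measurable_lebesgue)
  have int: "integrable lebesgue (\<lambda>x. M *\<^sub>R (indicator (fund_cell e) x *\<^sub>R w x))"
    using locally_integrable_bounded[OF assms(1) bounded_fund_cell sets_fund_cell]
    unfolding set_integrable_def by (rule integrable_scaleR_right)
  show ?thesis
    unfolding set_integrable_def
  proof (rule Bochner_Integration.integrable_bound[OF int])
    have "norm (indicator (fund_cell e) x *\<^sub>R (g x *\<^sub>R w x)) \<le> norm (M *\<^sub>R (indicator (fund_cell e) x *\<^sub>R w x))" for x
    proof (cases "x \<in> fund_cell e")
      case True
      then have "\<bar>g x\<bar> * norm (w x) \<le> \<bar>M\<bar> * norm (w x)" using M by (intro mult_right_mono) auto
      then show ?thesis using True by simp
    qed simp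
    then show "AE x in lebesgue. norm (indicator (fund_cell e) x *\<^sub>R (g x *\<^sub>R w x)) \<le> norm (M *\<^sub>R (indicator (fund_cell e) x *\<^sub>R w x))"
      by simp
  qed measurable
qed

text \<open>A partial derivative is the limit of difference quotients, whose integrals vanish by
  translation invariance. Dominated convergence passes to the limit, and no boundary terms on the
  skew fundamental cell have to be matched.\<close>

lemma torus_integral_partial_zero:
  fixes F :: "'n euclid \<Rightarrow> real"
  assumes F: "\<And>x. F differentiable (at x)" "periodic e F"
    and cD: "continuous_on UNIV (partial_deriv [j] F)"
  shows "torus_integral e (partial_deriv [j] F) = 0"
proof -
  let ?v = "axis j 1 :: 'n euclid"
  define D where "D k x = real (Suc k) * (F (x + inverse (real (Suc k)) *\<^sub>R ?v) - F x)" for k x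
  have cF: "continuous_on A F" for A
    using F(1) differentiable_imp_continuous_within by (auto intro!: continuous_at_imp_continuous_on)
  have der: "((\<lambda>t. F (x + t *\<^sub>R ?v)) has_field_derivative partial_deriv [j] F (x + t *\<^sub>R ?v)) (at t)" for x t
  proof -
    have 1: "((\<lambda>t. x + t *\<^sub>R ?v) has_derivative (\<lambda>s. s *\<^sub>R ?v)) (at t)"
      by (auto intro!: derivative_eq_intros)
    have "((\<lambda>t. F (x + t *\<^sub>R ?v)) has_derivative
        (\<lambda>s. \<Sum>i\<in>UNIV. ((s *\<^sub>R ?v) $ i) *\<^sub>R partial_deriv [i] F (x + t *\<^sub>R ?v))) (at t)"
      by (rule has_derivative_compose[OF 1 differentiable_imp_has_derivative_partials[OF F(1)]])
    moreover have "(\<Sum>i\<in>UNIV. ((s *\<^sub>R ?v) $ i) *\<^sub>R partial_deriv [i] F (x + t *\<^sub>R ?v)) = partial_deriv [j] F (x + t *\<^sub>R ?v) * s" for s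
    proof -
      have "(\<Sum>i\<in>UNIV. ((s *\<^sub>R ?v) $ i) *\<^sub>R partial_deriv [i] F (x + t *\<^sub>R ?v))
        = (\<Sum>i\<in>UNIV. if i = j then s * partial_deriv [i] F (x + t *\<^sub>R ?v) else 0)"
        by (intro sum.cong) (auto simp: axis_def)
      then show ?thesis by simp
    qed
    ultimately show ?thesis by (simp add: has_field_derivative_def)
  qed
  obtain R where R: "0 < R" "fund_cell e \<subseteq> ball 0 R"
    using bounded_subset_ballD[OF bounded_fund_cell] by blast
  have "compact (partial_deriv [j] F ` cball 0 (R + 1))"
    by (intro compact_continuous_image continuous_on_subset[OF cD]) auto
  then obtain M where M: "\<forall>y\<in>partial_deriv [j] F ` cball 0 (R + 1). norm y \<le> M"
    using compact_imp_bounded bounded_iff by metis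
  \<comment> \<open>By the mean value theorem the quotient is a value of the derivative at distance
    at most 1 from x, whence the radius R + 1.\<close>
  have bound: "\<bar>D k x\<bar> \<le> M" if x: "x \<in> fund_cell e" for k x
  proof -
    have pos: "0 < inverse (real (Suc k))" by simp
    obtain z where z: "0 < z" "z < inverse (real (Suc k))"
       "F (x + inverse (real (Suc k)) *\<^sub>R ?v) - F (x + 0 *\<^sub>R ?v) = (inverse (real (Suc k)) - 0) * partial_deriv [j] F (x + z *\<^sub>R ?v)"
      using MVT2[OF pos, of "\<lambda>t. F (x + t *\<^sub>R ?v)" "\<lambda>t. partial_deriv [j] F (x + t *\<^sub>R ?v)"] der by blast
    then have "D k x = partial_deriv [j] F (x + z *\<^sub>R ?v)"
      by (simp add: D_def field_simps del: of_nat_Suc)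
    moreover have "x + z *\<^sub>R ?v \<in> cball 0 (R + 1)"
    proof -
      have "z \<le> 1" using z(2) by (rule order_trans[OF less_imp_le]) (simp add: inverse_eq_divide)
      moreover have "norm x < R" using x R by auto
      moreover have "norm (x + z *\<^sub>R ?v) \<le> norm x + \<bar>z\<bar> * norm ?v"
        using norm_triangle_ineq[of x "z *\<^sub>R ?v"] by simp
      moreover have "norm ?v = 1" by (simp add: norm_eq_sqrt_inner inner_axis_axis)
      ultimately show ?thesis using z(1) by simp
    qed
    ultimately show ?thesis using M by auto
  qed
  have lim: "(\<lambda>k. D k x) \<longlonglongrightarrow> partial_deriv [j] F x" for x
  proof -
    have "((\<lambda>t. (F (x + (0 + t) *\<^sub>R ?v) - F (x + 0 *\<^sub>R ?v)) / t) \<longlongrightarrow> partial_deriv [j] F (x + 0 *\<^sub>R ?v)) (at 0)"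
      using der[of x 0] unfolding DERIV_def .
    moreover have "filterlim (\<lambda>k. inverse (real (Suc k))) (at 0) sequentially"
      unfolding filterlim_at using LIMSEQ_inverse_real_of_nat by (auto simp: eventually_sequentially)
    ultimately have "((\<lambda>k. (F (x + (0 + inverse (real (Suc k))) *\<^sub>R ?v) - F (x + 0 *\<^sub>R ?v)) / inverse (real (Suc k)))
        \<longlonglongrightarrow> partial_deriv [j] F (x + 0 *\<^sub>R ?v))"
      by (rule filterlim_compose)
    then show ?thesis by (simp add: D_def divide_inverse mult.commute del: of_nat_Suc)
  qed
  have intF: "set_integrable lebesgue (fund_cell e) (\<lambda>x. F (x + a))" for a
    by (intro locally_integrable_bounded[OF continuous_locally_integrable] bounded_fund_cell sets_fund_cell
        continuous_on_compose2[OF cF[of UNIV]] continuous_intros) auto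
  have D0: "torus_integral e (D k) = 0" for k
  proof -
    let ?a = "inverse (real (Suc k)) *\<^sub>R ?v"
    have "torus_integral e (\<lambda>x. F (x + ?a)) = torus_integral e F"
      by (rule torus_integral_translate(2)[OF F(2) continuous_borel_measurable_lebesgue[OF cF]])
    then show ?thesis
      using intF[of ?a] intF[of 0] unfolding torus_integral_def D_def
      by (simp add: set_integral_mult_right set_integral_diff(2) del: of_nat_Suc)
  qed
  have "(\<lambda>k. torus_integral e (D k)) \<longlonglongrightarrow> torus_integral e (partial_deriv [j] F)"
    unfolding torus_integral_def set_lebesgue_integral_def
  proof (rule integral_dominated_convergence)
    have cDk: "continuous_on UNIV (D k)" for k
      unfolding D_def by (intro continuous_intros continuous_on_compose2[OF cF[of UNIV]]) auto
    have [measurable]: "D k \<in> borel_measurable lebesgue" "partial_deriv [j] F \<in> borel_measurable lebesgue" for k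
      by (intro continuous_borel_measurable_lebesgue cD cDk)+
    show "(\<lambda>x. indicator (fund_cell e) x *\<^sub>R partial_deriv [j] F x) \<in> borel_measurable lebesgue"
      "(\<lambda>x. indicator (fund_cell e) x *\<^sub>R D k x) \<in> borel_measurable lebesgue" for k
      by measurable
    show "integrable lebesgue (\<lambda>x. M * indicator (fund_cell e) x)"
      using finite_emeasure_fund_cell by (intro integrable_mult_right integrable_real_indicator) auto
    show "AE x in lebesgue. (\<lambda>k. indicator (fund_cell e) x *\<^sub>R D k x) \<longlonglongrightarrow> indicator (fund_cell e) x *\<^sub>R partial_deriv [j] F x"
      by (intro AE_I2 tendsto_intros lim)
    show "AE x in lebesgue. norm (indicator (fund_cell e) x *\<^sub>R D k x) \<le> M * indicator (fund_cell e) x" for k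
      by (intro AE_I2) (use bound in \<open>auto simp: indicator_def\<close>)
  qed
  then show ?thesis using D0 LIMSEQ_unique[OF tendsto_const] by (simp add: LIMSEQ_const_iff)
qed

lemma torus_integral_mult_continuous_add:
  fixes f g :: "'n euclid \<Rightarrow> real"
  assumes "continuous_on UNIV f" "continuous_on UNIV g"
  shows "torus_integral e (\<lambda>x. f x + g x) = torus_integral e f + torus_integral e g"
proof -
  have "set_integrable lebesgue (fund_cell e) f" "set_integrable lebesgue (fund_cell e) g"
    by (intro locally_integrable_bounded[OF continuous_locally_integrable] bounded_fund_cell sets_fund_cell assms)+
  then show ?thesis
    unfolding torus_integral_def by (rule set_integral_add)
qed

lemma torus_integral_by_parts_single:
  fixes f g :: "'n euclid \<Rightarrow> real"
  assumes f: "smooth f" "periodic e f" and g: "smooth g" "periodic e g"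
  shows "torus_integral e (\<lambda>x. partial_deriv [j] f x * g x) = - torus_integral e (\<lambda>x. f x * partial_deriv [j] g x)"
proof -
  let ?F = "\<lambda>x. f x * g x"
  have der: "(?F has_derivative (\<lambda>v. f x * (\<Sum>i\<in>UNIV. v $ i *\<^sub>R partial_deriv [i] g x)
      + (\<Sum>i\<in>UNIV. v $ i *\<^sub>R partial_deriv [i] f x) * g x)) (at x)" for x
    by (rule has_derivative_mult[OF smooth_has_derivative[OF f(1)] smooth_has_derivative[OF g(1)]])
  have axis: "(\<Sum>i\<in>UNIV. axis j 1 $ i *\<^sub>R c i) = c j" for c :: "'n \<Rightarrow> real"
  proof -
    have "(\<Sum>i\<in>UNIV. axis j 1 $ i *\<^sub>R c i) = (\<Sum>i\<in>UNIV. if i = j then c i else 0)"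
      by (intro sum.cong) (auto simp: axis_def)
    then show ?thesis by simp
  qed
  have partial: "partial_deriv [j] ?F = (\<lambda>x. f x * partial_deriv [j] g x + partial_deriv [j] f x * g x)"
  proof
    fix x
    show "partial_deriv [j] ?F x = f x * partial_deriv [j] g x + partial_deriv [j] f x * g x"
      using partial_deriv_single_eqI[OF der, of j x] unfolding axis .
  qed
  have c: "continuous_on UNIV (\<lambda>x. f x * partial_deriv [j] g x)" "continuous_on UNIV (\<lambda>x. partial_deriv [j] f x * g x)"
    by (intro continuous_intros smooth_continuous_on smooth_continuous f g)+
  have "torus_integral e (partial_deriv [j] ?F) = 0"
  proof (rule torus_integral_partial_zero)
    show "?F differentiable at x" for x using der differentiable_def by blast
    show "periodic e ?F" using f g by (simp add: periodic_def)
    show "continuous_on UNIV (partial_deriv [j] ?F)" unfolding partial by (intro continuous_intros c)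
  qed
  then show ?thesis unfolding partial using torus_integral_mult_continuous_add[OF c] by simp
qed

text \<open>Derivatives cross over one at a time, and the outermost on one side becomes the
  innermost on the other. Carrying \<open>rev js\<close> avoids any appeal to the symmetry of mixed
  derivatives.\<close>

lemma torus_integral_by_parts:
  fixes f g :: "'n euclid \<Rightarrow> real"
  assumes "smooth f" "periodic e f" "smooth g" "periodic e g"
  shows "torus_integral e (\<lambda>x. partial_deriv (rev js) f x * g x)
    = (- 1) ^ length js * torus_integral e (\<lambda>x. f x * partial_deriv js g x)"
  using assms
proof (induction js arbitrary: f)
  case (Cons j js)
  have "torus_integral e (\<lambda>x. partial_deriv (rev (j # js)) f x * g x)
      = torus_integral e (\<lambda>x. partial_deriv (rev js) (partial_deriv [j] f) x * g x)"
    by (simp add: partial_deriv_append)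
  also have "\<dots> = (- 1) ^ length js * torus_integral e (\<lambda>x. partial_deriv [j] f x * partial_deriv js g x)"
    using Cons.prems by (intro Cons.IH smooth_partial_deriv smooth_periodic_partial)
  also have "torus_integral e (\<lambda>x. partial_deriv [j] f x * partial_deriv js g x)
      = - torus_integral e (\<lambda>x. f x * partial_deriv [j] (partial_deriv js g) x)"
    using Cons.prems by (intro torus_integral_by_parts_single smooth_partial_deriv smooth_periodic_partial)
  finally show ?case by (simp add: partial_deriv_append[symmetric])
qed simp

end

section \<open>Mollification against weak derivatives\<close>

lemma AE_lebesgue_reflect:
  assumes "AE x in lebesgue. P x"
  shows "AE x in lebesgue. P (a - (x::'a::euclidean_space))"
proof -
  have "AE x in distr lebesgue lebesgue (\<lambda>x. a - x). P x"
    unfolding lebesgue_distr_reflect by (rule assms)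
  then show ?thesis
    by (rule AE_distrD[OF lebesgue_reflect_measurable])
qed

context torus_basis
begin

text \<open>Fubini for the double integral of k(y) w(x - y) g(x). Product measurability is obtained
  for a Borel function \<open>w'\<close> equal to \<open>w\<close> almost everywhere, and
  \<open>w\<close> is substituted back in each iterated integral separately.\<close>

lemma conv_pairing:
  fixes w :: "'n euclid \<Rightarrow> real"
  assumes k: "kernel k r" and w: "locally_integrable w" "periodic e w" and g: "continuous_on UNIV g"
  shows "integrable lborel (\<lambda>y. k y * torus_integral e (\<lambda>x. w (x - y) * g x))"
    and "torus_integral e (\<lambda>x. conv k w x * g x) = (\<integral>y. k y * torus_integral e (\<lambda>x. w (x - y) * g x) \<partial>lborel)"
proof -
  have wm[measurable]: "w \<in> borel_measurable lebesgue" using w by (simp add: locally_integrable_def)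
  obtain w' where w'[measurable]: "w' \<in> borel_measurable borel" and AEw: "AE x in lborel. w x = w' x"
    using completion_ex_borel_measurable_real[OF wm] by auto
  have AEw: "AE x in lebesgue. w x = w' x" using AEw by (rule AE_completion)
  have [measurable]: "w' \<in> borel_measurable lebesgue" using w' by (intro measurable_completion) simp
  have AE1: "AE x in lebesgue. w (x - y) = w' (x - y)" for y
    using AE_lebesgue_translate[OF AEw, of "- y"] by simp
  have AE2: "AE y in lebesgue. w (x - y) = w' (x - y)" for x
    by (rule AE_lebesgue_reflect[OF AEw])
  have ck: "continuous_on UNIV k" by (rule smooth_continuous[OF kernel.smooth_k[OF k]])
  have [measurable]: "k \<in> borel_measurable borel" "g \<in> borel_measurable borel"
    using ck g by (auto intro: borel_measurable_continuous_onI)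
  have [measurable]: "g \<in> borel_measurable lebesgue" by (rule continuous_borel_measurable_lebesgue[OF g])
  have [measurable]: "fund_cell e \<in> sets borel" by (rule borel_fund_cell)
  obtain M where M: "0 \<le> M" "\<forall>x\<in>fund_cell e. norm (g x) \<le> M"
    using continuous_bounded_on_fund_cell[OF g] by blast
  define f where "f y x = k y * (indicator (fund_cell e) x * (w' (x - y) * g x))" for x y
  define L where "L = (\<integral>\<^sup>+x\<in>fund_cell e. ennreal \<bar>w x\<bar> \<partial>lebesgue)"
  have L: "L < \<infinity>"
  proof -
    have "set_integrable lebesgue (fund_cell e) w"
      by (rule locally_integrable_bounded[OF w(1) bounded_fund_cell sets_fund_cell])
    then show ?thesis
      unfolding L_def set_integrable_def integrable_iff_bounded
      by (simp add: abs_mult ennreal_indicator_sq)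
  qed
  have fm: "case_prod f \<in> borel_measurable (lborel \<Otimes>\<^sub>M lborel)"
    unfolding f_def case_prod_unfold by measurable
  \<comment> \<open>Apart from |k y| the bound does not depend on y, because translates of a
    periodic function have the same integral over the cell.\<close>
  have inner: "(\<integral>\<^sup>+x. ennreal (norm (f y x)) \<partial>lborel) \<le> ennreal (M * \<bar>k y\<bar>) * L" for y
  proof -
    have m: "(\<lambda>x. ennreal \<bar>w' (x - y)\<bar> * indicator (fund_cell e) x) \<in> borel_measurable lborel" by measurable
    have "(\<integral>\<^sup>+x. ennreal (norm (f y x)) \<partial>lborel) \<le> (\<integral>\<^sup>+x. ennreal (M * \<bar>k y\<bar>) * (ennreal \<bar>w' (x - y)\<bar> * indicator (fund_cell e) x) \<partial>lborel)"
    proof (intro nn_integral_mono)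
      fix x
      have "\<bar>k y\<bar> * (\<bar>w' (x - y)\<bar> * \<bar>g x\<bar>) \<le> M * \<bar>k y\<bar> * \<bar>w' (x - y)\<bar>" if "x \<in> fund_cell e"
      proof -
        have "\<bar>k y\<bar> * \<bar>w' (x - y)\<bar> * \<bar>g x\<bar> \<le> \<bar>k y\<bar> * \<bar>w' (x - y)\<bar> * M"
          using M that by (intro mult_left_mono) auto
        then show ?thesis by (simp add: ac_simps)
      qed
      then show "ennreal (norm (f y x)) \<le> ennreal (M * \<bar>k y\<bar>) * (ennreal \<bar>w' (x - y)\<bar> * indicator (fund_cell e) x)"
        using M(1) by (auto simp: f_def indicator_def abs_mult ennreal_mult'[symmetric] intro!: ennreal_leI)
    qed
    also have "\<dots> = ennreal (M * \<bar>k y\<bar>) * (\<integral>\<^sup>+x. ennreal \<bar>w' (x - y)\<bar> * indicator (fund_cell e) x \<partial>lborel)"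
      by (rule nn_integral_cmult[OF m])
    also have "(\<integral>\<^sup>+x. ennreal \<bar>w' (x - y)\<bar> * indicator (fund_cell e) x \<partial>lborel)
       = (\<integral>\<^sup>+x. ennreal \<bar>w (x - y)\<bar> * indicator (fund_cell e) x \<partial>lebesgue)"
      unfolding nn_integral_completion[symmetric, of lborel]
      by (rule nn_integral_cong_AE) (use AE1[of y] in \<open>auto elim: eventually_mono\<close>)
    also have "\<dots> = L"
      using nn_integral_torus_translate[of "\<lambda>x. ennreal \<bar>w x\<bar>" "- y"] w(2)
      by (simp add: L_def periodic_def)
    finally show ?thesis .
  qed
  have fint: "integrable (lborel \<Otimes>\<^sub>M lborel) (case_prod f)"
  proof (rule integrableI_bounded[OF fm])
    have intk: "integrable lebesgue (\<lambda>y. k y)"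
      using kernel.conv_eq_reflected(2)[OF k continuous_locally_integrable[OF continuous_on_const[of UNIV "1::real"]]]
      by simp
    have "(\<integral>\<^sup>+p. ennreal (norm (case_prod f p)) \<partial>(lborel \<Otimes>\<^sub>M lborel)) = (\<integral>\<^sup>+y. \<integral>\<^sup>+x. ennreal (norm (f y x)) \<partial>lborel \<partial>lborel)"
      using fm by (subst lborel.nn_integral_fst[symmetric]) auto
    also have "\<dots> \<le> (\<integral>\<^sup>+y. ennreal (M * \<bar>k y\<bar>) * L \<partial>lborel)"
      by (intro nn_integral_mono inner)
    also have "\<dots> = (ennreal M * (\<integral>\<^sup>+y. ennreal \<bar>k y\<bar> \<partial>lborel)) * L"
      using M(1) by (simp add: nn_integral_multc nn_integral_cmult ennreal_mult)
    also have "(\<integral>\<^sup>+y. ennreal \<bar>k y\<bar> \<partial>lborel) < \<infinity>"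
      using intk unfolding integrable_iff_bounded by (simp add: nn_integral_completion)
    then have "(ennreal M * (\<integral>\<^sup>+y. ennreal \<bar>k y\<bar> \<partial>lborel)) * L < \<infinity>"
      using L by (auto simp: ennreal_mult_less_top)
    finally show "(\<integral>\<^sup>+p. ennreal (norm (case_prod f p)) \<partial>(lborel \<Otimes>\<^sub>M lborel)) < \<infinity>" .
  qed
  have X: "(\<integral>x. f y x \<partial>lborel) = k y * torus_integral e (\<lambda>x. w (x - y) * g x)" for y
  proof -
    have [measurable]: "(\<lambda>x. indicator (fund_cell e) x * (w' (x - y) * g x)) \<in> borel_measurable lborel" by measurable
    have "(\<integral>x. f y x \<partial>lborel) = k y * (\<integral>x. indicator (fund_cell e) x * (w' (x - y) * g x) \<partial>lborel)"
      by (simp add: f_def)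
    also have "(\<integral>x. indicator (fund_cell e) x * (w' (x - y) * g x) \<partial>lborel) = (\<integral>x. indicator (fund_cell e) x * (w' (x - y) * g x) \<partial>lebesgue)"
      by (rule integral_completion[symmetric]) measurable
    also have "\<dots> = (\<integral>x. indicator (fund_cell e) x *\<^sub>R (w (x - y) * g x) \<partial>lebesgue)"
    proof (rule integral_cong_AE)
      show "(\<lambda>x. indicator (fund_cell e) x *\<^sub>R (w (x - y) * g x)) \<in> borel_measurable lebesgue" by measurable
      show "(\<lambda>x. indicator (fund_cell e) x * (w' (x - y) * g x)) \<in> borel_measurable lebesgue" by measurable
      show "AE x in lebesgue. indicator (fund_cell e) x * (w' (x - y) * g x) = indicator (fund_cell e) x *\<^sub>R (w (x - y) * g x)"
        using AE1[of y] by eventually_elim simp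
    qed
    finally show ?thesis by (simp add: torus_integral_def set_lebesgue_integral_def)
  qed
  have Y: "(\<integral>y. f y x \<partial>lborel) = indicator (fund_cell e) x * (conv k w x * g x)" for x
  proof -
    have "(\<integral>y. f y x \<partial>lborel) = (\<integral>y. (k y * w' (x - y)) * (indicator (fund_cell e) x * g x) \<partial>lborel)"
      by (simp add: f_def ac_simps)
    also have "\<dots> = (\<integral>y. k y * w' (x - y) \<partial>lborel) * (indicator (fund_cell e) x * g x)"
      by simp
    also have "(\<integral>y. k y * w' (x - y) \<partial>lborel) = (\<integral>y. k y * w' (x - y) \<partial>lebesgue)"
      by (rule integral_completion[symmetric]) measurable
    also have "\<dots> = (\<integral>y. k y *\<^sub>R w (x - y) \<partial>lebesgue)"
    proof (rule integral_cong_AE)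
      have [measurable]: "k \<in> borel_measurable lebesgue" by (rule continuous_borel_measurable_lebesgue[OF ck])
      show "(\<lambda>y. k y *\<^sub>R w (x - y)) \<in> borel_measurable lebesgue" by measurable
      show "(\<lambda>y. k y * w' (x - y)) \<in> borel_measurable lebesgue" by measurable
      show "AE y in lebesgue. k y * w' (x - y) = k y *\<^sub>R w (x - y)"
        using AE2[of x] by eventually_elim simp
    qed
    also have "\<dots> = conv k w x" by (rule kernel.conv_eq_reflected(1)[OF k w(1), symmetric])
    finally show ?thesis by simp
  qed
  have cc: "continuous_on UNIV (conv k w)" by (rule smooth_continuous[OF kernel.conv_smooth(2)[OF k w(1)]])
  show "integrable lborel (\<lambda>y. k y * torus_integral e (\<lambda>x. w (x - y) * g x))"
    using lborel_pair.integrable_fst[OF fint] by (simp add: X)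
  have [measurable]: "(\<lambda>x. conv k w x * g x) \<in> borel_measurable borel"
    by (intro borel_measurable_continuous_onI continuous_intros cc g)
  have "torus_integral e (\<lambda>x. conv k w x * g x) = (\<integral>x. \<integral>y. f y x \<partial>lborel \<partial>lborel)"
    by (simp add: torus_integral_lborel Y)
  also have "\<dots> = (\<integral>y. \<integral>x. f y x \<partial>lborel \<partial>lborel)"
    using lborel_pair.integral_fst[OF fint] lborel_pair.integral_snd[OF fint] by simp
  finally show "torus_integral e (\<lambda>x. conv k w x * g x) = (\<integral>y. k y * torus_integral e (\<lambda>x. w (x - y) * g x) \<partial>lborel)"
    by (simp add: X)
qed

lemma torus_integral_mono:
  fixes f g :: "'n euclid \<Rightarrow> real"
  assumes "set_integrable lebesgue (fund_cell e) f" "set_integrable lebesgue (fund_cell e) g"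
    and "\<And>x. f x \<le> g x"
  shows "torus_integral e f \<le> torus_integral e g"
  using assms unfolding torus_integral_def set_lebesgue_integral_def set_integrable_def
  by (intro integral_mono) (auto intro: mult_left_mono)

text \<open>Duality with the derivative \<open>D\<close> of the mollified function itself. Its
  squared norm is moved by parts onto translates of \<open>w\<close>, the weak derivative is tested
  with translates of \<open>D\<close>, and what results is an average over \<open>k\<close> of
  pairings of \<open>v\<close> with these translates. This is Young's inequality for the convolution
  of \<open>k\<close> with \<open>v\<close>, without identifying that convolution as a
  derivative.\<close>

lemma mollified_weak_partial_scalar:
  fixes w v :: "'n euclid \<Rightarrow> real"
  assumes k: "kernel k r" and c: "(\<integral>\<^sup>+y. ennreal \<bar>k y\<bar> \<partial>lborel) = ennreal c" "0 < c"
    and w: "locally_integrable w" "periodic e w" and v: "locally_integrable v" "set_integrable lebesgue (fund_cell e) (\<lambda>x. (v x)\<^sup>2)"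
    and weak: "\<And>\<psi>. \<psi> \<in> test_functions e \<Longrightarrow>
      torus_integral e (\<lambda>x. \<psi> x * v x) = (- 1) ^ length js * torus_integral e (\<lambda>x. partial_deriv js \<psi> x * w x)"
  shows "torus_integral e (\<lambda>x. (partial_deriv (rev js) (conv k w) x)\<^sup>2) \<le> c\<^sup>2 * torus_integral e (\<lambda>x. (v x)\<^sup>2)"
proof -
  define G where "G = conv k w"
  define D where "D = partial_deriv (rev js) G"
  have sG: "smooth G" and pG: "periodic e G"
    unfolding G_def by (rule kernel.conv_smooth(2)[OF k w(1)], rule conv_periodic[OF k w])
  have sD: "smooth D" and pD: "periodic e D"
    unfolding D_def by (intro smooth_partial_deriv sG, intro smooth_periodic_partial sG pG)
  define d where "d = torus_integral e (\<lambda>x. (D x)\<^sup>2)"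
  define b where "b = torus_integral e (\<lambda>x. (v x)\<^sup>2)"
  have cD: "continuous_on UNIV D" by (rule smooth_continuous[OF sD])
  have cD2: "continuous_on UNIV (\<lambda>x. D (x + y))" for y
    by (rule smooth_continuous[OF partial_deriv_translate(2)[OF sD]])
  have intD2: "set_integrable lebesgue (fund_cell e) (\<lambda>x. (D (x + y))\<^sup>2)" for y
    by (intro locally_integrable_bounded[OF continuous_locally_integrable] bounded_fund_cell sets_fund_cell
        continuous_intros cD2)
  define J where "J y = torus_integral e (\<lambda>x. D (x + y) * v x)" for y
  have shift: "torus_integral e (\<lambda>x. w (x - y) * partial_deriv js D x) = (- 1) ^ length js * J y" for y
  proof -
    let ?f = "\<lambda>x. w x * partial_deriv js D (x + y)"
    have per: "periodic e ?f"
      using periodic_translate[OF smooth_periodic_partial[OF sD pD]] w(2) by (simp add: periodic_def)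
    have meas: "?f \<in> borel_measurable lebesgue"
    proof (rule borel_measurable_times)
      show "w \<in> borel_measurable lebesgue" using w(1) by (simp add: locally_integrable_def)
      show "(\<lambda>x. partial_deriv js D (x + y)) \<in> borel_measurable lebesgue"
        using smooth_continuous_on[OF partial_deriv_translate(2)[OF sD, of y], of UNIV js]
        by (intro continuous_borel_measurable_lebesgue) (simp add: partial_deriv_translate(1)[OF sD])
    qed
    have "torus_integral e (\<lambda>x. w (x - y) * partial_deriv js D x) = torus_integral e (\<lambda>x. ?f (x + - y))"
      by simp
    also have "\<dots> = torus_integral e ?f"
      by (rule torus_integral_translate(2)[OF per meas])
    also have "\<dots> = torus_integral e (\<lambda>x. partial_deriv js (\<lambda>x. D (x + y)) x * w x)"
      by (simp add: partial_deriv_translate(1)[OF sD] mult.commute)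
    also have "\<dots> = (- 1) ^ length js * J y"
    proof -
      have "(\<lambda>x. D (x + y)) \<in> test_functions e"
        using partial_deriv_translate(2)[OF sD] periodic_translate[OF pD] by (simp add: test_functions_def)
      from weak[OF this] show ?thesis
        by (simp add: J_def mult.assoc[symmetric] power_mult_distrib[symmetric])
    qed
    finally show ?thesis .
  qed
  have "d = torus_integral e (\<lambda>x. partial_deriv (rev js) G x * D x)"
    by (simp add: d_def D_def power2_eq_square)
  also have "\<dots> = (- 1) ^ length js * torus_integral e (\<lambda>x. conv k w x * partial_deriv js D x)"
    using torus_integral_by_parts[OF sG pG sD pD] by (simp add: G_def)
  also have "torus_integral e (\<lambda>x. conv k w x * partial_deriv js D x)
      = (\<integral>y. k y * ((- 1) ^ length js * J y) \<partial>lborel)"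
    unfolding shift[symmetric] by (rule conv_pairing(2)[OF k w smooth_continuous_on[OF sD]])
  also have "\<dots> = (- 1) ^ length js * (\<integral>y. k y * J y \<partial>lborel)"
    by (subst integral_mult_right_zero[symmetric]) (simp add: mult.left_commute)
  finally have dJ: "d = (\<integral>y. k y * J y \<partial>lborel)"
    by (simp add: mult.assoc[symmetric] power_mult_distrib[symmetric])
  \<comment> \<open>The weights c / 2 and 1 / (2 c) are such that, after integration against |k|,
    the term in d becomes d / 2 and can be absorbed on the left; this leaves d \<le> c^2 b.\<close>
  have Jb: "\<bar>J y\<bar> \<le> c / 2 * b + d / (2 * c)" for y
  proof -
    have dy: "torus_integral e (\<lambda>x. (D (x + y))\<^sup>2) = d"
      unfolding d_def
      by (rule torus_integral_translate(2)[of "\<lambda>x. (D x)\<^sup>2"])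
         (use pD in \<open>auto simp: periodic_def intro!: continuous_borel_measurable_lebesgue continuous_intros cD\<close>)
    have int1: "set_integrable lebesgue (fund_cell e) (\<lambda>x. c / 2 * (v x)\<^sup>2 + 1 / (2 * c) * (D (x + y))\<^sup>2)"
      by (intro set_integral_add set_integrable_mult_right) (use v intD2 in auto)
    have val: "torus_integral e (\<lambda>x. c / 2 * (v x)\<^sup>2 + 1 / (2 * c) * (D (x + y))\<^sup>2) = c / 2 * b + d / (2 * c)"
    proof -
      have "torus_integral e (\<lambda>x. c / 2 * (v x)\<^sup>2 + 1 / (2 * c) * (D (x + y))\<^sup>2)
        = torus_integral e (\<lambda>x. c / 2 * (v x)\<^sup>2) + torus_integral e (\<lambda>x. 1 / (2 * c) * (D (x + y))\<^sup>2)"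
        unfolding torus_integral_def
        by (rule set_integral_add(2); rule set_integrable_mult_right) (use v intD2 in auto)
      also have "\<dots> = c / 2 * b + 1 / (2 * c) * torus_integral e (\<lambda>x. (D (x + y))\<^sup>2)"
        unfolding torus_integral_def b_def by (simp only: set_integral_mult_right)
      finally show ?thesis unfolding dy by simp
    qed
    have int2: "set_integrable lebesgue (fund_cell e) (\<lambda>x. D (x + y) * v x)"
      using integrable_scaleR_continuous[OF v(1) cD2] by simp
    have young: "\<bar>D (x + y) * v x\<bar> \<le> c / 2 * (v x)\<^sup>2 + 1 / (2 * c) * (D (x + y))\<^sup>2" for x
    proof -
      have "0 \<le> (c * \<bar>v x\<bar> - \<bar>D (x + y)\<bar>)\<^sup>2" by simp
      then have "2 * c * (\<bar>v x\<bar> * \<bar>D (x + y)\<bar>) \<le> c\<^sup>2 * (v x)\<^sup>2 + (D (x + y))\<^sup>2"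
        by (simp add: power2_diff power_mult_distrib)
      then have "\<bar>v x\<bar> * \<bar>D (x + y)\<bar> \<le> (c\<^sup>2 * (v x)\<^sup>2 + (D (x + y))\<^sup>2) / (2 * c)"
        using c(2) by (simp add: pos_le_divide_eq mult.commute)
      also have "\<dots> = c / 2 * (v x)\<^sup>2 + 1 / (2 * c) * (D (x + y))\<^sup>2"
        using c(2) by (simp add: add_divide_distrib power2_eq_square)
      finally show ?thesis by (simp add: abs_mult mult.commute)
    qed
    have "J y \<le> c / 2 * b + d / (2 * c)"
      unfolding J_def val[of, symmetric]
      by (rule torus_integral_mono[OF int2 int1]) (use young abs_le_D1 in blast)
    moreover have "- J y \<le> c / 2 * b + d / (2 * c)"
    proof -
      have "- J y = torus_integral e (\<lambda>x. - (D (x + y) * v x))"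
        unfolding J_def torus_integral_def set_lebesgue_integral_def by simp
      also have "\<dots> \<le> torus_integral e (\<lambda>x. c / 2 * (v x)\<^sup>2 + 1 / (2 * c) * (D (x + y))\<^sup>2)"
        by (rule torus_integral_mono[OF _ int1]) (use int2 young abs_le_D2 in \<open>auto simp: set_integrable_def\<close>)
      finally show ?thesis unfolding val .
    qed
    ultimately show ?thesis by linarith
  qed
  have nb: "0 \<le> b" "0 \<le> d"
    unfolding b_def d_def torus_integral_def set_lebesgue_integral_def by (auto intro!: integral_nonneg_AE)
  let ?B = "c / 2 * b + d / (2 * c)"
  have B0: "0 \<le> ?B" using nb c(2) by simp
  have [measurable]: "k \<in> borel_measurable borel"
    by (intro borel_measurable_continuous_onI smooth_continuous[OF kernel.smooth_k[OF k]])
  have "ennreal d = ennreal (norm (\<integral>y. k y * J y \<partial>lborel))" using nb(2) dJ by simp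
  also have "\<dots> \<le> (\<integral>\<^sup>+y. ennreal (norm (k y * J y)) \<partial>lborel)"
    by (rule ennreal_norm_integral_le)
  also have "\<dots> \<le> (\<integral>\<^sup>+y. ennreal \<bar>k y\<bar> * ennreal ?B \<partial>lborel)"
    by (intro nn_integral_mono)
       (use Jb B0 in \<open>auto simp: abs_mult ennreal_mult[symmetric] intro!: ennreal_leI mult_left_mono\<close>)
  also have "\<dots> = ennreal (c * ?B)"
    using c B0 by (subst nn_integral_multc) (auto simp: ennreal_mult)
  finally have "d \<le> c * ?B" using B0 c(2) by (subst (asm) ennreal_le_iff) auto
  then have "d \<le> c\<^sup>2 * b"
    using c(2) by (simp add: field_simps power2_eq_square)
  then show ?thesis by (simp add: d_def b_def D_def G_def)
qed

end

text \<open>The L1 norm does not depend on the scale and is at least the integral, which is 1; hence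
  it is positive and may be divided by. It can exceed 1, since \<phi> may change sign for p \<ge>
  2.\<close>

lemma nn_integral_abs_mollifier_kernel:
  fixes \<phi> :: "'n::finite euclid \<Rightarrow> real"
  assumes \<phi>: "mollifier p \<phi>" and \<delta>: "0 < \<delta>"
  shows "(\<integral>\<^sup>+y. ennreal \<bar>mollifier_kernel \<phi> \<delta> y\<bar> \<partial>lborel) = ennreal (\<integral>y. \<bar>\<phi> y\<bar> \<partial>lebesgue)"
    and "(\<integral>y. mollifier_kernel \<phi> \<delta> y \<partial>lebesgue) = 1"
    and "0 < (\<integral>y. \<bar>\<phi> y\<bar> \<partial>lebesgue)"
proof -
  let ?k = "mollifier_kernel \<phi> \<delta>"
  note ker = kernel_mollifier[OF \<phi> \<delta>]
  have ck: "continuous_on UNIV ?k" by (rule smooth_continuous[OF kernel.smooth_k[OF ker]])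
  have int: "integrable lebesgue ?k"
    using kernel.conv_eq_reflected(2)[OF ker continuous_locally_integrable[OF continuous_on_const[of UNIV "1::real"]]]
    by simp
  have resc: "\<bar>\<delta>\<bar> ^ DIM('n euclid) * ?k (\<delta> *\<^sub>R y) = \<phi> y" for y
    using \<delta> by (simp add: mollifier_kernel_def power_divide)
  have "(\<integral>y. ?k y \<partial>lebesgue) = (\<integral>y. \<bar>\<delta>\<bar> ^ DIM('n euclid) * ?k (\<delta> *\<^sub>R y) \<partial>lebesgue)"
    by (subst integral_lebesgue_scale[of \<delta>]) (use \<delta> continuous_borel_measurable_lebesgue[OF ck] in auto)
  then show "(\<integral>y. ?k y \<partial>lebesgue) = 1"
    unfolding resc using \<phi> by (simp add: mollifier_def)
  have "(\<integral>y. \<bar>?k y\<bar> \<partial>lebesgue) = (\<integral>y. \<bar>\<delta>\<bar> ^ DIM('n euclid) * \<bar>?k (\<delta> *\<^sub>R y)\<bar> \<partial>lebesgue)"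
    by (subst integral_lebesgue_scale[of \<delta>])
       (use \<delta> in \<open>auto intro!: continuous_borel_measurable_lebesgue continuous_intros ck\<close>)
  also have "\<dots> = (\<integral>y. \<bar>\<phi> y\<bar> \<partial>lebesgue)"
  proof (rule Bochner_Integration.integral_cong[OF refl])
    show "\<bar>\<delta>\<bar> ^ DIM('n euclid) * \<bar>?k (\<delta> *\<^sub>R y)\<bar> = \<bar>\<phi> y\<bar>" for y
      using arg_cong[OF resc[of y], of abs] by (simp only: abs_mult power_abs abs_abs)
  qed
  finally have abs: "(\<integral>y. \<bar>?k y\<bar> \<partial>lebesgue) = (\<integral>y. \<bar>\<phi> y\<bar> \<partial>lebesgue)" .
  have "(\<integral>\<^sup>+y. ennreal \<bar>?k y\<bar> \<partial>lborel) = (\<integral>\<^sup>+y. ennreal \<bar>?k y\<bar> \<partial>lebesgue)"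
    by (simp add: nn_integral_completion)
  also have "\<dots> = ennreal (\<integral>y. \<bar>?k y\<bar> \<partial>lebesgue)"
    by (rule nn_integral_eq_integral) (use int in auto)
  finally show "(\<integral>\<^sup>+y. ennreal \<bar>?k y\<bar> \<partial>lborel) = ennreal (\<integral>y. \<bar>\<phi> y\<bar> \<partial>lebesgue)"
    unfolding abs .
  have "1 = norm (\<integral>y. ?k y \<partial>lebesgue)" using \<open>(\<integral>y. ?k y \<partial>lebesgue) = 1\<close> by simp
  also have "\<dots> \<le> (\<integral>y. \<bar>?k y\<bar> \<partial>lebesgue)"
    using integral_norm_bound[of lebesgue ?k] by simp
  finally show "0 < (\<integral>y. \<bar>\<phi> y\<bar> \<partial>lebesgue)" unfolding abs by simp
qed

text \<open>Nearest point projection onto a ball truncates values continuously. A measurable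
  function is almost everywhere a limit of continuous ones, and after truncation these are uniformly
  bounded, so that dominated convergence applies.\<close>

lemma L2_continuous_approx:
  fixes w :: "'a::euclidean_space \<Rightarrow> 'b::euclidean_space"
  assumes w[measurable]: "w \<in> borel_measurable lebesgue"
    and fin: "(\<integral>\<^sup>+x\<in>cball 0 R. ennreal ((norm (w x))\<^sup>2) \<partial>lebesgue) < \<infinity>" and \<eta>: "0 < \<eta>"
  shows "\<exists>g. continuous_on UNIV g \<and> (\<integral>\<^sup>+x\<in>cball 0 R. ennreal ((norm (w x - g x))\<^sup>2) \<partial>lebesgue) < ennreal \<eta>"
proof -
  have [measurable]: "cball (0::'a) R \<in> sets lebesgue" by simp
  define T where "T N = closest_point (cball (0::'b) (real N))" for N
  have cT: "continuous_on A (T N)" for A N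
    unfolding T_def by (rule continuous_on_closest_point) auto
  have Tle: "norm (T N v) \<le> real N" for N v
    using closest_point_in_set[of "cball (0::'b) (real N)" v] by (simp add: T_def)
  have Tdiff: "norm (v - T N v) \<le> norm v" for N v
    using closest_point_le[of "cball (0::'b) (real N)" 0 v] by (simp add: T_def dist_norm)
  have Tself: "T N v = v" if "norm v \<le> real N" for N v
    using that closest_point_self[of v "cball (0::'b) (real N)"] by (simp add: T_def)
  have [measurable]: "T N \<in> borel_measurable borel" for N by (rule borel_measurable_continuous_onI[OF cT])
  have "(\<lambda>N. \<integral>\<^sup>+x. ennreal ((norm (w x - T N (w x)))\<^sup>2) * indicator (cball 0 R) x \<partial>lebesgue) \<longlonglongrightarrow> (\<integral>\<^sup>+x. 0 \<partial>(lebesgue :: 'a measure))"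
  proof (rule nn_integral_dominated_convergence[OF _ _ _ _ fin])
    show "(\<lambda>x. ennreal ((norm (w x - T N (w x)))\<^sup>2) * indicator (cball 0 R) x) \<in> borel_measurable lebesgue" for N
      by measurable
    show "AE x in lebesgue. ennreal ((norm (w x - T N (w x)))\<^sup>2) * indicator (cball 0 R) x
        \<le> ennreal ((norm (w x))\<^sup>2) * indicator (cball 0 R) x" for N
      by (intro AE_I2 mult_right_mono ennreal_leI power_mono Tdiff) auto
    show "AE x in lebesgue. (\<lambda>N. ennreal ((norm (w x - T N (w x)))\<^sup>2) * indicator (cball 0 R) x) \<longlonglongrightarrow> 0"
    proof (intro AE_I2)
      fix x
      obtain N0 :: nat where "norm (w x) \<le> real N0" using real_arch_simple by blast
      then have "ennreal ((norm (w x - T N (w x)))\<^sup>2) * indicator (cball 0 R) x = 0" if "N0 \<le> N" for N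
        using that Tself[of "w x" N] by simp
      then show "(\<lambda>N. ennreal ((norm (w x - T N (w x)))\<^sup>2) * indicator (cball 0 R) x) \<longlonglongrightarrow> 0"
        by (intro tendsto_eventually) (auto simp: eventually_sequentially)
    qed
  qed measurable
  then have "\<forall>\<^sub>F N in sequentially. (\<integral>\<^sup>+x. ennreal ((norm (w x - T N (w x)))\<^sup>2) * indicator (cball 0 R) x \<partial>lebesgue) < ennreal (\<eta> / 4)"
    by (intro order_tendstoD) (use \<eta> in auto)
  \<comment> \<open>There is a second error, from replacing \<open>w\<close> by \<open>g n\<close>.
    Both are doubled when the squares are added, so each gets the share \<eta> / 4.\<close>
  then obtain N where N: "(\<integral>\<^sup>+x. ennreal ((norm (w x - T N (w x)))\<^sup>2) * indicator (cball 0 R) x \<partial>lebesgue) < ennreal (\<eta> / 4)"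
    by (auto simp: eventually_sequentially)
  have "w measurable_on UNIV"
    by (subst measurable_on_iff_borel_measurable) auto
  then obtain Z g where Z: "negligible Z" "\<And>n. continuous_on UNIV (g n)"
    "\<And>x. x \<notin> Z \<Longrightarrow> (\<lambda>n. g n x) \<longlonglongrightarrow> w x"
    unfolding measurable_on_def by auto
  have cTg: "continuous_on UNIV (\<lambda>x. T N (g n x))" for n
    by (rule continuous_on_compose2[OF cT Z(2)]) auto
  have [measurable]: "(\<lambda>x. T N (g n x)) \<in> borel_measurable lebesgue" for n
    by (rule continuous_borel_measurable_lebesgue[OF cTg])
  have bd: "(norm (T N u - T N v))\<^sup>2 \<le> (2 * real N)\<^sup>2" for u v
    using norm_triangle_ineq4[of "T N u" "T N v"] Tle[of N u] Tle[of N v] by (intro power_mono) auto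
  have "(\<lambda>n. \<integral>\<^sup>+x. ennreal ((norm (T N (w x) - T N (g n x)))\<^sup>2) * indicator (cball 0 R) x \<partial>lebesgue) \<longlonglongrightarrow> (\<integral>\<^sup>+x. 0 \<partial>(lebesgue :: 'a measure))"
  proof (rule nn_integral_dominated_convergence)
    show "(\<lambda>x. ennreal ((norm (T N (w x) - T N (g n x)))\<^sup>2) * indicator (cball 0 R) x) \<in> borel_measurable lebesgue" for n
      by measurable
    show "AE x in lebesgue. ennreal ((norm (T N (w x) - T N (g n x)))\<^sup>2) * indicator (cball 0 R) x
        \<le> ennreal ((2 * real N)\<^sup>2) * indicator (cball 0 R) x" for n
      by (intro AE_I2 mult_right_mono ennreal_leI bd) auto
    have "emeasure lebesgue (cball (0::'a) R) < \<infinity>"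
      using emeasure_bounded_finite[OF bounded_cball[of "0::'a" R]] by simp
    then show "(\<integral>\<^sup>+x. ennreal ((2 * real N)\<^sup>2) * indicator (cball 0 R) x \<partial>(lebesgue :: 'a measure)) < \<infinity>"
      by (subst nn_integral_cmult_indicator) (auto simp: ennreal_mult_less_top)
    have "Z \<in> null_sets lebesgue" using Z(1) by (simp add: negligible_iff_null_sets)
    then have "AE x in lebesgue. x \<notin> Z" by (rule AE_not_in)
    then show "AE x in lebesgue. (\<lambda>n. ennreal ((norm (T N (w x) - T N (g n x)))\<^sup>2) * indicator (cball 0 R) x) \<longlonglongrightarrow> 0"
    proof eventually_elim
      case (elim x)
      have "isCont (T N) (w x)"
        using cT[of UNIV] by (simp add: continuous_on_eq_continuous_at)
      then have "(\<lambda>n. T N (g n x)) \<longlonglongrightarrow> T N (w x)"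
        using Z(3)[OF elim] isCont_tendsto_compose by blast
      then have "(\<lambda>n. (norm (T N (w x) - T N (g n x)))\<^sup>2) \<longlonglongrightarrow> (norm (T N (w x) - T N (w x)))\<^sup>2"
        by (intro tendsto_intros)
      then have "(\<lambda>n. ennreal ((norm (T N (w x) - T N (g n x)))\<^sup>2)) \<longlonglongrightarrow> 0"
        using tendsto_ennrealI by fastforce
      then show ?case by (cases "x \<in> cball 0 R") auto
    qed
  qed measurable
  then have "\<forall>\<^sub>F n in sequentially. (\<integral>\<^sup>+x. ennreal ((norm (T N (w x) - T N (g n x)))\<^sup>2) * indicator (cball 0 R) x \<partial>lebesgue) < ennreal (\<eta> / 4)"
    by (intro order_tendstoD) (use \<eta> in auto)
  then obtain n where n: "(\<integral>\<^sup>+x. ennreal ((norm (T N (w x) - T N (g n x)))\<^sup>2) * indicator (cball 0 R) x \<partial>lebesgue) < ennreal (\<eta> / 4)"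
    by (auto simp: eventually_sequentially)
  have "(\<integral>\<^sup>+x. ennreal ((norm (w x - T N (g n x)))\<^sup>2) * indicator (cball 0 R) x \<partial>lebesgue)
    \<le> (\<integral>\<^sup>+x. 2 * (ennreal ((norm (w x - T N (w x)))\<^sup>2) * indicator (cball 0 R) x)
        + 2 * (ennreal ((norm (T N (w x) - T N (g n x)))\<^sup>2) * indicator (cball 0 R) x) \<partial>lebesgue)"
  proof (intro nn_integral_mono)
    fix x
    have "ennreal ((norm (w x - T N (g n x)))\<^sup>2) = (ennreal (norm (w x - T N (g n x))))\<^sup>2" by (simp add: ennreal_power)
    also have "\<dots> \<le> (ennreal (norm (w x - T N (w x))) + ennreal (norm (T N (w x) - T N (g n x))))\<^sup>2"
      using norm_triangle_ineq[of "w x - T N (w x)" "T N (w x) - T N (g n x)"]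
      by (intro power_mono) (auto simp: ennreal_plus[symmetric] simp del: ennreal_plus intro!: ennreal_leI)
    also have "\<dots> \<le> 2 * (ennreal (norm (w x - T N (w x))))\<^sup>2 + 2 * (ennreal (norm (T N (w x) - T N (g n x))))\<^sup>2"
      by (rule ennreal_sum_square_le)
    finally show "ennreal ((norm (w x - T N (g n x)))\<^sup>2) * indicator (cball 0 R) x
      \<le> 2 * (ennreal ((norm (w x - T N (w x)))\<^sup>2) * indicator (cball 0 R) x)
        + 2 * (ennreal ((norm (T N (w x) - T N (g n x)))\<^sup>2) * indicator (cball 0 R) x)"
      by (auto simp: indicator_def ennreal_power)
  qed
  also have "\<dots> = 2 * (\<integral>\<^sup>+x. (ennreal ((norm (w x - T N (w x)))\<^sup>2) * indicator (cball 0 R) x) \<partial>lebesgue)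
        + 2 * (\<integral>\<^sup>+x. (ennreal ((norm (T N (w x) - T N (g n x)))\<^sup>2) * indicator (cball 0 R) x) \<partial>lebesgue)"
    by (subst nn_integral_add) (auto simp: nn_integral_cmult)
  also have "\<dots> < 2 * ennreal (\<eta> / 4) + 2 * ennreal (\<eta> / 4)"
    using N n by (intro add_strict_mono ennreal_mult_strict_left_mono) auto
  also have "\<dots> = ennreal \<eta>"
    using \<eta> by (simp add: ennreal_plus[symmetric] ennreal_mult'[symmetric] flip: ennreal_numeral del: ennreal_plus)
  finally show ?thesis using cTg by blast
qed

context torus_basis
begin

lemma L2sq_components:
  fixes u :: "'n euclid \<Rightarrow> real^'m::finite"
  assumes [measurable]: "u \<in> borel_measurable lebesgue"
  shows "L2sq u = (\<Sum>I\<in>UNIV. L2sq (\<lambda>x. u x $ I))"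
proof -
  have [measurable]: "(\<lambda>x. u x $ I) \<in> borel_measurable lebesgue" for I
    by (rule borel_measurable_continuous_on[OF linear_continuous_on[OF bounded_linear_vec_nth]]) simp
  have eq: "ennreal ((norm (u x))\<^sup>2) = (\<Sum>I\<in>UNIV. ennreal ((u x $ I)\<^sup>2))" for x
    by (simp add: norm_vec_def L2_set_def sum_nonneg sum_ennreal)
  show ?thesis
    unfolding L2sq_def eq sum_distrib_right by (subst nn_integral_sum) auto
qed

lemma L2sq_real:
  fixes f :: "'n euclid \<Rightarrow> real"
  assumes "set_integrable lebesgue (fund_cell e) (\<lambda>x. (f x)\<^sup>2)"
  shows "L2sq f = ennreal (torus_integral e (\<lambda>x. (f x)\<^sup>2))"
  using assms unfolding L2sq_def torus_integral_def set_integrable_def set_lebesgue_integral_def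
  by (subst nn_integral_eq_integral[symmetric]) (auto simp: ennreal_indicator_sq)

lemma torus_integral_component:
  fixes u :: "'n euclid \<Rightarrow> real^'m::finite"
  assumes "set_integrable lebesgue (fund_cell e) u"
  shows "torus_integral e u $ I = torus_integral e (\<lambda>x. u x $ I)"
  using integral_bounded_linear[OF bounded_linear_vec_nth[of I] assms[unfolded set_integrable_def]]
  unfolding torus_integral_def set_lebesgue_integral_def by simp

lemma locally_integrable_component:
  fixes u :: "'n euclid \<Rightarrow> real^'m::finite"
  assumes "locally_integrable u"
  shows "locally_integrable (\<lambda>x. u x $ I)"
proof -
  have "(\<lambda>x. u x $ I) \<in> borel_measurable lebesgue"
    by (rule borel_measurable_continuous_on[OF linear_continuous_on[OF bounded_linear_vec_nth]])
       (use assms in \<open>simp add: locally_integrable_def\<close>)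
  moreover have "set_integrable lebesgue (cball 0 R) (\<lambda>x. u x $ I)" for R
    using integrable_bounded_linear[OF bounded_linear_vec_nth[of I], of lebesgue "\<lambda>x. indicator (cball 0 R) x *\<^sub>R u x"] assms
    by (simp add: locally_integrable_def set_integrable_def)
  ultimately show ?thesis by (simp add: locally_integrable_def)
qed

lemma L2_component_integrable:
  assumes "u \<in> L2_forms e"
  shows "set_integrable lebesgue (fund_cell e) (\<lambda>x. (u x $ I)\<^sup>2)"
proof -
  have [measurable]: "u \<in> borel_measurable lebesgue" using assms by (simp add: L2_forms_iff)
  have [measurable]: "(\<lambda>x. u x $ I) \<in> borel_measurable lebesgue"
    using locally_integrable_component[OF L2_forms_locally_integrable[OF assms]] by (simp add: locally_integrable_def)
  have int: "integrable lebesgue (\<lambda>x. indicator (fund_cell e) x *\<^sub>R (norm (u x))\<^sup>2)"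
    using assms unfolding L2_forms_def set_integrable_def by simp
  show ?thesis
    unfolding set_integrable_def
  proof (rule Bochner_Integration.integrable_bound[OF int])
    have "(u x $ I)\<^sup>2 \<le> (norm (u x))\<^sup>2" for x
      using component_le_norm_cart[of "u x" I] by (metis abs_ge_zero power2_abs power_mono)
    then show "AE x in lebesgue. norm (indicator (fund_cell e) x *\<^sub>R (u x $ I)\<^sup>2) \<le> norm (indicator (fund_cell e) x *\<^sub>R (norm (u x))\<^sup>2)"
      by (auto simp: indicator_def)
  qed measurable
qed

lemma mollified_weak_partial:
  assumes k: "kernel k r" and c: "(\<integral>\<^sup>+y. ennreal \<bar>k y\<bar> \<partial>lborel) = ennreal c" "0 < c"
    and w: "w \<in> L2_forms e" and V: "has_weak_partial e js w V"
  shows "L2sq (partial_deriv (rev js) (conv k w)) \<le> ennreal (c\<^sup>2) * L2sq V"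
proof -
  have VL2: "V \<in> L2_forms e" using V by (simp add: has_weak_partial_def)
  note lw = L2_forms_locally_integrable[OF w] and lV = L2_forms_locally_integrable[OF VL2]
  define D where "D = partial_deriv (rev js) (conv k w)"
  have sk: "smooth (conv k w)" by (rule kernel.conv_smooth(2)[OF k lw])
  have sD: "smooth D" unfolding D_def by (intro smooth_partial_deriv sk)
  have mD: "D \<in> borel_measurable lebesgue" by (rule continuous_borel_measurable_lebesgue[OF smooth_continuous[OF sD]])
  have mV: "V \<in> borel_measurable lebesgue" using VL2 by (simp add: L2_forms_iff)
  have comp: "L2sq (\<lambda>x. D x $ I) \<le> ennreal (c\<^sup>2) * L2sq (\<lambda>x. V x $ I)" for I
  proof -
    have DI: "(\<lambda>x. D x $ I) = partial_deriv (rev js) (conv k (\<lambda>x. w x $ I))"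
      unfolding D_def smooth_component(2)[OF sk, symmetric]
      using kernel.conv_bounded_linear[OF k bounded_linear_vec_nth[of I] lw] by presburger
    have weak: "torus_integral e (\<lambda>x. \<psi> x * V x $ I) = (- 1) ^ length js * torus_integral e (\<lambda>x. partial_deriv js \<psi> x * w x $ I)"
      if \<psi>: "\<psi> \<in> test_functions e" for \<psi>
    proof -
      have s\<psi>: "smooth \<psi>" using \<psi> by (simp add: test_functions_def)
      have "torus_integral e (\<lambda>x. \<psi> x *\<^sub>R V x) = (- 1) ^ length js *\<^sub>R torus_integral e (\<lambda>x. partial_deriv js \<psi> x *\<^sub>R w x)"
        using V \<psi> by (simp add: has_weak_partial_def)
      then have "torus_integral e (\<lambda>x. \<psi> x *\<^sub>R V x) $ I = (- 1) ^ length js * torus_integral e (\<lambda>x. partial_deriv js \<psi> x *\<^sub>R w x) $ I"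
        by simp
      then show ?thesis
        by (simp add: torus_integral_component integrable_scaleR_continuous lV lw smooth_continuous[OF s\<psi>] smooth_continuous_on[OF s\<psi>])
    qed
    have "torus_integral e (\<lambda>x. (partial_deriv (rev js) (conv k (\<lambda>x. w x $ I)) x)\<^sup>2) \<le> c\<^sup>2 * torus_integral e (\<lambda>x. (V x $ I)\<^sup>2)"
      by (rule mollified_weak_partial_scalar[OF k c])
         (use w weak in \<open>auto simp: L2_forms_iff periodic_def intro!: locally_integrable_component lw lV L2_component_integrable VL2\<close>)
    moreover have "set_integrable lebesgue (fund_cell e) (\<lambda>x. (D x $ I)\<^sup>2)"
      by (intro locally_integrable_bounded[OF continuous_locally_integrable] bounded_fund_cell sets_fund_cell
          continuous_intros smooth_continuous[OF sD])
    ultimately have "L2sq (\<lambda>x. D x $ I) \<le> ennreal (c\<^sup>2 * torus_integral e (\<lambda>x. (V x $ I)\<^sup>2))"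
      unfolding DI[symmetric] by (subst L2sq_real) (auto intro: ennreal_leI)
    also have "\<dots> = ennreal (c\<^sup>2) * L2sq (\<lambda>x. V x $ I)"
      unfolding L2sq_real[OF L2_component_integrable[OF VL2]] by (rule ennreal_mult') simp
    finally show ?thesis .
  qed
  have "L2sq D \<le> (\<Sum>I\<in>UNIV. ennreal (c\<^sup>2) * L2sq (\<lambda>x. V x $ I))"
    unfolding L2sq_components[OF mD] by (intro sum_mono comp)
  then show ?thesis
    unfolding L2sq_components[OF mV] D_def by (simp add: sum_distrib_left)
qed

text \<open>Young's inequality, from Cauchy-Schwarz with |k| split into two square roots. As
  \<open>v\<close> is not assumed periodic, the right side integrates over a ball that contains the
  cell with a margin of width 1 for the support of \<open>k\<close>.\<close>

lemma conv_L2_le: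
  fixes v :: "'n euclid \<Rightarrow> 'b::euclidean_space"
  assumes k: "kernel k r" "r \<le> 1" and v: "locally_integrable v" and R: "fund_cell e \<subseteq> cball 0 (R - 1)"
  shows "L2sq (conv k v) \<le> (\<integral>\<^sup>+y. ennreal \<bar>k y\<bar> \<partial>lborel)\<^sup>2 * (\<integral>\<^sup>+x\<in>cball 0 R. ennreal ((norm (v x))\<^sup>2) \<partial>lebesgue)"
proof -
  let ?c = "\<integral>\<^sup>+y. ennreal \<bar>k y\<bar> \<partial>lborel"
  have [measurable]: "v \<in> borel_measurable lebesgue" using v by (simp add: locally_integrable_def)
  have "(\<lambda>x. ennreal (norm (v x))) \<in> borel_measurable lebesgue" by measurable
  \<comment> \<open>A Borel version of |v|, for product measurability in Tonelli.\<close>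
  then obtain N where N[measurable]: "N \<in> borel_measurable borel" and AEN: "AE x in lborel. ennreal (norm (v x)) = N x"
    using completion_ex_borel_measurable[of "\<lambda>x. ennreal (norm (v x))" lborel] by auto
  have AEN: "AE x in lebesgue. ennreal (norm (v x)) = N x" using AEN by (rule AE_completion)
  have [measurable]: "k \<in> borel_measurable borel"
    by (intro borel_measurable_continuous_onI smooth_continuous[OF kernel.smooth_k[OF k(1)]])
  have [measurable]: "fund_cell e \<in> sets borel" by (rule borel_fund_cell)
  have [measurable]: "cball (0 :: 'n euclid) R \<in> sets borel" by simp
  have pointwise: "ennreal ((norm (conv k v x))\<^sup>2) \<le> ?c * (\<integral>\<^sup>+y. ennreal \<bar>k y\<bar> * (N (x - y))\<^sup>2 \<partial>lborel)" for x
  proof -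
    have "ennreal (norm (conv k v x)) \<le> (\<integral>\<^sup>+y. ennreal (norm (k y *\<^sub>R v (x - y))) \<partial>lebesgue)"
      unfolding kernel.conv_eq_reflected(1)[OF k(1) v] by (rule ennreal_norm_integral_le)
    also have "\<dots> = (\<integral>\<^sup>+y. ennreal \<bar>k y\<bar> * N (x - y) \<partial>lebesgue)"
      by (rule nn_integral_cong_AE)
         (use AE_lebesgue_reflect[OF AEN, of x] in \<open>auto elim!: eventually_mono simp: ennreal_mult\<close>)
    also have "\<dots> = (\<integral>\<^sup>+y. ennreal (sqrt \<bar>k y\<bar>) * (ennreal (sqrt \<bar>k y\<bar>) * N (x - y)) \<partial>lborel)"
      unfolding nn_integral_completion by (intro nn_integral_cong) (simp add: mult.assoc[symmetric] ennreal_mult[symmetric])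
    finally have "(ennreal (norm (conv k v x)))\<^sup>2 \<le> (\<integral>\<^sup>+y. ennreal (sqrt \<bar>k y\<bar>) * (ennreal (sqrt \<bar>k y\<bar>) * N (x - y)) \<partial>lborel)\<^sup>2"
      by (intro power_mono) auto
    also have "\<dots> \<le> (\<integral>\<^sup>+y. (ennreal (sqrt \<bar>k y\<bar>))\<^sup>2 \<partial>lborel) * (\<integral>\<^sup>+y. (ennreal (sqrt \<bar>k y\<bar>) * N (x - y))\<^sup>2 \<partial>lborel)"
      by (rule Cauchy_Schwarz_nn_integral) measurable
    also have "\<dots> = ?c * (\<integral>\<^sup>+y. ennreal \<bar>k y\<bar> * (N (x - y))\<^sup>2 \<partial>lborel)"
      by (simp add: power_mult_distrib ennreal_power)
    finally show ?thesis by (simp add: ennreal_power)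
  qed
  let ?I = "\<integral>\<^sup>+x\<in>cball 0 R. (N x)\<^sup>2 \<partial>lborel"
  have slice: "(\<integral>\<^sup>+x\<in>fund_cell e. (N (x - y))\<^sup>2 \<partial>lborel) \<le> ?I" if "norm y \<le> 1" for y
  proof -
    have "(\<integral>\<^sup>+x\<in>fund_cell e. (N (x - y))\<^sup>2 \<partial>lborel) \<le> (\<integral>\<^sup>+x. (N (x + - y))\<^sup>2 * indicator (cball 0 R) (x + - y) \<partial>lborel)"
    proof (intro nn_integral_mono)
      fix x
      have "x - y \<in> cball 0 R" if "x \<in> fund_cell e"
        using R that \<open>norm y \<le> 1\<close> norm_triangle_ineq4[of x y] by force
      then show "(N (x - y))\<^sup>2 * indicator (fund_cell e) x \<le> (N (x + - y))\<^sup>2 * indicator (cball 0 R) (x + - y)"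
        by (auto simp: indicator_def)
    qed
    also have "\<dots> = (\<integral>\<^sup>+x. (N (x + - y))\<^sup>2 * indicator (cball 0 R) (x + - y) \<partial>lebesgue)"
      by (simp add: nn_integral_completion)
    also have "\<dots> = (\<integral>\<^sup>+x. (N x)\<^sup>2 * indicator (cball 0 R) x \<partial>lebesgue)"
    proof (rule nn_integral_lebesgue_translate)
      have "(\<lambda>x. (N x)\<^sup>2 * indicator (cball 0 R) x) \<in> borel_measurable lborel" by measurable
      then show "(\<lambda>x. (N x)\<^sup>2 * indicator (cball 0 R) x) \<in> borel_measurable lebesgue" by (rule measurable_completion)
    qed
    finally show ?thesis by (simp add: nn_integral_completion)
  qed
  have "L2sq (conv k v) \<le> (\<integral>\<^sup>+x. \<integral>\<^sup>+y. ?c * (ennreal \<bar>k y\<bar> * (N (x - y))\<^sup>2) * indicator (fund_cell e) x \<partial>lborel \<partial>lborel)"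
    unfolding L2sq_lborel
  proof (intro nn_integral_mono)
    fix x
    have "ennreal ((norm (conv k v x))\<^sup>2) * indicator (fund_cell e) x \<le> (?c * (\<integral>\<^sup>+y. ennreal \<bar>k y\<bar> * (N (x - y))\<^sup>2 \<partial>lborel)) * indicator (fund_cell e) x"
      by (intro mult_right_mono pointwise) simp
    also have "\<dots> = (\<integral>\<^sup>+y. ?c * (ennreal \<bar>k y\<bar> * (N (x - y))\<^sup>2) * indicator (fund_cell e) x \<partial>lborel)"
      by (simp add: nn_integral_cmult nn_integral_multc)
    finally show "ennreal ((norm (conv k v x))\<^sup>2) * indicator (fund_cell e) x
      \<le> (\<integral>\<^sup>+y. ?c * (ennreal \<bar>k y\<bar> * (N (x - y))\<^sup>2) * indicator (fund_cell e) x \<partial>lborel)" .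
  qed
  also have "\<dots> = (\<integral>\<^sup>+y. \<integral>\<^sup>+x. ?c * (ennreal \<bar>k y\<bar> * (N (x - y))\<^sup>2) * indicator (fund_cell e) x \<partial>lborel \<partial>lborel)"
    by (rule lborel_pair.Fubini'[symmetric]) measurable
  also have "\<dots> = (\<integral>\<^sup>+y. ?c * (ennreal \<bar>k y\<bar> * (\<integral>\<^sup>+x\<in>fund_cell e. (N (x - y))\<^sup>2 \<partial>lborel)) \<partial>lborel)"
    by (simp add: nn_integral_cmult mult.assoc)
  also have "\<dots> \<le> (\<integral>\<^sup>+y. ?c * (ennreal \<bar>k y\<bar> * ?I) \<partial>lborel)"
  proof (rule nn_integral_mono, rule mult_left_mono)
    fix y
    show "ennreal \<bar>k y\<bar> * (\<integral>\<^sup>+x\<in>fund_cell e. (N (x - y))\<^sup>2 \<partial>lborel) \<le> ennreal \<bar>k y\<bar> * ?I"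
    proof (cases "norm y \<le> 1")
      case True
      then show ?thesis by (intro mult_left_mono slice) auto
    next
      case False
      then have "k y = 0" using kernel.supp_k[OF k(1), of y] k(2) by simp
      then show ?thesis by simp
    qed
  qed simp
  also have "\<dots> = ?c\<^sup>2 * ?I"
    by (simp add: nn_integral_cmult nn_integral_multc power2_eq_square mult.assoc)
  finally have bound: "L2sq (conv k v) \<le> ?c\<^sup>2 * ?I" .
  have I: "?I = (\<integral>\<^sup>+x\<in>cball 0 R. ennreal ((norm (v x))\<^sup>2) \<partial>lebesgue)"
    unfolding nn_integral_completion[symmetric, of lborel]
    by (rule nn_integral_cong_AE) (use AEN in \<open>auto elim!: eventually_mono simp: ennreal_power[symmetric]\<close>)
  show ?thesis using bound unfolding I .
qed

end

context torus_basis
begin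

lemma L2sq_minus: "L2sq (\<lambda>x. - u x) = L2sq u"
  by (simp add: L2sq_def)

text \<open>By density, \<open>w\<close> is compared with a continuous \<open>g\<close>, for which
  mollification converges uniformly on the cell, and the mollification of w - g is controlled by
  Young's inequality. The function \<open>g\<close> is not known to be periodic, so it is taken
  close to \<open>w\<close> on a ball larger than the cell.\<close>

lemma mollify_L2_approx:
  fixes w :: "'n form"
  assumes \<phi>: "mollifier p \<phi>" and w: "w \<in> L2_forms e" and \<eta>: "0 < \<eta>"
  shows "\<exists>\<delta>>0. L2sq (\<lambda>x. w x - conv (mollifier_kernel \<phi> \<delta>) w x) \<le> ennreal \<eta>"
proof -
  define c where "c = (\<integral>y. \<bar>\<phi> y\<bar> \<partial>lebesgue)"
  define a where "a = measure lebesgue (fund_cell e)"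
  have c0: "0 < c" unfolding c_def by (rule nn_integral_abs_mollifier_kernel(3)[OF \<phi> zero_less_one])
  have a0: "0 \<le> a" by (simp add: a_def)
  have ea: "emeasure lebesgue (fund_cell e) = ennreal a"
    unfolding a_def using finite_emeasure_fund_cell by (intro emeasure_eq_ennreal_measure) auto
  obtain R0 where R0: "fund_cell e \<subseteq> ball 0 R0"
    using bounded_subset_ballD[OF bounded_fund_cell] by blast
  define R where "R = R0 + 1"
  have R: "fund_cell e \<subseteq> cball 0 (R - 1)"
    using R0 ball_subset_cball[of 0 R0] unfolding R_def by auto
  have R': "fund_cell e \<subseteq> cball 0 R" using R by (rule order_trans) auto
  \<comment> \<open>The final sum is 2 \<eta>1 + 4 c^2 \<eta>1 + 4 (c \<eta>2)^2 a. The first two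
    terms add up to \<eta> / 2 and the third is at most \<eta> / 2; the summand 1 in \<eta>2 keeps
    the denominator positive.\<close>
  define \<eta>1 where "\<eta>1 = \<eta> / (4 + 8 * c\<^sup>2)"
  define \<eta>2 where "\<eta>2 = sqrt (\<eta> / (8 * (c\<^sup>2 * a + 1)))"
  have pos1: "0 < \<eta>1" unfolding \<eta>1_def using \<eta> by (intro divide_pos_pos add_pos_nonneg) auto
  have den: "0 < c\<^sup>2 * a + 1" using a0 by (intro add_nonneg_pos) auto
  have pos2: "0 < \<eta>2" unfolding \<eta>2_def using \<eta> den by simp
  note lw = L2_forms_locally_integrable[OF w]
  have mw[measurable]: "w \<in> borel_measurable lebesgue" using w by (simp add: L2_forms_iff)
  obtain g where cg: "continuous_on UNIV g"
    and g: "(\<integral>\<^sup>+x\<in>cball 0 R. ennreal ((norm (w x - g x))\<^sup>2) \<partial>lebesgue) < ennreal \<eta>1"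
    using L2_continuous_approx[OF mw L2_forms_square_cball[OF w] pos1] by blast
  have lg: "locally_integrable g" by (rule continuous_locally_integrable[OF cg])
  have lv: "locally_integrable (\<lambda>x. w x - g x)" by (rule locally_integrable_diff[OF lw lg])
  have mg[measurable]: "g \<in> borel_measurable lebesgue" by (rule continuous_borel_measurable_lebesgue[OF cg])
  have "uniformly_continuous_on (cball 0 R) g"
    by (intro compact_uniformly_continuous continuous_on_subset[OF cg]) auto
  then obtain d where d: "0 < d" "\<And>x x'. x \<in> cball 0 R \<Longrightarrow> x' \<in> cball 0 R \<Longrightarrow> dist x' x < d \<Longrightarrow> dist (g x') (g x) < \<eta>2"
    unfolding uniformly_continuous_on_def using pos2 by metis
  \<comment> \<open>At most 1, to stay within the margin of the ball, and below d, for uniform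
    continuity.\<close>
  define \<delta> where "\<delta> = min 1 (d / 2)"
  have \<delta>: "0 < \<delta>" "\<delta> \<le> 1" "\<delta> < d" using d(1) by (auto simp: \<delta>_def)
  let ?k = "mollifier_kernel \<phi> \<delta>"
  note ker = kernel_mollifier[OF \<phi> \<delta>(1)]
  have ck: "(\<integral>\<^sup>+y. ennreal \<bar>?k y\<bar> \<partial>lborel) = ennreal c"
    unfolding c_def by (rule nn_integral_abs_mollifier_kernel(1)[OF \<phi> \<delta>(1)])
  have k1: "(\<integral>y. ?k y \<partial>lebesgue) = 1" by (rule nn_integral_abs_mollifier_kernel(2)[OF \<phi> \<delta>(1)])
  have intk: "integrable lebesgue ?k"
    using kernel.conv_eq_reflected(2)[OF ker continuous_locally_integrable[OF continuous_on_const[of UNIV "1::real"]]]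
    by simp
  have diff_g: "norm (g x - conv ?k g x) \<le> c * \<eta>2" if x: "x \<in> fund_cell e" for x
  proof -
    note intg = kernel.conv_eq_reflected(2)[OF ker lg, of x]
    have "g x = (\<integral>y. ?k y *\<^sub>R g x \<partial>lebesgue)" using intk k1 by simp
    then have "g x - conv ?k g x = (\<integral>y. ?k y *\<^sub>R g x \<partial>lebesgue) - (\<integral>y. ?k y *\<^sub>R g (x - y) \<partial>lebesgue)"
      by (simp add: kernel.conv_eq_reflected(1)[OF ker lg])
    also have "\<dots> = (\<integral>y. ?k y *\<^sub>R g x - ?k y *\<^sub>R g (x - y) \<partial>lebesgue)"
      using intk intg by (intro Bochner_Integration.integral_diff[symmetric]) auto
    also have "\<dots> = (\<integral>y. ?k y *\<^sub>R (g x - g (x - y)) \<partial>lebesgue)"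
      by (simp add: scaleR_diff_right)
    finally have diff: "g x - conv ?k g x = (\<integral>y. ?k y *\<^sub>R (g x - g (x - y)) \<partial>lebesgue)" .
    have "ennreal (norm (g x - conv ?k g x)) \<le> (\<integral>\<^sup>+y. ennreal (norm (?k y *\<^sub>R (g x - g (x - y)))) \<partial>lebesgue)"
      unfolding diff by (rule ennreal_norm_integral_le)
    also have "\<dots> \<le> (\<integral>\<^sup>+y. ennreal \<bar>?k y\<bar> * ennreal \<eta>2 \<partial>lebesgue)"
    proof (intro nn_integral_mono)
      fix y
      show "ennreal (norm (?k y *\<^sub>R (g x - g (x - y)))) \<le> ennreal \<bar>?k y\<bar> * ennreal \<eta>2"
      proof (cases "norm y \<le> \<delta>")
        case True
        have "x \<in> cball 0 R" using x R' by blast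
        moreover have "x - y \<in> cball 0 R"
        proof -
          have "norm x \<le> R - 1" using x R by auto
          then show ?thesis using True \<delta>(2) norm_triangle_ineq4[of x y] by simp
        qed
        moreover have "dist (x - y) x < d" using True \<delta>(3) by (simp add: dist_norm)
        ultimately have "dist (g (x - y)) (g x) < \<eta>2" by (intro d(2))
        then have "norm (g x - g (x - y)) \<le> \<eta>2" by (simp add: dist_norm norm_minus_commute)
        then show ?thesis
          using pos2 by (auto simp: ennreal_mult[symmetric] intro!: ennreal_leI mult_left_mono)
      next
        case False
        then have "?k y = 0" using kernel.supp_k[OF ker, of y] by simp
        then show ?thesis by simp
      qed
    qed
    also have "\<dots> = ennreal c * ennreal \<eta>2"
    proof -
      have "(\<lambda>y. ennreal \<bar>?k y\<bar>) \<in> borel_measurable lebesgue" using intk by measurable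
      then show ?thesis
        using ck by (subst nn_integral_multc) (auto simp: nn_integral_completion)
    qed
    also have "\<dots> = ennreal (c * \<eta>2)" using c0 pos2 by (simp add: ennreal_mult)
    finally show ?thesis using c0 pos2 by (subst (asm) ennreal_le_iff) auto
  qed
  have cconv: "continuous_on UNIV (conv ?k u)" if "locally_integrable u" for u :: "'n form"
    by (rule smooth_continuous[OF kernel.conv_smooth(2)[OF ker that]])
  have mconv: "conv ?k u \<in> borel_measurable lebesgue" if "locally_integrable u" for u :: "'n form"
    by (rule continuous_borel_measurable_lebesgue[OF cconv[OF that]])
  note [measurable] = mconv[OF lg] mconv[OF lv]
  have A: "L2sq (\<lambda>x. w x - g x) \<le> ennreal \<eta>1"
  proof -
    have "L2sq (\<lambda>x. w x - g x) \<le> (\<integral>\<^sup>+x\<in>cball 0 R. ennreal ((norm (w x - g x))\<^sup>2) \<partial>lebesgue)"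
      unfolding L2sq_def by (intro nn_integral_mono) (use R' in \<open>auto simp: indicator_def\<close>)
    then show ?thesis using g by simp
  qed
  have B: "L2sq (\<lambda>x. g x - conv ?k g x) \<le> ennreal ((c * \<eta>2)\<^sup>2 * a)"
  proof -
    have "L2sq (\<lambda>x. g x - conv ?k g x) \<le> (\<integral>\<^sup>+x. ennreal ((c * \<eta>2)\<^sup>2) * indicator (fund_cell e) x \<partial>lebesgue)"
      unfolding L2sq_def
      by (intro nn_integral_mono) (auto simp: indicator_def intro!: ennreal_leI power_mono diff_g)
    also have "\<dots> = ennreal ((c * \<eta>2)\<^sup>2 * a)"
      using ea by (simp add: nn_integral_cmult_indicator ennreal_mult')
    finally show ?thesis .
  qed
  have D: "L2sq (conv ?k (\<lambda>x. w x - g x)) \<le> ennreal (c\<^sup>2 * \<eta>1)"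
  proof -
    have "L2sq (conv ?k (\<lambda>x. w x - g x)) \<le> (ennreal c)\<^sup>2 * (\<integral>\<^sup>+x\<in>cball 0 R. ennreal ((norm (w x - g x))\<^sup>2) \<partial>lebesgue)"
      using conv_L2_le[OF ker \<delta>(2) lv R] unfolding ck .
    also have "\<dots> \<le> (ennreal c)\<^sup>2 * ennreal \<eta>1" using g by (intro mult_left_mono) auto
    also have "\<dots> = ennreal (c\<^sup>2 * \<eta>1)" using c0 pos1 by (simp add: ennreal_mult ennreal_power)
    finally show ?thesis .
  qed
  have eq: "w x - conv ?k w x = (w x - g x) + ((g x - conv ?k g x) + - conv ?k (\<lambda>x. w x - g x) x)" for x
    using kernel.conv_diff[OF ker lw lg, of x] by simp
  have "L2sq (\<lambda>x. w x - conv ?k w x) \<le> 2 * L2sq (\<lambda>x. w x - g x)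
      + 2 * L2sq (\<lambda>x. (g x - conv ?k g x) + - conv ?k (\<lambda>x. w x - g x) x)"
    unfolding eq by (rule L2sq_add_le) measurable
  also have "\<dots> \<le> 2 * L2sq (\<lambda>x. w x - g x)
      + 2 * (2 * L2sq (\<lambda>x. g x - conv ?k g x) + 2 * L2sq (\<lambda>x. - conv ?k (\<lambda>x. w x - g x) x))"
    by (intro add_mono mult_left_mono order_refl L2sq_add_le) auto
  also have "\<dots> \<le> 2 * ennreal \<eta>1 + 2 * (2 * ennreal ((c * \<eta>2)\<^sup>2 * a) + 2 * ennreal (c\<^sup>2 * \<eta>1))"
    unfolding L2sq_minus by (intro add_mono mult_left_mono A B D) auto
  also have "\<dots> = ennreal (2 * \<eta>1 + 2 * (2 * ((c * \<eta>2)\<^sup>2 * a) + 2 * (c\<^sup>2 * \<eta>1)))"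
    using pos1 a0 by (simp add: ennreal_plus ennreal_mult')
  also have "\<dots> \<le> ennreal \<eta>"
  proof (rule ennreal_leI)
    have 1: "2 * \<eta>1 + 4 * (c\<^sup>2 * \<eta>1) = \<eta> / 2"
    proof -
      have "(4 + 8 * c\<^sup>2) * \<eta>1 = \<eta>" unfolding \<eta>1_def by (simp add: add_pos_nonneg less_imp_neq[symmetric])
      then show ?thesis by (simp add: algebra_simps)
    qed
    have "(c * \<eta>2)\<^sup>2 * a = c\<^sup>2 * a * \<eta> / (8 * (c\<^sup>2 * a + 1))"
      using \<eta> den by (simp add: \<eta>2_def power_mult_distrib)
    also have "\<dots> \<le> \<eta> / 8"
    proof -
      have "c\<^sup>2 * a * \<eta> \<le> (c\<^sup>2 * a + 1) * \<eta>" using \<eta> by (intro mult_right_mono) auto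
      then show ?thesis using den by (subst pos_divide_le_eq) (auto simp: algebra_simps)
    qed
    finally show "2 * \<eta>1 + 2 * (2 * ((c * \<eta>2)\<^sup>2 * a) + 2 * (c\<^sup>2 * \<eta>1)) \<le> \<eta>"
      using 1 by simp
  qed
  finally show ?thesis using \<delta>(1) by blast
qed

end

section \<open>The smoothed projection\<close>

lemma ae_eq_trans: "ae_eq u v \<Longrightarrow> ae_eq v w \<Longrightarrow> ae_eq u w"
proof -
  assume "ae_eq u v" "ae_eq v w"
  then show ?thesis unfolding ae_eq_def by eventually_elim simp
qed

lemma ae_eq_sym: "ae_eq u v \<Longrightarrow> ae_eq v u"
  unfolding ae_eq_def by (simp add: eq_commute)

locale fe_projection = fe_interpolation e K X F
  for e :: "'n::{finite,linorder} \<Rightarrow> 'n euclid" and K and X and F +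
  fixes \<phi> :: "'n euclid \<Rightarrow> real" and p :: nat and \<epsilon> h CP :: real
  assumes mollifier_\<phi>: "mollifier p \<phi>" and pos_eps: "0 < \<epsilon>" and pos_h: "0 < h"
    and conforming: "global_space e K X \<subseteq> d_domain e"
    and iso: "restricts_to_iso (global_space e K X) (mollified_interpolator K X F \<phi> (\<epsilon> * h))"
    and proj_bound: "\<And>u. u \<in> L2_forms e \<Longrightarrow>
      L2_norm e (smoothed_projection e K X F \<phi> (\<epsilon> * h) u) \<le> CP * L2_norm e u"
begin

abbreviation "XH \<equiv> global_space e K X"
abbreviation "Q \<equiv> mollified_interpolator K X F \<phi> (\<epsilon> * h)"
abbreviation "P \<equiv> smoothed_projection e K X F \<phi> (\<epsilon> * h)"

lemma XH_L2: "u \<in> XH \<Longrightarrow> u \<in> L2_forms e"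
  using conforming unfolding d_domain_def by blast

lemma pos_eps_h: "0 < \<epsilon> * h"
  using pos_eps pos_h by simp

lemma mollify_smooth:
  assumes "u \<in> L2_forms e"
  shows "smooth (mollify \<phi> (\<epsilon> * h) u)" "periodic e (mollify \<phi> (\<epsilon> * h) u)"
  using assms L2_forms_locally_integrable[OF assms] kernel_mollifier[OF mollifier_\<phi> pos_eps_h]
  by (auto simp: mollify_eq_conv[OF mollifier_\<phi> pos_eps_h] L2_forms_iff intro!: kernel.conv_smooth(2) conv_periodic)

lemma Q_mem: "u \<in> L2_forms e \<Longrightarrow> Q u \<in> XH"
  unfolding mollified_interpolator_def by (intro interpolator_in_global_space mollify_smooth)

lemma Q_diff:
  assumes "u \<in> L2_forms e" "v \<in> L2_forms e"
  shows "ae_eq (Q (\<lambda>x. u x - v x)) (\<lambda>x. Q u x - Q v x)"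
proof -
  note lu = L2_forms_locally_integrable[OF assms(1)] and lv = L2_forms_locally_integrable[OF assms(2)]
  have "mollify \<phi> (\<epsilon> * h) (\<lambda>x. u x - v x) = (\<lambda>x. mollify \<phi> (\<epsilon> * h) u x - mollify \<phi> (\<epsilon> * h) v x)"
    using kernel.conv_diff[OF kernel_mollifier[OF mollifier_\<phi> pos_eps_h] lu lv]
    by (simp add: mollify_eq_conv[OF mollifier_\<phi> pos_eps_h] lu lv locally_integrable_diff fun_eq_iff)
  then show ?thesis
    unfolding ae_eq_def mollified_interpolator_def
    using AE_in_full_cell
    by (auto elim!: eventually_mono simp: interpolator_diff mollify_smooth assms)
qed

text \<open>\<open>projection_of\<close> selects a solution of an equation modulo null sets. A
  solution exists because the image of \<open>u\<close> under \<open>Q\<close> lies in the discrete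
  space, and \<open>Q\<close> is onto there.\<close>

lemma P_spec:
  assumes "u \<in> L2_forms e"
  shows "P u \<in> XH" "ae_eq (Q (P u)) (Q u)"
proof -
  have "\<forall>v\<in>XH. \<exists>w\<in>XH. ae_eq (Q w) v" using iso unfolding restricts_to_iso_def by blast
  then have "\<exists>w. w \<in> XH \<and> ae_eq (Q w) (Q u)" using Q_mem[OF assms] by blast
  then have "P u \<in> XH \<and> ae_eq (Q (P u)) (Q u)"
    unfolding smoothed_projection_def projection_of_def by (rule someI_ex)
  then show "P u \<in> XH" "ae_eq (Q (P u)) (Q u)" by auto
qed

lemma Q_inj: "w \<in> XH \<Longrightarrow> w' \<in> XH \<Longrightarrow> ae_eq (Q w) (Q w') \<Longrightarrow> ae_eq w w'"
  using iso unfolding restricts_to_iso_def by blast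

text \<open>Being a choice of representatives, \<open>P\<close> is linear only up to null sets. Both
  sides lie in the discrete space and have the same image under \<open>Q\<close>, which is injective
  there. This combines linearity with the projection property for \<open>v\<close>.\<close>

lemma P_diff_XH:
  assumes u: "u \<in> L2_forms e" and v: "v \<in> XH"
  shows "ae_eq (P (\<lambda>x. u x - v x)) (\<lambda>x. P u x - v x)"
proof (rule Q_inj)
  note vL = XH_L2[OF v]
  have uv: "(\<lambda>x. u x - v x) \<in> L2_forms e" by (rule L2_forms_diff[OF u vL])
  show "P (\<lambda>x. u x - v x) \<in> XH" by (rule P_spec(1)[OF uv])
  show "(\<lambda>x. P u x - v x) \<in> XH" by (rule global_space_diff[OF P_spec(1)[OF u] v])
  have "ae_eq (Q (P (\<lambda>x. u x - v x))) (\<lambda>x. Q u x - Q v x)"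
    using P_spec(2)[OF uv] Q_diff[OF u vL] by (rule ae_eq_trans)
  moreover have "ae_eq (Q (\<lambda>x. P u x - v x)) (\<lambda>x. Q (P u) x - Q v x)"
    by (rule Q_diff[OF XH_L2[OF P_spec(1)[OF u]] vL])
  moreover have "ae_eq (\<lambda>x. Q (P u) x - Q v x) (\<lambda>x. Q u x - Q v x)"
    using P_spec(2)[OF u] unfolding ae_eq_def by (auto elim!: eventually_mono)
  ultimately show "ae_eq (Q (P (\<lambda>x. u x - v x))) (Q (\<lambda>x. P u x - v x))"
    by (rule ae_eq_trans[OF _ ae_eq_sym[OF ae_eq_trans]])
qed

text \<open>With w = u - v, the error u - P u equals w - P w almost everywhere, so it is bounded
  through the boundedness of \<open>P\<close>. Adding squares gives 2 + 2 CP^2 in place of (1 +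
  CP)^2.\<close>

lemma quasi_optimal:
  assumes u: "u \<in> L2_forms e" and v: "v \<in> XH"
  shows "L2sq (\<lambda>x. u x - P u x) \<le> ennreal (2 + 2 * CP\<^sup>2) * L2sq (\<lambda>x. u x - v x)"
proof -
  let ?w = "\<lambda>x. u x - v x"
  have w: "?w \<in> L2_forms e" by (rule L2_forms_diff[OF u XH_L2[OF v]])
  have Pw: "P ?w \<in> L2_forms e" by (rule XH_L2[OF P_spec(1)[OF w]])
  have [measurable]: "u \<in> borel_measurable lebesgue" "v \<in> borel_measurable lebesgue" "P ?w \<in> borel_measurable lebesgue"
    using u XH_L2[OF v] Pw by (auto simp: L2_forms_iff)
  have "L2sq (\<lambda>x. u x - P u x) = L2sq (\<lambda>x. ?w x + - P ?w x)"
    using P_diff_XH[OF u v] unfolding ae_eq_def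
    by (intro L2sq_cong_AE) (auto elim!: eventually_mono)
  also have "\<dots> \<le> 2 * L2sq ?w + 2 * L2sq (\<lambda>x. - P ?w x)"
    by (rule L2sq_add_le) measurable
  also have "\<dots> = 2 * L2sq ?w + 2 * L2sq (P ?w)" by (simp add: L2sq_minus)
  also have "L2sq (P ?w) \<le> ennreal (CP\<^sup>2) * L2sq ?w"
  proof -
    have "(L2_norm e (P ?w))\<^sup>2 \<le> (CP * L2_norm e ?w)\<^sup>2"
      by (rule power_mono[OF proj_bound[OF w] L2_norm_nonneg])
    then show ?thesis
      unfolding L2sq_eq_norm[OF w] L2sq_eq_norm[OF Pw] by (simp add: power_mult_distrib ennreal_mult[symmetric] ennreal_leI)
  qed
  then have "2 * L2sq ?w + 2 * L2sq (P ?w) \<le> 2 * L2sq ?w + 2 * (ennreal (CP\<^sup>2) * L2sq ?w)"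
    by (intro add_left_mono mult_left_mono) auto
  also have "\<dots> = ennreal (2 + 2 * CP\<^sup>2) * L2sq ?w"
    by (simp add: ennreal_plus ennreal_mult' distrib_right mult.assoc)
  finally show ?thesis .
qed

text \<open>The competitor is Q f, with \<open>f\<close> a mollification of \<open>w\<close> at a
  scale \<delta> chosen after h. It contributes its distance to \<open>w\<close>, as small as
  desired, and the interpolation error of \<open>f\<close>, bounded by weak derivatives of
  \<open>w\<close> with a factor free of \<delta>. The arbitrary \<theta> lets the first
  contribution disappear.\<close>

lemma projection_error:
  assumes B: "\<And>js y. norm (partial_deriv js \<phi> y) \<le> B js"
    and bounded: "\<And>T k u. is_full T \<Longrightarrow> u \<in> smooth_kforms k \<Longrightarrow> Cm_norm h m T (LI k T u) \<le> C * Cm_norm h m T u"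
    and diam: "\<And>T. T \<in> K \<Longrightarrow> diameter T \<le> h"
    and polynomials: "\<And>T k. T \<in> K \<Longrightarrow> polynomial_kforms p k \<subseteq> X k T"
    and r: "r \<le> p + 1" and w: "w \<in> L2_forms e" and V: "\<And>js. length js = r \<Longrightarrow> has_weak_partial e js w (V js)"
  shows "L2sq (\<lambda>x. w x - P w x)
    \<le> ennreal ((2 + 2 * CP\<^sup>2) * (2 * smooth_error_constant CARD('n) (stability_constant B \<epsilon> m C) \<epsilon> r
          * (\<integral>y. \<bar>\<phi> y\<bar> \<partial>lebesgue)\<^sup>2) * (h ^ r)\<^sup>2)
        * (\<Sum>js | length js = r. L2sq (V js))"
proof -
  define E where "E = smooth_error_constant CARD('n) (stability_constant B \<epsilon> m C) \<epsilon> r"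
  define c where "c = (\<integral>y. \<bar>\<phi> y\<bar> \<partial>lebesgue)"
  define S where "S = (\<Sum>js | length js = r. L2sq (V js))"
  have c0: "0 < c" unfolding c_def by (rule nn_integral_abs_mollifier_kernel(3)[OF mollifier_\<phi> zero_less_one])
  have E0: "0 \<le> E" unfolding E_def smooth_error_constant_def by (intro mult_nonneg_nonneg add_nonneg_nonneg) auto
  let ?K = "2 + 2 * CP\<^sup>2"
  have K0: "0 < ?K" by (simp add: add_pos_nonneg)
  have "L2sq (\<lambda>x. w x - P w x) \<le> ennreal (?K * (2 * E * c\<^sup>2) * (h ^ r)\<^sup>2) * S + ennreal \<theta>" if \<theta>: "0 < \<theta>" for \<theta>
  proof -
    \<comment> \<open>The factor \<open>?K\<close> of quasi-optimality and the 2 from adding squares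
      turn \<eta> into \<theta>.\<close>
    define \<eta> where "\<eta> = \<theta> / (2 * ?K)"
    have \<eta>: "0 < \<eta>" using \<theta> K0 by (simp add: \<eta>_def)
    obtain \<delta> where \<delta>: "0 < \<delta>" "L2sq (\<lambda>x. w x - conv (mollifier_kernel \<phi> \<delta>) w x) \<le> ennreal \<eta>"
      using mollify_L2_approx[OF mollifier_\<phi> w \<eta>] by blast
    note ker = kernel_mollifier[OF mollifier_\<phi> \<delta>(1)]
    define f where "f = conv (mollifier_kernel \<phi> \<delta>) w"
    note lw = L2_forms_locally_integrable[OF w]
    have sf: "smooth f" and pf: "periodic e f"
      unfolding f_def using w by (auto simp: L2_forms_iff intro!: kernel.conv_smooth(2)[OF ker lw] conv_periodic[OF ker lw])
    have fL: "f \<in> L2_forms e" by (rule continuous_periodic_L2[OF pf smooth_continuous[OF sf]])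
    have Qf: "Q f \<in> XH" by (rule Q_mem[OF fL])
    \<comment> \<open>The bound for mollified forms concerns derivatives in reversed order; in a sum
      over all lists of length r this makes no difference.\<close>
    have rev: "(\<Sum>js | length js = r. L2sq (partial_deriv js f)) = (\<Sum>js | length js = r. L2sq (partial_deriv (rev js) f))"
      by (rule sum.reindex_bij_witness[of _ rev rev]) auto
    have "L2sq (\<lambda>x. f x - Q f x) \<le> ennreal (E * (h ^ r)\<^sup>2) * (\<Sum>js | length js = r. L2sq (partial_deriv js f))"
      unfolding mollified_interpolator_def E_def
      by (rule smooth_interpolation_error[OF mollifier_\<phi> pos_eps pos_h B bounded diam polynomials sf pf r])
    also have "\<dots> \<le> ennreal (E * (h ^ r)\<^sup>2) * (ennreal (c\<^sup>2) * S)"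
      unfolding rev unfolding S_def sum_distrib_left f_def
      by (intro mult_left_mono sum_mono mollified_weak_partial[OF ker _ c0 w V])
         (auto simp: c_def nn_integral_abs_mollifier_kernel(1)[OF mollifier_\<phi> \<delta>(1)])
    finally have fQ: "L2sq (\<lambda>x. f x - Q f x) \<le> ennreal (E * (h ^ r)\<^sup>2) * (ennreal (c\<^sup>2) * S)" .
    have [measurable]: "w \<in> borel_measurable lebesgue" "f \<in> borel_measurable lebesgue" "Q f \<in> borel_measurable lebesgue"
      using w fL XH_L2[OF Qf] by (auto simp: L2_forms_iff)
    have "L2sq (\<lambda>x. w x - Q f x) = L2sq (\<lambda>x. (w x - f x) + (f x - Q f x))" by simp
    also have "\<dots> \<le> 2 * L2sq (\<lambda>x. w x - f x) + 2 * L2sq (\<lambda>x. f x - Q f x)"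
      by (rule L2sq_add_le) measurable
    also have "\<dots> \<le> 2 * ennreal \<eta> + 2 * (ennreal (E * (h ^ r)\<^sup>2) * (ennreal (c\<^sup>2) * S))"
      using \<delta>(2) fQ by (intro add_mono mult_left_mono) (auto simp: f_def)
    finally have wQ: "L2sq (\<lambda>x. w x - Q f x) \<le> 2 * ennreal \<eta> + 2 * (ennreal (E * (h ^ r)\<^sup>2) * (ennreal (c\<^sup>2) * S))" .
    have "L2sq (\<lambda>x. w x - P w x) \<le> ennreal ?K * L2sq (\<lambda>x. w x - Q f x)"
      by (rule quasi_optimal[OF w Qf])
    also have "\<dots> \<le> ennreal ?K * (2 * ennreal \<eta> + 2 * (ennreal (E * (h ^ r)\<^sup>2) * (ennreal (c\<^sup>2) * S)))"
      by (intro mult_left_mono wQ) simp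
    also have "\<dots> = ennreal ?K * (2 * ennreal \<eta>) + (ennreal ?K * (2 * (ennreal (E * (h ^ r)\<^sup>2) * ennreal (c\<^sup>2)))) * S"
      by (simp only: distrib_left mult.assoc)
    also have "ennreal ?K * (2 * (ennreal (E * (h ^ r)\<^sup>2) * ennreal (c\<^sup>2))) = ennreal (?K * (2 * E * c\<^sup>2) * (h ^ r)\<^sup>2)"
    proof -
      have "ennreal ?K * (2 * (ennreal (E * (h ^ r)\<^sup>2) * ennreal (c\<^sup>2))) = ennreal (?K * (2 * (E * (h ^ r)\<^sup>2 * c\<^sup>2)))"
        using E0 K0 by (simp only: ennreal_mult'' ennreal_numeral[symmetric] zero_le_power2 mult_nonneg_nonneg zero_le_numeral)
      then show ?thesis by (simp add: ac_simps)
    qed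
    also have "ennreal ?K * (2 * ennreal \<eta>) = ennreal \<theta>"
    proof -
      have scale: "a * (2 * (\<theta> / (2 * a))) = \<theta>" if "0 < a" for a :: real
        using that by simp
      have "ennreal ?K * (2 * ennreal \<eta>) = ennreal (?K * (2 * \<eta>))"
        using \<eta> K0 by (simp only: ennreal_mult'' ennreal_numeral[symmetric] less_imp_le mult_nonneg_nonneg zero_le_numeral)
      also have "?K * (2 * \<eta>) = \<theta>" unfolding \<eta>_def by (rule scale[OF K0])
      finally show ?thesis .
    qed
    finally show ?thesis by (simp add: add.commute)
  qed
  note approx = this
  show ?thesis
    unfolding E_def[symmetric] c_def[symmetric] S_def[symmetric]
    by (rule ennreal_le_epsilon) (rule approx)
qed

end

section \<open>Fourier coefficients\<close>

text \<open>The real span of cosine and sine at one frequency. It is closed under partial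
  derivatives, so one family serves as test functions and for the real and imaginary parts of
  Fourier coefficients.\<close>

definition trig :: "real \<Rightarrow> real \<Rightarrow> 'n::finite euclid \<Rightarrow> 'n euclid \<Rightarrow> real" where
  "trig a b \<xi> x = a * cos (\<xi> \<bullet> x) + b * sin (\<xi> \<bullet> x)"

lemma trig_has_derivative:
  "(trig a b \<xi> has_derivative (\<lambda>v. (\<xi> \<bullet> v) * trig b (- a) \<xi> x)) (at x)"
proof -
  have "(trig a b \<xi> has_derivative (\<lambda>v. a * (- sin (\<xi> \<bullet> x) * (\<xi> \<bullet> v)) + b * (cos (\<xi> \<bullet> x) * (\<xi> \<bullet> v)))) (at x)"
    unfolding trig_def by (auto intro!: derivative_eq_intros)
  then show ?thesis by (simp add: trig_def algebra_simps)
qed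

lemma partial_deriv_trig: "partial_deriv [j] (trig a b \<xi>) = trig (\<xi> $ j * b) (- (\<xi> $ j * a)) \<xi>"
  using partial_deriv_single_eqI[OF trig_has_derivative, of j a b \<xi>]
  by (simp add: fun_eq_iff inner_axis trig_def algebra_simps)

lemma smooth_trig: "smooth (trig a b \<xi>)"
proof (rule smoothI_class[where S = "{trig a b \<xi> | a b. True}"])
  show "\<And>v x. v \<in> {trig a b \<xi> | a b. True} \<Longrightarrow> v differentiable at x"
    using trig_has_derivative differentiable_def by blast
  show "\<And>v j. v \<in> {trig a b \<xi> | a b. True} \<Longrightarrow> partial_deriv [j] v \<in> {trig a b \<xi> | a b. True}"
    using partial_deriv_trig by blast
qed blast

context torus_basis
begin

abbreviation "covolume \<equiv> measure lebesgue (fund_cell e)"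

lemma frequency_inner_lattice:
  assumes "\<xi> \<in> frequencies e" "l \<in> lattice e"
  shows "\<exists>m::int. \<xi> \<bullet> l = 2 * pi * of_int m"
proof -
  obtain m :: "'n \<Rightarrow> int" where m: "\<And>i. \<xi> \<bullet> e i = 2 * pi * of_int (m i)"
    using assms(1) unfolding frequencies_def mem_Collect_eq by metis
  obtain k :: "'n \<Rightarrow> int" where k: "l = (\<Sum>i\<in>UNIV. of_int (k i) *\<^sub>R e i)"
    using assms(2) unfolding lattice_def by blast
  have "\<xi> \<bullet> l = 2 * pi * of_int (\<Sum>i\<in>UNIV. k i * m i)"
    unfolding k by (simp add: inner_sum_right m sum_distrib_left ac_simps)
  then show ?thesis by blast
qed

lemma periodic_trig:
  assumes "\<xi> \<in> frequencies e"
  shows "periodic e (trig a b \<xi>)"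
  unfolding periodic_def
proof (intro ballI allI)
  fix l x assume "l \<in> lattice e"
  then obtain m :: int where m: "\<xi> \<bullet> l = 2 * pi * of_int m"
    using frequency_inner_lattice[OF assms] by blast
  have "cos (\<xi> \<bullet> x + 2 * pi * of_int m) = cos (\<xi> \<bullet> x)" "sin (\<xi> \<bullet> x + 2 * pi * of_int m) = sin (\<xi> \<bullet> x)"
    by (simp_all add: cos_add sin_add)
  then show "trig a b \<xi> (x + l) = trig a b \<xi> x"
    by (simp add: trig_def inner_add_right m)
qed

lemma trig_test_function: "\<xi> \<in> frequencies e \<Longrightarrow> trig a b \<xi> \<in> test_functions e"
  by (simp add: test_functions_def periodic_trig smooth_trig)

text \<open>A nonzero frequency has a nonzero coordinate j, and dividing by it exhibits the function
  as the j-th partial derivative of a periodic one.\<close>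

lemma torus_integral_trig_zero:
  assumes \<xi>: "\<xi> \<in> frequencies e" "\<xi> \<noteq> 0"
  shows "torus_integral e (trig a b \<xi>) = 0"
proof -
  obtain j where j: "\<xi> $ j \<noteq> 0" using \<xi>(2) by (auto simp: vec_eq_iff)
  have "partial_deriv [j] (trig (- b / \<xi> $ j) (a / \<xi> $ j) \<xi>) = trig a b \<xi>"
    using j by (simp add: partial_deriv_trig)
  moreover have "torus_integral e (partial_deriv [j] (trig (- b / \<xi> $ j) (a / \<xi> $ j) \<xi>)) = 0"
    by (rule torus_integral_partial_zero)
       (auto intro!: periodic_trig \<xi> smooth_continuous_on smooth_trig simp: differentiable_def intro: trig_has_derivative)
  ultimately show ?thesis by simp
qed

lemma set_integrable_of_real_cis:
  assumes "locally_integrable f" "continuous_on UNIV \<theta>"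
  shows "set_integrable lebesgue (fund_cell e) (\<lambda>x. complex_of_real (f x) * cis (\<theta> x))"
proof -
  have [measurable]: "f \<in> borel_measurable lebesgue" using assms by (simp add: locally_integrable_def)
  have [measurable]: "(\<lambda>x. cis (\<theta> x)) \<in> borel_measurable lebesgue"
    by (intro continuous_borel_measurable_lebesgue continuous_intros assms)
  have int: "integrable lebesgue (\<lambda>x. indicator (fund_cell e) x *\<^sub>R f x)"
    using locally_integrable_bounded[OF assms(1) bounded_fund_cell sets_fund_cell] unfolding set_integrable_def .
  show ?thesis
    unfolding set_integrable_def
    by (rule Bochner_Integration.integrable_bound[OF int]) (auto simp: norm_mult)
qed

lemma Re_Im_torus_integral:
  fixes g :: "'n euclid \<Rightarrow> complex"
  assumes "set_integrable lebesgue (fund_cell e) g"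
  shows "Re (torus_integral e g) = torus_integral e (\<lambda>x. Re (g x))"
    and "Im (torus_integral e g) = torus_integral e (\<lambda>x. Im (g x))"
  using integral_bounded_linear[OF bounded_linear_Re assms[unfolded set_integrable_def]]
    integral_bounded_linear[OF bounded_linear_Im assms[unfolded set_integrable_def]]
  unfolding torus_integral_def set_lebesgue_integral_def by simp_all

lemma torus_integral_cis:
  assumes f: "locally_integrable f"
  shows "torus_integral e (\<lambda>x. complex_of_real (f x) * cis (- (\<xi> \<bullet> x)))
    = Complex (torus_integral e (\<lambda>x. trig 1 0 \<xi> x * f x)) (- torus_integral e (\<lambda>x. trig 0 1 \<xi> x * f x))"
proof -
  have int: "set_integrable lebesgue (fund_cell e) (\<lambda>x. complex_of_real (f x) * cis (- (\<xi> \<bullet> x)))"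
    by (intro set_integrable_of_real_cis f continuous_intros)
  have "torus_integral e (\<lambda>x. - (sin (\<xi> \<bullet> x) * f x)) = - torus_integral e (\<lambda>x. sin (\<xi> \<bullet> x) * f x)"
    unfolding torus_integral_def set_lebesgue_integral_def by simp
  then show ?thesis
    by (intro complex_eqI) (simp_all add: Re_Im_torus_integral[OF int] trig_def mult.commute)
qed

lemma cis_frequency_orthogonal:
  assumes "\<xi> \<in> frequencies e" "\<eta> \<in> frequencies e"
  shows "torus_integral e (\<lambda>x. cis (\<xi> \<bullet> x) * cnj (cis (\<eta> \<bullet> x))) = (if \<xi> = \<eta> then of_real covolume else 0)"
proof -
  have eq: "cis (\<xi> \<bullet> x) * cnj (cis (\<eta> \<bullet> x)) = complex_of_real 1 * cis (- ((\<eta> - \<xi>) \<bullet> x))" for x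
    by (simp add: cis_cnj cis_mult inner_diff_left)
  have freq: "\<eta> - \<xi> \<in> frequencies e"
    unfolding frequencies_def mem_Collect_eq
  proof
    fix i
    obtain m m' :: int where "\<xi> \<bullet> e i = 2 * pi * of_int m" "\<eta> \<bullet> e i = 2 * pi * of_int m'"
      using assms unfolding frequencies_def by blast
    then show "\<exists>m::int. (\<eta> - \<xi>) \<bullet> e i = 2 * pi * of_int m"
      by (intro exI[of _ "m' - m"]) (simp add: inner_diff_left right_diff_distrib)
  qed
  have l1: "locally_integrable (\<lambda>x :: 'n euclid. 1 :: real)"
    by (intro continuous_locally_integrable continuous_intros)
  show ?thesis
  proof (cases "\<xi> = \<eta>")
    case True
    then show ?thesis
      unfolding torus_integral_def set_lebesgue_integral_def
      by (simp add: cis_cnj cis_mult scaleR_conv_of_real)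
  next
    case False
    then have "torus_integral e (trig a b (\<eta> - \<xi>)) = 0" for a b
      by (intro torus_integral_trig_zero freq) simp
    then show ?thesis
      unfolding eq torus_integral_cis[OF l1] using False by (simp add: complex_eq_iff)
  qed
qed

text \<open>Expansion of the nonnegative integral of |f - g|^2, with \<open>g\<close> the partial
  Fourier sum over \<open>F\<close>. The mixed term and the squared norm of \<open>g\<close> both
  equal \<open>S\<close>, the former by the definition of the coefficients, the latter by
  orthogonality.\<close>

lemma bessel:
  fixes f :: "'n euclid \<Rightarrow> real"
  assumes f: "locally_integrable f" "set_integrable lebesgue (fund_cell e) (\<lambda>x. (f x)\<^sup>2)"
    and F: "finite F" "F \<subseteq> frequencies e"
  defines "c \<equiv> \<lambda>\<xi>. torus_integral e (\<lambda>x. complex_of_real (f x) * cis (- (\<xi> \<bullet> x))) / of_real covolume"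
  shows "(\<Sum>\<xi>\<in>F. covolume * (cmod (c \<xi>))\<^sup>2) \<le> torus_integral e (\<lambda>x. (f x)\<^sup>2)"
proof (cases "covolume = 0")
  \<comment> \<open>Setting this case aside lets the division in the coefficients be undone without
    first proving that the cell has positive volume.\<close>
  case True
  then show ?thesis
    unfolding torus_integral_def set_lebesgue_integral_def by (auto intro!: integral_nonneg_AE)
next
  case False
  define g where "g x = (\<Sum>\<xi>\<in>F. c \<xi> * cis (\<xi> \<bullet> x))" for x
  define S where "S = (\<Sum>\<xi>\<in>F. covolume * (cmod (c \<xi>))\<^sup>2)"
  let ?ind = "indicator (fund_cell e) :: 'n euclid \<Rightarrow> real"
  have cg: "continuous_on UNIV g" unfolding g_def by (intro continuous_intros)
  have intc: "set_integrable lebesgue (fund_cell e) h" if "continuous_on UNIV h" for h :: "'n euclid \<Rightarrow> complex"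
    by (intro locally_integrable_bounded[OF continuous_locally_integrable] bounded_fund_cell sets_fund_cell that)
  have I1: "set_integrable lebesgue (fund_cell e) (\<lambda>x. of_real (f x) * cnj (g x))"
    and V1: "torus_integral e (\<lambda>x. of_real (f x) * cnj (g x)) = of_real S"
  proof -
    have eq: "of_real (f x) * cnj (g x) = (\<Sum>\<xi>\<in>F. cnj (c \<xi>) * (of_real (f x) * cis (- (\<xi> \<bullet> x))))" for x
      by (simp add: g_def sum_distrib_left cis_cnj ac_simps)
    have int: "integrable lebesgue (\<lambda>x. ?ind x *\<^sub>R (complex_of_real (f x) * cis (- (\<xi> \<bullet> x))))" for \<xi>
      by (rule set_integrable_of_real_cis[OF f(1), unfolded set_integrable_def]) (intro continuous_intros)
    have eq2: "?ind x *\<^sub>R (of_real (f x) * cnj (g x)) = (\<Sum>\<xi>\<in>F. cnj (c \<xi>) * (?ind x *\<^sub>R (complex_of_real (f x) * cis (- (\<xi> \<bullet> x)))))" for x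
      unfolding eq by (simp add: scaleR_sum_right)
    show "set_integrable lebesgue (fund_cell e) (\<lambda>x. of_real (f x) * cnj (g x))"
      unfolding set_integrable_def eq2 by (intro Bochner_Integration.integrable_sum integrable_mult_right int)
    have "torus_integral e (\<lambda>x. of_real (f x) * cnj (g x))
      = (\<Sum>\<xi>\<in>F. cnj (c \<xi>) * torus_integral e (\<lambda>x. complex_of_real (f x) * cis (- (\<xi> \<bullet> x))))"
      unfolding torus_integral_def set_lebesgue_integral_def eq2
      by (subst Bochner_Integration.integral_sum, (intro integrable_mult_right int), simp only: integral_mult_right_zero)
    also have "\<dots> = (\<Sum>\<xi>\<in>F. cnj (c \<xi>) * (of_real covolume * c \<xi>))"
      using False by (simp add: c_def)
    also have "\<dots> = of_real S"
    proof -
      have "cnj (c \<xi>) * (of_real covolume * c \<xi>) = of_real (covolume * (cmod (c \<xi>))\<^sup>2)" for \<xi>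
        using complex_norm_square[of "c \<xi>"] by (simp add: ac_simps)
      then show ?thesis by (simp only: S_def of_real_sum)
    qed
    finally show "torus_integral e (\<lambda>x. of_real (f x) * cnj (g x)) = of_real S" .
  qed
  have I2: "set_integrable lebesgue (fund_cell e) (\<lambda>x. g x * cnj (g x))"
    by (intro intc continuous_intros cg)
  have V2: "torus_integral e (\<lambda>x. g x * cnj (g x)) = of_real S"
  proof -
    have eq2: "?ind x *\<^sub>R (g x * cnj (g x)) = (\<Sum>\<xi>\<in>F. \<Sum>\<eta>\<in>F. (c \<xi> * cnj (c \<eta>)) * (?ind x *\<^sub>R (cis (\<xi> \<bullet> x) * cnj (cis (\<eta> \<bullet> x)))))" for x
      by (simp add: g_def sum_product scaleR_sum_right ac_simps)
    have int: "integrable lebesgue (\<lambda>x. ?ind x *\<^sub>R (cis (\<xi> \<bullet> x) * cnj (cis (\<eta> \<bullet> x))))" for \<xi> \<eta>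
      by (rule intc[unfolded set_integrable_def]) (intro continuous_intros)
    have "torus_integral e (\<lambda>x. g x * cnj (g x))
      = (\<Sum>\<xi>\<in>F. \<Sum>\<eta>\<in>F. (c \<xi> * cnj (c \<eta>)) * torus_integral e (\<lambda>x. cis (\<xi> \<bullet> x) * cnj (cis (\<eta> \<bullet> x))))"
      unfolding torus_integral_def set_lebesgue_integral_def eq2
      by (subst Bochner_Integration.integral_sum, (intro Bochner_Integration.integrable_sum integrable_mult_right int),
          subst Bochner_Integration.integral_sum, (intro integrable_mult_right int), simp only: integral_mult_right_zero)
    also have "\<dots> = (\<Sum>\<xi>\<in>F. \<Sum>\<eta>\<in>F. if \<xi> = \<eta> then (c \<xi> * cnj (c \<eta>)) * of_real covolume else 0)"
      using F(2) by (intro sum.cong refl) (auto simp: cis_frequency_orthogonal subset_iff simp del: cis_cnj)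
    also have "\<dots> = (\<Sum>\<xi>\<in>F. (c \<xi> * cnj (c \<xi>)) * of_real covolume)"
      using F(1) by (intro sum.cong refl) simp
    also have "\<dots> = of_real S"
    proof -
      have "(c \<xi> * cnj (c \<xi>)) * of_real covolume = of_real (covolume * (cmod (c \<xi>))\<^sup>2)" for \<xi>
        using complex_norm_square[of "c \<xi>"] by (simp add: ac_simps)
      then show ?thesis by (simp only: S_def of_real_sum)
    qed
    finally show ?thesis .
  qed
  have iRe: "integrable lebesgue (\<lambda>x. ?ind x *\<^sub>R Re (h x))" if "set_integrable lebesgue (fund_cell e) h" for h :: "'n euclid \<Rightarrow> complex"
    using integrable_bounded_linear[OF bounded_linear_Re that[unfolded set_integrable_def]] by simp
  have lin: "(\<integral>x. A x - 2 * B x + C x \<partial>lebesgue) = (\<integral>x. A x \<partial>lebesgue) - 2 * (\<integral>x. B x \<partial>lebesgue) + (\<integral>x. C x \<partial>lebesgue)"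
    if "integrable lebesgue A" "integrable lebesgue B" "integrable lebesgue C" for A B C :: "'n euclid \<Rightarrow> real"
    using that by simp
  have R1: "torus_integral e (\<lambda>x. Re (of_real (f x) * cnj (g x))) = S"
    using Re_Im_torus_integral(1)[OF I1] V1 by simp
  have R2: "torus_integral e (\<lambda>x. Re (g x * cnj (g x))) = S"
    using Re_Im_torus_integral(1)[OF I2] V2 by simp
  have pw: "0 \<le> ?ind x *\<^sub>R (f x)\<^sup>2 - 2 * (?ind x *\<^sub>R Re (of_real (f x) * cnj (g x))) + ?ind x *\<^sub>R Re (g x * cnj (g x))" for x
  proof -
    have "0 \<le> (f x - Re (g x))\<^sup>2 + (Im (g x))\<^sup>2" by simp
    then have "0 \<le> (f x)\<^sup>2 - 2 * Re (of_real (f x) * cnj (g x)) + Re (g x * cnj (g x))"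
      by (simp add: power2_eq_square algebra_simps)
    then show ?thesis by (auto simp: indicator_def)
  qed
  have "0 \<le> (\<integral>x. ?ind x *\<^sub>R (f x)\<^sup>2 - 2 * (?ind x *\<^sub>R Re (of_real (f x) * cnj (g x))) + ?ind x *\<^sub>R Re (g x * cnj (g x)) \<partial>lebesgue)"
    by (intro integral_nonneg_AE AE_I2 pw)
  also have "\<dots> = torus_integral e (\<lambda>x. (f x)\<^sup>2) - 2 * torus_integral e (\<lambda>x. Re (of_real (f x) * cnj (g x))) + torus_integral e (\<lambda>x. Re (g x * cnj (g x)))"
    unfolding torus_integral_def set_lebesgue_integral_def
    by (rule lin[OF f(2)[unfolded set_integrable_def] iRe[OF I1] iRe[OF I2]])
  finally show ?thesis unfolding R1 R2 S_def by simp
qed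

lemma L2_norm_sq_components:
  assumes "u \<in> L2_forms e"
  shows "(L2_norm e u)\<^sup>2 = (\<Sum>I\<in>UNIV. torus_integral e (\<lambda>x. (u x $ I)\<^sup>2))"
proof -
  have nn: "0 \<le> torus_integral e (\<lambda>x. (u x $ I)\<^sup>2)" for I
    unfolding torus_integral_def set_lebesgue_integral_def by (auto intro!: integral_nonneg_AE)
  have "ennreal ((L2_norm e u)\<^sup>2) = (\<Sum>I\<in>UNIV. L2sq (\<lambda>x. u x $ I))"
    using L2sq_eq_norm[OF assms] L2sq_components[of u] assms by (simp add: L2_forms_iff)
  also have "\<dots> = ennreal (\<Sum>I\<in>UNIV. torus_integral e (\<lambda>x. (u x $ I)\<^sup>2))"
    using nn by (simp add: L2sq_real[OF L2_component_integrable[OF assms]] sum_ennreal)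
  finally show ?thesis using nn by (subst (asm) ennreal_inj) (auto intro: sum_nonneg)
qed

lemma fourier_bessel:
  assumes u: "u \<in> L2_forms e" and F: "finite F" "F \<subseteq> frequencies e"
  shows "(\<Sum>\<xi>\<in>F. covolume * (\<Sum>I\<in>UNIV. (cmod (fourier_coeff e u I \<xi>))\<^sup>2)) \<le> (L2_norm e u)\<^sup>2"
proof -
  have "(\<Sum>\<xi>\<in>F. covolume * (\<Sum>I\<in>UNIV. (cmod (fourier_coeff e u I \<xi>))\<^sup>2))
      = (\<Sum>I\<in>UNIV. \<Sum>\<xi>\<in>F. covolume * (cmod (fourier_coeff e u I \<xi>))\<^sup>2)"
    by (subst sum.swap) (simp add: sum_distrib_left)
  also have "\<dots> \<le> (\<Sum>I\<in>UNIV. torus_integral e (\<lambda>x. (u x $ I)\<^sup>2))"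
    unfolding fourier_coeff_def
    by (intro sum_mono bessel locally_integrable_component L2_forms_locally_integrable u L2_component_integrable F)
  finally show ?thesis by (simp add: L2_norm_sq_components[OF u])
qed

end

text \<open>Interpolation between \<open>H\<^sup>0\<close> and \<open>H\<^sup>-\<^sup>1\<close>: a number \<open>a = 1 / (1 + |\<xi>|\<^sup>2)\<close> satisfies
  \<open>a\<^sup>s \<le> t\<^sup>2\<^sup>s\<close> if \<open>a \<le> t\<^sup>2\<close>, and \<open>a\<^sup>s \<le> t\<^sup>2\<^sup>s\<^sup>-\<^sup>2 a\<close> otherwise.\<close>

lemma powr_interpolation:
  fixes y s t :: real
  assumes "0 \<le> y" "0 < s" "s < 1" "0 < t"
  shows "(1 + y) powr (- s) \<le> t powr (2 * s) + t powr (2 * s - 2) / (1 + y)"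
proof (cases "1 / (1 + y) \<le> t\<^sup>2")
  case True
  have "1 / (1 + y) = (1 + y) powr (- 1)"
    using assms(1) by (simp add: powr_minus divide_inverse)
  then have "(1 + y) powr (- s) = (1 / (1 + y)) powr s"
    by (simp only: powr_powr mult_minus_left mult_1)
  also have "\<dots> \<le> (t\<^sup>2) powr s" using True assms by (intro powr_mono2) auto
  also have "\<dots> = t powr (2 * s)" using assms by (simp add: powr_powr flip: powr_numeral)
  also have "\<dots> \<le> t powr (2 * s) + t powr (2 * s - 2) / (1 + y)" using assms by simp
  finally show ?thesis .
next
  case False
  have y: "0 < 1 + y" using assms by simp
  have lt: "1 + y \<le> 1 / t\<^sup>2"
    using False assms by (simp add: field_simps)
  have "(1 + y) powr (- s) = (1 + y) powr (1 - s) * (1 / (1 + y))"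
    using y by (simp add: powr_diff powr_minus field_simps)
  also have "\<dots> \<le> (1 / t\<^sup>2) powr (1 - s) * (1 / (1 + y))"
    using lt assms y by (intro mult_right_mono powr_mono2) auto
  also have "(1 / t\<^sup>2) powr (1 - s) = t powr (2 * s - 2)"
  proof -
    have "1 / t\<^sup>2 = t powr (- 2)" using assms by (simp add: powr_minus divide_inverse)
    then show ?thesis by (simp add: powr_powr algebra_simps)
  qed
  also have "t powr (2 * s - 2) * (1 / (1 + y)) \<le> t powr (2 * s) + t powr (2 * s - 2) / (1 + y)" by simp
  finally show ?thesis .
qed

locale oriented_torus = torus_basis e for e :: "'n::{finite,linorder} \<Rightarrow> 'n euclid"
begin

text \<open>Cosine and sine at the frequency \<xi> are test functions, so the definition of the weak
  derivative gives the coefficients directly: d acts as i times the exterior product with \<xi>. The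
  two real pairings are computed apart and recombined.\<close>

lemma fourier_coeff_weak_d:
  assumes u: "u \<in> L2_forms e" and v: "has_weak_d e u v" and \<xi>: "\<xi> \<in> frequencies e"
  shows "fourier_coeff e v J \<xi> = (\<Sum>j\<in>J. of_real (ext_sign j J * \<xi> $ j) * \<i> * fourier_coeff e u (J - {j}) \<xi>)"
proof -
  have vL: "v \<in> L2_forms e" using v by (simp add: has_weak_d_def)
  define A where "A I = torus_integral e (\<lambda>x. trig 1 0 \<xi> x * u x $ I)" for I
  define B where "B I = torus_integral e (\<lambda>x. trig 0 1 \<xi> x * u x $ I)" for I
  have scale: "torus_integral e (\<lambda>x. trig (c * a) (c * b) \<xi> x * u x $ I) = c * torus_integral e (\<lambda>x. trig a b \<xi> x * u x $ I)" for a b c I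
  proof -
    have "trig (c * a) (c * b) \<xi> x * u x $ I = c * (trig a b \<xi> x * u x $ I)" for x
      by (simp add: trig_def algebra_simps)
    then show ?thesis unfolding torus_integral_def by (simp only: set_integral_mult_right)
  qed
  have weak: "torus_integral e (\<lambda>x. trig a b \<xi> x * v x $ J)
      = - (\<Sum>j\<in>J. ext_sign j J * torus_integral e (\<lambda>x. trig (\<xi> $ j * b) (\<xi> $ j * - a) \<xi> x * u x $ (J - {j})))" for a b
  proof -
    have "torus_integral e (\<lambda>x. trig a b \<xi> x * v x $ J)
      = - (\<Sum>j\<in>J. ext_sign j J * torus_integral e (\<lambda>x. partial_deriv [j] (trig a b \<xi>) x * u x $ (J - {j})))"
      using v trig_test_function[OF \<xi>] unfolding has_weak_d_def by blast
    then show ?thesis unfolding partial_deriv_trig by simp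
  qed
  have A1: "torus_integral e (\<lambda>x. trig 1 0 \<xi> x * v x $ J) = (\<Sum>j\<in>J. (ext_sign j J * \<xi> $ j) * B (J - {j}))"
  proof -
    have "trig (\<xi> $ j * 0) (\<xi> $ j * - 1) \<xi> = trig ((- \<xi> $ j) * 0) ((- \<xi> $ j) * 1) \<xi>" for j by simp
    then show ?thesis unfolding weak B_def by (simp only: scale) (simp add: sum_negf mult.assoc)
  qed
  have B1: "torus_integral e (\<lambda>x. trig 0 1 \<xi> x * v x $ J) = - (\<Sum>j\<in>J. (ext_sign j J * \<xi> $ j) * A (J - {j}))"
    unfolding weak A_def by (simp only: scale minus_zero) (simp add: mult.assoc)
  have cv: "fourier_coeff e v J \<xi> = Complex (\<Sum>j\<in>J. (ext_sign j J * \<xi> $ j) * B (J - {j})) (\<Sum>j\<in>J. (ext_sign j J * \<xi> $ j) * A (J - {j})) / of_real covolume"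
    unfolding fourier_coeff_def
    by (subst torus_integral_cis[OF locally_integrable_component[OF L2_forms_locally_integrable[OF vL]]])
       (simp only: A1 B1 minus_minus)
  have cu: "fourier_coeff e u I \<xi> = Complex (A I) (- B I) / of_real covolume" for I
    unfolding fourier_coeff_def A_def B_def
    by (subst torus_integral_cis[OF locally_integrable_component[OF L2_forms_locally_integrable[OF u]]]) (rule refl)
  have "Complex (\<Sum>j\<in>J. (ext_sign j J * \<xi> $ j) * B (J - {j})) (\<Sum>j\<in>J. (ext_sign j J * \<xi> $ j) * A (J - {j}))
      = (\<Sum>j\<in>J. of_real (ext_sign j J * \<xi> $ j) * \<i> * Complex (A (J - {j})) (- B (J - {j})))"
    by (intro complex_eqI) (simp_all add: Re_sum Im_sum)
  then show ?thesis
    unfolding cv cu by (simp add: sum_divide_distrib)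
qed

text \<open>Cauchy-Schwarz applies to the sum over j for each component, the sets
  \<open>J - {j}\<close> being distinct. Adding one crude bound over all components gives the factor
  \<open>CARD('n set)\<close>.\<close>

lemma fourier_coeff_weak_d_bound:
  assumes u: "u \<in> L2_forms e" and v: "has_weak_d e u v" and \<xi>: "\<xi> \<in> frequencies e"
  shows "(\<Sum>J\<in>UNIV. (cmod (fourier_coeff e v J \<xi>))\<^sup>2)
    \<le> real CARD('n set) * (norm \<xi>)\<^sup>2 * (\<Sum>I\<in>UNIV. (cmod (fourier_coeff e u I \<xi>))\<^sup>2)"
proof -
  let ?S = "\<Sum>I\<in>UNIV. (cmod (fourier_coeff e u I \<xi>))\<^sup>2"
  have "(cmod (fourier_coeff e v J \<xi>))\<^sup>2 \<le> (norm \<xi>)\<^sup>2 * ?S" for J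
  proof -
    define w where "w j = (if j \<in> J then of_real (ext_sign j J) * \<i> * fourier_coeff e u (J - {j}) \<xi> else 0)" for j
    have "fourier_coeff e v J \<xi> = (\<Sum>j\<in>J. \<xi> $ j *\<^sub>R w j)"
      unfolding fourier_coeff_weak_d[OF u v \<xi>] by (intro sum.cong) (auto simp: w_def scaleR_conv_of_real)
    also have "\<dots> = (\<Sum>j\<in>UNIV. \<xi> $ j *\<^sub>R w j)"
      by (intro sum.mono_neutral_left) (auto simp: w_def)
    finally have "(cmod (fourier_coeff e v J \<xi>))\<^sup>2 \<le> (norm \<xi>)\<^sup>2 * (\<Sum>j\<in>UNIV. (cmod (w j))\<^sup>2)"
      using norm_sum_scaleR_sq_le[of \<xi> w] by simp
    also have "(\<Sum>j\<in>UNIV. (cmod (w j))\<^sup>2) = (\<Sum>j\<in>J. (cmod (w j))\<^sup>2)"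
      by (intro sum.mono_neutral_right) (auto simp: w_def)
    also have "\<dots> = (\<Sum>j\<in>J. (cmod (fourier_coeff e u (J - {j}) \<xi>))\<^sup>2)"
      by (intro sum.cong) (auto simp: w_def norm_mult ext_sign_def norm_power)
    also have "\<dots> = (\<Sum>I\<in>(\<lambda>j. J - {j}) ` J. (cmod (fourier_coeff e u I \<xi>))\<^sup>2)"
      by (subst sum.reindex) (auto intro!: inj_onI)
    also have "\<dots> \<le> ?S" by (intro sum_mono2) auto
    finally show ?thesis by (simp add: mult_left_mono)
  qed
  then have "(\<Sum>J\<in>UNIV. (cmod (fourier_coeff e v J \<xi>))\<^sup>2) \<le> (\<Sum>J\<in>(UNIV :: 'n set set). (norm \<xi>)\<^sup>2 * ?S)"
    by (intro sum_mono)
  then show ?thesis by simp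
qed

text \<open>At each frequency, \<open>powr_interpolation\<close> weighs the L2 norm of
  \<open>v\<close> against its H^-1 norm. The latter is at most a multiple of the L2 norm of
  \<open>u\<close>, as |\<xi>|^2 \<le> 1 + |\<xi>|^2. Bounds on finite partial sums yield both
  summability and the value; t stays free for later balancing.\<close>

lemma Hr_norm_weak_d:
  assumes u: "u \<in> L2_forms e" and v: "has_weak_d e u v" and s: "0 < s" "s < 1" and t: "0 < t"
  defines "b \<equiv> t powr (2 * s) * (L2_norm e v)\<^sup>2 + t powr (2 * s - 2) * (real CARD('n set) * (L2_norm e u)\<^sup>2)"
  shows "finite_Hr_norm e (- s) v" "(Hr_norm e (- s) v)\<^sup>2 \<le> b"
proof -
  have vL: "v \<in> L2_forms e" using v by (simp add: has_weak_d_def)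
  let ?N = "real CARD('n set)"
  let ?U = "\<lambda>\<xi>. \<Sum>I\<in>UNIV. (cmod (fourier_coeff e u I \<xi>))\<^sup>2"
  let ?V = "\<lambda>\<xi>. \<Sum>I\<in>UNIV. (cmod (fourier_coeff e v I \<xi>))\<^sup>2"
  have nonneg: "0 \<le> Hr_term e (- s) v \<xi>" for \<xi>
    unfolding Hr_term_def by (intro mult_nonneg_nonneg sum_nonneg) auto
  have each: "Hr_term e (- s) v \<xi> \<le> t powr (2 * s) * (covolume * ?V \<xi>) + t powr (2 * s - 2) * (?N * (covolume * ?U \<xi>))"
    if \<xi>: "\<xi> \<in> frequencies e" for \<xi>
  proof -
    have V0: "0 \<le> ?V \<xi>" and U0: "0 \<le> ?U \<xi>" by (intro sum_nonneg, simp)+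
    have Vle: "?V \<xi> / (1 + (norm \<xi>)\<^sup>2) \<le> ?N * ?U \<xi>"
    proof -
      have "?V \<xi> \<le> (norm \<xi>)\<^sup>2 * (?N * ?U \<xi>)"
        using fourier_coeff_weak_d_bound[OF u v \<xi>] by (simp add: ac_simps)
      also have "\<dots> \<le> (1 + (norm \<xi>)\<^sup>2) * (?N * ?U \<xi>)"
        using U0 by (intro mult_right_mono) auto
      finally show ?thesis by (simp add: pos_divide_le_eq add_pos_nonneg mult.commute)
    qed
    have "Hr_term e (- s) v \<xi> = (covolume * ?V \<xi>) * (1 + (norm \<xi>)\<^sup>2) powr (- s)"
      by (simp add: Hr_term_def ac_simps)
    also have "\<dots> \<le> (covolume * ?V \<xi>) * (t powr (2 * s) + t powr (2 * s - 2) / (1 + (norm \<xi>)\<^sup>2))"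
      using V0 s t by (intro mult_left_mono powr_interpolation) auto
    also have "\<dots> = t powr (2 * s) * (covolume * ?V \<xi>) + t powr (2 * s - 2) * (covolume * (?V \<xi> / (1 + (norm \<xi>)\<^sup>2)))"
      by (simp add: algebra_simps)
    also have "\<dots> \<le> t powr (2 * s) * (covolume * ?V \<xi>) + t powr (2 * s - 2) * (covolume * (?N * ?U \<xi>))"
      by (intro add_left_mono mult_left_mono Vle) auto
    finally show ?thesis by (simp add: ac_simps)
  qed
  have fin: "sum (Hr_term e (- s) v) F \<le> b" if F: "finite F" "F \<subseteq> frequencies e" for F
  proof -
    have "sum (Hr_term e (- s) v) F \<le> (\<Sum>\<xi>\<in>F. t powr (2 * s) * (covolume * ?V \<xi>) + t powr (2 * s - 2) * (?N * (covolume * ?U \<xi>)))"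
      using F by (intro sum_mono each) auto
    also have "\<dots> = t powr (2 * s) * (\<Sum>\<xi>\<in>F. covolume * ?V \<xi>) + t powr (2 * s - 2) * (?N * (\<Sum>\<xi>\<in>F. covolume * ?U \<xi>))"
      by (simp only: sum.distrib sum_distrib_left)
    also have "\<dots> \<le> b"
      unfolding b_def by (intro add_mono mult_left_mono fourier_bessel u vL F) auto
    finally show ?thesis .
  qed
  show sm: "finite_Hr_norm e (- s) v"
    unfolding finite_Hr_norm_def
    by (rule nonneg_bounded_partial_sums_imp_summable_on[of _ _ b])
       (use nonneg fin in \<open>auto simp: eventually_finite_subsets_at_top intro!: exI[of _ "{}"]\<close>)
  have "(\<Sum>\<^sub>\<infinity>\<xi>\<in>frequencies e. Hr_term e (- s) v \<xi>) \<le> b"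
    by (rule infsum_le_finite_sums[OF sm[unfolded finite_Hr_norm_def] fin])
  then show "(Hr_norm e (- s) v)\<^sup>2 \<le> b"
    unfolding Hr_norm_def by (simp add: infsum_nonneg nonneg)
qed

end

section \<open>Exterior derivatives of Sobolev forms\<close>

text \<open>Exterior multiplication by dx_j: the exterior derivative is the sum over j of this
  operation applied to the j-th partial derivative.\<close>

definition wedge_coord :: "'n::{finite,linorder} \<Rightarrow> real^('n set) \<Rightarrow> real^('n set)" where
  "wedge_coord j v = (\<chi> J. if j \<in> J then ext_sign j J * v $ (J - {j}) else 0)"

lemma bounded_linear_wedge_coord: "bounded_linear (wedge_coord j)"
  by (intro bounded_linear_of_euclidean linearI) (auto simp: vec_eq_iff wedge_coord_def algebra_simps)

text \<open>The nonzero components are, up to sign, distinct components of \<open>v\<close>: among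
  the sets containing j, \<open>J - {j}\<close> determines J.\<close>

lemma norm_wedge_coord_le: "norm (wedge_coord j v) \<le> norm v"
proof -
  have "(\<Sum>J\<in>UNIV. (wedge_coord j v $ J)\<^sup>2) = (\<Sum>J | j \<in> J. (v $ (J - {j}))\<^sup>2)"
    by (rule sum.mono_neutral_cong_right) (auto simp: wedge_coord_def power_mult_distrib ext_sign_def power2_eq_square simp flip: power_mult_distrib)
  also have "\<dots> = (\<Sum>I\<in>(\<lambda>J. J - {j}) ` {J. j \<in> J}. (v $ I)\<^sup>2)"
    by (subst sum.reindex) (auto intro!: inj_onI)
  also have "\<dots> \<le> (\<Sum>I\<in>UNIV. (v $ I)\<^sup>2)" by (intro sum_mono2) auto
  finally show ?thesis by (simp add: norm_vec_def L2_set_def)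
qed

lemma sum_wedge_coord_nth:
  "(\<Sum>j\<in>UNIV. wedge_coord j (U j)) $ J = (\<Sum>j\<in>J. ext_sign j J * U j $ (J - {j}))"
proof -
  have "(\<Sum>j\<in>UNIV. wedge_coord j (U j)) $ J = (\<Sum>j\<in>UNIV. if j \<in> J then ext_sign j J * U j $ (J - {j}) else 0)"
    by (simp add: wedge_coord_def)
  also have "\<dots> = (\<Sum>j\<in>J. ext_sign j J * U j $ (J - {j}))"
    by (rule sum.mono_neutral_cong_right) auto
  finally show ?thesis .
qed

context oriented_torus
begin

lemma wedge_coord_L2:
  assumes "u \<in> L2_forms e"
  shows "(\<lambda>x. wedge_coord j (u x)) \<in> L2_forms e"
proof -
  have "(\<lambda>x. wedge_coord j (u x)) \<in> borel_measurable lebesgue"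
    by (rule borel_measurable_continuous_on[OF linear_continuous_on[OF bounded_linear_wedge_coord]])
       (use assms in \<open>simp add: L2_forms_iff\<close>)
  moreover have "L2sq (\<lambda>x. wedge_coord j (u x)) \<le> L2sq u"
    by (intro L2sq_mono_AE AE_I2 norm_wedge_coord_le)
  ultimately show ?thesis
    using assms by (auto simp: L2_forms_iff periodic_def)
qed

text \<open>The factor n is the squared length of the all-ones vector in Cauchy-Schwarz.\<close>

lemma sum_wedge_coord_L2:
  assumes "\<And>j. U j \<in> L2_forms e"
  shows "(\<lambda>x. \<Sum>j\<in>UNIV. wedge_coord j (U j x)) \<in> L2_forms e"
    and "L2sq (\<lambda>x. \<Sum>j\<in>UNIV. wedge_coord j (U j x)) \<le> of_nat CARD('n) * (\<Sum>j\<in>UNIV. L2sq (U j))"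
proof -
  show "(\<lambda>x. \<Sum>j\<in>UNIV. wedge_coord j (U j x)) \<in> L2_forms e"
    by (intro L2_forms_sum wedge_coord_L2 assms)
  have m[measurable]: "U j \<in> borel_measurable lebesgue" for j using assms by (simp add: L2_forms_iff)
  have "(norm (\<Sum>j\<in>UNIV. wedge_coord j (U j x)))\<^sup>2 \<le> real CARD('n) * (\<Sum>j\<in>UNIV. (norm (U j x))\<^sup>2)" for x
  proof -
    let ?one = "\<chi> j. 1 :: 'n euclid"
    have "(norm (\<Sum>j\<in>UNIV. wedge_coord j (U j x)))\<^sup>2 \<le> (norm ?one)\<^sup>2 * (\<Sum>j\<in>UNIV. (norm (wedge_coord j (U j x)))\<^sup>2)"
      using norm_sum_scaleR_sq_le[of ?one "\<lambda>j. wedge_coord j (U j x)"] by simp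
    also have "(norm ?one)\<^sup>2 = real CARD('n)"
      by (simp add: norm_vec_def L2_set_def)
    also have "real CARD('n) * (\<Sum>j\<in>UNIV. (norm (wedge_coord j (U j x)))\<^sup>2) \<le> real CARD('n) * (\<Sum>j\<in>UNIV. (norm (U j x))\<^sup>2)"
      by (intro mult_left_mono sum_mono power_mono norm_wedge_coord_le) auto
    finally show ?thesis .
  qed
  then have pw: "ennreal ((norm (\<Sum>j\<in>UNIV. wedge_coord j (U j x)))\<^sup>2) \<le> of_nat CARD('n) * (\<Sum>j\<in>UNIV. ennreal ((norm (U j x))\<^sup>2))" for x
    using ennreal_leI[of _ "real CARD('n) * (\<Sum>j\<in>UNIV. (norm (U j x))\<^sup>2)"]
    by (simp add: sum_ennreal ennreal_mult sum_nonneg ennreal_of_nat_eq_real_of_nat)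
  have "L2sq (\<lambda>x. \<Sum>j\<in>UNIV. wedge_coord j (U j x)) \<le>
      (\<integral>\<^sup>+x. of_nat CARD('n) * (\<Sum>j\<in>UNIV. ennreal ((norm (U j x))\<^sup>2) * indicator (fund_cell e) x) \<partial>lebesgue)"
    unfolding L2sq_def
  proof (rule nn_integral_mono)
    fix x
    show "ennreal ((norm (\<Sum>j\<in>UNIV. wedge_coord j (U j x)))\<^sup>2) * indicator (fund_cell e) x
      \<le> of_nat CARD('n) * (\<Sum>j\<in>UNIV. ennreal ((norm (U j x))\<^sup>2) * indicator (fund_cell e) x)"
      unfolding sum_distrib_right[symmetric] mult.assoc[symmetric] by (intro mult_right_mono pw) simp
  qed
  also have "\<dots> = of_nat CARD('n) * (\<Sum>j\<in>UNIV. L2sq (U j))"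
    unfolding L2sq_def by (rule nn_integral_cmult_sum) measurable
  finally show "L2sq (\<lambda>x. \<Sum>j\<in>UNIV. wedge_coord j (U j x)) \<le> of_nat CARD('n) * (\<Sum>j\<in>UNIV. L2sq (U j))" .
qed

lemma torus_integral_mult_component:
  assumes "u \<in> L2_forms e" "continuous_on UNIV \<psi>"
  shows "torus_integral e (\<lambda>x. \<psi> x *\<^sub>R u x) $ I = torus_integral e (\<lambda>x. \<psi> x * u x $ I)"
  using torus_integral_component[OF integrable_scaleR_continuous[OF L2_forms_locally_integrable[OF assms(1)] assms(2)], of I]
  by simp

lemma torus_integral_wedge_sum:
  assumes U: "\<And>j. U j \<in> L2_forms e" and \<psi>: "continuous_on UNIV \<psi>"
  shows "torus_integral e (\<lambda>x. \<psi> x * (\<Sum>j\<in>UNIV. wedge_coord j (U j x)) $ J)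
    = (\<Sum>j\<in>J. ext_sign j J * torus_integral e (\<lambda>x. \<psi> x * U j x $ (J - {j})))"
proof -
  let ?ind = "indicator (fund_cell e) :: 'n euclid \<Rightarrow> real"
  have int: "integrable lebesgue (\<lambda>x. ?ind x *\<^sub>R (\<psi> x * U j x $ I))" for j I
    using integrable_scaleR_continuous[OF locally_integrable_component[OF L2_forms_locally_integrable[OF U]] \<psi>]
    unfolding set_integrable_def by simp
  have eq: "?ind x *\<^sub>R (\<psi> x * (\<Sum>j\<in>UNIV. wedge_coord j (U j x)) $ J)
      = (\<Sum>j\<in>J. ext_sign j J * (?ind x *\<^sub>R (\<psi> x * U j x $ (J - {j}))))" for x
    unfolding sum_wedge_coord_nth by (simp add: sum_distrib_left ac_simps)
  show ?thesis
    unfolding torus_integral_def set_lebesgue_integral_def eq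
    by (subst Bochner_Integration.integral_sum, (intro integrable_mult_right int), simp only: integral_mult_right_zero)
qed

section \<open>Weak derivatives of Sobolev forms and of their exterior derivatives\<close>

lemma sobolev_weak_partial:
  assumes "u \<in> sobolev_forms e m" "length js \<le> m"
  shows "has_weak_partial e js u (weak_partial e js u)"
proof -
  have "\<exists>v. has_weak_partial e js u v" using assms by (auto simp: sobolev_forms_def)
  then show ?thesis unfolding weak_partial_def by (rule someI_ex)
qed

lemma weak_partial_L2: "has_weak_partial e js u v \<Longrightarrow> v \<in> L2_forms e"
  by (simp add: has_weak_partial_def)

lemma test_function_partial:
  assumes "\<psi> \<in> test_functions e"
  shows "partial_deriv js \<psi> \<in> test_functions e"
  using assms by (simp add: test_functions_def smooth_partial_deriv smooth_periodic_partial)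

lemma test_function_continuous: "\<psi> \<in> test_functions e \<Longrightarrow> continuous_on UNIV \<psi>"
  by (simp add: test_functions_def smooth_continuous)

lemma weak_partial_component:
  assumes u: "u \<in> L2_forms e" and v: "has_weak_partial e js u v" and \<psi>: "\<psi> \<in> test_functions e"
  shows "torus_integral e (\<lambda>x. \<psi> x * v x $ I) = (- 1) ^ length js * torus_integral e (\<lambda>x. partial_deriv js \<psi> x * u x $ I)"
proof -
  have "torus_integral e (\<lambda>x. \<psi> x *\<^sub>R v x) $ I = (- 1) ^ length js * torus_integral e (\<lambda>x. partial_deriv js \<psi> x *\<^sub>R u x) $ I"
    using v \<psi> by (simp add: has_weak_partial_def)
  then show ?thesis
    by (simp add: torus_integral_mult_component weak_partial_L2[OF v] u test_function_continuous \<psi> test_function_partial)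
qed

lemma sobolev_d_domain:
  assumes u: "u \<in> sobolev_forms e (Suc m)"
  shows "u \<in> d_domain e"
proof -
  have uL: "u \<in> L2_forms e" using u by (simp add: sobolev_forms_def)
  define U where "U j = weak_partial e [j] u" for j
  have wU: "has_weak_partial e [j] u (U j)" for j
    unfolding U_def by (rule sobolev_weak_partial[OF u]) simp
  have UL: "U j \<in> L2_forms e" for j by (rule weak_partial_L2[OF wU])
  have "has_weak_d e u (\<lambda>x. \<Sum>j\<in>UNIV. wedge_coord j (U j x))"
    unfolding has_weak_d_def
  proof (intro conjI ballI allI)
    show "(\<lambda>x. \<Sum>j\<in>UNIV. wedge_coord j (U j x)) \<in> L2_forms e" by (rule sum_wedge_coord_L2(1)[OF UL])
    fix \<psi> J assume \<psi>: "\<psi> \<in> test_functions e"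
    show "torus_integral e (\<lambda>x. \<psi> x * (\<Sum>j\<in>UNIV. wedge_coord j (U j x)) $ J)
        = - (\<Sum>j\<in>J. ext_sign j J * torus_integral e (\<lambda>x. partial_deriv [j] \<psi> x * u x $ (J - {j})))"
      unfolding torus_integral_wedge_sum[OF UL test_function_continuous[OF \<psi>]] weak_partial_component[OF uL wU \<psi>]
      by (simp add: sum_negf)
  qed
  then show ?thesis using uL by (auto simp: d_domain_def)
qed

lemma weak_d_spec:
  assumes "u \<in> d_domain e"
  shows "has_weak_d e u (weak_d e u)"
proof -
  have "\<exists>v. has_weak_d e u v" using assms by (auto simp: d_domain_def)
  then show ?thesis unfolding weak_d_def by (rule someI_ex)
qed

text \<open>A derivative of a test function is again a test function, so the defining identity of
  the weak exterior derivative may be tested with the derivative \<open>js\<close> of \<psi>. The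
  derivatives \<open>j # js\<close> of \<psi> that appear are those dual to the weak derivatives of
  \<open>u\<close>; regularity m of d u thus uses regularity m + 1 of \<open>u\<close>.\<close>

lemma weak_d_weak_partial:
  assumes u: "u \<in> sobolev_forms e (Suc m)" and js: "length js \<le> m"
  shows "has_weak_partial e js (weak_d e u) (\<lambda>x. \<Sum>j\<in>UNIV. wedge_coord j (weak_partial e (j # js) u x))"
proof -
  have uL: "u \<in> L2_forms e" using u by (simp add: sobolev_forms_def)
  note wd = weak_d_spec[OF sobolev_d_domain[OF u]]
  have dL: "weak_d e u \<in> L2_forms e" using wd by (simp add: has_weak_d_def)
  define U where "U j = weak_partial e (j # js) u" for j
  have wU: "has_weak_partial e (j # js) u (U j)" for j
    unfolding U_def by (rule sobolev_weak_partial[OF u]) (use js in simp)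
  have UL: "U j \<in> L2_forms e" for j by (rule weak_partial_L2[OF wU])
  let ?V = "\<lambda>x. \<Sum>j\<in>UNIV. wedge_coord j (U j x)"
  have VL: "?V \<in> L2_forms e" by (rule sum_wedge_coord_L2(1)[OF UL])
  have "has_weak_partial e js (weak_d e u) ?V"
    unfolding has_weak_partial_def
  proof (intro conjI ballI VL)
    fix \<psi> assume \<psi>: "\<psi> \<in> test_functions e"
    note c\<psi> = test_function_continuous[OF \<psi>]
    note d\<psi> = test_function_partial[OF \<psi>, of js]
    have "torus_integral e (\<lambda>x. \<psi> x *\<^sub>R ?V x) $ J = ((- 1) ^ length js *\<^sub>R torus_integral e (\<lambda>x. partial_deriv js \<psi> x *\<^sub>R weak_d e u x)) $ J" for J
    proof -
      have "torus_integral e (\<lambda>x. \<psi> x *\<^sub>R ?V x) $ J = torus_integral e (\<lambda>x. \<psi> x * ?V x $ J)"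
        by (rule torus_integral_mult_component[OF VL c\<psi>])
      also have "\<dots> = (\<Sum>j\<in>J. ext_sign j J * ((- 1) ^ length (j # js) * torus_integral e (\<lambda>x. partial_deriv (j # js) \<psi> x * u x $ (J - {j}))))"
        unfolding torus_integral_wedge_sum[OF UL c\<psi>] weak_partial_component[OF uL wU \<psi>] ..
      also have "\<dots> = (- 1) ^ length js * - (\<Sum>j\<in>J. ext_sign j J * torus_integral e (\<lambda>x. partial_deriv [j] (partial_deriv js \<psi>) x * u x $ (J - {j})))"
        unfolding sum_negf[symmetric] sum_distrib_left
        by (intro sum.cong refl) (simp add: partial_deriv_append[symmetric])
      also have "\<dots> = (- 1) ^ length js * torus_integral e (\<lambda>x. partial_deriv js \<psi> x * weak_d e u x $ J)"
        using wd d\<psi> unfolding has_weak_d_def by simp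
      also have "\<dots> = ((- 1) ^ length js *\<^sub>R torus_integral e (\<lambda>x. partial_deriv js \<psi> x *\<^sub>R weak_d e u x)) $ J"
        by (simp add: torus_integral_mult_component[OF dL test_function_continuous[OF d\<psi>]])
      finally show ?thesis .
    qed
    then show "torus_integral e (\<lambda>x. \<psi> x *\<^sub>R ?V x) = (- 1) ^ length js *\<^sub>R torus_integral e (\<lambda>x. partial_deriv js \<psi> x *\<^sub>R weak_d e u x)"
      unfolding vec_eq_iff by blast
  qed
  then show ?thesis by (simp add: U_def)
qed

lemma has_weak_d_diff:
  assumes u: "u \<in> L2_forms e" and w: "w \<in> L2_forms e" and "has_weak_d e u u'" "has_weak_d e w w'"
  shows "has_weak_d e (\<lambda>x. u x - w x) (\<lambda>x. u' x - w' x)"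
proof -
  have u'L: "u' \<in> L2_forms e" and w'L: "w' \<in> L2_forms e" using assms by (auto simp: has_weak_d_def)
  have diff: "torus_integral e (\<lambda>x. \<psi> x * (a x - b x) $ I)
      = torus_integral e (\<lambda>x. \<psi> x * a x $ I) - torus_integral e (\<lambda>x. \<psi> x * b x $ I)"
    if "a \<in> L2_forms e" "b \<in> L2_forms e" "continuous_on UNIV \<psi>" for a b \<psi> I
  proof -
    have int: "set_integrable lebesgue (fund_cell e) (\<lambda>x. \<psi> x * c x $ I)" if "c \<in> L2_forms e" for c
      using integrable_scaleR_continuous[OF locally_integrable_component[OF L2_forms_locally_integrable[OF that]] \<open>continuous_on UNIV \<psi>\<close>]
      by simp
    show ?thesis
      using set_integral_diff(2)[OF int[OF that(1)] int[OF that(2)]]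
      unfolding torus_integral_def by (simp add: right_diff_distrib)
  qed
  show ?thesis
    unfolding has_weak_d_def
  proof (intro conjI ballI allI L2_forms_diff u'L w'L)
    fix \<psi> J assume \<psi>: "\<psi> \<in> test_functions e"
    have c: "continuous_on UNIV \<psi>" "continuous_on UNIV (partial_deriv [j] \<psi>)" for j
      by (intro test_function_continuous \<psi> test_function_partial)+
    have "torus_integral e (\<lambda>x. \<psi> x * u' x $ J) = - (\<Sum>j\<in>J. ext_sign j J * torus_integral e (\<lambda>x. partial_deriv [j] \<psi> x * u x $ (J - {j})))"
      "torus_integral e (\<lambda>x. \<psi> x * w' x $ J) = - (\<Sum>j\<in>J. ext_sign j J * torus_integral e (\<lambda>x. partial_deriv [j] \<psi> x * w x $ (J - {j})))"
      using assms(3,4) \<psi> unfolding has_weak_d_def by blast+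
    then show "torus_integral e (\<lambda>x. \<psi> x * (u' x - w' x) $ J)
      = - (\<Sum>j\<in>J. ext_sign j J * torus_integral e (\<lambda>x. partial_deriv [j] \<psi> x * (u x - w x) $ (J - {j})))"
      unfolding diff[OF u'L w'L c(1)] diff[OF u w c(2)]
      by (simp add: right_diff_distrib sum_subtractf)
  qed
qed

lemma grad_norm_sq:
  assumes "u \<in> sobolev_forms e m"
  shows "ennreal ((grad_norm e m u)\<^sup>2) = (\<Sum>js | length js = m. L2sq (weak_partial e js u))"
proof -
  have "L2sq (weak_partial e js u) = ennreal ((L2_norm e (weak_partial e js u))\<^sup>2)" if "length js = m" for js
    by (rule L2sq_eq_norm[OF weak_partial_L2[OF sobolev_weak_partial[OF assms]]]) (use that in simp)
  then show ?thesis
    by (simp add: grad_norm_def sum_nonneg sum_ennreal)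
qed

text \<open>Each list of length m + 1 occurs exactly once as a head j with a tail \<open>js\<close>,
  so the double sum is the full gradient seminorm of order m + 1.\<close>

lemma weak_d_partials_L2:
  assumes u: "u \<in> sobolev_forms e (Suc m)"
  shows "(\<Sum>js | length js = m. L2sq (\<lambda>x. \<Sum>j\<in>UNIV. wedge_coord j (weak_partial e (j # js) u x)))
    \<le> of_nat CARD('n) * ennreal ((grad_norm e (Suc m) u)\<^sup>2)"
proof -
  have "(\<Sum>js | length js = m. L2sq (\<lambda>x. \<Sum>j\<in>UNIV. wedge_coord j (weak_partial e (j # js) u x)))
    \<le> (\<Sum>js | length js = m. of_nat CARD('n) * (\<Sum>j\<in>UNIV. L2sq (weak_partial e (j # js) u)))"
  proof (rule sum_mono, rule sum_wedge_coord_L2(2))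
    fix js :: "'n list" and j assume "js \<in> {js. length js = m}"
    then show "weak_partial e (j # js) u \<in> L2_forms e"
      by (intro weak_partial_L2[OF sobolev_weak_partial[OF u]]) simp
  qed
  also have "\<dots> = of_nat CARD('n) * (\<Sum>js | length js = m. \<Sum>j\<in>UNIV. L2sq (weak_partial e (j # js) u))"
    by (simp add: sum_distrib_left)
  also have "(\<Sum>js | length js = m. \<Sum>j\<in>UNIV. L2sq (weak_partial e (j # js) u)) = (\<Sum>js | length js = Suc m. L2sq (weak_partial e js u))"
    unfolding sum.cartesian_product
    by (rule sum.reindex_bij_witness[of _ "\<lambda>js. (tl js, hd js)" "\<lambda>(js, j). j # js"]) (auto simp: length_Suc_conv)
  finally show ?thesis by (simp add: grad_norm_sq[OF u])
qed

end

section \<open>The error estimate\<close>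

theorem proposition5p11:
  fixes e :: "'n::{finite,linorder} \<Rightarrow> 'n euclid"
    and K :: "nat \<Rightarrow> ('n euclid) set set"
    and h :: "nat \<Rightarrow> real"
    and X :: "nat \<Rightarrow> 'n local_spaces"
    and F :: "nat \<Rightarrow> 'n dofs"
    and \<phi> :: "'n euclid \<Rightarrow> real"
    and \<epsilon> s :: real
    and p :: nat
  assumes basis: "inj e" "independent (range e)"
    and mesh: "\<And>i. cellular_complex e (K i)" "\<And>i. mesh_width (K i) (h i)"
    and width: "\<And>i. 0 < h i" "h \<longlonglongrightarrow> 0"
    and quasi_uniform: "quasi_uniform e K h"
    and compatible: "\<And>i. compatible_system e (K i) (X i)"
    and conforming: "\<And>i. global_space e (K i) (X i) \<subseteq> d_domain e"
    and compact: "compact_macro_elements K X h"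
    and polynomials: "\<And>i k T. T \<in> K i \<Longrightarrow> polynomial_kforms p k \<subseteq> X i k T"
    and dofs: "\<And>i. degrees_of_freedom e (K i) (F i)" "\<And>i. unisolvent (K i) (X i) (F i)"
    and commuting: "\<And>i. interpolator_commutes (K i) (X i) (F i)"
    and bounded: "interpolators_uniformly_bounded K X F h"
    and mollifier: "mollifier p \<phi>"
    and eps: "admissible_eps e K X F h \<phi> \<epsilon>"
    and s: "0 < s" "s < 1"
  shows "\<exists>M. \<forall>i. \<forall>u \<in> sobolev_forms e (p + 1).
           (let v = (\<lambda>x. weak_d e u x
                      - weak_d e (smoothed_projection e (K i) (X i) (F i) \<phi> (\<epsilon> * h i) u) x)
            in finite_Hr_norm e (- s) v \<and>
               Hr_norm e (- s) v \<le> M * h i powr (real p + s) * grad_norm e (p + 1) u)"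
proof -
  interpret oriented_torus e by unfold_locales (fact basis)+
  have eps0: "0 < \<epsilon>" using eps by (simp add: admissible_eps_def)
  have iso: "restricts_to_iso (global_space e (K i) (X i)) (mollified_interpolator (K i) (X i) (F i) \<phi> (\<epsilon> * h i))" for i
    using eps by (simp add: admissible_eps_def)
  obtain CP where CP: "\<And>i u. u \<in> L2_forms e \<Longrightarrow>
      L2_norm e (smoothed_projection e (K i) (X i) (F i) \<phi> (\<epsilon> * h i) u) \<le> CP * L2_norm e u"
    using eps unfolding admissible_eps_def by blast
  have proj_d: "ae_eq (weak_d e (smoothed_projection e (K i) (X i) (F i) \<phi> (\<epsilon> * h i) u))
      (smoothed_projection e (K i) (X i) (F i) \<phi> (\<epsilon> * h i) (weak_d e u))" if "u \<in> d_domain e" for i u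
    using eps that unfolding admissible_eps_def by blast
  obtain m C where mC: "\<And>i T k u. T \<in> K i \<Longrightarrow> is_cell CARD('n) T \<Longrightarrow> u \<in> smooth_kforms k \<Longrightarrow>
      Cm_norm (h i) m T (local_interpolator (K i) (X i) (F i) k T u) \<le> C * Cm_norm (h i) m T u"
    using bounded unfolding interpolators_uniformly_bounded_def by blast
  have "\<forall>js. \<exists>B. \<forall>y. norm (partial_deriv js \<phi> y) \<le> B"
    using smooth_compact_support_bounded(2)[of \<phi> 1] mollifier unfolding mollifier_def by meson
  then obtain B where B: "\<And>js y. norm (partial_deriv js \<phi> y) \<le> B js" by metis
  define E where "E r = (2 + 2 * CP\<^sup>2) * (2 * smooth_error_constant CARD('n) (stability_constant B \<epsilon> m C) \<epsilon> r
      * (\<integral>y. \<bar>\<phi> y\<bar> \<partial>lebesgue)\<^sup>2)" for r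
  have E0: "0 \<le> E r" for r
    unfolding E_def smooth_error_constant_def using eps0 by (intro mult_nonneg_nonneg add_nonneg_nonneg) auto
  \<comment> \<open>The first part stems from the L2 error of d u, of order p, with the n of the
    exterior derivative; the second from the L2 error of \<open>u\<close>, of order p + 1, with the
    number of components from the passage to H^-1.\<close>
  define N where "N = real CARD('n) * E p + real CARD('n set) * E (p + 1)"
  have N0: "0 \<le> N" unfolding N_def using E0 by (intro add_nonneg_nonneg mult_nonneg_nonneg) auto
  have "finite_Hr_norm e (- s) (\<lambda>x. weak_d e u x - weak_d e (smoothed_projection e (K i) (X i) (F i) \<phi> (\<epsilon> * h i) u) x) \<and>
     Hr_norm e (- s) (\<lambda>x. weak_d e u x - weak_d e (smoothed_projection e (K i) (X i) (F i) \<phi> (\<epsilon> * h i) u) x)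
       \<le> sqrt N * h i powr (real p + s) * grad_norm e (p + 1) u"
    if u: "u \<in> sobolev_forms e (p + 1)" for i u
  proof -
    interpret fe_projection e "K i" "X i" "F i" \<phi> p \<epsilon> "h i" CP
      by unfold_locales (fact mesh compatible dofs mollifier eps0 width conforming iso CP)+
    let ?h = "h i"
    let ?G = "grad_norm e (p + 1) u"
    let ?v = "\<lambda>x. weak_d e u x - weak_d e (P u) x"
    have h0: "0 < ?h" by (rule width)
    have G0: "0 \<le> ?G" by (simp add: grad_norm_def sum_nonneg)
    have diam: "diameter T \<le> ?h" if "T \<in> K i" for T
      using mesh(2)[of i] that unfolding mesh_width_def by blast
    have bounded_i: "Cm_norm ?h m T (LI k T u) \<le> C * Cm_norm ?h m T u" if "is_full T" "u \<in> smooth_kforms k" for T k u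
      using mC that by blast
    have error: "L2sq (\<lambda>x. w x - P w x) \<le> ennreal (E r * (?h ^ r)\<^sup>2) * (\<Sum>js | length js = r. L2sq (V js))"
      if "r \<le> p + 1" "w \<in> L2_forms e" "\<And>js. length js = r \<Longrightarrow> has_weak_partial e js w (V js)" for r w V
      unfolding E_def
    proof (rule projection_error[OF B _ _ _ that])
      show "\<And>T k u. is_full T \<Longrightarrow> u \<in> smooth_kforms k \<Longrightarrow> Cm_norm ?h m T (LI k T u) \<le> C * Cm_norm ?h m T u"
        by (rule bounded_i)
    qed (rule diam polynomials, assumption)+
    have u': "u \<in> sobolev_forms e (Suc p)" using u by simp
    have uL: "u \<in> L2_forms e" using u by (simp add: sobolev_forms_def)
    have ud: "u \<in> d_domain e" by (rule sobolev_d_domain[OF u'])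
    have Pu: "P u \<in> d_domain e" using P_spec(1)[OF uL] conforming by blast
    have PuL: "P u \<in> L2_forms e" using Pu by (simp add: d_domain_def)
    note wdu = weak_d_spec[OF ud] and wdP = weak_d_spec[OF Pu]
    have dL: "weak_d e u \<in> L2_forms e" using wdu by (simp add: has_weak_d_def)
    have wv: "has_weak_d e (\<lambda>x. u x - P u x) ?v"
      by (rule has_weak_d_diff[OF uL PuL wdu wdP])
    have vL: "?v \<in> L2_forms e" using wv by (simp add: has_weak_d_def)
    have wL: "(\<lambda>x. u x - P u x) \<in> L2_forms e" by (rule L2_forms_diff[OF uL PuL])
    have "ennreal ((L2_norm e (\<lambda>x. u x - P u x))\<^sup>2) \<le> ennreal (E (p + 1) * (?h ^ (p + 1))\<^sup>2) * ennreal (?G\<^sup>2)"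
      unfolding L2sq_eq_norm[OF wL, symmetric] grad_norm_sq[OF u]
      by (rule error[OF _ uL sobolev_weak_partial[OF u]]) auto
    then have L2w: "(L2_norm e (\<lambda>x. u x - P u x))\<^sup>2 \<le> E (p + 1) * (?h ^ (p + 1))\<^sup>2 * ?G\<^sup>2"
      using E0 by (simp add: ennreal_mult[symmetric])
    \<comment> \<open>The projection commutes with d up to null sets, so the same error is that of
      projecting d u, which has p weak derivatives.\<close>
    have "ennreal ((L2_norm e ?v)\<^sup>2) = L2sq (\<lambda>x. weak_d e u x - P (weak_d e u) x)"
      unfolding L2sq_eq_norm[OF vL, symmetric]
      using proj_d[OF ud, of i] unfolding ae_eq_def by (intro L2sq_cong_AE) (auto elim!: eventually_mono)
    also have "\<dots> \<le> ennreal (E p * (?h ^ p)\<^sup>2) * (\<Sum>js | length js = p. L2sq (\<lambda>x. \<Sum>j\<in>UNIV. wedge_coord j (weak_partial e (j # js) u x)))"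
      by (rule error[OF _ dL weak_d_weak_partial[OF u']]) auto
    also have "\<dots> \<le> ennreal (E p * (?h ^ p)\<^sup>2) * (of_nat CARD('n) * ennreal (?G\<^sup>2))"
      using weak_d_partials_L2[OF u'] by (intro mult_left_mono) auto
    also have "\<dots> = ennreal (E p * (?h ^ p)\<^sup>2 * (real CARD('n) * ?G\<^sup>2))"
      using E0 by (simp add: ennreal_mult ennreal_of_nat_eq_real_of_nat)
    finally have L2v: "(L2_norm e ?v)\<^sup>2 \<le> E p * (?h ^ p)\<^sup>2 * (real CARD('n) * ?G\<^sup>2)"
      using E0 by (subst (asm) ennreal_le_iff) auto
    have pw: "(?h ^ k)\<^sup>2 = ?h powr (2 * real k)" for k
    proof -
      have "(?h ^ k)\<^sup>2 = ?h ^ (2 * k)" by (simp only: power_mult[symmetric] mult.commute)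
      also have "\<dots> = ?h powr real (2 * k)" by (rule powr_realpow[OF h0, symmetric])
      finally show ?thesis by simp
    qed
    \<comment> \<open>With h as the interpolation parameter both terms have the same exponent: 2 s +
      2 p and (2 s - 2) + 2 (p + 1) are each twice p + s.\<close>
    have "(Hr_norm e (- s) ?v)\<^sup>2 \<le> ?h powr (2 * s) * (L2_norm e ?v)\<^sup>2
        + ?h powr (2 * s - 2) * (real CARD('n set) * (L2_norm e (\<lambda>x. u x - P u x))\<^sup>2)"
      by (rule Hr_norm_weak_d(2)[OF wL wv s h0])
    also have "\<dots> \<le> ?h powr (2 * s) * (E p * (?h ^ p)\<^sup>2 * (real CARD('n) * ?G\<^sup>2))
        + ?h powr (2 * s - 2) * (real CARD('n set) * (E (p + 1) * (?h ^ (p + 1))\<^sup>2 * ?G\<^sup>2))"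
      by (intro add_mono mult_left_mono L2v L2w) auto
    also have "\<dots> = (?h powr (2 * s) * ?h powr (2 * real p)) * (real CARD('n) * E p * ?G\<^sup>2)
        + (?h powr (2 * s - 2) * ?h powr (2 * real (p + 1))) * (real CARD('n set) * E (p + 1) * ?G\<^sup>2)"
      unfolding pw by (simp only: ac_simps)
    also have "\<dots> = (sqrt N * ?h powr (real p + s) * ?G)\<^sup>2"
    proof -
      have 1: "?h powr (2 * s) * ?h powr (2 * real p) = (?h powr (real p + s))\<^sup>2"
        unfolding power2_eq_square powr_add[symmetric] by (simp add: algebra_simps)
      have 2: "?h powr (2 * s - 2) * ?h powr (2 * real (p + 1)) = (?h powr (real p + s))\<^sup>2"
        unfolding power2_eq_square powr_add[symmetric] by (simp add: algebra_simps)
      show ?thesis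
        unfolding 1 2 using N0 by (simp add: power_mult_distrib) (simp add: N_def algebra_simps)
    qed
    finally have "Hr_norm e (- s) ?v \<le> sqrt N * ?h powr (real p + s) * ?G"
      by (rule power2_le_imp_le) (use N0 G0 in \<open>auto intro!: mult_nonneg_nonneg\<close>)
    then show ?thesis using Hr_norm_weak_d(1)[OF wL wv s h0] by blast
  qed
  then show ?thesis unfolding Let_def by blast
qed

end
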